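(* Let $(M,\pi)$ be a Poisson manifold. The DG operad morphism $\mathcal{BV}/\Delta\to\mathcal{E}(\Omega(M))$ given by $\mu\mapsto\wedge$ (exterior product), $\Delta\mapsto L_\pi$, $\phi_1\mapsto i_\pi$, and $\phi_n\mapsto 0$ for $n\geq2$, factors as a composite of DG operad morphisms $$\mathcal{BV}/\Delta\longrightarrow\mathcal{EBV}\longrightarrow\mathcal{E}(\Omega(M)),$$ where the first morphism is given by $\mu\mapsto\mu$, $\Delta\mapsto-d(i)$, $\phi_1\mapsto i$, $\phi_n\mapsto0$ for $n\geq 2$, and the second one by $\mu\mapsto\wedge$, $i\mapsto i_\pi$.
   Context: The ground field is $k=\mathbb{R}$. Operads are symmetric DG operads; complexes are cochain complexes. $\mathcal{E}(X)$ is the endomorphism operad of a complex $X$. The right action of $\tau\in\mathbb{S}_n$ is normalized so that $(f\cdot\tau)(x_1,\dots,x_n)=\pm f(x_{\tau^{-1}(1)},\dots,x_{\tau^{-1}(n)})$ with Koszul sign. Products of arity $1$ elements are compositions, $[a,b]=ab-(-1)^{|a||b|}ba$. "DG operad generated by $X$" means generated by the elements of $X$ and their differentials, the differentials being free unless a relation says otherwise. A Poisson manifold $(M,\pi)$ is a smooth manifold with a bivector field $\pi\in\Gamma(\Lambda^2T(M))$ such that $[\pi,\pi]=0$ (Schouten--Nijenhuis bracket). $\Omega(M)$ is the de Rham complex with exterior differential $d$. For a polyvector field $P$, $i_P$ is the interior product on $\Omega(M)$ ($i_{PQ}=i_Pi_Q$), $L_P=[i_P,d]$ is the Lie derivative,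 and $i_{[P,Q]}=[L_P,i_Q]$. $\mu^{(m)}$ denotes the iterated product of arity $m$ of a commutative associative $\mu$, with $\mu^{(1)}$ the operadic unit. For an arity $1$ element $D$ and $n\geq1$, $\mathrm{DO}_n(D)$ denotes the relation $$\sum_{\substack{p+q=n+1\\ p\geq1}}(-1)^p\sum_{\sigma\in \mathrm{Sh}_{p,q}}\bigl(\mu^{(q+1)}\circ_1(D\circ_1\mu^{(p)})\bigr)\cdot\sigma^{-1}=0,$$ where $\mathrm{Sh}_{p,q}\subset\mathbb{S}_{n+1}$ is the set of $(p,q)$-shuffles. It says that $D$ is a differential operator of order $\leq n$. $\mathcal{EBV}$ is the DG operad generated by $\mu\in\mathcal{EBV}(2)^0$ and $i\in\mathcal{EBV}(1)^{-2}$ with $\mu\cdot(1\ 2)=\mu$, subject to $d(\mu)=0$, $\mu\circ_1\mu=\mu\circ_2\mu$, $i\,d(i)=d(i)\,i$, and $\mathrm{DO}_2(i)$. $\mathcal{BV}/\Delta$ is the DG operad generated by $\mu$ in arity $2$ and degree $0$, $\Delta$ in arity $1$ and degree $-1$, and $\phi_n$ in arity $1$ and degree $-2n$, $n\geq1$, with $\mu\cdot(1\ 2)=\mu$, subject to $d(\mu)=0$, $\mu\circ_1\mu=\mu\circ_2\mu$, $d(\Delta)=0$, $\Delta^2=0$, $\mathrm{DO}_2(\Delta)$, $d(\phi_1)=-\Delta$, and for $n\geq2$ $$d(\phi_n)+\sum_{p=2}^n\frac{1}{p!}\sum_{\substack{q_1+\cdots+q_p=n\\ q_1,\dots,q_p\geq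 1}}[\phi_{q_1},\dots[\phi_{q_{p-1}},d(\phi_{q_p})]\dots]=0.$$ *)

theory Defs
  imports "HOL-Analysis.Analysis" "HOL-Library.Function_Algebras" "HOL-Combinatorics.Permutations"
begin

section \<open>Preliminaries\<close>

text \<open>Pointwise scalar multiplication: spaces of differential forms and of multilinear maps are
  linear subspaces of function types.\<close>

instantiation "fun" :: (type, real_vector) real_vector
begin

definition scaleR_fun :: "real \<Rightarrow> ('a \<Rightarrow> 'b) \<Rightarrow> 'a \<Rightarrow> 'b"
  where "scaleR_fun r f = (\<lambda>x. r *\<^sub>R f x)"

instance
  by standard (auto simp: scaleR_fun_def fun_eq_iff scaleR_add_right scaleR_add_left)

end

text \<open>Everything that is indexed by positions is indexed from \<open>0\<close>: \<open>S\<^sub>n\<close> is the group of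
  permutations of \<open>{..<n}\<close>, and the partial composition \<open>f \<circ>\<^sub>i g\<close> of the literature is
  \<open>f \<circ>\<^bsub>i-1\<^esub> g\<close> here. Note that \<open>permute_list \<sigma> [x\<^sub>0, x\<^sub>1, \<dots>] = [x\<^bsub>\<sigma> 0\<^esub>, x\<^bsub>\<sigma> 1\<^esub>, \<dots>]\<close>.\<close>

definition shuffles_perm :: "nat \<Rightarrow> nat \<Rightarrow> (nat \<Rightarrow> nat) set"
  where "shuffles_perm p q =
    {\<sigma>. \<sigma> permutes {..<p + q} \<and> strict_mono_on {..<p} \<sigma> \<and> strict_mono_on {p..<p + q} \<sigma>}"


section \<open>Symmetric DG operads\<close>

text \<open>\<open>op_car P n k\<close> is the set \<open>P(n)\<^sup>k\<close> of elements of arity \<open>n\<close> and degree \<open>k\<close>. The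
  operations are indexed by the arities and degrees of their arguments;
  \<open>op_cmp P m k n l i f g\<close> is \<open>f \<circ>\<^sub>i g\<close> for \<open>f \<in> P(m)\<^sup>k\<close>, \<open>g \<in> P(n)\<^sup>l\<close>, \<open>i < m\<close>.\<close>

record 'x operad =
  op_car :: "nat \<Rightarrow> int \<Rightarrow> 'x set"
  op_zero :: "nat \<Rightarrow> int \<Rightarrow> 'x"
  op_add :: "nat \<Rightarrow> int \<Rightarrow> 'x \<Rightarrow> 'x \<Rightarrow> 'x"
  op_smul :: "nat \<Rightarrow> int \<Rightarrow> real \<Rightarrow> 'x \<Rightarrow> 'x"
  op_dif :: "nat \<Rightarrow> int \<Rightarrow> 'x \<Rightarrow> 'x"
  op_act :: "nat \<Rightarrow> int \<Rightarrow> 'x \<Rightarrow> (nat \<Rightarrow> nat) \<Rightarrow> 'x"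
  op_unit :: "'x"
  op_cmp :: "nat \<Rightarrow> int \<Rightarrow> nat \<Rightarrow> int \<Rightarrow> nat \<Rightarrow> 'x \<Rightarrow> 'x \<Rightarrow> 'x"

text \<open>The permutation \<open>\<tau> \<circ>\<^sub>i \<sigma>\<close> of \<open>{..<m + n - 1}\<close>, for \<open>\<tau> \<in> S\<^sub>m\<close> and \<open>\<sigma> \<in> S\<^sub>n\<close>, such that
  \<open>(f \<cdot> \<tau>) \<circ>\<^sub>i (g \<cdot> \<sigma>) = (f \<circ>\<^bsub>\<tau> i\<^esub> g) \<cdot> (\<tau> \<circ>\<^sub>i \<sigma>)\<close> in endomorphism operads, where
  \<open>(f \<cdot> \<tau>)(x\<^sub>0, x\<^sub>1, \<dots>) = \<plusminus>f(x\<^bsub>\<tau>\<^sup>-\<^sup>1 0\<^esub>, x\<^bsub>\<tau>\<^sup>-\<^sup>1 1\<^esub>, \<dots>)\<close>, i.e. where the \<open>j\<close>-th argument of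
  \<open>f \<cdot> \<tau>\<close> is put into the slot \<open>\<tau> j\<close> of \<open>f\<close>.\<close>

definition block_perm :: "nat \<Rightarrow> nat \<Rightarrow> nat \<Rightarrow> (nat \<Rightarrow> nat) \<Rightarrow> (nat \<Rightarrow> nat) \<Rightarrow> nat \<Rightarrow> nat"
  where "block_perm m n i \<tau> \<sigma> j =
    (let shift = (\<lambda>a. if a < \<tau> i then a else a + n - 1) in
     if j < i then shift (\<tau> j)
     else if j < i + n then \<tau> i + \<sigma> (j - i)
     else if j < m + n - 1 then shift (\<tau> (j + 1 - n))
     else j)"

locale dg_operad =
  fixes P :: "'x operad" (structure)
  assumes zero_closed: "op_zero P n k \<in> op_car P n k"
    and add_closed: "\<lbrakk>x \<in> op_car P n k; y \<in> op_car P n k\<rbrakk> \<Longrightarrow> op_add P n k x y \<in> op_car P n k"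
    and smul_closed: "x \<in> op_car P n k \<Longrightarrow> op_smul P n k a x \<in> op_car P n k"
    and dif_closed: "x \<in> op_car P n k \<Longrightarrow> op_dif P n k x \<in> op_car P n (k + 1)"
    and act_closed: "\<lbrakk>x \<in> op_car P n k; \<tau> permutes {..<n}\<rbrakk> \<Longrightarrow> op_act P n k x \<tau> \<in> op_car P n k"
    and unit_closed: "op_unit P \<in> op_car P 1 0"
    and cmp_closed: "\<lbrakk>f \<in> op_car P m k; g \<in> op_car P n l; i < m\<rbrakk>
      \<Longrightarrow> op_cmp P m k n l i f g \<in> op_car P (m + n - 1) (k + l)"
    \<comment> \<open>each \<open>P(n)\<^sup>k\<close> is a real vector space\<close>
    and add_assoc: "\<lbrakk>x \<in> op_car P n k; y \<in> op_car P n k; z \<in> op_car P n k\<rbrakk>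
      \<Longrightarrow> op_add P n k (op_add P n k x y) z = op_add P n k x (op_add P n k y z)"
    and add_commute: "\<lbrakk>x \<in> op_car P n k; y \<in> op_car P n k\<rbrakk> \<Longrightarrow> op_add P n k x y = op_add P n k y x"
    and add_zero: "x \<in> op_car P n k \<Longrightarrow> op_add P n k x (op_zero P n k) = x"
    and add_minus: "x \<in> op_car P n k \<Longrightarrow> op_add P n k x (op_smul P n k (-1) x) = op_zero P n k"
    and smul_add: "\<lbrakk>x \<in> op_car P n k; y \<in> op_car P n k\<rbrakk>
      \<Longrightarrow> op_smul P n k a (op_add P n k x y) = op_add P n k (op_smul P n k a x) (op_smul P n k a y)"
    and add_smul: "x \<in> op_car P n k
      \<Longrightarrow> op_smul P n k (a + b) x = op_add P n k (op_smul P n k a x) (op_smul P n k b x)"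
    and smul_smul: "x \<in> op_car P n k \<Longrightarrow> op_smul P n k a (op_smul P n k b x) = op_smul P n k (a * b) x"
    and smul_one: "x \<in> op_car P n k \<Longrightarrow> op_smul P n k 1 x = x"
    \<comment> \<open>each \<open>P(n)\<close> is a cochain complex\<close>
    and dif_add: "\<lbrakk>x \<in> op_car P n k; y \<in> op_car P n k\<rbrakk>
      \<Longrightarrow> op_dif P n k (op_add P n k x y) = op_add P n (k + 1) (op_dif P n k x) (op_dif P n k y)"
    and dif_smul: "x \<in> op_car P n k
      \<Longrightarrow> op_dif P n k (op_smul P n k a x) = op_smul P n (k + 1) a (op_dif P n k x)"
    and dif_dif: "x \<in> op_car P n k \<Longrightarrow> op_dif P n (k + 1) (op_dif P n k x) = op_zero P n (k + 2)"
    \<comment> \<open>with a right action of \<open>S\<^sub>n\<close> by automorphisms of complexes\<close>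
    and act_add: "\<lbrakk>x \<in> op_car P n k; y \<in> op_car P n k; \<tau> permutes {..<n}\<rbrakk>
      \<Longrightarrow> op_act P n k (op_add P n k x y) \<tau> = op_add P n k (op_act P n k x \<tau>) (op_act P n k y \<tau>)"
    and act_smul: "\<lbrakk>x \<in> op_car P n k; \<tau> permutes {..<n}\<rbrakk>
      \<Longrightarrow> op_act P n k (op_smul P n k a x) \<tau> = op_smul P n k a (op_act P n k x \<tau>)"
    and act_id: "x \<in> op_car P n k \<Longrightarrow> op_act P n k x id = x"
    and act_act: "\<lbrakk>x \<in> op_car P n k; \<tau> permutes {..<n}; \<sigma> permutes {..<n}\<rbrakk>
      \<Longrightarrow> op_act P n k (op_act P n k x \<tau>) \<sigma> = op_act P n k x (\<tau> \<circ> \<sigma>)"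
    and dif_act: "\<lbrakk>x \<in> op_car P n k; \<tau> permutes {..<n}\<rbrakk>
      \<Longrightarrow> op_dif P n k (op_act P n k x \<tau>) = op_act P n (k + 1) (op_dif P n k x) \<tau>"
    \<comment> \<open>partial compositions are morphisms of complexes \<open>P(m) \<otimes> P(n) \<rightarrow> P(m + n - 1)\<close>\<close>
    and cmp_add_left: "\<lbrakk>f \<in> op_car P m k; f' \<in> op_car P m k; g \<in> op_car P n l; i < m\<rbrakk>
      \<Longrightarrow> op_cmp P m k n l i (op_add P m k f f') g =
        op_add P (m + n - 1) (k + l) (op_cmp P m k n l i f g) (op_cmp P m k n l i f' g)"
    and cmp_smul_left: "\<lbrakk>f \<in> op_car P m k; g \<in> op_car P n l; i < m\<rbrakk>
      \<Longrightarrow> op_cmp P m k n l i (op_smul P m k a f) g =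
        op_smul P (m + n - 1) (k + l) a (op_cmp P m k n l i f g)"
    and cmp_add_right: "\<lbrakk>f \<in> op_car P m k; g \<in> op_car P n l; g' \<in> op_car P n l; i < m\<rbrakk>
      \<Longrightarrow> op_cmp P m k n l i f (op_add P n l g g') =
        op_add P (m + n - 1) (k + l) (op_cmp P m k n l i f g) (op_cmp P m k n l i f g')"
    and cmp_smul_right: "\<lbrakk>f \<in> op_car P m k; g \<in> op_car P n l; i < m\<rbrakk>
      \<Longrightarrow> op_cmp P m k n l i f (op_smul P n l a g) =
        op_smul P (m + n - 1) (k + l) a (op_cmp P m k n l i f g)"
    and dif_cmp: "\<lbrakk>f \<in> op_car P m k; g \<in> op_car P n l; i < m\<rbrakk>
      \<Longrightarrow> op_dif P (m + n - 1) (k + l) (op_cmp P m k n l i f g) =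
        op_add P (m + n - 1) (k + l + 1) (op_cmp P m (k + 1) n l i (op_dif P m k f) g)
          (op_smul P (m + n - 1) (k + l + 1) ((-1) powi k) (op_cmp P m k n (l + 1) i f (op_dif P n l g)))"
    \<comment> \<open>associativity, unitality, equivariance\<close>
    and cmp_assoc_seq: "\<lbrakk>f \<in> op_car P m k; g \<in> op_car P n l; h \<in> op_car P r s; i < m; j < n\<rbrakk>
      \<Longrightarrow> op_cmp P (m + n - 1) (k + l) r s (i + j) (op_cmp P m k n l i f g) h =
        op_cmp P m k (n + r - 1) (l + s) i f (op_cmp P n l r s j g h)"
    and cmp_assoc_par: "\<lbrakk>f \<in> op_car P m k; g \<in> op_car P n l; h \<in> op_car P r s; i < j; j < m\<rbrakk>
      \<Longrightarrow> op_cmp P (m + r - 1) (k + s) n l i (op_cmp P m k r s j f h) g =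
        op_smul P (m + n + r - 2) (k + l + s) ((-1) powi (l * s))
          (op_cmp P (m + n - 1) (k + l) r s (j + n - 1) (op_cmp P m k n l i f g) h)"
    and cmp_unit_left: "g \<in> op_car P n l \<Longrightarrow> op_cmp P 1 0 n l 0 (op_unit P) g = g"
    and cmp_unit_right: "\<lbrakk>f \<in> op_car P m k; i < m\<rbrakk> \<Longrightarrow> op_cmp P m k 1 0 i f (op_unit P) = f"
    and cmp_act: "\<lbrakk>f \<in> op_car P m k; g \<in> op_car P n l; i < m; \<tau> permutes {..<m}; \<sigma> permutes {..<n}\<rbrakk>
      \<Longrightarrow> op_cmp P m k n l i (op_act P m k f \<tau>) (op_act P n l g \<sigma>) =
        op_act P (m + n - 1) (k + l) (op_cmp P m k n l (\<tau> i) f g) (block_perm m n i \<tau> \<sigma>)"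

text \<open>A morphism has a component on each \<open>P(n)\<^sup>k\<close>, set to \<open>undefined\<close> outside of it, so that
  morphisms are equal iff they agree on \<open>P\<close>.\<close>

definition dg_operad_hom :: "'x operad \<Rightarrow> 'y operad \<Rightarrow> (nat \<Rightarrow> int \<Rightarrow> 'x \<Rightarrow> 'y) set"
  where "dg_operad_hom P Q = {F. dg_operad P \<and> dg_operad Q \<and>
    (\<forall>n k. F n k \<in> op_car P n k \<rightarrow>\<^sub>E op_car Q n k) \<and>
    (\<forall>n k. \<forall>x\<in>op_car P n k. \<forall>y\<in>op_car P n k.
      F n k (op_add P n k x y) = op_add Q n k (F n k x) (F n k y)) \<and>
    (\<forall>n k a. \<forall>x\<in>op_car P n k. F n k (op_smul P n k a x) = op_smul Q n k a (F n k x)) \<and>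
    (\<forall>n k. \<forall>x\<in>op_car P n k. F n (k + 1) (op_dif P n k x) = op_dif Q n k (F n k x)) \<and>
    (\<forall>n k \<tau>. \<forall>x\<in>op_car P n k. \<tau> permutes {..<n} \<longrightarrow>
      F n k (op_act P n k x \<tau>) = op_act Q n k (F n k x) \<tau>) \<and>
    F 1 0 (op_unit P) = op_unit Q \<and>
    (\<forall>m k n l i. \<forall>f\<in>op_car P m k. \<forall>g\<in>op_car P n l. i < m \<longrightarrow>
      F (m + n - 1) (k + l) (op_cmp P m k n l i f g) = op_cmp Q m k n l i (F m k f) (F n l g))}"

definition operad_hom_comp ::
    "'x operad \<Rightarrow> (nat \<Rightarrow> int \<Rightarrow> 'y \<Rightarrow> 'z) \<Rightarrow> (nat \<Rightarrow> int \<Rightarrow> 'x \<Rightarrow> 'y) \<Rightarrow> nat \<Rightarrow> int \<Rightarrow> 'x \<Rightarrow> 'z"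
  where "operad_hom_comp P H G = (\<lambda>n k. compose (op_car P n k) (H n k) (G n k))"


section \<open>DG operads given by generators and relations\<close>

datatype 'g oterm =
    Gen 'g
  | Unit
  | Zero nat int
  | Add "'g oterm" "'g oterm"
  | Smul real "'g oterm"
  | Dif "'g oterm"
  | Act "'g oterm" "nat \<Rightarrow> nat"
  | Cmp nat "'g oterm" "'g oterm"  \<comment> \<open>\<open>Cmp i f g\<close> is \<open>f \<circ>\<^sub>i g\<close>\<close>

text \<open>A pair \<open>(s, t)\<close> in \<open>rels\<close> is the relation \<open>s = t\<close>.\<close>

record 'g presentation =
  gens :: "'g set"
  gen_arity :: "'g \<Rightarrow> nat"
  gen_degree :: "'g \<Rightarrow> int"
  rels :: "('g oterm \<times> 'g oterm) set"

inductive oterm_of :: "'g presentation \<Rightarrow> nat \<Rightarrow> int \<Rightarrow> 'g oterm \<Rightarrow> bool"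
  for R :: "'g presentation"
  where
    gen: "g \<in> gens R \<Longrightarrow> oterm_of R (gen_arity R g) (gen_degree R g) (Gen g)"
  | unit: "oterm_of R 1 0 Unit"
  | zero: "oterm_of R n k (Zero n k)"
  | add: "\<lbrakk>oterm_of R n k s; oterm_of R n k t\<rbrakk> \<Longrightarrow> oterm_of R n k (Add s t)"
  | smul: "oterm_of R n k t \<Longrightarrow> oterm_of R n k (Smul a t)"
  | dif: "oterm_of R n k t \<Longrightarrow> oterm_of R n (k + 1) (Dif t)"
  | act: "\<lbrakk>oterm_of R n k t; \<tau> permutes {..<n}\<rbrakk> \<Longrightarrow> oterm_of R n k (Act t \<tau>)"
  | cmp: "\<lbrakk>oterm_of R m k s; oterm_of R n l t; i < m\<rbrakk> \<Longrightarrow> oterm_of R (m + n - 1) (k + l) (Cmp i s t)"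

text \<open>The least congruence on terms containing the axioms of DG operads and the relations of \<open>R\<close>.\<close>

inductive oeq :: "'g presentation \<Rightarrow> nat \<Rightarrow> int \<Rightarrow> 'g oterm \<Rightarrow> 'g oterm \<Rightarrow> bool"
  for R :: "'g presentation"
  where
    rel: "\<lbrakk>(s, t) \<in> rels R; oterm_of R n k s; oterm_of R n k t\<rbrakk> \<Longrightarrow> oeq R n k s t"
  | refl: "oterm_of R n k t \<Longrightarrow> oeq R n k t t"
  | sym: "oeq R n k s t \<Longrightarrow> oeq R n k t s"
  | trans: "\<lbrakk>oeq R n k s t; oeq R n k t u\<rbrakk> \<Longrightarrow> oeq R n k s u"
  | cong_add: "\<lbrakk>oeq R n k s s'; oeq R n k t t'\<rbrakk> \<Longrightarrow> oeq R n k (Add s t) (Add s' t')"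
  | cong_smul: "oeq R n k t t' \<Longrightarrow> oeq R n k (Smul a t) (Smul a t')"
  | cong_dif: "oeq R n k t t' \<Longrightarrow> oeq R n (k + 1) (Dif t) (Dif t')"
  | cong_act: "\<lbrakk>oeq R n k t t'; \<tau> permutes {..<n}\<rbrakk> \<Longrightarrow> oeq R n k (Act t \<tau>) (Act t' \<tau>)"
  | cong_cmp: "\<lbrakk>oeq R m k s s'; oeq R n l t t'; i < m\<rbrakk>
      \<Longrightarrow> oeq R (m + n - 1) (k + l) (Cmp i s t) (Cmp i s' t')"
  | add_assoc: "\<lbrakk>oterm_of R n k s; oterm_of R n k t; oterm_of R n k u\<rbrakk>
      \<Longrightarrow> oeq R n k (Add (Add s t) u) (Add s (Add t u))"
  | add_commute: "\<lbrakk>oterm_of R n k s; oterm_of R n k t\<rbrakk> \<Longrightarrow> oeq R n k (Add s t) (Add t s)"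
  | add_zero: "oterm_of R n k t \<Longrightarrow> oeq R n k (Add t (Zero n k)) t"
  | add_minus: "oterm_of R n k t \<Longrightarrow> oeq R n k (Add t (Smul (-1) t)) (Zero n k)"
  | smul_add: "\<lbrakk>oterm_of R n k s; oterm_of R n k t\<rbrakk>
      \<Longrightarrow> oeq R n k (Smul a (Add s t)) (Add (Smul a s) (Smul a t))"
  | add_smul: "oterm_of R n k t \<Longrightarrow> oeq R n k (Smul (a + b) t) (Add (Smul a t) (Smul b t))"
  | smul_smul: "oterm_of R n k t \<Longrightarrow> oeq R n k (Smul a (Smul b t)) (Smul (a * b) t)"
  | smul_one: "oterm_of R n k t \<Longrightarrow> oeq R n k (Smul 1 t) t"
  | dif_add: "\<lbrakk>oterm_of R n k s; oterm_of R n k t\<rbrakk>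
      \<Longrightarrow> oeq R n (k + 1) (Dif (Add s t)) (Add (Dif s) (Dif t))"
  | dif_smul: "oterm_of R n k t \<Longrightarrow> oeq R n (k + 1) (Dif (Smul a t)) (Smul a (Dif t))"
  | dif_dif: "oterm_of R n k t \<Longrightarrow> oeq R n (k + 2) (Dif (Dif t)) (Zero n (k + 2))"
  | act_add: "\<lbrakk>oterm_of R n k s; oterm_of R n k t; \<tau> permutes {..<n}\<rbrakk>
      \<Longrightarrow> oeq R n k (Act (Add s t) \<tau>) (Add (Act s \<tau>) (Act t \<tau>))"
  | act_smul: "\<lbrakk>oterm_of R n k t; \<tau> permutes {..<n}\<rbrakk> \<Longrightarrow> oeq R n k (Act (Smul a t) \<tau>) (Smul a (Act t \<tau>))"
  | act_id: "oterm_of R n k t \<Longrightarrow> oeq R n k (Act t id) t"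
  | act_act: "\<lbrakk>oterm_of R n k t; \<tau> permutes {..<n}; \<sigma> permutes {..<n}\<rbrakk>
      \<Longrightarrow> oeq R n k (Act (Act t \<tau>) \<sigma>) (Act t (\<tau> \<circ> \<sigma>))"
  | dif_act: "\<lbrakk>oterm_of R n k t; \<tau> permutes {..<n}\<rbrakk> \<Longrightarrow> oeq R n (k + 1) (Dif (Act t \<tau>)) (Act (Dif t) \<tau>)"
  | cmp_add_left: "\<lbrakk>oterm_of R m k s; oterm_of R m k s'; oterm_of R n l t; i < m\<rbrakk>
      \<Longrightarrow> oeq R (m + n - 1) (k + l) (Cmp i (Add s s') t) (Add (Cmp i s t) (Cmp i s' t))"
  | cmp_smul_left: "\<lbrakk>oterm_of R m k s; oterm_of R n l t; i < m\<rbrakk>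
      \<Longrightarrow> oeq R (m + n - 1) (k + l) (Cmp i (Smul a s) t) (Smul a (Cmp i s t))"
  | cmp_add_right: "\<lbrakk>oterm_of R m k s; oterm_of R n l t; oterm_of R n l t'; i < m\<rbrakk>
      \<Longrightarrow> oeq R (m + n - 1) (k + l) (Cmp i s (Add t t')) (Add (Cmp i s t) (Cmp i s t'))"
  | cmp_smul_right: "\<lbrakk>oterm_of R m k s; oterm_of R n l t; i < m\<rbrakk>
      \<Longrightarrow> oeq R (m + n - 1) (k + l) (Cmp i s (Smul a t)) (Smul a (Cmp i s t))"
  | dif_cmp: "\<lbrakk>oterm_of R m k s; oterm_of R n l t; i < m\<rbrakk>
      \<Longrightarrow> oeq R (m + n - 1) (k + l + 1) (Dif (Cmp i s t))
        (Add (Cmp i (Dif s) t) (Smul ((-1) powi k) (Cmp i s (Dif t))))"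
  | cmp_assoc_seq: "\<lbrakk>oterm_of R m k s; oterm_of R n l t; oterm_of R r e u; i < m; j < n\<rbrakk>
      \<Longrightarrow> oeq R (m + n + r - 2) (k + l + e) (Cmp (i + j) (Cmp i s t) u) (Cmp i s (Cmp j t u))"
  | cmp_assoc_par: "\<lbrakk>oterm_of R m k s; oterm_of R n l t; oterm_of R r e u; i < j; j < m\<rbrakk>
      \<Longrightarrow> oeq R (m + n + r - 2) (k + l + e) (Cmp i (Cmp j s u) t)
        (Smul ((-1) powi (l * e)) (Cmp (j + n - 1) (Cmp i s t) u))"
  | cmp_unit_left: "oterm_of R n l t \<Longrightarrow> oeq R n l (Cmp 0 Unit t) t"
  | cmp_unit_right: "\<lbrakk>oterm_of R m k s; i < m\<rbrakk> \<Longrightarrow> oeq R m k (Cmp i s Unit) s"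
  | cmp_act: "\<lbrakk>oterm_of R m k s; oterm_of R n l t; i < m; \<tau> permutes {..<m}; \<sigma> permutes {..<n}\<rbrakk>
      \<Longrightarrow> oeq R (m + n - 1) (k + l) (Cmp i (Act s \<tau>) (Act t \<sigma>))
        (Act (Cmp (\<tau> i) s t) (block_perm m n i \<tau> \<sigma>))"

definition ocls :: "'g presentation \<Rightarrow> nat \<Rightarrow> int \<Rightarrow> 'g oterm \<Rightarrow> 'g oterm set"
  where "ocls R n k t = {s. oeq R n k t s}"

text \<open>The operations act on equivalence classes through representatives.\<close>

definition presented_operad :: "'g presentation \<Rightarrow> 'g oterm set operad"
  where "presented_operad R = \<lparr>
    op_car = (\<lambda>n k. {ocls R n k t | t. oterm_of R n k t}),
    op_zero = (\<lambda>n k. ocls R n k (Zero n k)),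
    op_add = (\<lambda>n k X Y. \<Union>s\<in>X. \<Union>t\<in>Y. ocls R n k (Add s t)),
    op_smul = (\<lambda>n k a X. \<Union>t\<in>X. ocls R n k (Smul a t)),
    op_dif = (\<lambda>n k X. \<Union>t\<in>X. ocls R n (k + 1) (Dif t)),
    op_act = (\<lambda>n k X \<tau>. \<Union>t\<in>X. ocls R n k (Act t \<tau>)),
    op_unit = ocls R 1 0 Unit,
    op_cmp = (\<lambda>m k n l i X Y. \<Union>s\<in>X. \<Union>t\<in>Y. ocls R (m + n - 1) (k + l) (Cmp i s t)) \<rparr>"

definition gen_class :: "'g presentation \<Rightarrow> 'g \<Rightarrow> 'g oterm set"
  where "gen_class R g = ocls R (gen_arity R g) (gen_degree R g) (Gen g)"


section \<open>The operads \<open>EBV\<close> and \<open>BV/\<Delta>\<close>\<close>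

text \<open>A term for the sum over a finite set of terms of arity \<open>n\<close> and degree \<open>k\<close>; up to \<^const>\<open>oeq\<close> it
  does not depend on the chosen enumeration.\<close>

definition Sum_term :: "nat \<Rightarrow> int \<Rightarrow> ('a \<Rightarrow> 'g oterm) \<Rightarrow> 'a set \<Rightarrow> 'g oterm"
  where "Sum_term n k f S =
    foldr (\<lambda>a t. Add (f a) t) (SOME xs. distinct xs \<and> set xs = S) (Zero n k)"

text \<open>\<open>mu_pow \<mu> m\<close> is \<open>\<mu>\<^sup>(\<^sup>m\<^sup>)\<close>, meaningful for \<open>m \<ge> 1\<close>.\<close>

fun mu_pow :: "'g oterm \<Rightarrow> nat \<Rightarrow> 'g oterm"
  where
    "mu_pow \<mu> 0 = Unit"
  | "mu_pow \<mu> (Suc 0) = Unit"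
  | "mu_pow \<mu> (Suc (Suc m)) = Cmp 0 \<mu> (mu_pow \<mu> (Suc m))"

text \<open>The left hand side of \<open>DO\<^sub>n(D)\<close> for \<open>D\<close> of arity \<open>1\<close> and degree \<open>k\<close>.\<close>

definition DO_term :: "'g oterm \<Rightarrow> nat \<Rightarrow> int \<Rightarrow> 'g oterm \<Rightarrow> 'g oterm"
  where "DO_term \<mu> n k D =
    Sum_term (n + 1) k
      (\<lambda>(p, q). Smul ((-1) ^ p)
        (Sum_term (n + 1) k
          (\<lambda>\<sigma>. Act (Cmp 0 (mu_pow \<mu> (q + 1)) (Cmp 0 D (mu_pow \<mu> p))) (inv \<sigma>))
          (shuffles_perm p q)))
      {(p, q). p + q = n + 1 \<and> 1 \<le> p}"

text \<open>The commutator of terms of arity \<open>1\<close> and degrees \<open>k\<close>, \<open>l\<close>.\<close>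

definition Bracket_term :: "int \<Rightarrow> int \<Rightarrow> 'g oterm \<Rightarrow> 'g oterm \<Rightarrow> 'g oterm"
  where "Bracket_term k l a b = Add (Cmp 0 a b) (Smul (- ((-1) powi (k * l))) (Cmp 0 b a))"

datatype ebv_gen = EBV_mu | EBV_i

definition EBV_presentation :: "ebv_gen presentation"
  where "EBV_presentation = \<lparr>
    gens = UNIV,
    gen_arity = (\<lambda>g. case g of EBV_mu \<Rightarrow> 2 | EBV_i \<Rightarrow> 1),
    gen_degree = (\<lambda>g. case g of EBV_mu \<Rightarrow> 0 | EBV_i \<Rightarrow> -2),
    rels = {
      (Act (Gen EBV_mu) (Transposition.transpose 0 1), Gen EBV_mu),
      (Dif (Gen EBV_mu), Zero 2 1),
      (Cmp 0 (Gen EBV_mu) (Gen EBV_mu), Cmp 1 (Gen EBV_mu) (Gen EBV_mu)),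
      (Cmp 0 (Gen EBV_i) (Dif (Gen EBV_i)), Cmp 0 (Dif (Gen EBV_i)) (Gen EBV_i)),
      (DO_term (Gen EBV_mu) 2 (-2) (Gen EBV_i), Zero 3 (-2)) } \<rparr>"

definition EBV :: "ebv_gen oterm set operad"
  where "EBV = presented_operad EBV_presentation"

text \<open>The generators \<open>\<phi>\<^sub>n\<close> are \<open>BVD_phi n\<close> with \<open>n \<ge> 1\<close>; \<open>BVD_phi 0\<close> is not a generator.\<close>

datatype bvd_gen = BVD_mu | BVD_Delta | BVD_phi nat

text \<open>\<open>phi_bracket [q\<^sub>1, \<dots>, q\<^sub>p]\<close> is \<open>[\<phi>\<^bsub>q\<^sub>1\<^esub>, \<dots> [\<phi>\<^bsub>q\<^sub>p\<^sub>-\<^sub>1\<^esub>, d(\<phi>\<^bsub>q\<^sub>p\<^esub>)] \<dots>]\<close>, of degree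
  \<open>1 - 2(q\<^sub>1 + \<dots> + q\<^sub>p)\<close>.\<close>

fun phi_bracket :: "nat list \<Rightarrow> bvd_gen oterm"
  where
    "phi_bracket [] = Zero 1 1"
  | "phi_bracket [q] = Dif (Gen (BVD_phi q))"
  | "phi_bracket (q # q' # qs) =
      Bracket_term (- 2 * int q) (1 - 2 * int (sum_list (q' # qs)))
        (Gen (BVD_phi q)) (phi_bracket (q' # qs))"

definition phi_relation :: "nat \<Rightarrow> bvd_gen oterm"
  where "phi_relation n =
    Add (Dif (Gen (BVD_phi n)))
      (Sum_term 1 (1 - 2 * int n)
        (\<lambda>p. Smul (1 / fact p)
          (Sum_term 1 (1 - 2 * int n) phi_bracket
            {qs. length qs = p \<and> sum_list qs = n \<and> (\<forall>q\<in>set qs. 1 \<le> q)}))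
        {2..n})"

definition BVD_presentation :: "bvd_gen presentation"
  where "BVD_presentation = \<lparr>
    gens = {BVD_mu, BVD_Delta} \<union> {BVD_phi n | n. 1 \<le> n},
    gen_arity = (\<lambda>g. case g of BVD_mu \<Rightarrow> 2 | BVD_Delta \<Rightarrow> 1 | BVD_phi n \<Rightarrow> 1),
    gen_degree = (\<lambda>g. case g of BVD_mu \<Rightarrow> 0 | BVD_Delta \<Rightarrow> -1 | BVD_phi n \<Rightarrow> - 2 * int n),
    rels = {
      (Act (Gen BVD_mu) (Transposition.transpose 0 1), Gen BVD_mu),
      (Dif (Gen BVD_mu), Zero 2 1),
      (Cmp 0 (Gen BVD_mu) (Gen BVD_mu), Cmp 1 (Gen BVD_mu) (Gen BVD_mu)),
      (Dif (Gen BVD_Delta), Zero 1 0),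
      (Cmp 0 (Gen BVD_Delta) (Gen BVD_Delta), Zero 1 (-2)),
      (DO_term (Gen BVD_mu) 2 (-1) (Gen BVD_Delta), Zero 3 (-1)),
      (Dif (Gen (BVD_phi 1)), Smul (-1) (Gen BVD_Delta)) }
      \<union> {(phi_relation n, Zero 1 (1 - 2 * int n)) | n. 2 \<le> n} \<rparr>"

definition BV_mod_Delta :: "bvd_gen oterm set operad"
  where "BV_mod_Delta = presented_operad BVD_presentation"


section \<open>The endomorphism operad of a complex\<close>

record 'v cochain_complex =
  cx :: "int \<Rightarrow> 'v set"
  cx_d :: "int \<Rightarrow> 'v \<Rightarrow> 'v"

definition is_cochain_complex :: "('v::real_vector) cochain_complex \<Rightarrow> bool"
  where "is_cochain_complex X \<longleftrightarrow>
    (\<forall>k. subspace (cx X k)) \<and>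
    (\<forall>k. \<forall>x\<in>cx X k. cx_d X k x \<in> cx X (k + 1) \<and> cx_d X (k + 1) (cx_d X k x) = 0) \<and>
    (\<forall>k a b. \<forall>x\<in>cx X k. \<forall>y\<in>cx X k. cx_d X k (a *\<^sub>R x + b *\<^sub>R y) = a *\<^sub>R cx_d X k x + b *\<^sub>R cx_d X k y)"

text \<open>A homogeneous element of \<open>X\<close> is a pair of a degree \<open>k\<close> and an element of \<open>X\<^sup>k\<close>. An element
  of \<open>Hom\<^sup>k(X\<^sup>\<otimes>\<^sup>n, X)\<close> is a function on \<open>n\<close>-tuples of homogeneous elements, raising
  the total degree by \<open>k\<close> and linear in each argument; it is set to \<open>0\<close> on everything that is not
  such a tuple.\<close>

definition tuples :: "'v cochain_complex \<Rightarrow> nat \<Rightarrow> (int \<times> 'v) list set"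
  where "tuples X n = {zs. length zs = n \<and> (\<forall>(k, x)\<in>set zs. x \<in> cx X k)}"

definition tdeg :: "(int \<times> 'v) list \<Rightarrow> int"
  where "tdeg zs = sum_list (map fst zs)"

definition multilinear_maps ::
    "('v::real_vector) cochain_complex \<Rightarrow> nat \<Rightarrow> int \<Rightarrow> ((int \<times> 'v) list \<Rightarrow> 'v) set"
  where "multilinear_maps X n k = {f.
    (\<forall>zs. zs \<notin> tuples X n \<longrightarrow> f zs = 0) \<and>
    (\<forall>zs\<in>tuples X n. f zs \<in> cx X (tdeg zs + k)) \<and>
    (\<forall>zs\<in>tuples X n. \<forall>j<n. \<forall>l a b. \<forall>x\<in>cx X l. \<forall>y\<in>cx X l.
      f (zs[j := (l, a *\<^sub>R x + b *\<^sub>R y)]) = a *\<^sub>R f (zs[j := (l, x)]) + b *\<^sub>R f (zs[j := (l, y)]))}"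

definition koszul_sign :: "(nat \<Rightarrow> nat) \<Rightarrow> (int \<times> 'v) list \<Rightarrow> real"
  where "koszul_sign \<tau> zs =
    (\<Prod>(a, b)\<in>{(a, b). a < b \<and> b < length zs \<and> \<tau> b < \<tau> a}. (-1) powi (fst (zs ! a) * fst (zs ! b)))"

text \<open>The differential is \<open>f \<mapsto> [d, f]\<close>.\<close>

definition End_operad :: "('v::real_vector) cochain_complex \<Rightarrow> ((int \<times> 'v) list \<Rightarrow> 'v) operad"
  where "End_operad X = \<lparr>
    op_car = multilinear_maps X,
    op_zero = (\<lambda>n k. 0),
    op_add = (\<lambda>n k f g. f + g),
    op_smul = (\<lambda>n k a f. a *\<^sub>R f),
    op_dif = (\<lambda>n k f zs. if zs \<in> tuples X n
      then cx_d X (tdeg zs + k) (f zs)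
        - (-1) powi k *\<^sub>R (\<Sum>j<n. (-1) powi (tdeg (take j zs)) *\<^sub>R
            f (zs[j := (fst (zs ! j) + 1, cx_d X (fst (zs ! j)) (snd (zs ! j)))]))
      else 0),
    op_act = (\<lambda>n k f \<tau> zs. if zs \<in> tuples X n
      then koszul_sign \<tau> zs *\<^sub>R f (permute_list (inv \<tau>) zs) else 0),
    op_unit = (\<lambda>zs. if zs \<in> tuples X 1 then snd (zs ! 0) else 0),
    op_cmp = (\<lambda>m k n l i f g zs. if zs \<in> tuples X (m + n - 1)
      then (let us = take i zs; vs = take n (drop i zs); ws = drop (i + n) zs
            in (-1) powi (l * tdeg us) *\<^sub>R f (us @ [(tdeg vs + l, g vs)] @ ws))
      else 0) \<rparr>"


section \<open>Smooth manifolds\<close>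

text \<open>On an open subset of a finite-dimensional space this is the usual notion of a \<open>C\<^sup>k\<close> map.\<close>

primrec Ck_on :: "nat \<Rightarrow> ('a::real_normed_vector \<Rightarrow> 'b::real_normed_vector) \<Rightarrow> 'a set \<Rightarrow> bool"
  where
    "Ck_on 0 f U \<longleftrightarrow> continuous_on U f"
  | "Ck_on (Suc k) f U \<longleftrightarrow> (\<forall>x\<in>U. f differentiable (at x)) \<and>
      (\<forall>v. Ck_on k (\<lambda>x. frechet_derivative f (at x) v) U)"

definition smooth_on :: "('a::real_normed_vector \<Rightarrow> 'b::real_normed_vector) \<Rightarrow> 'a set \<Rightarrow> bool"
  where "smooth_on f U \<longleftrightarrow> (\<forall>k. Ck_on k f U)"

text \<open>A chart consists of its domain \<open>U \<subseteq> M\<close> and the coordinate map on \<open>U\<close>. The model space is a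
  finite-dimensional inner product space \<open>'e\<close>, i.e. some \<open>\<real>\<^sup>n\<close>. (The class \<open>euclidean_space\<close>
  is not used because it excludes \<open>n = 0\<close>.)\<close>

type_synonym ('m, 'e) chart = "'m set \<times> ('m \<Rightarrow> 'e)"

definition chart_image :: "('m, 'e) chart \<Rightarrow> 'e set"
  where "chart_image c = snd c ` fst c"

definition chart_overlap :: "('m, 'e) chart \<Rightarrow> ('m, 'e) chart \<Rightarrow> 'e set"
  where "chart_overlap c c' = snd c ` (fst c \<inter> fst c')"

definition transition :: "('m, 'e) chart \<Rightarrow> ('m, 'e) chart \<Rightarrow> 'e \<Rightarrow> 'e"
  where "transition c c' = snd c' \<circ> inv_into (fst c) (snd c)"

locale smooth_manifold =
  fixes M :: "'m topology" and A :: "('m, 'e::real_inner) chart set"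
  assumes model_finite_dim: "\<exists>B::'e set. finite B \<and> span B = UNIV"
    and Hausdorff: "Hausdorff_space M"
    and second_countable: "second_countable M"
    and chart: "c \<in> A \<Longrightarrow> openin M (fst c) \<and> open (chart_image c) \<and>
      homeomorphic_map (subtopology M (fst c)) (top_of_set (chart_image c)) (snd c)"
    and cover: "(\<Union>c\<in>A. fst c) = topspace M"
    and smooth_transition: "\<lbrakk>c \<in> A; c' \<in> A\<rbrakk> \<Longrightarrow> smooth_on (transition c c') (chart_overlap c c')"


section \<open>Alternating multilinear algebra\<close>

definition alternating :: "nat \<Rightarrow> ('a::real_vector list \<Rightarrow> real) set"
  where "alternating k = {a.
    (\<forall>vs. length vs \<noteq> k \<longrightarrow> a vs = 0) \<and>
    (\<forall>vs. \<forall>j<k. length vs = k \<longrightarrow> linear (\<lambda>v. a (vs[j := v]))) \<and>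
    (\<forall>vs i j. length vs = k \<longrightarrow> i < j \<longrightarrow> j < k \<longrightarrow> vs ! i = vs ! j \<longrightarrow> a vs = 0)}"

definition alt_wedge :: "nat \<Rightarrow> nat \<Rightarrow> ('a list \<Rightarrow> real) \<Rightarrow> ('a list \<Rightarrow> real) \<Rightarrow> 'a list \<Rightarrow> real"
  where "alt_wedge p q a b vs = (if length vs = p + q
    then \<Sum>\<sigma>\<in>shuffles_perm p q.
      of_int (sign \<sigma>) * a (take p (permute_list \<sigma> vs)) * b (drop p (permute_list \<sigma> vs))
    else 0)"

text \<open>\<open>\<Lambda>\<^sup>k\<close> of the dual of the model space consists of the alternating functions of \<open>k\<close> vectors
  (with the determinant convention for \<open>\<and>\<close>), and \<open>\<Lambda>\<^sup>p\<close> of the model space consists of the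
  alternating functions of \<open>p\<close> covectors, \<open>X\<^sub>1 \<and> \<dots> \<and> X\<^sub>p\<close> being
  \<open>(\<alpha>\<^sub>1, \<dots>, \<alpha>\<^sub>p) \<mapsto> det (\<alpha>\<^sub>i(X\<^sub>j))\<close>. A basis of the model space is fixed to write
  contractions; they do not depend on it.\<close>

definition model_basis :: "'e::real_inner set"
  where "model_basis = extend_basis {}"

definition dual_basis :: "'e::real_inner \<Rightarrow> 'e \<Rightarrow>\<^sub>L real"
  where "dual_basis b = Blinfun (\<lambda>v. representation model_basis v b)"

text \<open>As \<open>i\<^bsub>PQ\<^esub> = i\<^sub>P i\<^sub>Q\<close>, one has \<open>i\<^bsub>X\<^sub>1 \<and> \<dots> \<and> X\<^sub>p\<^esub> \<omega> = \<omega>(X\<^sub>p, \<dots>, X\<^sub>1, -)\<close>, whence the reversal.\<close>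

definition contract :: "nat \<Rightarrow> (('e::real_inner \<Rightarrow>\<^sub>L real) list \<Rightarrow> real) \<Rightarrow> ('e list \<Rightarrow> real) \<Rightarrow> 'e list \<Rightarrow> real"
  where "contract p P a vs =
    (1 / fact p) * (\<Sum>bs\<in>{bs. length bs = p \<and> set bs \<subseteq> model_basis}.
      P (map dual_basis bs) * a (rev bs @ vs))"


section \<open>Differential forms and polyvector fields\<close>

text \<open>A differential form is a family of forms on the images of the charts, compatible under pullback
  along the transition maps; it is set to \<open>0\<close> outside of the images of the charts. In
  \<open>\<omega> c x vs\<close>, \<open>c\<close> is the chart, \<open>x\<close> the coordinate of the point and \<open>vs\<close> the arguments.
  Polyvector fields are described in the same way, transforming by pushforward.\<close>

type_synonym ('m, 'e) form = "('m, 'e) chart \<Rightarrow> 'e \<Rightarrow> 'e list \<Rightarrow> real"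
type_synonym ('m, 'e) polyvector = "('m, 'e) chart \<Rightarrow> 'e \<Rightarrow> ('e \<Rightarrow>\<^sub>L real) list \<Rightarrow> real"

definition forms :: "('m, 'e::real_inner) chart set \<Rightarrow> nat \<Rightarrow> ('m, 'e) form set"
  where "forms A k = {\<omega>.
    (\<forall>c x. \<omega> c x \<in> alternating k) \<and>
    (\<forall>c x. \<not> (c \<in> A \<and> x \<in> chart_image c) \<longrightarrow> \<omega> c x = 0) \<and>
    (\<forall>c\<in>A. \<forall>vs. smooth_on (\<lambda>x. \<omega> c x vs) (chart_image c)) \<and>
    (\<forall>c\<in>A. \<forall>c'\<in>A. \<forall>x\<in>chart_overlap c c'. \<forall>vs.
      \<omega> c x vs = \<omega> c' (transition c c' x) (map (frechet_derivative (transition c c') (at x)) vs))}"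

definition polyvector_fields :: "('m, 'e::real_inner) chart set \<Rightarrow> nat \<Rightarrow> ('m, 'e) polyvector set"
  where "polyvector_fields A p = {P.
    (\<forall>c x. P c x \<in> alternating p) \<and>
    (\<forall>c x. \<not> (c \<in> A \<and> x \<in> chart_image c) \<longrightarrow> P c x = 0) \<and>
    (\<forall>c\<in>A. \<forall>\<alpha>s. smooth_on (\<lambda>x. P c x \<alpha>s) (chart_image c)) \<and>
    (\<forall>c\<in>A. \<forall>c'\<in>A. \<forall>x\<in>chart_overlap c c'. \<forall>\<alpha>s.
      P c' (transition c c' x) \<alpha>s =
      P c x (map (\<lambda>\<alpha>. \<alpha> o\<^sub>L Blinfun (frechet_derivative (transition c c') (at x))) \<alpha>s))}"

text \<open>\<open>(d\<omega>)(v\<^sub>0, \<dots>, v\<^sub>k) = \<Sum>\<^sub>i (-1)\<^sup>i \<partial>\<^bsub>v\<^sub>i\<^esub> (\<omega>(v\<^sub>0, \<dots>, \<hat>v\<^sub>i, \<dots>, v\<^sub>k))\<close> for constant \<open>v\<^sub>i\<close>.\<close>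

definition ext_d :: "('m, 'e::real_inner) chart set \<Rightarrow> ('m, 'e) form \<Rightarrow> ('m, 'e) form"
  where "ext_d A \<omega> = (\<lambda>c x vs. if c \<in> A \<and> x \<in> chart_image c
    then \<Sum>i<length vs. (-1) ^ i *
      frechet_derivative (\<lambda>y. \<omega> c y (take i vs @ drop (Suc i) vs)) (at x) (vs ! i)
    else 0)"

definition de_Rham :: "('m, 'e::real_inner) chart set \<Rightarrow> ('m, 'e) form cochain_complex"
  where "de_Rham A = \<lparr>
    cx = (\<lambda>k. if 0 \<le> k then forms A (nat k) else {0}),
    cx_d = (\<lambda>k. ext_d A) \<rparr>"

definition form_wedge :: "nat \<Rightarrow> nat \<Rightarrow> ('m, 'e) form \<Rightarrow> ('m, 'e) form \<Rightarrow> ('m, 'e) form"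
  where "form_wedge p q \<alpha> \<beta> = (\<lambda>c x. alt_wedge p q (\<alpha> c x) (\<beta> c x))"

definition interior_product :: "nat \<Rightarrow> ('m, 'e::real_inner) polyvector \<Rightarrow> ('m, 'e) form \<Rightarrow> ('m, 'e) form"
  where "interior_product p P \<omega> = (\<lambda>c x. contract p (P c x) (\<omega> c x))"

definition Lie_derivative ::
    "('m, 'e::real_inner) chart set \<Rightarrow> nat \<Rightarrow> ('m, 'e) polyvector \<Rightarrow> ('m, 'e) form \<Rightarrow> ('m, 'e) form"
  where "Lie_derivative A p P \<omega> =
    interior_product p P (ext_d A \<omega>) - (-1) ^ p *\<^sub>R ext_d A (interior_product p P \<omega>)"

text \<open>In coordinates the Schouten--Nijenhuis bracket is
  \<open>[P, Q] = \<Sum>\<^sub>b P\<^sup>b \<and> \<partial>\<^sub>bQ - (-1)\<^bsup>(p-1)(q-1)\<^esup> \<Sum>\<^sub>b Q\<^sup>b \<and> \<partial>\<^sub>bP\<close>, where \<open>\<partial>\<^sub>b\<close> differentiates coefficients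
  and \<open>P\<^sup>b = P(-, \<dots>, -, b\<^sup>*)\<close>. This is the sign convention in which
  \<open>i\<^bsub>[P,Q]\<^esub> = [[i\<^sub>P, d], i\<^sub>Q]\<close>.\<close>

definition Schouten_half :: "nat \<Rightarrow> nat \<Rightarrow> ('m, 'e::real_inner) polyvector \<Rightarrow> ('m, 'e) polyvector \<Rightarrow> ('m, 'e) polyvector"
  where "Schouten_half p q P Q = (\<lambda>c x \<alpha>s. if p = 0 then 0 else
    (\<Sum>b\<in>model_basis. alt_wedge (p - 1) q
      (\<lambda>\<beta>s. P c x (\<beta>s @ [dual_basis b]))
      (\<lambda>\<beta>s. frechet_derivative (\<lambda>y. Q c y \<beta>s) (at x) b) \<alpha>s))"

definition Schouten ::
    "('m, 'e::real_inner) chart set \<Rightarrow> nat \<Rightarrow> nat \<Rightarrow> ('m, 'e) polyvector \<Rightarrow> ('m, 'e) polyvector \<Rightarrow> ('m, 'e) polyvector"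
  where "Schouten A p q P Q = (\<lambda>c x \<alpha>s. if c \<in> A \<and> x \<in> chart_image c
    then Schouten_half p q P Q c x \<alpha>s
      - (-1) powi ((int p - 1) * (int q - 1)) * Schouten_half q p Q P c x \<alpha>s
    else 0)"

locale Poisson_manifold = smooth_manifold M A
  for M :: "'m topology" and A :: "('m, 'e::real_inner) chart set" +
  fixes \<pi> :: "('m, 'e) polyvector"
  assumes bivector: "\<pi> \<in> polyvector_fields A 2"
    and Jacobi: "Schouten A 2 2 \<pi> \<pi> = 0"


section \<open>Operations on differential forms as elements of the endomorphism operad\<close>

definition wedge_op :: "('m, 'e::real_inner) chart set \<Rightarrow> (int \<times> ('m, 'e) form) list \<Rightarrow> ('m, 'e) form"
  where "wedge_op A zs = (if zs \<in> tuples (de_Rham A) 2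
    then form_wedge (nat (fst (zs ! 0))) (nat (fst (zs ! 1))) (snd (zs ! 0)) (snd (zs ! 1)) else 0)"

definition unary_op ::
    "('m, 'e::real_inner) chart set \<Rightarrow> (('m, 'e) form \<Rightarrow> ('m, 'e) form) \<Rightarrow> (int \<times> ('m, 'e) form) list \<Rightarrow> ('m, 'e) form"
  where "unary_op A T zs = (if zs \<in> tuples (de_Rham A) 1 then T (snd (zs ! 0)) else 0)"

end

theory Submission
  imports Defs
begin

text \<open>A morphism out of an operad given by generators and relations is the same thing as a choice of
  images of the generators that satisfy the relations (\<open>presented_operad_universal\<close>,
  \<open>dg_operad_hom_eqI\<close>). This gives all uniqueness statements. It also reduces the factorization to a
  comparison on generators, where the point is that \<open>- d(i)\<close> goes to \<open>- [d, i\<^sub>\<pi>] = [i\<^sub>\<pi>, d] = L\<^sub>\<pi>\<close>. What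
  remains are two sets of relations.

  The relations of \<open>BV/\<Delta>\<close> hold in \<open>EBV\<close> for \<open>\<Delta> = - d(i)\<close>, \<open>\<phi>\<^sub>1 = i\<close> and \<open>\<phi>\<^sub>n = 0\<close> for \<open>n \<ge> 2\<close>
  (\<open>bvd_relations\<close>). Applying \<open>d\<close> to \<open>i d(i) = d(i) i\<close> shows \<open>d(i)\<^sup>2 = 0\<close>, hence \<open>\<Delta>\<^sup>2 = 0\<close>
  (\<open>ebv_di_squared\<close>). Since \<open>d(\<mu>) = 0\<close>, applying \<open>d\<close> to \<open>DO\<^sub>2(i)\<close> shows \<open>DO\<^sub>2(d(i))\<close>
  (\<open>minus_dif_of_DO_term\<close>). In the relation for \<open>d(\<phi>\<^sub>n)\<close>, each iterated bracket either contains some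
  \<open>\<phi>\<^sub>q\<close> with \<open>q \<ge> 2\<close> or has \<open>[i, d(i)] = 0\<close> as its innermost bracket (\<open>bvd_value_phi_bracket\<close>).

  The relations of \<open>EBV\<close> hold for the exterior product and \<open>i\<^sub>\<pi>\<close> (\<open>ebv_assign_relations\<close>). Those on \<open>\<mu>\<close>
  alone are graded commutativity, associativity and the Leibniz rule. Contraction with a vector is a
  derivation of the exterior product, so that the contraction with a bivector is of order \<open>2\<close>
  (\<open>insert_two_order_two\<close>). Finally \<open>[i\<^sub>\<pi>, L\<^sub>\<pi>] = 0\<close>, because this commutator is, up to sign, the
  contraction with \<open>[\<pi>, \<pi>]\<close>; this is a calculation with coefficients in a chart
  (\<open>bivector_contract_Lie_commute\<close>).

  Two devices keep these calculations short. In the endomorphism operad of a complex, the differential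
  is the commutator with an operation of arity \<open>1\<close> and degree \<open>1\<close> (\<open>op_dif_eq\<close>), so that its
  compatibility with compositions and permutations follows from the axioms of graded operads
  (\<open>dg_operad_End\<close>). And a form at a point is a function on lists of vectors, determined by its value
  on the empty list and by its contractions with vectors. The exterior product is characterized by
  the derivation rule for these contractions and \<open>d\<close> by the Cartan formula for constant vector
  fields (\<open>local_d_Cons\<close>), which makes induction on the list of arguments available.\<close>

text \<open>Arities are numerals, and they are easier to match if \<open>1\<close> is not rewritten.\<close>

declare One_nat_def [simp del]

section \<open>Operads given by generators and relations\<close>

lemma oterm_of_cmp_eq:
  "\<lbrakk>oterm_of R m k s; oterm_of R n l t; i < m; N = m + n - 1; K = k + l\<rbrakk> \<Longrightarrow> oterm_of R N K (Cmp i s t)"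
  using oterm_of.cmp by blast

lemma oterm_of_dif_eq: "\<lbrakk>oterm_of R n k t; K = k + 1\<rbrakk> \<Longrightarrow> oterm_of R n K (Dif t)"
  using oterm_of.dif by blast

lemma block_perm_permutes:
  assumes \<tau>: "\<tau> permutes {..<m}" and \<sigma>: "\<sigma> permutes {..<n}" and i: "i < m"
  shows "block_perm m n i \<tau> \<sigma> permutes {..<m + n - 1}"
proof (rule inj_imp_permutes)
  have T: "\<And>j. \<tau> j < m \<longleftrightarrow> j < m" and S: "\<And>j. \<sigma> j < n \<longleftrightarrow> j < n"
    using permutes_in_image[OF \<tau>] permutes_in_image[OF \<sigma>] by auto
  have injT: "\<And>a b. \<tau> a = \<tau> b \<longleftrightarrow> a = b" and injS: "\<And>a b. \<sigma> a = \<sigma> b \<longleftrightarrow> a = b"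
    using permutes_inj[OF \<tau>] permutes_inj[OF \<sigma>] by (auto dest: injD)
  \<comment> \<open>the slot of the outer operation that the argument in position \<open>j\<close> belongs to\<close>
  define q where "q = (\<lambda>j. if j < i then j else if j < i + n then i else j + 1 - n)"
  have val: "block_perm m n i \<tau> \<sigma> j =
      (if q j = i then \<tau> i + \<sigma> (j - i) else if \<tau> (q j) < \<tau> i then \<tau> (q j) else \<tau> (q j) + n - 1)"
    and ran: "q j < m" and blk: "q j = i \<longleftrightarrow> i \<le> j \<and> j < i + n" if "j < m + n - 1" for j
    using that i by (auto simp: block_perm_def q_def Let_def)
  show "inj_on (block_perm m n i \<tau> \<sigma>) {..<m + n - 1}"
  proof (rule inj_onI)
    fix x y assume x: "x \<in> {..<m + n - 1}" and y: "y \<in> {..<m + n - 1}"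
      and eq: "block_perm m n i \<tau> \<sigma> x = block_perm m n i \<tau> \<sigma> y"
    have neq: "\<tau> (q z) \<noteq> \<tau> i" if "q z \<noteq> i" for z using that injT by blast
    have lt: "\<sigma> (z - i) < n" if "z < m + n - 1" "q z = i" for z
      using that blk S by auto
    consider "q x = i" "q y = i" | "q x \<noteq> i" "q y \<noteq> i" | "q x \<noteq> i \<longleftrightarrow> q y = i" by blast
    then show "x = y"
    proof cases
      case 1
      then have "\<sigma> (x - i) = \<sigma> (y - i)" using eq x y val by simp
      then show ?thesis using injS 1 x y blk by auto
    next
      case 2
      then have "\<tau> (q x) = \<tau> (q y)"
        using eq x y val[of x] val[of y] neq[of x] neq[of y] by (auto split: if_splits)
      then have "q x = q y" using injT by blast
      then show ?thesis using 2 by (auto simp: q_def split: if_splits)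
    next
      case 3
      then show ?thesis using eq x y val[of x] val[of y] neq[of x] neq[of y] lt[of x] lt[of y]
        by (cases "q x = i") (auto split: if_splits)
    qed
  qed
  show "block_perm m n i \<tau> \<sigma> x \<in> {..<m + n - 1}" if "x \<in> {..<m + n - 1}" for x
  proof -
    have "\<tau> (q x) < m" "\<tau> i < m" "q x \<noteq> i \<Longrightarrow> \<tau> (q x) \<noteq> \<tau> i" "q x = i \<Longrightarrow> \<sigma> (x - i) < n"
      using that ran T S i injT blk by auto
    then show ?thesis using that val[of x] by auto
  qed
  show "block_perm m n i \<tau> \<sigma> x = x" if "x \<notin> {..<m + n - 1}" for x
    using that i by (auto simp: block_perm_def)
qed simp

lemma oterm_of_if_oeq: "oeq R n k s t \<Longrightarrow> oterm_of R n k s \<and> oterm_of R n k t"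
proof (induction rule: oeq.induct)
  case (dif_dif n k t)
  then show ?case by (auto intro!: oterm_of.zero oterm_of_dif_eq)
next
  case (cmp_unit_left n l t)
  then show ?case using oterm_of.cmp[OF oterm_of.unit, of R n l t 0] by simp
next
  case (cmp_unit_right m k s i)
  then show ?case using oterm_of.cmp[OF _ oterm_of.unit, of R m k s i] by simp
next
  case (cmp_assoc_seq m k s n l t r e u i j)
  have "oterm_of R (m + n + r - 2) (k + l + e) (Cmp (i + j) (Cmp i s t) u)"
    by (rule oterm_of_cmp_eq[OF oterm_of.cmp[of R m k s n l t i]]) (use cmp_assoc_seq in auto)
  moreover have "oterm_of R (m + n + r - 2) (k + l + e) (Cmp i s (Cmp j t u))"
    by (rule oterm_of_cmp_eq[OF _ oterm_of.cmp[of R n l t r e u j]]) (use cmp_assoc_seq in auto)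
  ultimately show ?case ..
next
  case (cmp_assoc_par m k s n l t r e u i j)
  have "oterm_of R (m + n + r - 2) (k + l + e) (Cmp i (Cmp j s u) t)"
    by (rule oterm_of_cmp_eq[OF oterm_of.cmp[of R m k s r e u j]]) (use cmp_assoc_par in auto)
  moreover have "oterm_of R (m + n + r - 2) (k + l + e) (Cmp (j + n - 1) (Cmp i s t) u)"
    by (rule oterm_of_cmp_eq[OF oterm_of.cmp[of R m k s n l t i]]) (use cmp_assoc_par in auto)
  ultimately show ?case by (auto intro: oterm_of.smul)
next
  case (dif_cmp m k s n l t i)
  have "oterm_of R (m + n - 1) (k + l + 1) (Cmp i (Dif s) t)"
    by (rule oterm_of_cmp_eq[OF oterm_of.dif[of R m k s]]) (use dif_cmp in auto)
  moreover have "oterm_of R (m + n - 1) (k + l + 1) (Cmp i s (Dif t))"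
    by (rule oterm_of_cmp_eq[OF _ oterm_of.dif[of R n l t]]) (use dif_cmp in auto)
  ultimately show ?case
    using dif_cmp by (auto intro!: oterm_of.add oterm_of.smul oterm_of.dif oterm_of.cmp)
next
  case (cmp_act m k s n l t i \<tau> \<sigma>)
  then show ?case
    using permutes_in_image[OF cmp_act(4), of i]
    by (auto intro!: oterm_of.act oterm_of.cmp block_perm_permutes)
qed (auto intro: oterm_of.intros permutes_compose)

lemma ocls_eqI: "oeq R n k s t \<Longrightarrow> ocls R n k s = ocls R n k t"
  unfolding ocls_def by (auto intro: oeq.trans oeq.sym)

lemma UN_const_on: "\<lbrakk>a \<in> X; \<And>x. x \<in> X \<Longrightarrow> f x = c\<rbrakk> \<Longrightarrow> (\<Union>x\<in>X. f x) = c"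
  by auto

lemma in_ocls: "oterm_of R n k t \<Longrightarrow> t \<in> ocls R n k t"
  by (simp add: ocls_def oeq.refl)

context
  fixes R :: "'g presentation"
begin

text \<open>The operations of the presented operad can be computed on any representatives.\<close>

lemma presented_car: "X \<in> op_car (presented_operad R) n k \<longleftrightarrow> (\<exists>t. oterm_of R n k t \<and> X = ocls R n k t)"
  by (auto simp: presented_operad_def)

lemma presented_carE:
  assumes "X \<in> op_car (presented_operad R) n k"
  obtains t where "oterm_of R n k t" "X = ocls R n k t"
  using assms presented_car by blast

lemma presented_carI: "oterm_of R n k t \<Longrightarrow> ocls R n k t \<in> op_car (presented_operad R) n k"
  using presented_car by blast

lemma presented_zero: "op_zero (presented_operad R) n k = ocls R n k (Zero n k)"
  by (simp add: presented_operad_def)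

lemma presented_unit: "op_unit (presented_operad R) = ocls R 1 0 Unit"
  by (simp add: presented_operad_def)

lemma in_oclsD: "s \<in> ocls R n k t \<Longrightarrow> oeq R n k s t"
  unfolding ocls_def by (rule oeq.sym) simp

lemma presented_add:
  assumes "oterm_of R n k s" "oterm_of R n k t"
  shows "op_add (presented_operad R) n k (ocls R n k s) (ocls R n k t) = ocls R n k (Add s t)"
  unfolding presented_operad_def operad.simps
  by (rule UN_const_on[OF in_ocls[OF assms(1)]], rule UN_const_on[OF in_ocls[OF assms(2)]])
     (rule ocls_eqI[OF oeq.cong_add[OF in_oclsD in_oclsD]])

lemma presented_smul:
  assumes "oterm_of R n k t"
  shows "op_smul (presented_operad R) n k a (ocls R n k t) = ocls R n k (Smul a t)"
  unfolding presented_operad_def operad.simps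
  by (rule UN_const_on[OF in_ocls[OF assms(1)]]) (rule ocls_eqI[OF oeq.cong_smul[OF in_oclsD]])

lemma presented_dif:
  assumes "oterm_of R n k t"
  shows "op_dif (presented_operad R) n k (ocls R n k t) = ocls R n (k + 1) (Dif t)"
  unfolding presented_operad_def operad.simps
  by (rule UN_const_on[OF in_ocls[OF assms(1)]]) (rule ocls_eqI[OF oeq.cong_dif[OF in_oclsD]])

lemma presented_act:
  assumes "oterm_of R n k t" "\<tau> permutes {..<n}"
  shows "op_act (presented_operad R) n k (ocls R n k t) \<tau> = ocls R n k (Act t \<tau>)"
  unfolding presented_operad_def operad.simps
  by (rule UN_const_on[OF in_ocls[OF assms(1)]]) (rule ocls_eqI[OF oeq.cong_act[OF in_oclsD assms(2)]])

lemma presented_cmp: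
  assumes "oterm_of R m k s" "oterm_of R n l t" "i < m"
  shows "op_cmp (presented_operad R) m k n l i (ocls R m k s) (ocls R n l t)
    = ocls R (m + n - 1) (k + l) (Cmp i s t)"
  unfolding presented_operad_def operad.simps
  by (rule UN_const_on[OF in_ocls[OF assms(1)]], rule UN_const_on[OF in_ocls[OF assms(2)]])
     (rule ocls_eqI[OF oeq.cong_cmp[OF in_oclsD in_oclsD assms(3)]])

lemmas presented_ops = presented_zero presented_unit presented_add presented_smul presented_dif
  presented_act presented_cmp

text \<open>The axioms are among the rules that generate the congruence. The work consists in
  bringing the arities and degrees of both sides to the same form.\<close>

lemma dg_operad_presented_operad: "dg_operad (presented_operad R)"
proof (unfold_locales, goal_cases)
  case (7 f m k g n l i)
  then show ?case by (auto elim!: presented_carE simp: presented_cmp intro!: presented_carI oterm_of.cmp)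
next
  case (18 x n k)
  then obtain t where t: "oterm_of R n k t" "x = ocls R n k t" by (rule presented_carE)
  show ?case
    using presented_dif[OF oterm_of.dif[OF t(1)]] ocls_eqI[OF oeq.dif_dif[OF t(1)]]
    by (simp add: t presented_dif presented_zero add.assoc)
next
  case (28 f m k g n l i)
  then obtain s t where st: "oterm_of R m k s" "f = ocls R m k s" "oterm_of R n l t" "g = ocls R n l t" "i < m"
    by (auto elim!: presented_carE)
  have 1: "oterm_of R (m + n - 1) (k + l + 1) (Cmp i (Dif s) t)"
    by (rule oterm_of_cmp_eq[OF oterm_of.dif[OF st(1)] st(3)]) (use st in auto)
  have 2: "oterm_of R (m + n - 1) (k + l + 1) (Cmp i s (Dif t))"
    by (rule oterm_of_cmp_eq[OF st(1) oterm_of.dif[OF st(3)]]) (use st in auto)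
  have 3: "op_cmp (presented_operad R) m (k + 1) n l i (ocls R m (k + 1) (Dif s)) (ocls R n l t)
      = ocls R (m + n - 1) (k + l + 1) (Cmp i (Dif s) t)"
    using presented_cmp[OF oterm_of.dif[OF st(1)] st(3,5)] by (simp add: algebra_simps)
  have 4: "op_cmp (presented_operad R) m k n (l + 1) i (ocls R m k s) (ocls R n (l + 1) (Dif t))
      = ocls R (m + n - 1) (k + l + 1) (Cmp i s (Dif t))"
    using presented_cmp[OF st(1) oterm_of.dif[OF st(3)] st(5)] by (simp add: algebra_simps)
  show ?case
    using st 1 2 oeq.dif_cmp[OF st(1,3,5)]
    by (simp add: presented_cmp presented_dif 3 4 presented_smul presented_add oterm_of.cmp oterm_of.smul
        ocls_eqI)
next
  case (29 f m k g n l h r s i j)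
  then obtain a b c where abc: "oterm_of R m k a" "f = ocls R m k a" "oterm_of R n l b" "g = ocls R n l b"
    "oterm_of R r s c" "h = ocls R r s c" "i < m" "j < n"
    by (auto elim!: presented_carE)
  have 1: "op_cmp (presented_operad R) (m + n - 1) (k + l) r s (i + j) (ocls R (m + n - 1) (k + l) (Cmp i a b)) (ocls R r s c)
      = ocls R (m + n + r - 2) (k + l + s) (Cmp (i + j) (Cmp i a b) c)"
    using presented_cmp[OF oterm_of.cmp[OF abc(1,3,7)] abc(5), of "i + j"] abc(7,8) by (simp add: algebra_simps numeral_2_eq_2)
  have 2: "op_cmp (presented_operad R) m k (n + r - 1) (l + s) i (ocls R m k a) (ocls R (n + r - 1) (l + s) (Cmp j b c))
      = ocls R (m + n + r - 2) (k + l + s) (Cmp i a (Cmp j b c))"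
    using presented_cmp[OF abc(1) oterm_of.cmp[OF abc(3,5,8)] abc(7)] abc(7,8)
    by (simp add: algebra_simps numeral_2_eq_2)
  show ?case using abc oeq.cmp_assoc_seq[OF abc(1,3,5,7,8)] by (simp add: presented_cmp 1 2 ocls_eqI)
next
  case (30 f m k g n l h r s i j)
  then obtain a b c where abc: "oterm_of R m k a" "f = ocls R m k a" "oterm_of R n l b" "g = ocls R n l b"
    "oterm_of R r s c" "h = ocls R r s c" "i < j" "j < m" "i < m"
    by (auto elim!: presented_carE)
  have 1: "op_cmp (presented_operad R) (m + r - 1) (k + s) n l i (ocls R (m + r - 1) (k + s) (Cmp j a c)) (ocls R n l b)
      = ocls R (m + n + r - 2) (k + l + s) (Cmp i (Cmp j a c) b)"
    using presented_cmp[OF oterm_of.cmp[OF abc(1,5,8)] abc(3), of i] abc(7,8) by (simp add: algebra_simps numeral_2_eq_2)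
  have 2: "op_cmp (presented_operad R) (m + n - 1) (k + l) r s (j + n - 1) (ocls R (m + n - 1) (k + l) (Cmp i a b)) (ocls R r s c)
      = ocls R (m + n + r - 2) (k + l + s) (Cmp (j + n - 1) (Cmp i a b) c)"
    using presented_cmp[OF oterm_of.cmp[OF abc(1,3,9)] abc(5), of "j + n - 1"] abc(7,8) by (simp add: algebra_simps numeral_2_eq_2)
  have 3: "oterm_of R (m + n + r - 2) (k + l + s) (Cmp (j + n - 1) (Cmp i a b) c)"
    using abc by (intro oterm_of_cmp_eq[OF oterm_of.cmp[OF abc(1,3,9)] abc(5)]) auto
  show ?case using abc 3 oeq.cmp_assoc_par[OF abc(1,3,5,7,8)]
    by (simp add: presented_cmp 1 2 presented_smul ocls_eqI)
next
  case (31 g n l)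
  then obtain t where "oterm_of R n l t" "g = ocls R n l t" by (rule presented_carE)
  then show ?case
    using presented_cmp[OF oterm_of.unit, of n l t 0] ocls_eqI[OF oeq.cmp_unit_left, of R n l t]
    by (simp add: presented_unit)
next
  case (32 f m k i)
  then obtain t where "oterm_of R m k t" "f = ocls R m k t" "i < m" by (auto elim: presented_carE)
  then show ?case
    using presented_cmp[OF _ oterm_of.unit, of m k t i] ocls_eqI[OF oeq.cmp_unit_right, of R m k t i]
    by (simp add: presented_unit)
next
  case (33 f m k g n l i \<tau> \<sigma>)
  then obtain s t where "oterm_of R m k s" "f = ocls R m k s" "oterm_of R n l t" "g = ocls R n l t"
    by (auto elim!: presented_carE)
  then show ?case
    using permutes_in_image[OF 33(4), of i] 33 ocls_eqI[OF oeq.cmp_act, of R m k s n l t i \<tau> \<sigma>]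
    by (simp add: presented_ops oterm_of.cmp oterm_of.act block_perm_permutes)
qed (auto elim!: presented_carE simp: presented_ops oterm_of.intros permutes_compose del: equalityI
    intro!: presented_carI ocls_eqI oterm_of.intros
    intro: oeq.add_assoc oeq.add_commute oeq.add_zero oeq.add_minus oeq.smul_add oeq.add_smul
      oeq.smul_smul oeq.smul_one oeq.dif_add oeq.dif_smul oeq.act_add oeq.act_smul oeq.act_id
      oeq.act_act oeq.dif_act oeq.cmp_add_left oeq.cmp_smul_left oeq.cmp_add_right oeq.cmp_smul_right)

end

text \<open>Arity and degree are computed for all terms, well-formed or not, which makes evaluation in an
  operad a structural recursion on terms.\<close>

primrec term_arity :: "'g presentation \<Rightarrow> 'g oterm \<Rightarrow> nat" where
  "term_arity R (Gen g) = gen_arity R g"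
| "term_arity R Unit = 1"
| "term_arity R (Zero n k) = n"
| "term_arity R (Add s t) = term_arity R s"
| "term_arity R (Smul a t) = term_arity R t"
| "term_arity R (Dif t) = term_arity R t"
| "term_arity R (Act t \<tau>) = term_arity R t"
| "term_arity R (Cmp i s t) = term_arity R s + term_arity R t - 1"

primrec term_degree :: "'g presentation \<Rightarrow> 'g oterm \<Rightarrow> int" where
  "term_degree R (Gen g) = gen_degree R g"
| "term_degree R Unit = 0"
| "term_degree R (Zero n k) = k"
| "term_degree R (Add s t) = term_degree R s"
| "term_degree R (Smul a t) = term_degree R t"
| "term_degree R (Dif t) = term_degree R t + 1"
| "term_degree R (Act t \<tau>) = term_degree R t"
| "term_degree R (Cmp i s t) = term_degree R s + term_degree R t"

primrec term_value :: "'g presentation \<Rightarrow> 'x operad \<Rightarrow> ('g \<Rightarrow> 'x) \<Rightarrow> 'g oterm \<Rightarrow> 'x" where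
  "term_value R Q \<phi> (Gen g) = \<phi> g"
| "term_value R Q \<phi> Unit = op_unit Q"
| "term_value R Q \<phi> (Zero n k) = op_zero Q n k"
| "term_value R Q \<phi> (Add s t) =
    op_add Q (term_arity R s) (term_degree R s) (term_value R Q \<phi> s) (term_value R Q \<phi> t)"
| "term_value R Q \<phi> (Smul a t) = op_smul Q (term_arity R t) (term_degree R t) a (term_value R Q \<phi> t)"
| "term_value R Q \<phi> (Dif t) = op_dif Q (term_arity R t) (term_degree R t) (term_value R Q \<phi> t)"
| "term_value R Q \<phi> (Act t \<tau>) = op_act Q (term_arity R t) (term_degree R t) (term_value R Q \<phi> t) \<tau>"
| "term_value R Q \<phi> (Cmp i s t) =
    op_cmp Q (term_arity R s) (term_degree R s) (term_arity R t) (term_degree R t) i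
      (term_value R Q \<phi> s) (term_value R Q \<phi> t)"

lemma term_arity_degree: "oterm_of R n k t \<Longrightarrow> term_arity R t = n \<and> term_degree R t = k"
  by (induction rule: oterm_of.induct) auto

lemma term_value_in_car:
  assumes "dg_operad Q" and "\<And>g. g \<in> gens R \<Longrightarrow> \<phi> g \<in> op_car Q (gen_arity R g) (gen_degree R g)"
    and "oterm_of R n k t"
  shows "term_value R Q \<phi> t \<in> op_car Q n k"
proof -
  interpret dg_operad Q by fact
  show ?thesis
    using assms(3)
    by induction
      (auto simp: term_arity_degree assms(2) zero_closed add_closed smul_closed dif_closed act_closed
        unit_closed cmp_closed)
qed

text \<open>The congruence is generated by the axioms, which hold in \<open>Q\<close>, and by the relations.\<close>

lemma term_value_respects_oeq:
  assumes Q: "dg_operad Q" and gen: "\<And>g. g \<in> gens R \<Longrightarrow> \<phi> g \<in> op_car Q (gen_arity R g) (gen_degree R g)"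
    and rel: "\<And>n k s t. \<lbrakk>(s, t) \<in> rels R; oterm_of R n k s; oterm_of R n k t\<rbrakk>
      \<Longrightarrow> term_value R Q \<phi> s = term_value R Q \<phi> t"
    and "oeq R n k s t"
  shows "term_value R Q \<phi> s = term_value R Q \<phi> t"
proof -
  interpret Q: dg_operad Q by fact
  note [simp] = term_arity_degree term_value_in_car[OF Q gen]
  have deg: "\<And>n k s t. oeq R n k s t \<Longrightarrow> term_arity R s = n \<and> term_degree R s = k \<and>
      term_arity R t = n \<and> term_degree R t = k"
    using oterm_of_if_oeq term_arity_degree by blast
  show ?thesis
    using \<open>oeq R n k s t\<close>
  proof induction
    case (cong_add n k s s' t t')
    then show ?case using deg[OF cong_add(1)] by simp
  next
    case (cong_smul n k t t' a)
    then show ?case using deg[OF cong_smul(1)] by simp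
  next
    case (cong_dif n k t t')
    then show ?case using deg[OF cong_dif(1)] by simp
  next
    case (cong_act n k t t' \<tau>)
    then show ?case using deg[OF cong_act(1)] by simp
  next
    case (cong_cmp m k s s' n l t t' i)
    then show ?case using deg[OF cong_cmp(1)] deg[OF cong_cmp(2)] by simp
  next
    case (add_assoc n k s t u)
    then show ?case by (simp add: Q.add_assoc)
  next
    case (dif_cmp m k s n l t i)
    then show ?case by (simp add: Q.dif_cmp add.commute add.left_commute)
  next
    case (cmp_assoc_seq m k s n l t r e u i j)
    then show ?case by (simp add: Q.cmp_assoc_seq)
  next
    case (cmp_assoc_par m k s n l t r e u i j)
    moreover have "m + n - 1 + r - 1 = m + n + r - 2" using cmp_assoc_par by simp
    ultimately show ?case
      by (simp add: Q.cmp_assoc_par)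
  next
    case (cmp_act m k s n l t i \<tau> \<sigma>)
    then show ?case
      using permutes_in_image[OF cmp_act(4), of i] by (simp add: Q.cmp_act)
  qed (simp_all add: rel Q.add_commute Q.add_zero Q.add_minus Q.smul_add Q.add_smul
      Q.smul_smul Q.smul_one Q.dif_add Q.dif_smul Q.dif_dif Q.act_add Q.act_smul
      Q.act_id Q.act_act Q.dif_act Q.cmp_add_left Q.cmp_smul_left Q.cmp_add_right
      Q.cmp_smul_right Q.cmp_unit_left Q.cmp_unit_right)
qed

lemma (in dg_operad) zero_smul:
  assumes "x \<in> op_car P n k"
  shows "op_smul P n k 0 x = op_zero P n k"
proof -
  have "op_smul P n k 0 x = op_smul P n k (1 + (-1)) x" by simp
  also have "\<dots> = op_zero P n k" unfolding add_smul[OF assms] by (simp add: smul_one add_minus assms)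
  finally show ?thesis .
qed

lemma dg_operad_hom_zero:
  assumes G: "G \<in> dg_operad_hom P Q"
  shows "G n k (op_zero P n k) = op_zero Q n k"
proof -
  have PQ: "dg_operad P" "dg_operad Q" using G by (auto simp: dg_operad_hom_def)
  have z: "op_zero P n k \<in> op_car P n k" using dg_operad.zero_closed[OF PQ(1)] .
  have "G n k (op_smul P n k 0 (op_zero P n k)) = op_smul Q n k 0 (G n k (op_zero P n k))"
    using G z by (simp add: dg_operad_hom_def)
  moreover have "G n k (op_zero P n k) \<in> op_car Q n k"
    using G z by (auto simp: dg_operad_hom_def)
  ultimately show ?thesis
    using dg_operad.zero_smul[OF PQ(1) z] dg_operad.zero_smul[OF PQ(2)] by metis
qed

text \<open>A morphism is compatible with all constructors of terms, so that its values on generators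
  propagate to all terms.\<close>

lemma dg_operad_hom_eqI:
  assumes F: "F \<in> dg_operad_hom (presented_operad R) Q" and F': "F' \<in> dg_operad_hom (presented_operad R) Q"
    and gen: "\<And>g. g \<in> gens R \<Longrightarrow>
      F (gen_arity R g) (gen_degree R g) (gen_class R g) = F' (gen_arity R g) (gen_degree R g) (gen_class R g)"
  shows "F = F'"
proof (intro ext)
  fix n k X
  have eq: "F n k (ocls R n k t) = F' n k (ocls R n k t)" if "oterm_of R n k t" for t n k
    using that
  proof induction
    case (gen g)
    then show ?case using assms(3) by (simp add: gen_class_def)
  next
    case unit
    then show ?case using F F' by (simp add: dg_operad_hom_def flip: presented_unit)
  next
    case (zero n k)
    then show ?case using dg_operad_hom_zero[OF F] dg_operad_hom_zero[OF F'] by (simp flip: presented_zero)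
  next
    case (add n k s t)
    then show ?case using F F' by (simp add: dg_operad_hom_def presented_carI flip: presented_add)
  next
    case (smul n k t a)
    then show ?case using F F' by (simp add: dg_operad_hom_def presented_carI flip: presented_smul)
  next
    case (dif n k t)
    then show ?case using F F' by (simp add: dg_operad_hom_def presented_carI flip: presented_dif)
  next
    case (act n k t \<tau>)
    then show ?case using F F' by (simp add: dg_operad_hom_def presented_carI flip: presented_act)
  next
    case (cmp m k s n l t i)
    then show ?case using F F' by (simp add: dg_operad_hom_def presented_carI flip: presented_cmp)
  qed
  have ext: "F n k \<in> op_car (presented_operad R) n k \<rightarrow>\<^sub>E op_car Q n k" "F' n k \<in> op_car (presented_operad R) n k \<rightarrow>\<^sub>E op_car Q n k"
    using F F' by (simp_all add: dg_operad_hom_def)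
  show "F n k X = F' n k X"
  proof (cases "X \<in> op_car (presented_operad R) n k")
    case True
    then obtain t where "oterm_of R n k t" "X = ocls R n k t" by (rule presented_carE)
    then show ?thesis using eq[of n k t] by simp
  next
    case False
    then show ?thesis using PiE_arb[OF ext(1)] PiE_arb[OF ext(2)] by simp
  qed
qed

text \<open>The image of a class is obtained by evaluating any of its representatives.\<close>

lemma presented_operad_universal:
  assumes Q: "dg_operad Q" and gen: "\<And>g. g \<in> gens R \<Longrightarrow> \<phi> g \<in> op_car Q (gen_arity R g) (gen_degree R g)"
    and rel: "\<And>n k s t. \<lbrakk>(s, t) \<in> rels R; oterm_of R n k s; oterm_of R n k t\<rbrakk>
      \<Longrightarrow> term_value R Q \<phi> s = term_value R Q \<phi> t"
  shows "\<exists>F\<in>dg_operad_hom (presented_operad R) Q.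
    \<forall>g\<in>gens R. F (gen_arity R g) (gen_degree R g) (gen_class R g) = \<phi> g"
proof -
  interpret dg_operad Q by fact
  let ?P = "presented_operad R"
  let ?v = "term_value R Q \<phi>"
  define F where "F = (\<lambda>n k. \<lambda>X\<in>op_car ?P n k. ?v (SOME t. t \<in> X))"
  have F: "F n k (ocls R n k t) = ?v t" if "oterm_of R n k t" for n k t
  proof -
    have "(SOME s. s \<in> ocls R n k t) \<in> ocls R n k t" using in_ocls[OF that] by (rule someI)
    then have "?v t = ?v (SOME s. s \<in> ocls R n k t)"
      unfolding ocls_def by (intro term_value_respects_oeq[OF Q gen rel]) auto
    then show ?thesis using presented_carI[OF that] by (simp add: F_def)
  qed
  note [simp] = term_arity_degree presented_ops oterm_of.intros F
  have "F \<in> dg_operad_hom ?P Q"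
    unfolding dg_operad_hom_def mem_Collect_eq
  proof (intro conjI allI ballI impI, goal_cases)
    case 1
    show ?case by (rule dg_operad_presented_operad)
  next
    case 2
    show ?case by (rule Q)
  next
    case (3 n k)
    show ?case
    proof (rule PiE_I)
      fix X assume "X \<in> op_car ?P n k"
      then obtain t where "oterm_of R n k t" "X = ocls R n k t" by (rule presented_carE)
      then show "F n k X \<in> op_car Q n k" using term_value_in_car[OF Q gen] F by simp
    qed (simp add: F_def)
  next
    case (4 n k x y)
    then obtain s t where "oterm_of R n k s" "x = ocls R n k s" "oterm_of R n k t" "y = ocls R n k t"
      by (auto elim!: presented_carE)
    then show ?case by simp
  next
    case (5 n k a x)
    then obtain t where "oterm_of R n k t" "x = ocls R n k t" by (auto elim!: presented_carE)
    then show ?case by simp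
  next
    case (6 n k x)
    then obtain t where "oterm_of R n k t" "x = ocls R n k t" by (auto elim!: presented_carE)
    then show ?case by simp
  next
    case (7 n k \<tau> x)
    then obtain t where "oterm_of R n k t" "x = ocls R n k t" by (auto elim!: presented_carE)
    then show ?case using 7 by simp
  next
    case 8
    then show ?case by simp
  next
    case (9 m k n l i f g)
    then obtain s t where "oterm_of R m k s" "f = ocls R m k s" "oterm_of R n l t" "g = ocls R n l t"
      by (auto elim!: presented_carE)
    then show ?case using 9 by simp
  qed
  moreover have "F (gen_arity R g) (gen_degree R g) (gen_class R g) = \<phi> g" if "g \<in> gens R" for g
    using F[OF oterm_of.gen[OF that]] by (simp add: gen_class_def)
  ultimately show ?thesis by blast
qed

lemma dg_operad_hom_comp:
  assumes G: "G \<in> dg_operad_hom P Q" and H: "H \<in> dg_operad_hom Q S"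
  shows "operad_hom_comp P H G \<in> dg_operad_hom P S"
proof -
  have P: "dg_operad P" and S: "dg_operad S" using G H by (auto simp: dg_operad_hom_def)
  interpret P: dg_operad P by fact
  have car: "x \<in> op_car P n k \<Longrightarrow> G n k x \<in> op_car Q n k" "y \<in> op_car Q n k \<Longrightarrow> H n k y \<in> op_car S n k" for n k x y
    using G H by (auto simp: dg_operad_hom_def PiE_iff)
  show ?thesis
    unfolding dg_operad_hom_def mem_Collect_eq operad_hom_comp_def
    using G H P S
    by (auto simp: compose_def dg_operad_hom_def P.add_closed P.smul_closed P.dif_closed P.act_closed
        P.unit_closed P.cmp_closed car)
qed

section \<open>Sums of terms\<close>

text \<open>This is the enumeration that is used in \<open>Sum_term\<close>.\<close>

definition set_enum :: "'a set \<Rightarrow> 'a list" where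
  "set_enum S = (SOME xs. distinct xs \<and> set xs = S)"

lemma set_enum: assumes "finite S" shows "distinct (set_enum S) \<and> set (set_enum S) = S"
  unfolding set_enum_def by (rule someI_ex) (use finite_distinct_list[OF assms] in blast)

lemma oterm_of_Sum_term:
  assumes "finite S" "\<And>a. a \<in> S \<Longrightarrow> oterm_of R n k (f a)"
  shows "oterm_of R n k (Sum_term n k f S)"
proof -
  have "oterm_of R n k (foldr (\<lambda>a. Add (f a)) xs (Zero n k))" if "set xs \<subseteq> S" for xs
    using that assms(2) by (induction xs) (auto intro: oterm_of.intros)
  then show ?thesis using set_enum[OF assms(1)] by (simp add: Sum_term_def set_enum_def)
qed

lemma term_value_Sum_term:
  assumes "finite S" "\<And>a. a \<in> S \<Longrightarrow> term_arity R (f a) = n \<and> term_degree R (f a) = k"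
  shows "term_value R Q \<phi> (Sum_term n k f S) =
    foldr (\<lambda>a. op_add Q n k (term_value R Q \<phi> (f a))) (set_enum S) (op_zero Q n k)"
proof -
  have "term_value R Q \<phi> (foldr (\<lambda>a. Add (f a)) xs (Zero n k)) =
    foldr (\<lambda>a. op_add Q n k (term_value R Q \<phi> (f a))) xs (op_zero Q n k)" if "set xs \<subseteq> S" for xs
    using that assms(2) by (induction xs) auto
  then show ?thesis using set_enum[OF assms(1)] by (simp add: Sum_term_def set_enum_def)
qed

lemma finite_shuffles_perm: "finite (shuffles_perm p q)"
  by (rule finite_subset[OF _ finite_permutations[of "{..<p + q}"]]) (auto simp: shuffles_perm_def)

lemma oterm_of_mu_pow: "oterm_of R 2 0 \<mu> \<Longrightarrow> oterm_of R (Suc m) 0 (mu_pow \<mu> (Suc m))"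
proof (induction m)
  case 0
  then show ?case using oterm_of.unit[of R] by (simp add: One_nat_def)
next
  case (Suc m)
  then show ?case using oterm_of.cmp[of R 2 0 \<mu> "Suc m" 0 "mu_pow \<mu> (Suc m)" 0] by simp
qed

lemma oterm_of_DO_summand:
  assumes "oterm_of R 2 0 \<mu>" "oterm_of R 1 k D" "p + q = n + 1" "1 \<le> p" "\<sigma> \<in> shuffles_perm p q"
  shows "oterm_of R p k (Cmp 0 D (mu_pow \<mu> p))"
    and "oterm_of R (n + 1) k (Cmp 0 (mu_pow \<mu> (q + 1)) (Cmp 0 D (mu_pow \<mu> p)))"
    and "oterm_of R (n + 1) k (Act (Cmp 0 (mu_pow \<mu> (q + 1)) (Cmp 0 D (mu_pow \<mu> p))) (inv \<sigma>))"
proof -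
  have p: "oterm_of R p 0 (mu_pow \<mu> p)" and q: "oterm_of R (q + 1) 0 (mu_pow \<mu> (q + 1))"
    using oterm_of_mu_pow[OF assms(1), of "p - 1"] oterm_of_mu_pow[OF assms(1), of q] assms(4) by (auto simp: One_nat_def)
  show 1: "oterm_of R p k (Cmp 0 D (mu_pow \<mu> p))"
    by (rule oterm_of_cmp_eq[OF assms(2) p]) auto
  show 2: "oterm_of R (n + 1) k (Cmp 0 (mu_pow \<mu> (q + 1)) (Cmp 0 D (mu_pow \<mu> p)))"
    by (rule oterm_of_cmp_eq[OF q 1]) (use assms in auto)
  show "oterm_of R (n + 1) k (Act (Cmp 0 (mu_pow \<mu> (q + 1)) (Cmp 0 D (mu_pow \<mu> p))) (inv \<sigma>))"
    using assms by (intro oterm_of.act 2 permutes_inv) (auto simp: shuffles_perm_def)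
qed

lemma finite_DO_index: "finite {(p::nat, q). p + q = N \<and> 1 \<le> p}"
  by (rule finite_subset[of _ "{..N} \<times> {..N}"]) auto

lemma oterm_of_DO_term:
  assumes "oterm_of R 2 0 \<mu>" "oterm_of R 1 k D"
  shows "oterm_of R (n + 1) k (DO_term \<mu> n k D)"
  unfolding DO_term_def
  by (intro oterm_of_Sum_term finite_DO_index)
    (auto intro!: oterm_of.smul oterm_of_Sum_term finite_shuffles_perm oterm_of_DO_summand[OF assms] simp del: One_nat_def)

section \<open>Koszul signs\<close>

lemma minus_one_powi_if: "(-1::real) powi k = (if even k then 1 else -1)"
  by (auto simp: power_int_def minus_one_power_iff even_nat_iff)

lemma minus_one_powi_add: "(-1::real) powi (k + l) = (-1) powi k * (-1) powi l"
  by (simp add: power_int_add)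

lemma minus_one_powi_sum: "(-1::real) powi (\<Sum>a\<in>S. f a) = (\<Prod>a\<in>S. (-1) powi f a)"
  by (induction S rule: infinite_finite_induct) (auto simp: minus_one_powi_add)

text \<open>The Koszul sign depends on the degrees only. As a product over all pairs of positions, with a
  factor \<open>1\<close> for those that are not inverted, it can be reindexed and split into blocks.\<close>

definition degree_sign :: "(nat \<Rightarrow> nat) \<Rightarrow> int list \<Rightarrow> real" where
  "degree_sign \<tau> ds = (\<Prod>a<length ds. \<Prod>b<length ds.
     if a < b \<and> \<tau> b < \<tau> a then (-1) powi (ds ! a * ds ! b) else 1)"

lemma degree_sign_pairs:
  "degree_sign \<tau> ds = (\<Prod>(a, b)\<in>{(a, b). a < b \<and> b < length ds}.
     if \<tau> b < \<tau> a then (-1) powi (ds ! a * ds ! b) else 1)"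
proof -
  have "degree_sign \<tau> ds = (\<Prod>(a, b)\<in>{..<length ds} \<times> {..<length ds}.
     if a < b \<and> \<tau> b < \<tau> a then (-1) powi (ds ! a * ds ! b) else 1)"
    by (simp add: degree_sign_def prod.cartesian_product)
  also have "\<dots> = (\<Prod>(a, b)\<in>{(a, b). a < b \<and> b < length ds}.
     if \<tau> b < \<tau> a then (-1) powi (ds ! a * ds ! b) else 1)"
    by (rule prod.mono_neutral_cong_right) (auto split: if_splits)
  finally show ?thesis .
qed

lemma koszul_sign_eq_degree_sign: "koszul_sign \<tau> zs = degree_sign \<tau> (map fst zs)"
proof -
  have fin: "finite {(a, b). a < b \<and> b < length zs}"
    by (rule finite_subset[of _ "{..<length zs} \<times> {..<length zs}"]) auto
  show ?thesis
    unfolding koszul_sign_def degree_sign_pairs length_map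
    by (rule prod.mono_neutral_cong_left[OF fin]) (auto split: if_splits)
qed

lemma degree_sign_id: "degree_sign id ds = 1"
  by (auto simp: degree_sign_def intro!: prod.neutral)

text \<open>A pair is inverted by the composite iff it is inverted in exactly one of the two steps. The
  factors of a pair that is inverted in both of them cancel.\<close>

lemma degree_sign_compose:
  assumes \<sigma>: "\<sigma> permutes {..<length ds}" and \<tau>: "\<tau> permutes {..<length ds}"
  shows "degree_sign (\<tau> \<circ> \<sigma>) ds = degree_sign \<sigma> ds * degree_sign \<tau> (permute_list (inv \<sigma>) ds)"
proof -
  let ?N = "length ds" and ?P = "{(a, b). a < b \<and> b < length ds}"
  note \<sigma>' = permutes_inv[OF \<sigma>]
  have inv[simp]: "inv \<sigma> (\<sigma> a) = a" "\<sigma> (inv \<sigma> a) = a" for a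
    using permutes_inverses[OF \<sigma>] by auto
  have lt: "\<sigma> a < ?N \<longleftrightarrow> a < ?N" "inv \<sigma> a < ?N \<longleftrightarrow> a < ?N" for a
    using permutes_in_image[OF \<sigma>] permutes_in_image[OF \<sigma>'] by auto
  have inj: "\<sigma> a = \<sigma> b \<longleftrightarrow> a = b" "inv \<sigma> a = inv \<sigma> b \<longleftrightarrow> a = b" "\<tau> a = \<tau> b \<longleftrightarrow> a = b" for a b
    by (metis inv)+ (use permutes_inj[OF \<tau>] in \<open>auto dest: injD\<close>)
  have less: "\<lbrakk>\<not> \<sigma> a < \<sigma> b; a < b\<rbrakk> \<Longrightarrow> \<sigma> b < \<sigma> a"
    "\<lbrakk>\<not> inv \<sigma> a < inv \<sigma> b; a < b\<rbrakk> \<Longrightarrow> inv \<sigma> b < inv \<sigma> a" for a b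
    using inj(1)[of a b] inj(2)[of a b] by auto
  have "degree_sign \<tau> (permute_list (inv \<sigma>) ds) = (\<Prod>(c, d)\<in>?P.
      if \<tau> d < \<tau> c then (-1) powi (ds ! inv \<sigma> c * ds ! inv \<sigma> d) else 1)"
    by (auto simp: degree_sign_pairs permute_list_def intro!: prod.cong)
  also have "\<dots> = (\<Prod>(a, b)\<in>?P.
      if \<tau> (max (\<sigma> a) (\<sigma> b)) < \<tau> (min (\<sigma> a) (\<sigma> b)) then (-1) powi (ds ! a * ds ! b) else 1)"
    by (rule prod.reindex_bij_witness[where
          j = "\<lambda>(c, d). (min (inv \<sigma> c) (inv \<sigma> d), max (inv \<sigma> c) (inv \<sigma> d))" and
          i = "\<lambda>(a, b). (min (\<sigma> a) (\<sigma> b), max (\<sigma> a) (\<sigma> b))"])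
      (auto simp: min_def max_def lt inj mult.commute le_less split: if_splits intro: less)
  finally have "degree_sign \<sigma> ds * degree_sign \<tau> (permute_list (inv \<sigma>) ds) = (\<Prod>(a, b)\<in>?P.
      (if \<sigma> b < \<sigma> a then (-1) powi (ds ! a * ds ! b) else 1) *
      (if \<tau> (max (\<sigma> a) (\<sigma> b)) < \<tau> (min (\<sigma> a) (\<sigma> b)) then (-1) powi (ds ! a * ds ! b) else 1))"
    by (simp add: degree_sign_pairs prod.distrib[symmetric] case_prod_unfold)
  also have "\<dots> = degree_sign (\<tau> \<circ> \<sigma>) ds"
    unfolding degree_sign_pairs
  proof (intro prod.cong HOL.refl, clarify)
    fix a b :: nat assume "a < b"
    then have "\<sigma> a \<noteq> \<sigma> b" "\<tau> (\<sigma> a) \<noteq> \<tau> (\<sigma> b)" using inj by auto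
    then show "(if \<sigma> b < \<sigma> a then (-1) powi (ds ! a * ds ! b) else 1) *
      (if \<tau> (max (\<sigma> a) (\<sigma> b)) < \<tau> (min (\<sigma> a) (\<sigma> b)) then (-1) powi (ds ! a * ds ! b) else 1) =
      (if (\<tau> \<circ> \<sigma>) b < (\<tau> \<circ> \<sigma>) a then (-1::real) powi (ds ! a * ds ! b) else 1)"
      by (cases "\<sigma> a < \<sigma> b") (auto simp: minus_one_powi_if min_def max_def)
  qed
  finally show ?thesis by simp
qed

lemma lessThan_add_split:
  fixes f :: "nat \<Rightarrow> 'c::comm_monoid_mult"
  shows "(\<Prod>a<p + q. f a) = (\<Prod>a<p. f a) * (\<Prod>a<q. f (p + a))"
  by (induction q) (auto simp: mult.assoc)

text \<open>Inverting two blocks costs the sign of their total degrees, so a block can be replaced by a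
  single element of the same total degree.\<close>

lemma degree_sign_block_perm:
  assumes len: "length us = i" "length vs = n" "length ws = r" and m: "m = i + 1 + r"
    and \<tau>: "\<tau> permutes {..<m}" and \<sigma>: "\<sigma> permutes {..<n}"
  shows "degree_sign (block_perm m n i \<tau> \<sigma>) (us @ vs @ ws) =
    degree_sign \<sigma> vs * degree_sign \<tau> (us @ [sum_list vs] @ ws)"
proof -
  let ?\<beta> = "block_perm m n i \<tau> \<sigma>" and ?ds = "us @ vs @ ws" and ?es = "us @ [sum_list vs] @ ws"
  have S: "\<And>j. j < n \<Longrightarrow> \<sigma> j < n" using permutes_in_image[OF \<sigma>] by auto
  have injT: "\<And>a b. \<tau> a = \<tau> b \<longleftrightarrow> a = b"
    using permutes_inj[OF \<tau>] by (auto dest: injD)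
  define t where "t = (\<lambda>a b. if a < b \<and> ?\<beta> b < ?\<beta> a then (-1::real) powi (?ds ! a * ?ds ! b) else 1)"
  define u where "u = (\<lambda>a b. if a < b \<and> \<tau> b < \<tau> a then (-1::real) powi (?es ! a * ?es ! b) else 1)"
  have bA: "?\<beta> a = (if \<tau> a < \<tau> i then \<tau> a else \<tau> a + n - 1)" "\<tau> a \<noteq> \<tau> i" if "a < i" for a
    using that injT[of a i] by (auto simp: block_perm_def Let_def)
  have bB: "?\<beta> (i + b) = \<tau> i + \<sigma> b" "\<sigma> b < n" if "b < n" for b
    using that S by (auto simp: block_perm_def Let_def)
  have bC: "?\<beta> (i + (n + c)) = (if \<tau> (i + (1 + c)) < \<tau> i then \<tau> (i + (1 + c)) else \<tau> (i + (1 + c)) + n - 1)"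
    "\<tau> (i + (1 + c)) \<noteq> \<tau> i" if "c < r" for c
    using that injT[of "i + (1 + c)" i] m by (auto simp: block_perm_def Let_def algebra_simps)
  have dA: "?ds ! a = us ! a" "?es ! a = us ! a" if "a < i" for a
    using that len by (auto simp: nth_append)
  have dB: "?ds ! (i + b) = vs ! b" if "b < n" for b
    using that len by (auto simp: nth_append)
  have dI: "?es ! i = sum_list vs"
    using len by (auto simp: nth_append)
  have dC: "?ds ! (i + (n + c)) = ws ! c" "?es ! (i + (1 + c)) = ws ! c" if "c < r" for c
    using that len by (auto simp: nth_append)
  have sum: "sum_list vs = (\<Sum>b<n. vs ! b)"
    using len by (simp add: sum_list_sum_nth atLeast0LessThan)
  have AA: "t a a' = u a a'" if "a < i" "a' < i" for a a'
    using bA[OF that(1)] bA[OF that(2)] dA that by (auto simp: t_def u_def)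
  have AB: "(\<Prod>b<n. t a (i + b)) = u a i" if "a < i" for a
  proof -
    have "t a (i + b) = (if \<tau> i < \<tau> a then (-1) powi (us ! a * vs ! b) else 1)" if "b < n" for b
      using bA[OF \<open>a < i\<close>] bB[OF that] dA \<open>a < i\<close> dB[OF that] by (auto simp: t_def)
    then show ?thesis
      using \<open>a < i\<close> dA dI
      by (auto simp: u_def sum sum_distrib_left minus_one_powi_sum intro!: prod.cong prod.neutral)
  qed
  have AC: "t a (i + (n + c)) = u a (i + (1 + c))" if "a < i" "c < r" for a c
    using bA[OF that(1)] bC[OF that(2)] dA dC that by (auto simp: t_def u_def)
  have BA: "t (i + b) a = 1" "u i a = 1" if "a < i" for a b
    using that by (auto simp: t_def u_def)
  have BB: "t (i + a) (i + b) = (if a < b \<and> \<sigma> b < \<sigma> a then (-1) powi (vs ! a * vs ! b) else 1)"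
    if "a < n" "b < n" for a b
    using that bB dB by (auto simp: t_def)
  have BC: "(\<Prod>b<n. t (i + b) (i + (n + c))) = u i (i + (1 + c))" if "c < r" for c
  proof -
    have "t (i + b) (i + (n + c)) = (if \<tau> (i + (1 + c)) < \<tau> i then (-1) powi (vs ! b * ws ! c) else 1)" if "b < n" for b
      using bC[OF \<open>c < r\<close>] bB[OF that] dC \<open>c < r\<close> dB[OF that] that by (auto simp: t_def)
    then show ?thesis
      using \<open>c < r\<close> dC dI
      by (auto simp: u_def sum sum_distrib_right minus_one_powi_sum intro!: prod.cong prod.neutral)
  qed
  have CA: "t (i + (n + c)) a = 1" "u (i + (1 + c)) a = 1" if "a < i" for a c
    using that by (auto simp: t_def u_def)
  have CB: "t (i + (n + c)) (i + b) = 1" "u (i + (1 + c)) i = 1" if "b < n" for b c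
    using that by (auto simp: t_def u_def)
  have CI: "u (i + (1 + c)) i = 1" "u i i = 1" for c by (auto simp: u_def)
  have CC: "t (i + (n + c)) (i + (n + c')) = u (i + (1 + c)) (i + (1 + c'))" if "c < r" "c' < r" for c c'
    using bC[OF that(1)] bC[OF that(2)] dC that by (auto simp: t_def u_def)
  have len_es: "length ?es = i + (1 + r)" using len by simp
  have L: "degree_sign ?\<beta> ?ds = (\<Prod>a<i + (n + r). \<Prod>b<i + (n + r). t a b)"
    using len by (simp add: degree_sign_def t_def)
  have R: "degree_sign \<tau> ?es = (\<Prod>a<i + (1 + r). \<Prod>b<i + (1 + r). u a b)"
    unfolding degree_sign_def u_def len_es by (rule HOL.refl)
  have V: "degree_sign \<sigma> vs = (\<Prod>a<n. \<Prod>b<n. t (i + a) (i + b))"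
    using len BB by (simp add: degree_sign_def)
  have R': "degree_sign \<tau> ?es = (\<Prod>a<i. (\<Prod>b<i. u a b) * (u a i * (\<Prod>c<r. u a (i + (1 + c))))) *
     ((\<Prod>c<r. u i (i + (1 + c))) * (\<Prod>c<r. \<Prod>c'<r. u (i + (1 + c)) (i + (1 + c'))))"
    unfolding R lessThan_add_split prod.distrib by (simp add: BA CA CI)
  have "(\<Prod>b<n. \<Prod>c<r. t (i + b) (i + (n + c))) = (\<Prod>c<r. u i (i + (1 + c)))"
    by (subst prod.swap) (simp add: BC)
  then have L': "degree_sign ?\<beta> ?ds = (\<Prod>a<i. (\<Prod>b<i. u a b) * (u a i * (\<Prod>c<r. u a (i + (1 + c))))) *
     ((\<Prod>a<n. \<Prod>b<n. t (i + a) (i + b)) * (\<Prod>c<r. u i (i + (1 + c))) *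
       (\<Prod>c<r. \<Prod>c'<r. u (i + (1 + c)) (i + (1 + c'))))"
    unfolding L lessThan_add_split prod.distrib by (simp add: AA AB AC BA CA CB CC)
  show ?thesis unfolding L' R' V by simp
qed

text \<open>Raising the degree of the element in position \<open>i\<close> by \<open>l\<close> contributes a sign for each element
  that changes sides with it.\<close>

lemma degree_sign_raise:
  assumes i: "i < length ds"
  shows "degree_sign \<tau> (ds[i := ds ! i + l]) = degree_sign \<tau> ds *
    (\<Prod>a<length ds. if (a < i \<and> \<tau> i < \<tau> a) \<or> (i < a \<and> \<tau> a < \<tau> i) then (-1) powi (l * ds ! a) else 1)"
proof -
  let ?N = "length ds"
  define r where "r = (\<lambda>b. if i < b \<and> \<tau> b < \<tau> i then (-1::real) powi (l * ds ! b) else 1)"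
  define s where "s = (\<lambda>a. if a < i \<and> \<tau> i < \<tau> a then (-1::real) powi (l * ds ! a) else 1)"
  define t where "t = (\<lambda>a b. if a < b \<and> \<tau> b < \<tau> a then (-1::real) powi (ds ! a * ds ! b) else 1)"
  have "degree_sign \<tau> (ds[i := ds ! i + l]) =
    (\<Prod>a<?N. \<Prod>b<?N. t a b * ((if a = i then r b else 1) * (if b = i then s a else 1)))"
    unfolding degree_sign_def length_list_update
    by (intro prod.cong HOL.refl)
      (use i in \<open>auto simp: t_def r_def s_def nth_list_update algebra_simps minus_one_powi_add\<close>)
  also have "\<dots> = degree_sign \<tau> ds * ((\<Prod>a<?N. \<Prod>b<?N. (if a = i then r b else 1)) * (\<Prod>a<?N. s a))"
    using i by (simp add: prod.distrib degree_sign_def t_def)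
  also have "(\<Prod>a<?N. \<Prod>b<?N. (if a = i then r b else 1)) = (\<Prod>b<?N. r b)"
    using i by (subst prod.swap) simp
  also have "(\<Prod>b<?N. r b) * (\<Prod>a<?N. s a) =
    (\<Prod>a<?N. if (a < i \<and> \<tau> i < \<tau> a) \<or> (i < a \<and> \<tau> a < \<tau> i) then (-1) powi (l * ds ! a) else 1)"
    unfolding prod.distrib[symmetric] by (intro prod.cong) (auto simp: r_def s_def)
  finally show ?thesis .
qed

lemma permute_list_inv_eqI:
  assumes \<beta>: "\<beta> permutes {..<length zs}" and "length zs' = length zs"
    and "\<And>j. j < length zs \<Longrightarrow> zs' ! \<beta> j = zs ! j"
  shows "permute_list (inv \<beta>) zs = zs'"
proof (rule nth_equalityI)
  fix j assume "j < length (permute_list (inv \<beta>) zs)"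
  then show "permute_list (inv \<beta>) zs ! j = zs' ! j"
    using assms(3)[of "inv \<beta> j"] permutes_in_image[OF permutes_inv[OF \<beta>], of j] permutes_inverses[OF \<beta>]
    by (simp add: permute_list_def)
qed (simp add: assms)

lemma permute_list_inv_nth:
  assumes \<beta>: "\<beta> permutes {..<length zs}" and "j < length zs"
  shows "permute_list (inv \<beta>) zs ! \<beta> j = zs ! j"
  using assms permutes_in_image[OF \<beta>, of j] permutes_inverses[OF \<beta>] by (simp add: permute_list_def)

lemma permute_list_update:
  assumes \<tau>: "\<tau> permutes {..<length zs}" and j: "j < length zs"
  shows "permute_list (inv \<tau>) (zs[j := z]) = (permute_list (inv \<tau>) zs)[\<tau> j := z]"
  by (rule permute_list_inv_eqI)
    (use assms permutes_inj[OF \<tau>] permutes_in_image[OF \<tau>] in \<open>auto simp: nth_list_update permute_list_inv_nth dest: injD\<close>)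

text \<open>For \<open>\<tau> i\<close> the position of the \<open>i\<close>-th element after permuting, the elements that end up
  before it are those that started before it, up to those that changed sides.\<close>

lemma degree_before_permuted:
  assumes \<tau>: "\<tau> permutes {..<length ds}" and i: "i < length ds"
  shows "(-1::real) powi (l * sum_list (take i ds)) *
    (\<Prod>a<length ds. if (a < i \<and> \<tau> i < \<tau> a) \<or> (i < a \<and> \<tau> a < \<tau> i) then (-1) powi (l * ds ! a) else 1)
    = (-1) powi (l * sum_list (take (\<tau> i) (permute_list (inv \<tau>) ds)))"
proof -
  let ?N = "length ds"
  have lt: "\<tau> i < ?N" using permutes_in_image[OF \<tau>] i by auto
  have take: "sum_list (take j es) = (\<Sum>a<length es. if a < j then es ! a else 0)" if "j < length es" for j and es :: "int list"
  proof -
    have "sum_list (take j es) = (\<Sum>a<j. es ! a)"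
      using that by (simp add: sum_list_sum_nth atLeast0LessThan)
    also have "\<dots> = (\<Sum>a<length es. if a < j then es ! a else 0)"
      using that by (intro sum.mono_neutral_cong_left) auto
    finally show ?thesis .
  qed
  have 1: "(-1::real) powi (l * sum_list (take i ds)) = (\<Prod>a<?N. if a < i then (-1) powi (l * ds ! a) else 1)"
    unfolding take[OF i] by (auto simp: sum_distrib_left minus_one_powi_sum intro!: prod.cong)
  have "sum_list (take (\<tau> i) (permute_list (inv \<tau>) ds)) =
    (\<Sum>a<?N. if a < \<tau> i then permute_list (inv \<tau>) ds ! a else 0)"
    using take[of "\<tau> i" "permute_list (inv \<tau>) ds"] lt by simp
  also have "\<dots> = (\<Sum>a<?N. if \<tau> a < \<tau> i then permute_list (inv \<tau>) ds ! \<tau> a else 0)"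
    using sum.permute[OF \<tau>, of "\<lambda>a. if a < \<tau> i then permute_list (inv \<tau>) ds ! a else 0"]
    by (simp add: o_def)
  also have "\<dots> = (\<Sum>a<?N. if \<tau> a < \<tau> i then ds ! a else 0)"
    by (intro sum.cong) (auto simp: permute_list_inv_nth[OF \<tau>])
  finally have 2: "(-1::real) powi (l * sum_list (take (\<tau> i) (permute_list (inv \<tau>) ds))) =
    (\<Prod>a<?N. if \<tau> a < \<tau> i then (-1) powi (l * ds ! a) else 1)"
    by (auto simp: sum_distrib_left minus_one_powi_sum intro!: prod.cong)
  have neq: "a \<noteq> i \<Longrightarrow> \<tau> a \<noteq> \<tau> i" for a using permutes_inj[OF \<tau>] by (auto dest: injD)
  show ?thesis
    unfolding 1 2 prod.distrib[symmetric]
  proof (rule prod.cong[OF HOL.refl])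
    fix a
    show "(if a < i then (-1) powi (l * ds ! a) else 1) *
        (if (a < i \<and> \<tau> i < \<tau> a) \<or> (i < a \<and> \<tau> a < \<tau> i) then (-1) powi (l * ds ! a) else 1) =
        (if \<tau> a < \<tau> i then (-1::real) powi (l * ds ! a) else 1)"
      using neq[of a] by (cases "a = i") (auto simp: minus_one_powi_if)
  qed
qed

section \<open>The endomorphism operad of a complex\<close>

lemma sum_fun_apply: "(\<Sum>a\<in>S. F a) x = (\<Sum>a\<in>S. F a x)"
  by (induction S rule: infinite_finite_induct) auto

lemma scaleR_fun_apply [simp]: "(a *\<^sub>R f) x = a *\<^sub>R f x"
  by (simp add: scaleR_fun_def)

definition homogeneous_list :: "('v::real_vector) cochain_complex \<Rightarrow> (int \<times> 'v) list \<Rightarrow> bool" where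
  "homogeneous_list X zs \<longleftrightarrow> (\<forall>z\<in>set zs. snd z \<in> cx X (fst z))"

lemma homogeneous_list_simps [simp]:
  "homogeneous_list X []"
  "homogeneous_list X (z # zs) \<longleftrightarrow> snd z \<in> cx X (fst z) \<and> homogeneous_list X zs"
  "homogeneous_list X (us @ vs) \<longleftrightarrow> homogeneous_list X us \<and> homogeneous_list X vs"
  by (auto simp: homogeneous_list_def)

lemma tuples_iff: "zs \<in> tuples X n \<longleftrightarrow> length zs = n \<and> homogeneous_list X zs"
  by (auto simp: tuples_def homogeneous_list_def)

lemma tdeg_simps [simp]: "tdeg [] = 0" "tdeg (z # zs) = fst z + tdeg zs" "tdeg (us @ vs) = tdeg us + tdeg vs"
  by (auto simp: tdeg_def)

text \<open>Splitting the list of arguments around a slot, in place of updating it, makes linearity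
  applicable to composites, whose arguments are concatenations.\<close>

lemma multilinear_maps_slot_iff:
  "f \<in> multilinear_maps X n k \<longleftrightarrow>
    (\<forall>zs. zs \<notin> tuples X n \<longrightarrow> f zs = 0) \<and>
    (\<forall>zs\<in>tuples X n. f zs \<in> cx X (tdeg zs + k)) \<and>
    (\<forall>us ws l a b x y. homogeneous_list X us \<longrightarrow> homogeneous_list X ws \<longrightarrow> length us + 1 + length ws = n \<longrightarrow>
      x \<in> cx X l \<longrightarrow> y \<in> cx X l \<longrightarrow>
      f (us @ (l, a *\<^sub>R x + b *\<^sub>R y) # ws) = a *\<^sub>R f (us @ (l, x) # ws) + b *\<^sub>R f (us @ (l, y) # ws))"
  (is "_ \<longleftrightarrow> ?A \<and> ?B \<and> ?C")
proof -
  have "?C \<longleftrightarrow> (\<forall>zs\<in>tuples X n. \<forall>j<n. \<forall>l a b. \<forall>x\<in>cx X l. \<forall>y\<in>cx X l.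
      f (zs[j := (l, a *\<^sub>R x + b *\<^sub>R y)]) = a *\<^sub>R f (zs[j := (l, x)]) + b *\<^sub>R f (zs[j := (l, y)]))" (is "_ \<longleftrightarrow> ?D")
  proof (intro iffI)
    assume C: ?C
    show ?D
    proof (intro ballI allI impI)
      fix zs j l a b x y
      assume *: "zs \<in> tuples X n" "j < n" "x \<in> cx X l" "y \<in> cx X l"
      then have "homogeneous_list X (take j zs)" "homogeneous_list X (drop (Suc j) zs)"
        by (auto simp: tuples_iff homogeneous_list_def dest: in_set_takeD in_set_dropD)
      moreover have "zs[j := z] = take j zs @ z # drop (Suc j) zs" for z
        using * by (auto simp: tuples_iff upd_conv_take_nth_drop)
      moreover have "length (take j zs) + 1 + length (drop (Suc j) zs) = n"
        using * by (auto simp: tuples_iff)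
      ultimately show "f (zs[j := (l, a *\<^sub>R x + b *\<^sub>R y)]) = a *\<^sub>R f (zs[j := (l, x)]) + b *\<^sub>R f (zs[j := (l, y)])"
        using C * by metis
    qed
  next
    assume D: ?D
    show ?C
    proof (intro allI impI)
      fix us ws l a b x y
      assume *: "homogeneous_list X us" "homogeneous_list X ws" "length us + 1 + length ws = n"
        "x \<in> cx X l" "y \<in> cx X l"
      have "us @ (l, x) # ws \<in> tuples X n" "length us < n" using * by (auto simp: tuples_iff)
      then have "f ((us @ (l, x) # ws)[length us := (l, a *\<^sub>R x + b *\<^sub>R y)]) =
        a *\<^sub>R f ((us @ (l, x) # ws)[length us := (l, x)]) + b *\<^sub>R f ((us @ (l, x) # ws)[length us := (l, y)])"
        using D * by blast
      then show "f (us @ (l, a *\<^sub>R x + b *\<^sub>R y) # ws) = a *\<^sub>R f (us @ (l, x) # ws) + b *\<^sub>R f (us @ (l, y) # ws)"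
        by (simp add: list_update_append)
    qed
  qed
  then show ?thesis by (simp add: multilinear_maps_def)
qed

locale cochain_complex =
  fixes X :: "('v::real_vector) cochain_complex"
  assumes is_cochain_complex: "is_cochain_complex X"
begin

abbreviation "ml \<equiv> multilinear_maps X"
abbreviation "pcmp \<equiv> op_cmp (End_operad X)"
abbreviation "pact \<equiv> op_act (End_operad X)"
abbreviation "hl \<equiv> homogeneous_list X"

lemma cx_subspace: "subspace (cx X k)"
  using is_cochain_complex by (simp add: is_cochain_complex_def)

lemmas cx_closed = subspace_0[OF cx_subspace] subspace_add[OF cx_subspace] subspace_scale[OF cx_subspace]
  subspace_diff[OF cx_subspace] subspace_sum[OF cx_subspace]

lemma cx_d_in: "x \<in> cx X k \<Longrightarrow> cx_d X k x \<in> cx X (k + 1)"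
  and cx_d_d: "x \<in> cx X k \<Longrightarrow> cx_d X (k + 1) (cx_d X k x) = 0"
  and cx_d_linear: "\<lbrakk>x \<in> cx X k; y \<in> cx X k\<rbrakk> \<Longrightarrow> cx_d X k (a *\<^sub>R x + b *\<^sub>R y) = a *\<^sub>R cx_d X k x + b *\<^sub>R cx_d X k y"
  using is_cochain_complex by (simp_all add: is_cochain_complex_def)

lemma ml_zero: "f \<in> ml n k \<Longrightarrow> zs \<notin> tuples X n \<Longrightarrow> f zs = 0"
  and ml_in: "f \<in> ml n k \<Longrightarrow> length zs = n \<Longrightarrow> hl zs \<Longrightarrow> d = tdeg zs + k \<Longrightarrow> f zs \<in> cx X d"
  and ml_linear: "\<lbrakk>f \<in> ml n k; hl us; hl ws; length us + 1 + length ws = n; x \<in> cx X l; y \<in> cx X l\<rbrakk>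
    \<Longrightarrow> f (us @ (l, a *\<^sub>R x + b *\<^sub>R y) # ws) = a *\<^sub>R f (us @ (l, x) # ws) + b *\<^sub>R f (us @ (l, y) # ws)"
  by (simp_all add: multilinear_maps_slot_iff tuples_iff)

lemma ml_scale: "\<lbrakk>f \<in> ml n k; hl us; hl ws; length us + 1 + length ws = n; x \<in> cx X l\<rbrakk>
    \<Longrightarrow> f (us @ (l, a *\<^sub>R x) # ws) = a *\<^sub>R f (us @ (l, x) # ws)"
  using ml_linear[of f n k us ws x l x a 0] by simp

lemma ml_add: "\<lbrakk>f \<in> ml n k; hl us; hl ws; length us + 1 + length ws = n; x \<in> cx X l; y \<in> cx X l\<rbrakk>
    \<Longrightarrow> f (us @ (l, x + y) # ws) = f (us @ (l, x) # ws) + f (us @ (l, y) # ws)"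
  using ml_linear[of f n k us ws x l y 1 1] by simp

lemma ml_I:
  assumes "\<And>zs. zs \<notin> tuples X n \<Longrightarrow> f zs = 0"
    and "\<And>zs. length zs = n \<Longrightarrow> hl zs \<Longrightarrow> f zs \<in> cx X (tdeg zs + k)"
    and "\<And>us ws l a b x y. \<lbrakk>hl us; hl ws; length us + 1 + length ws = n; x \<in> cx X l; y \<in> cx X l\<rbrakk>
      \<Longrightarrow> f (us @ (l, a *\<^sub>R x + b *\<^sub>R y) # ws) = a *\<^sub>R f (us @ (l, x) # ws) + b *\<^sub>R f (us @ (l, y) # ws)"
  shows "f \<in> ml n k"
  using assms by (simp add: multilinear_maps_slot_iff tuples_iff)

lemma subspace_ml: "subspace (ml n k)"
proof (rule subspaceI)
  show "0 \<in> ml n k" by (rule ml_I) (auto simp: cx_closed)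
next
  fix f g assume "f \<in> ml n k" "g \<in> ml n k"
  then show "f + g \<in> ml n k"
    by (intro ml_I) (auto simp: cx_closed ml_zero ml_in ml_linear algebra_simps)
next
  fix c f assume "f \<in> ml n k"
  then show "c *\<^sub>R f \<in> ml n k"
    by (intro ml_I) (auto simp: cx_closed ml_zero ml_in ml_linear algebra_simps)
qed

lemmas ml_closed = subspace_0[OF subspace_ml] subspace_add[OF subspace_ml] subspace_scale[OF subspace_ml]
  subspace_diff[OF subspace_ml] subspace_sum[OF subspace_ml]

text \<open>On concatenations, composites are evaluated without any reference to \<open>take\<close> and \<open>drop\<close>.\<close>

lemma pcmp_split:
  assumes "i < m" "length us = i" "length vs = n" "length ws = m - 1 - i" "hl us" "hl vs" "hl ws"
  shows "pcmp m k n l i f g (us @ vs @ ws) =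
    (-1) powi (l * tdeg us) *\<^sub>R f (us @ (tdeg vs + l, g vs) # ws)"
  using assms by (auto simp: End_operad_def tuples_iff Let_def)

lemma pcmp_outside: "zs \<notin> tuples X (m + n - 1) \<Longrightarrow> pcmp m k n l i f g zs = 0"
  by (simp add: End_operad_def)

text \<open>A composite is determined by its values on tuples cut into the arguments of the outer
  operation before the slot, those of the inner operation, and the remaining ones.\<close>

lemma tuples_splitE:
  assumes "zs \<in> tuples X (m + n - 1)" "i < m"
  obtains us vs ws where "zs = us @ vs @ ws" "length us = i" "length vs = n" "length ws = m - 1 - i"
    "hl us" "hl vs" "hl ws"
proof
  have "zs = take i zs @ drop i zs" by simp
  also have "drop i zs = take n (drop i zs) @ drop (i + n) zs"
    by (metis append_take_drop_id drop_drop add.commute)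
  finally show eq: "zs = take i zs @ take n (drop i zs) @ drop (i + n) zs" .
  have "hl zs" using assms by (simp add: tuples_iff)
  then show "hl (take i zs)" "hl (take n (drop i zs))" "hl (drop (i + n) zs)"
    by (auto simp: homogeneous_list_def dest: in_set_takeD in_set_dropD)
qed (use assms in \<open>auto simp: tuples_iff\<close>)

text \<open>The possible positions of one slot in a list that is cut into three parts.\<close>

lemma append_Cons_split3:
  assumes "A @ z # B = U @ V @ W"
  obtains A' where "U = A @ z # A'" "B = A' @ V @ W"
  | A1 A2 where "V = A1 @ z # A2" "A = U @ A1" "B = A2 @ W"
  | A' where "W = A' @ z # B" "A = U @ V @ A'"
proof -
  from assms consider us where "A = U @ us" "us @ z # B = V @ W" | us where "A @ us = U" "z # B = us @ V @ W"
    by (auto simp: append_eq_append_conv2)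
  then show thesis
  proof cases
    case 1
    from 1(2) consider vs where "us = V @ vs" "vs @ z # B = W" | vs where "us @ vs = V" "z # B = vs @ W"
      by (auto simp: append_eq_append_conv2)
    then show thesis
    proof cases
      case 1
      then show thesis using that(3)[of vs] \<open>A = U @ us\<close> by simp
    next
      case 2
      show thesis
      proof (cases vs)
        case Nil
        then show thesis using that(3)[of "[]"] 2 \<open>A = U @ us\<close> by simp
      next
        case (Cons v vs')
        then show thesis using that(2)[of us vs'] 2 \<open>A = U @ us\<close> by simp
      qed
    qed
  next
    case 2
    show thesis
    proof (cases us)
      case Nil
      show thesis
      proof (cases V)
        case Nil
        then show thesis using that(3)[of "[]"] 2 \<open>us = []\<close> by simp
      next
        case (Cons v V')
        then show thesis using that(2)[of "[]" V'] 2 \<open>us = []\<close> by simp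
      qed
    next
      case (Cons u us')
      then show thesis using that(1)[of us'] 2 by simp
    qed
  qed
qed

text \<open>Linearity in an argument has three cases: it precedes the inner operation, belongs to it, or
  follows it. In the first case its degree enters the sign of the composite.\<close>

lemma pcmp_in:
  assumes f: "f \<in> ml m k" and g: "g \<in> ml n l" and i: "i < m"
  shows "pcmp m k n l i f g \<in> ml (m + n - 1) (k + l)"
proof (rule ml_I)
  show "pcmp m k n l i f g zs = 0" if "zs \<notin> tuples X (m + n - 1)" for zs
    using that by (rule pcmp_outside)
next
  fix zs assume "length zs = m + n - 1" "hl zs"
  then have "zs \<in> tuples X (m + n - 1)" by (simp add: tuples_iff)
  then obtain us vs ws where zs: "zs = us @ vs @ ws" "length us = i" "length vs = n" "length ws = m - 1 - i"
    "hl us" "hl vs" "hl ws" using i by (rule tuples_splitE)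
  then have "f (us @ (tdeg vs + l, g vs) # ws) \<in> cx X (tdeg zs + (k + l))"
    using i by (intro ml_in[OF f]) (auto intro!: ml_in[OF g])
  then show "pcmp m k n l i f g zs \<in> cx X (tdeg zs + (k + l))"
    using zs i by (simp add: pcmp_split cx_closed)
next
  fix A B p a b x y
  assume *: "hl A" "hl B" "length A + 1 + length B = m + n - 1" "x \<in> cx X p" "y \<in> cx X p"
  then have "A @ (p, x) # B \<in> tuples X (m + n - 1)" by (simp add: tuples_iff)
  then obtain us vs ws where zs: "A @ (p, x) # B = us @ vs @ ws" "length us = i" "length vs = n"
    "length ws = m - 1 - i" "hl us" "hl vs" "hl ws" using i by (rule tuples_splitE)
  have ax: "a *\<^sub>R x + b *\<^sub>R y \<in> cx X p" using * by (auto simp: cx_closed)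
  have gv: "g vs \<in> cx X (tdeg vs + l)" if "hl vs" "length vs = n" for vs
    using that by (auto intro!: ml_in[OF g])
  from zs(1) show "pcmp m k n l i f g (A @ (p, a *\<^sub>R x + b *\<^sub>R y) # B) =
    a *\<^sub>R pcmp m k n l i f g (A @ (p, x) # B) + b *\<^sub>R pcmp m k n l i f g (A @ (p, y) # B)"
  proof (cases rule: append_Cons_split3)
    case (1 A')
    have "pcmp m k n l i f g (A @ (p, u) # B) =
      (-1) powi (l * (tdeg A + (p + tdeg A'))) *\<^sub>R f (A @ (p, u) # (A' @ (tdeg vs + l, g vs) # ws))" if "u \<in> cx X p" for u
      using pcmp_split[OF i, of "A @ (p, u) # A'" vs n ws k l f g] that zs 1 * by simp
    then show ?thesis
      using ax * 1 zs i gv by (simp add: ml_linear[OF f] algebra_simps)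
  next
    case (2 A1 A2)
    have gu: "g (A1 @ (p, u) # A2) \<in> cx X (tdeg A1 + (p + tdeg A2) + l)" if "u \<in> cx X p" for u
      using gv[of "A1 @ (p, u) # A2"] that zs 2 by simp
    have "pcmp m k n l i f g (A @ (p, u) # B) =
      (-1) powi (l * tdeg us) *\<^sub>R f (us @ (tdeg A1 + (p + tdeg A2) + l, g (A1 @ (p, u) # A2)) # ws)" if "u \<in> cx X p" for u
      using pcmp_split[OF i, of us "A1 @ (p, u) # A2" n ws k l f g] that zs 2 * by simp
    then show ?thesis
      using ax * 2 zs i gu by (simp add: ml_linear[OF g] ml_linear[OF f] algebra_simps)
  next
    case (3 A')
    have "pcmp m k n l i f g (A @ (p, u) # B) =
      (-1) powi (l * tdeg us) *\<^sub>R f ((us @ (tdeg vs + l, g vs) # A') @ (p, u) # B)" if "u \<in> cx X p" for u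
      using pcmp_split[OF i, of us vs n "A' @ (p, u) # B" k l f g] that zs 3 * by simp
    then show ?thesis
      using ax * 3 zs i gv ml_linear[OF f, of "us @ (tdeg vs + l, g vs) # A'" B x p y a b] by (simp add: algebra_simps)
  qed
qed

lemma pcmp_eqI:
  assumes "\<And>us vs ws. \<lbrakk>length us = i; length vs = n; length ws = m - 1 - i; hl us; hl vs; hl ws\<rbrakk>
    \<Longrightarrow> F (us @ vs @ ws) = G (us @ vs @ ws)"
    and "\<And>zs. zs \<notin> tuples X N \<Longrightarrow> F zs = G zs" and "i < m" "N = m + n - 1"
  shows "F = G"
proof
  fix zs
  show "F zs = G zs"
  proof (cases "zs \<in> tuples X N")
    case True
    then have "zs \<in> tuples X (m + n - 1)" using assms(4) by simp
    then show ?thesis using assms(3) by (rule tuples_splitE) (use assms(1) in blast)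
  qed (use assms(2) in blast)
qed

lemma pcmp_add_left: "pcmp m k n l i (f + f') g = pcmp m k n l i f g + pcmp m k n l i f' g"
  and pcmp_scale_left: "pcmp m k n l i (a *\<^sub>R f) g = a *\<^sub>R pcmp m k n l i f g"
  and pcmp_zero_left: "pcmp m k n l i 0 g = 0"
  by (auto simp: End_operad_def fun_eq_iff Let_def algebra_simps)

lemma pcmp_diff_left: "pcmp m k n l i (f - f') g = pcmp m k n l i f g - pcmp m k n l i f' g"
  using pcmp_add_left[of m k n l i f "(-1) *\<^sub>R f'" g] pcmp_scale_left[of m k n l i "-1" f' g] by simp

lemma pcmp_sum_left: "pcmp m k n l i (\<Sum>a\<in>S. F a) g = (\<Sum>a\<in>S. pcmp m k n l i (F a) g)"
  by (induction S rule: infinite_finite_induct)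
    (simp_all only: simp_thms sum.infinite sum.empty sum.insert pcmp_zero_left pcmp_add_left)

lemma pcmp_add_right:
  assumes "f \<in> ml m k" "g \<in> ml n l" "g' \<in> ml n l" "i < m"
  shows "pcmp m k n l i f (g + g') = pcmp m k n l i f g + pcmp m k n l i f g'"
  by (rule pcmp_eqI[where n = n and m = m and i = i])
    (use assms in \<open>auto simp: pcmp_split pcmp_outside ml_add[OF assms(1)] ml_in[OF assms(2)] ml_in[OF assms(3)] algebra_simps\<close>)

lemma pcmp_scale_right:
  assumes "f \<in> ml m k" "g \<in> ml n l" "i < m"
  shows "pcmp m k n l i f (a *\<^sub>R g) = a *\<^sub>R pcmp m k n l i f g"
  by (rule pcmp_eqI[where n = n and m = m and i = i])
    (use assms in \<open>auto simp: pcmp_split pcmp_outside ml_scale[OF assms(1)] ml_in[OF assms(2)] algebra_simps\<close>)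

lemma pcmp_zero_right: "f \<in> ml m k \<Longrightarrow> i < m \<Longrightarrow> pcmp m k n l i f 0 = 0"
  using pcmp_scale_right[of f m k 0 n l i 0] ml_closed(1)[of n l] by simp

lemma pcmp_diff_right:
  assumes "f \<in> ml m k" "g \<in> ml n l" "g' \<in> ml n l" "i < m"
  shows "pcmp m k n l i f (g - g') = pcmp m k n l i f g - pcmp m k n l i f g'"
  using pcmp_add_right[OF assms(1,2) ml_closed(3)[OF assms(3), of "-1"] assms(4)]
    pcmp_scale_right[OF assms(1,3,4), of "-1"] by simp

lemma pcmp_sum_right:
  assumes "f \<in> ml m k" "\<And>a. a \<in> S \<Longrightarrow> G a \<in> ml n l" "i < m"
  shows "pcmp m k n l i f (\<Sum>a\<in>S. G a) = (\<Sum>a\<in>S. pcmp m k n l i f (G a))"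
  using assms(2)
  by (induction S rule: infinite_finite_induct)
    (auto simp: pcmp_zero_right[OF assms(1,3)] pcmp_add_right[OF assms(1) _ _ assms(3)] ml_closed)

lemma pcmp_assoc_seq:
  assumes f: "f \<in> ml m k" and g: "g \<in> ml n l" and h: "h \<in> ml r s" and i: "i < m" and j: "j < n"
    and N: "N = m + n - 1" and K: "K = k + l" and N': "N' = n + r - 1" and K': "K' = l + s"
  shows "pcmp N K r s (i + j) (pcmp m k n l i f g) h = pcmp m k N' K' i f (pcmp n l r s j g h)"
proof (rule pcmp_eqI[where m = m and n = N' and i = i])
  fix us vs ws assume *: "length us = i" "length vs = N'" "length ws = m - 1 - i" "hl us" "hl vs" "hl ws"
  then have "vs \<in> tuples X (n + r - 1)" by (simp add: tuples_iff N')
  then obtain A H B where vs: "vs = A @ H @ B" "length A = j" "length H = r" "length B = n - 1 - j"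
    "hl A" "hl H" "hl B" using j by (rule tuples_splitE)
  have hH: "h H \<in> cx X (tdeg H + s)" using ml_in[OF h] vs by simp
  have gH: "g (A @ (tdeg H + s, h H) # B) \<in> cx X (tdeg A + (tdeg H + s + tdeg B) + l)"
    using vs hH j by (intro ml_in[OF g]) auto
  have "pcmp N K r s (i + j) (pcmp m k n l i f g) h ((us @ A) @ H @ (B @ ws)) =
    (-1) powi (s * (tdeg us + tdeg A)) *\<^sub>R pcmp m k n l i f g (us @ (A @ (tdeg H + s, h H) # B) @ ws)"
    using * vs i j by (subst pcmp_split) (auto simp: N)
  also have "pcmp m k n l i f g (us @ (A @ (tdeg H + s, h H) # B) @ ws) =
    (-1) powi (l * tdeg us) *\<^sub>R f (us @ (tdeg A + (tdeg H + s + tdeg B) + l, g (A @ (tdeg H + s, h H) # B)) # ws)"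
    using * vs i j hH by (subst pcmp_split) auto
  finally have 1: "pcmp N K r s (i + j) (pcmp m k n l i f g) h (us @ vs @ ws) =
    ((-1) powi (s * (tdeg us + tdeg A)) * (-1) powi (l * tdeg us)) *\<^sub>R
    f (us @ (tdeg A + (tdeg H + s + tdeg B) + l, g (A @ (tdeg H + s, h H) # B)) # ws)"
    using vs by simp
  have "pcmp n l r s j g h vs = (-1) powi (s * tdeg A) *\<^sub>R g (A @ (tdeg H + s, h H) # B)"
    unfolding vs(1) using vs j by (intro pcmp_split) auto
  then have "pcmp m k N' K' i f (pcmp n l r s j g h) (us @ vs @ ws) =
    (-1) powi (K' * tdeg us) *\<^sub>R f (us @ (tdeg A + (tdeg H + s + tdeg B) + l, (-1) powi (s * tdeg A) *\<^sub>R g (A @ (tdeg H + s, h H) # B)) # ws)"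
    using * vs(1) i by (subst pcmp_split) (auto simp: K' add_ac)
  also have "\<dots> = ((-1) powi (K' * tdeg us) * (-1) powi (s * tdeg A)) *\<^sub>R
    f (us @ (tdeg A + (tdeg H + s + tdeg B) + l, g (A @ (tdeg H + s, h H) # B)) # ws)"
    using * i by (subst ml_scale[OF f _ _ _ gH]) auto
  finally show "pcmp N K r s (i + j) (pcmp m k n l i f g) h (us @ vs @ ws) =
      pcmp m k N' K' i f (pcmp n l r s j g h) (us @ vs @ ws)"
    unfolding 1 K' by (simp add: minus_one_powi_add algebra_simps)
next
  show "pcmp N K r s (i + j) (pcmp m k n l i f g) h zs = pcmp m k N' K' i f (pcmp n l r s j g h) zs"
    if "zs \<notin> tuples X (m + N' - 1)" for zs
  proof -
    have e: "m + N' - 1 = N + r - 1" using i j N N' by simp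
    show ?thesis
      using that pcmp_outside[of zs N r K s "i + j"] pcmp_outside[of zs m N' k K' i] by (simp only: e simp_thms)
  qed
qed (use i in auto)

text \<open>The sign appears when the two inner operations are moved past each other.\<close>

lemma pcmp_assoc_par:
  assumes f: "f \<in> ml m k" and g: "g \<in> ml n l" and h: "h \<in> ml r s" and ij: "i < j" and j: "j < m"
    and N: "N = m + r - 1" and K: "K = k + s" and N': "N' = m + n - 1" and K': "K' = k + l" and j': "j' = j + n - 1"
  shows "pcmp N K n l i (pcmp m k r s j f h) g = (-1) powi (l * s) *\<^sub>R pcmp N' K' r s j' (pcmp m k n l i f g) h"
proof (rule pcmp_eqI[where m = N and n = n and i = i])
  fix us vs ws' assume *: "length us = i" "length vs = n" "length ws' = N - 1 - i" "hl us" "hl vs" "hl ws'"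
  have "ws' \<in> tuples X (m - 1 - i + r - 1)" using * ij j by (simp add: tuples_iff N)
  moreover have "j - i - 1 < m - 1 - i" using ij j by auto
  ultimately obtain B H C where ws: "ws' = B @ H @ C" "length B = j - i - 1" "length H = r"
    "length C = m - 1 - i - 1 - (j - i - 1)" "hl B" "hl H" "hl C" by (rule tuples_splitE)
  have lC: "length C = m - 1 - j" using ws ij j by simp
  have hH: "h H \<in> cx X (tdeg H + s)" using ml_in[OF h] ws by simp
  have gv: "g vs \<in> cx X (tdeg vs + l)" using ml_in[OF g] * by simp
  have "pcmp N K n l i (pcmp m k r s j f h) g (us @ vs @ ws') =
    (-1) powi (l * tdeg us) *\<^sub>R pcmp m k r s j f h ((us @ (tdeg vs + l, g vs) # B) @ H @ C)"
    using * ij j ws by (subst pcmp_split) (auto simp: N)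
  also have "pcmp m k r s j f h ((us @ (tdeg vs + l, g vs) # B) @ H @ C) =
    (-1) powi (s * (tdeg us + (tdeg vs + l + tdeg B))) *\<^sub>R f ((us @ (tdeg vs + l, g vs) # B) @ (tdeg H + s, h H) # C)"
    using * ws lC gv ij j by (subst pcmp_split) auto
  finally have 1: "pcmp N K n l i (pcmp m k r s j f h) g (us @ vs @ ws') =
    ((-1) powi (l * tdeg us) * (-1) powi (s * (tdeg us + (tdeg vs + l + tdeg B)))) *\<^sub>R
      f (us @ (tdeg vs + l, g vs) # B @ (tdeg H + s, h H) # C)" by simp
  have "pcmp N' K' r s j' (pcmp m k n l i f g) h ((us @ vs @ B) @ H @ C) =
    (-1) powi (s * (tdeg us + (tdeg vs + tdeg B))) *\<^sub>R pcmp m k n l i f g (us @ vs @ (B @ (tdeg H + s, h H) # C))"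
    using * ws lC ij j by (subst pcmp_split) (auto simp: N' j')
  also have "pcmp m k n l i f g (us @ vs @ (B @ (tdeg H + s, h H) # C)) =
    (-1) powi (l * tdeg us) *\<^sub>R f (us @ (tdeg vs + l, g vs) # (B @ (tdeg H + s, h H) # C))"
    using * ws lC hH ij j by (subst pcmp_split) auto
  finally show "pcmp N K n l i (pcmp m k r s j f h) g (us @ vs @ ws') =
    ((-1) powi (l * s) *\<^sub>R pcmp N' K' r s j' (pcmp m k n l i f g) h) (us @ vs @ ws')"
    unfolding 1 using ws by (simp add: minus_one_powi_add algebra_simps)
next
  show "pcmp N K n l i (pcmp m k r s j f h) g zs = ((-1) powi (l * s) *\<^sub>R pcmp N' K' r s j' (pcmp m k n l i f g) h) zs"
    if "zs \<notin> tuples X (N + n - 1)" for zs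
  proof -
    have e: "N + n - 1 = N' + r - 1" using ij j N N' by simp
    show ?thesis
      using that pcmp_outside[of zs N n K l i] pcmp_outside[of zs N' r K' s j'] by (simp only: e scaleR_fun_apply simp_thms scaleR_zero_right)
  qed
qed (use ij j N in auto)

subsection \<open>The action of the symmetric groups\<close>

lemma pact_eq: "zs \<in> tuples X n \<Longrightarrow>
    pact n k f \<tau> zs = degree_sign \<tau> (map fst zs) *\<^sub>R f (permute_list (inv \<tau>) zs)"
  by (simp add: End_operad_def koszul_sign_eq_degree_sign)

lemma pact_outside: "zs \<notin> tuples X n \<Longrightarrow> pact n k f \<tau> zs = 0"
  by (simp add: End_operad_def)

lemma tuples_permute: "\<lbrakk>zs \<in> tuples X n; \<tau> permutes {..<n}\<rbrakk> \<Longrightarrow> permute_list (inv \<tau>) zs \<in> tuples X n"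
  by (auto simp: tuples_iff homogeneous_list_def permutes_inv)

lemma tdeg_permute:
  assumes "\<sigma> permutes {..<length zs}"
  shows "tdeg (permute_list \<sigma> zs) = tdeg zs"
proof -
  have "mset (map fst (permute_list \<sigma> zs)) = mset (map fst zs)" using assms by simp
  then show ?thesis unfolding tdeg_def by (metis sum_mset_sum_list)
qed

lemma pact_in:
  assumes f: "f \<in> ml n k" and \<tau>: "\<tau> permutes {..<n}"
  shows "pact n k f \<tau> \<in> ml n k"
proof (rule ml_I)
  fix zs assume "length zs = n" "hl zs"
  then have zs: "zs \<in> tuples X n" by (simp add: tuples_iff)
  then have "f (permute_list (inv \<tau>) zs) \<in> cx X (tdeg zs + k)"
    using tuples_permute[OF zs \<tau>] tdeg_permute[of "inv \<tau>" zs] permutes_inv[OF \<tau>] \<open>length zs = n\<close>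
    by (intro ml_in[OF f]) (auto simp: tuples_iff)
  then show "pact n k f \<tau> zs \<in> cx X (tdeg zs + k)" using zs by (simp add: pact_eq cx_closed)
next
  fix us ws l a b x y
  assume *: "hl us" "hl ws" "length us + 1 + length ws = n" "x \<in> cx X l" "y \<in> cx X l"
  let ?j = "length us"
  define zs where "zs = us @ (l, x) # ws"
  have zs: "zs \<in> tuples X n" "?j < n" using * by (auto simp: zs_def tuples_iff)
  have upd: "us @ (l, u) # ws = zs[?j := (l, u)]" for u by (simp add: zs_def)
  define qs where "qs = permute_list (inv \<tau>) zs"
  have qs: "qs \<in> tuples X n" using tuples_permute[OF zs(1) \<tau>] by (simp add: qs_def)
  have lt: "\<tau> ?j < n" using permutes_in_image[OF \<tau>] zs by auto
  have val: "pact n k f \<tau> (us @ (l, u) # ws) = degree_sign \<tau> (map fst zs) *\<^sub>R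
      f (take (\<tau> ?j) qs @ (l, u) # drop (Suc (\<tau> ?j)) qs)" if "u \<in> cx X l" for u
  proof -
    have "us @ (l, u) # ws \<in> tuples X n" using * that by (auto simp: tuples_iff)
    moreover have "permute_list (inv \<tau>) (us @ (l, u) # ws) = qs[\<tau> ?j := (l, u)]"
      unfolding upd qs_def using zs \<tau> by (intro permute_list_update) (auto simp: tuples_iff)
    moreover have "map fst (us @ (l, u) # ws) = map fst zs" by (simp add: zs_def)
    moreover have "qs[\<tau> ?j := (l, u)] = take (\<tau> ?j) qs @ (l, u) # drop (Suc (\<tau> ?j)) qs"
      using lt qs by (simp add: tuples_iff upd_conv_take_nth_drop)
    ultimately show ?thesis by (simp add: pact_eq)
  qed
  have "hl (take (\<tau> ?j) qs)" "hl (drop (Suc (\<tau> ?j)) qs)"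
    using qs by (auto simp: tuples_iff homogeneous_list_def dest: in_set_takeD in_set_dropD)
  then have "f (take (\<tau> ?j) qs @ (l, a *\<^sub>R x + b *\<^sub>R y) # drop (Suc (\<tau> ?j)) qs) =
    a *\<^sub>R f (take (\<tau> ?j) qs @ (l, x) # drop (Suc (\<tau> ?j)) qs) + b *\<^sub>R f (take (\<tau> ?j) qs @ (l, y) # drop (Suc (\<tau> ?j)) qs)"
    using lt qs * by (intro ml_linear[OF f]) (auto simp: tuples_iff)
  moreover have "a *\<^sub>R x + b *\<^sub>R y \<in> cx X l" using * by (auto simp: cx_closed)
  ultimately show "pact n k f \<tau> (us @ (l, a *\<^sub>R x + b *\<^sub>R y) # ws) =
     a *\<^sub>R pact n k f \<tau> (us @ (l, x) # ws) + b *\<^sub>R pact n k f \<tau> (us @ (l, y) # ws)"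
    using * by (simp add: val algebra_simps)
qed (rule pact_outside)

text \<open>This is the multiplicativity of the Koszul sign, \<open>degree_sign_compose\<close>.\<close>

lemma pact_pact:
  assumes f: "f \<in> ml n k" and \<tau>: "\<tau> permutes {..<n}" and \<sigma>: "\<sigma> permutes {..<n}"
  shows "pact n k (pact n k f \<tau>) \<sigma> = pact n k f (\<tau> \<circ> \<sigma>)"
proof
  fix zs
  show "pact n k (pact n k f \<tau>) \<sigma> zs = pact n k f (\<tau> \<circ> \<sigma>) zs"
  proof (cases "zs \<in> tuples X n")
    case True
    then have len: "length zs = n" by (simp add: tuples_iff)
    have "permute_list (inv (\<tau> \<circ> \<sigma>)) zs = permute_list (inv \<tau>) (permute_list (inv \<sigma>) zs)"
      using \<tau> \<sigma> len by (simp add: o_inv_distrib permutes_bij permute_list_compose permutes_inv)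
    moreover have "degree_sign (\<tau> \<circ> \<sigma>) (map fst zs) =
        degree_sign \<sigma> (map fst zs) * degree_sign \<tau> (map fst (permute_list (inv \<sigma>) zs))"
      using degree_sign_compose[of \<sigma> "map fst zs" \<tau>] \<tau> \<sigma> len by (simp add: permute_list_map permutes_inv)
    ultimately show ?thesis
      using True tuples_permute[OF True \<sigma>] by (simp add: pact_eq)
  qed (simp add: pact_outside)
qed

lemma pact_add: "pact n k (f + g) \<tau> = pact n k f \<tau> + pact n k g \<tau>"
  and pact_scale: "pact n k (a *\<^sub>R f) \<tau> = a *\<^sub>R pact n k f \<tau>"
  and pact_zero: "pact n k 0 \<tau> = 0"
  by (auto simp: End_operad_def fun_eq_iff algebra_simps)

lemma pact_diff: "pact n k (f - g) \<tau> = pact n k f \<tau> - pact n k g \<tau>"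
  using pact_add[of n k f "(-1) *\<^sub>R g" \<tau>] pact_scale[of n k "-1" g \<tau>] by simp

lemma pact_sum: "pact n k (\<Sum>a\<in>S. F a) \<tau> = (\<Sum>a\<in>S. pact n k (F a) \<tau>)"
  by (induction S rule: infinite_finite_induct)
    (simp_all only: simp_thms sum.infinite sum.empty sum.insert pact_zero pact_add)

lemma pact_id: "f \<in> ml n k \<Longrightarrow> pact n k f id = f"
  by (auto simp: End_operad_def fun_eq_iff koszul_sign_eq_degree_sign degree_sign_id ml_zero)

text \<open>After permuting, the arguments of the inner operation are still consecutive. The signs agree
  because such a block counts like one element of the same total degree, and because the sign for
  moving the inner operation to its place changes according to the elements that the block passes.\<close>

lemma pact_pcmp:
  assumes f: "f \<in> ml m k" and g: "g \<in> ml n l" and i: "i < m"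
    and \<tau>: "\<tau> permutes {..<m}" and \<sigma>: "\<sigma> permutes {..<n}"
  shows "pcmp m k n l i (pact m k f \<tau>) (pact n l g \<sigma>) =
    pact (m + n - 1) (k + l) (pcmp m k n l (\<tau> i) f g) (block_perm m n i \<tau> \<sigma>)"
proof (rule pcmp_eqI[where m = m and n = n and i = i])
  fix us vs ws assume *: "length us = i" "length vs = n" "length ws = m - 1 - i" "hl us" "hl vs" "hl ws"
  let ?\<beta> = "block_perm m n i \<tau> \<sigma>"
  have \<beta>: "?\<beta> permutes {..<m + n - 1}" by (rule block_perm_permutes[OF \<tau> \<sigma> i])
  have lt: "\<tau> i < m" using permutes_in_image[OF \<tau>] i by auto
  define V where "V = permute_list (inv \<sigma>) vs"
  have V: "V \<in> tuples X n" using tuples_permute[of vs n \<sigma>] * \<sigma> by (simp add: V_def tuples_iff)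
  have dV: "tdeg V = tdeg vs" using * \<sigma> by (simp add: V_def tdeg_permute permutes_inv)
  have gV: "g V \<in> cx X (tdeg vs + l)" using V by (intro ml_in[OF g]) (auto simp: tuples_iff dV)
  let ?y = "(tdeg vs + l, g V)"
  define qs where "qs = permute_list (inv \<tau>) (us @ ?y # ws)"
  have yt: "us @ ?y # ws \<in> tuples X m" using * i gV by (auto simp: tuples_iff)
  have qs: "qs \<in> tuples X m" using tuples_permute[OF yt \<tau>] by (simp add: qs_def)
  define us' where "us' = take (\<tau> i) qs"
  define ws' where "ws' = drop (Suc (\<tau> i)) qs"
  have lens: "length us' = \<tau> i" "length ws' = m - 1 - \<tau> i" using qs lt by (auto simp: us'_def ws'_def tuples_iff)
  have hl': "hl us'" "hl ws'"
    using qs by (auto simp: us'_def ws'_def tuples_iff homogeneous_list_def dest: in_set_takeD in_set_dropD)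
  have nth_qs: "qs ! \<tau> j = (us @ ?y # ws) ! j" if "j < m" for j
    unfolding qs_def using that \<tau> yt by (intro permute_list_inv_nth) (auto simp: tuples_iff)
  have "qs ! \<tau> i = ?y" using nth_qs[OF i] * by (simp add: nth_append)
  then have qs_split: "qs = us' @ ?y # ws'"
    using id_take_nth_drop[of "\<tau> i" qs] lt qs by (simp add: us'_def ws'_def tuples_iff)
  have injT: "\<And>a b. \<tau> a = \<tau> b \<longleftrightarrow> a = b" using permutes_inj[OF \<tau>] by (auto dest: injD)
  have T: "\<And>j. \<tau> j < m \<longleftrightarrow> j < m" and S: "\<And>j. \<sigma> j < n \<longleftrightarrow> j < n"
    using permutes_in_image[OF \<tau>] permutes_in_image[OF \<sigma>] by auto
  have perm: "permute_list (inv ?\<beta>) (us @ vs @ ws) = us' @ V @ ws'"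
  proof (rule permute_list_inv_eqI)
    have "length (us @ vs @ ws) = m + n - 1" using * i by simp
    then show "?\<beta> permutes {..<length (us @ vs @ ws)}" using \<beta> by (simp only:)
    show "length (us' @ V @ ws') = length (us @ vs @ ws)" using lens V * lt i by (simp add: tuples_iff)
    fix j assume j: "j < length (us @ vs @ ws)"
    have lenV: "length V = n" using V by (simp add: tuples_iff)
    have outer: "(us' @ V @ ws') ! (if \<tau> a < \<tau> i then \<tau> a else \<tau> a + n - 1) = (us @ ?y # ws) ! a" if "a < m" "a \<noteq> i" for a
    proof (cases "\<tau> a < \<tau> i")
      case True
      then show ?thesis using nth_qs[OF that(1)] lens unfolding qs_split by (simp add: nth_append)
    next
      case False
      then have "\<tau> i < \<tau> a" using injT that(2) by (meson linorder_neqE_nat)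
      then obtain c where c: "\<tau> a = \<tau> i + Suc c" using less_imp_Suc_add[of "\<tau> i" "\<tau> a"] by auto
      have 1: "\<tau> a + n - 1 = length us' + (length V + c)" using c lens lenV by simp
      have 2: "(us' @ ?y # ws') ! \<tau> a = ws' ! c" using c lens by (simp add: nth_append)
      have "(us' @ V @ ws') ! (\<tau> a + n - 1) = ws' ! c" unfolding 1 nth_append_length_plus ..
      then show ?thesis using False 2 nth_qs[OF that(1)] unfolding qs_split by simp
    qed
    consider "j < i" | "i \<le> j" "j < i + n" | "i + n \<le> j" by linarith
    then show "(us' @ V @ ws') ! ?\<beta> j = (us @ vs @ ws) ! j"
    proof cases
      case 1
      then show ?thesis using outer[of j] i * by (simp add: block_perm_def nth_append)
    next
      case 2
      then have "V ! \<sigma> (j - i) = vs ! (j - i)"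
        unfolding V_def using * \<sigma> by (intro permute_list_inv_nth) auto
      then show ?thesis using 2 * lens lenV S[of "j - i"] by (auto simp: block_perm_def nth_append)
    next
      case 3
      then have "j + 1 - n < m" "j + 1 - n \<noteq> i" "j < m + n - 1" using j * i by auto
      moreover have "(us @ ?y # ws) ! (j + 1 - n) = (us @ vs @ ws) ! j"
        using 3 * by (auto simp: nth_append nth_Cons' add.commute)
      ultimately show ?thesis using outer[of "j + 1 - n"] 3 by (simp add: block_perm_def)
    qed
  qed
  let ?ds = "map fst us @ [tdeg vs] @ map fst ws"
  have sum_vs: "sum_list (map fst vs) = tdeg vs" by (simp add: tdeg_def)
  have tup: "us @ vs @ ws \<in> tuples X (m + n - 1)" using * i by (auto simp: tuples_iff)
  have sgn1: "degree_sign ?\<beta> (map fst (us @ vs @ ws)) = degree_sign \<sigma> (map fst vs) * degree_sign \<tau> ?ds"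
    using degree_sign_block_perm[of "map fst us" i "map fst vs" n "map fst ws" "m - 1 - i" m \<tau> \<sigma>] * i \<tau> \<sigma>
    by (simp add: sum_vs)
  have "(us' @ V @ ws') = us' @ V @ ws'" ..
  have RHS: "pact (m + n - 1) (k + l) (pcmp m k n l (\<tau> i) f g) ?\<beta> (us @ vs @ ws) =
    (degree_sign \<sigma> (map fst vs) * degree_sign \<tau> ?ds * (-1) powi (l * tdeg us')) *\<^sub>R f qs"
    using pcmp_split[OF lt lens(1) _ lens(2), of V n k l f g] V hl'
    by (simp add: pact_eq[OF tup] sgn1 perm dV tuples_iff qs_split flip: map_append)
  have lds: "length ?ds = m" using * i by simp
  have raise: "map fst (us @ ?y # ws) = ?ds[i := ?ds ! i + l]" using * by (simp add: list_update_append nth_append)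
  have take_i: "sum_list (take i ?ds) = tdeg us" using * by (simp add: tdeg_def)
  have take_qs: "sum_list (take (\<tau> i) (permute_list (inv \<tau>) ?ds)) = tdeg us'"
  proof -
    have "map fst qs = (permute_list (inv \<tau>) ?ds)[\<tau> i := ?ds ! i + l]"
      unfolding qs_def using lds \<tau> i yt permute_list_update[of \<tau> ?ds i "?ds ! i + l"] raise
      by (simp add: permute_list_map[symmetric] permutes_inv tuples_iff)
    then have "take (\<tau> i) (map fst qs) = take (\<tau> i) (permute_list (inv \<tau>) ?ds)" by simp
    then show ?thesis by (simp add: tdeg_def us'_def take_map)
  qed
  have sgn2: "(-1) powi (l * tdeg us) * degree_sign \<tau> (map fst (us @ ?y # ws)) =
      degree_sign \<tau> ?ds * (-1) powi (l * tdeg us')"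
    unfolding raise using degree_sign_raise[of i ?ds \<tau> l] degree_before_permuted[of \<tau> ?ds i l] lds \<tau> i
    unfolding take_i take_qs lds by (simp add: mult_ac)
  have vt: "vs \<in> tuples X n" using * by (simp add: tuples_iff)
  have "pcmp m k n l i (pact m k f \<tau>) (pact n l g \<sigma>) (us @ vs @ ws) =
    (-1) powi (l * tdeg us) *\<^sub>R pact m k f \<tau> (us @ (tdeg vs + l, degree_sign \<sigma> (map fst vs) *\<^sub>R g V) # ws)"
    using * i by (simp add: pcmp_split pact_eq[OF vt] V_def)
  also have "\<dots> = ((-1) powi (l * tdeg us) * degree_sign \<sigma> (map fst vs)) *\<^sub>R pact m k f \<tau> (us @ ?y # ws)"
    using * i gV by (subst ml_scale[OF pact_in[OF f \<tau>]]) auto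
  also have "pact m k f \<tau> (us @ ?y # ws) = degree_sign \<tau> (map fst (us @ ?y # ws)) *\<^sub>R f qs"
    by (simp add: pact_eq[OF yt] qs_def)
  finally show "pcmp m k n l i (pact m k f \<tau>) (pact n l g \<sigma>) (us @ vs @ ws) =
    pact (m + n - 1) (k + l) (pcmp m k n l (\<tau> i) f g) ?\<beta> (us @ vs @ ws)"
    unfolding RHS using sgn2 by (simp add: mult_ac)
qed (use i in \<open>auto simp: pcmp_outside pact_outside\<close>)

end

context cochain_complex
begin

subsection \<open>The differential\<close>

text \<open>The differential of the complex as an element of its endomorphism operad.\<close>

definition differential_op :: "(int \<times> 'v) list \<Rightarrow> 'v" where
  "differential_op zs = (if zs \<in> tuples X 1 then cx_d X (fst (zs ! 0)) (snd (zs ! 0)) else 0)"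

lemma differential_op_single: "x \<in> cx X k \<Longrightarrow> differential_op [(k, x)] = cx_d X k x"
  by (simp add: differential_op_def tuples_iff)

lemma differential_op_in: "differential_op \<in> ml 1 1"
proof (rule ml_I)
  fix zs :: "(int \<times> 'v) list" assume "length zs = 1" "hl zs"
  then show "differential_op zs \<in> cx X (tdeg zs + 1)"
    by (cases zs) (auto simp: differential_op_single cx_d_in)
next
  fix us ws :: "(int \<times> 'v) list" and l a b x y
  assume *: "length us + 1 + length ws = 1" "x \<in> cx X l" "y \<in> cx X l"
  then have "a *\<^sub>R x + b *\<^sub>R y \<in> cx X l" by (auto simp: cx_closed)
  then show "differential_op (us @ (l, a *\<^sub>R x + b *\<^sub>R y) # ws) =
     a *\<^sub>R differential_op (us @ (l, x) # ws) + b *\<^sub>R differential_op (us @ (l, y) # ws)"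
    using * by (simp add: differential_op_single cx_d_linear)
qed (simp add: differential_op_def)

lemma differential_op_squared: "pcmp 1 1 1 1 0 differential_op differential_op = 0"
proof (rule pcmp_eqI[where m = 1 and n = 1 and i = 0])
  fix us vs ws :: "(int \<times> 'v) list"
  assume *: "length us = 0" "length vs = 1" "length ws = 1 - 1 - 0" "hl us" "hl vs" "hl ws"
  then obtain k x where "vs = [(k, x)]" "x \<in> cx X k" by (cases vs) auto
  then show "pcmp 1 1 1 1 0 differential_op differential_op (us @ vs @ ws) = 0 (us @ vs @ ws)"
    using * pcmp_split[of 0 1 "[]" vs 1 "[]" 1 1 differential_op differential_op]
    by (simp add: differential_op_single cx_d_in cx_d_d)
qed (auto simp: pcmp_outside)

abbreviation "dl n k f \<equiv> pcmp 1 1 n k 0 differential_op f"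
abbreviation "dr n k f \<equiv> \<Sum>j<n. pcmp n k 1 1 j f differential_op"

lemma dl_in: "f \<in> ml n k \<Longrightarrow> dl n k f \<in> ml n (k + 1)"
  using pcmp_in[OF differential_op_in, of f n k 0] by (simp add: add.commute)

lemma pcmp_differential_in: "f \<in> ml n k \<Longrightarrow> j < n \<Longrightarrow> pcmp n k 1 1 j f differential_op \<in> ml n (k + 1)"
  using pcmp_in[OF _ differential_op_in, of f n k j] by simp

lemma dr_in: "f \<in> ml n k \<Longrightarrow> dr n k f \<in> ml n (k + 1)"
  by (intro ml_closed pcmp_differential_in) auto

text \<open>The differential of the endomorphism operad is the commutator with an operation of arity and
  degree \<open>1\<close>. All its properties follow from this by the axioms for compositions.\<close>

lemma op_dif_eq:
  assumes f: "f \<in> ml n k"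
  shows "op_dif (End_operad X) n k f = dl n k f - (-1) powi k *\<^sub>R dr n k f"
proof
  fix zs
  show "op_dif (End_operad X) n k f zs = (dl n k f - (-1) powi k *\<^sub>R dr n k f) zs"
  proof (cases "zs \<in> tuples X n")
    case True
    then have len: "length zs = n" and hl: "hl zs" by (auto simp: tuples_iff)
    have "dl n k f zs = cx_d X (tdeg zs + k) (f zs)"
      using pcmp_split[of 0 1 "[]" zs n "[]" 1 k differential_op f] len hl ml_in[OF f]
      by (simp add: differential_op_single)
    moreover have "pcmp n k 1 1 j f differential_op zs = (-1) powi (tdeg (take j zs)) *\<^sub>R
            f (zs[j := (fst (zs ! j) + 1, cx_d X (fst (zs ! j)) (snd (zs ! j)))])" if "j < n" for j
    proof -
      have zs: "zs = take j zs @ [zs ! j] @ drop (Suc j) zs"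
        using that len by (simp add: id_take_nth_drop[symmetric])
      have hl': "hl (take j zs)" "hl [zs ! j]" "hl (drop (Suc j) zs)"
        using hl that len by (auto simp: homogeneous_list_def dest: in_set_takeD in_set_dropD)
      then have "differential_op [zs ! j] = cx_d X (fst (zs ! j)) (snd (zs ! j))"
        using differential_op_single[of "snd (zs ! j)" "fst (zs ! j)"] by simp
      moreover have "pcmp n k 1 1 j f differential_op (take j zs @ [zs ! j] @ drop (Suc j) zs) =
        (-1) powi (1 * tdeg (take j zs)) *\<^sub>R f (take j zs @ (tdeg [zs ! j] + 1, differential_op [zs ! j]) # drop (Suc j) zs)"
        using that len hl' by (intro pcmp_split) auto
      ultimately show ?thesis using zs that len by (simp add: upd_conv_take_nth_drop)
    qed
    then have "dr n k f zs = (\<Sum>j<n. (-1) powi (tdeg (take j zs)) *\<^sub>R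
            f (zs[j := (fst (zs ! j) + 1, cx_d X (fst (zs ! j)) (snd (zs ! j)))]))"
      by (simp add: sum_fun_apply)
    ultimately show ?thesis using True by (simp add: End_operad_def[of X])
  next
    case False
    then have "dl n k f zs = 0" "\<And>j. j < n \<Longrightarrow> pcmp n k 1 1 j f differential_op zs = 0"
      using pcmp_outside[of zs 1 n] pcmp_outside[of zs n 1] by simp_all
    then have "(dl n k f - (-1) powi k *\<^sub>R dr n k f) zs = 0" by (simp add: sum_fun_apply)
    moreover have "op_dif (End_operad X) n k f zs = 0" using False by (simp add: End_operad_def)
    ultimately show ?thesis by simp
  qed
qed

lemma op_dif_in: "f \<in> ml n k \<Longrightarrow> op_dif (End_operad X) n k f \<in> ml n (k + 1)"
  unfolding op_dif_eq by (intro ml_closed dl_in dr_in)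

lemma lessThan_sum_split:
  fixes f :: "nat \<Rightarrow> 'c::comm_monoid_add"
  shows "(\<Sum>a<p + q. f a) = (\<Sum>a<p. f a) + (\<Sum>a<q. f (p + a))"
  by (induction q) (auto simp: add.assoc)

text \<open>The differential is inserted into an argument of the inner operation, or into a slot of the
  outer one other than the slot \<open>i\<close>. The sum over all slots of the outer operation has the
  slot \<open>i\<close> in excess.\<close>

lemma dr_pcmp:
  assumes f: "f \<in> ml m k" and g: "g \<in> ml n l" and i: "i < m"
  shows "dr (m + n - 1) (k + l) (pcmp m k n l i f g) = pcmp m k n (l + 1) i f (dr n l g)
    + (-1) powi l *\<^sub>R (pcmp m (k + 1) n l i (dr m k f) g
        - pcmp m (k + 1) n l i (pcmp m k 1 1 i f differential_op) g)"
proof -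
  define r where "r = m - 1 - i"
  have m: "m = i + (1 + r)" and N: "m + n - 1 = i + (n + r)" using i by (auto simp: r_def)
  define F where "F = (\<lambda>p. pcmp (m + n - 1) (k + l) 1 1 p (pcmp m k n l i f g) differential_op)"
  define G where "G = (\<lambda>j. pcmp m (k + 1) n l i (pcmp m k 1 1 j f differential_op) g)"
  have F1: "F p = (-1) powi l *\<^sub>R G p" if "p < i" for p
    unfolding F_def G_def using that i
    by (subst pcmp_assoc_par[OF f differential_op_in g that i, of _ _ m "k + 1" i]) auto
  have F2: "F (i + b) = pcmp m k n (l + 1) i f (pcmp n l 1 1 b g differential_op)" if "b < n" for b
    unfolding F_def by (rule pcmp_assoc_seq[OF f g differential_op_in i that]) auto
  have F3: "F (i + (n + c)) = (-1) powi l *\<^sub>R G (i + (1 + c))" if "c < r" for c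
  proof -
    have "G (i + (1 + c)) = (-1) powi (l * 1) *\<^sub>R F (i + (n + c))"
      unfolding F_def G_def using that m
      by (intro pcmp_assoc_par[OF f g differential_op_in]) auto
    then show ?thesis by simp
  qed
  have "dr (m + n - 1) (k + l) (pcmp m k n l i f g) = (\<Sum>p<i + (n + r). F p)"
    by (simp add: F_def N)
  also have "\<dots> = (\<Sum>p<i. (-1) powi l *\<^sub>R G p) + ((\<Sum>b<n. pcmp m k n (l + 1) i f (pcmp n l 1 1 b g differential_op)) +
      (\<Sum>c<r. (-1) powi l *\<^sub>R G (i + (1 + c))))"
    unfolding lessThan_sum_split by (simp add: F1 F2 F3)
  also have "\<dots> = (\<Sum>b<n. pcmp m k n (l + 1) i f (pcmp n l 1 1 b g differential_op)) +
      (-1) powi l *\<^sub>R ((\<Sum>j<i + (1 + r). G j) - G i)"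
    unfolding lessThan_sum_split by (simp add: scaleR_sum_right algebra_simps One_nat_def)
  also have "(\<Sum>j<i + (1 + r). G j) = pcmp m (k + 1) n l i (dr m k f) g"
    unfolding m[symmetric] G_def pcmp_sum_left ..
  also have "(\<Sum>b<n. pcmp m k n (l + 1) i f (pcmp n l 1 1 b g differential_op)) = pcmp m k n (l + 1) i f (dr n l g)"
    by (rule pcmp_sum_right[symmetric, OF f _ i]) (simp add: pcmp_differential_in g)
  finally show ?thesis by (simp only: G_def)
qed

text \<open>The terms in which the differential stands between the outer and the inner operation cancel.\<close>

lemma op_dif_pcmp:
  assumes f: "f \<in> ml m k" and g: "g \<in> ml n l" and i: "i < m"
  shows "op_dif (End_operad X) (m + n - 1) (k + l) (pcmp m k n l i f g) =
    pcmp m (k + 1) n l i (op_dif (End_operad X) m k f) g +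
    (-1) powi k *\<^sub>R pcmp m k n (l + 1) i f (op_dif (End_operad X) n l g)"
proof -
  have 1: "dl (m + n - 1) (k + l) (pcmp m k n l i f g) = pcmp m (k + 1) n l i (dl m k f) g"
    using pcmp_assoc_seq[OF differential_op_in f g _ i, of 0 m "k + 1" "m + n - 1" "k + l"] by simp
  have 2: "pcmp m k n (l + 1) i f (dl n l g) = pcmp m (k + 1) n l i (pcmp m k 1 1 i f differential_op) g"
    using pcmp_assoc_seq[OF f differential_op_in g i, of 0 m "k + 1" n "l + 1"] by simp
  show ?thesis
    unfolding op_dif_eq[OF pcmp_in[OF f g i]] op_dif_eq[OF f] op_dif_eq[OF g] dr_pcmp[OF f g i] 1
      pcmp_diff_left pcmp_scale_left pcmp_diff_right[OF f dl_in[OF g] ml_closed(3)[OF dr_in[OF g]] i]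
      pcmp_scale_right[OF f dr_in[OF g] i] 2
    by (simp add: algebra_simps minus_one_powi_add)
qed

text \<open>Inserting the differential into two distinct slots in either order gives opposite results,
  since it is odd; inserting it twice into the same slot gives zero.\<close>

lemma op_dif_op_dif:
  assumes f: "f \<in> ml n k"
  shows "op_dif (End_operad X) n (k + 1) (op_dif (End_operad X) n k f) = 0"
proof -
  note \<delta> = differential_op_in
  let ?\<delta> = "differential_op"
  have "pcmp 1 2 n k (0 + 0) (pcmp 1 1 1 1 0 ?\<delta> ?\<delta>) f = dl n (k + 1) (dl n k f)"
    by (rule pcmp_assoc_seq[OF \<delta> \<delta> f]) auto
  then have 1: "dl n (k + 1) (dl n k f) = 0"
    by (simp only: differential_op_squared pcmp_zero_left add_0)
  have 2: "pcmp n (k + 1) 1 1 j (dl n k f) ?\<delta> = dl n (k + 1) (pcmp n k 1 1 j f ?\<delta>)" if "j < n" for j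
  proof -
    have "pcmp n (k + 1) 1 1 (0 + j) (dl n k f) ?\<delta> = dl n (k + 1) (pcmp n k 1 1 j f ?\<delta>)"
      by (rule pcmp_assoc_seq[OF \<delta> f \<delta>]) (use that in auto)
    then show ?thesis by simp
  qed
  have "dl n (k + 1) (dr n k f) = (\<Sum>j<n. dl n (k + 1) (pcmp n k 1 1 j f ?\<delta>))"
    by (rule pcmp_sum_right[OF \<delta>]) (auto intro: pcmp_differential_in f)
  then have 3: "dr n (k + 1) (dl n k f) = dl n (k + 1) (dr n k f)" by (simp add: 2)
  define H where "H = (\<lambda>i j. pcmp n (k + 1) 1 1 j (pcmp n k 1 1 i f ?\<delta>) ?\<delta>)"
  have "H j j = 0" if "j < n" for j
  proof -
    have "pcmp n (k + 1) 1 1 (j + 0) (pcmp n k 1 1 j f ?\<delta>) ?\<delta> = pcmp n k 1 2 j f (pcmp 1 1 1 1 0 ?\<delta> ?\<delta>)"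
      by (rule pcmp_assoc_seq[OF f \<delta> \<delta> that]) auto
    then show ?thesis
      unfolding H_def differential_op_squared pcmp_zero_right[OF f that] by simp
  qed
  moreover have H: "H j i = - H i j" if "i < j" "j < n" for i j
  proof -
    have "H j i = (-1) powi (1 * 1) *\<^sub>R H i j"
      unfolding H_def by (rule pcmp_assoc_par[OF f \<delta> \<delta> that]) auto
    then show ?thesis by simp
  qed
  ultimately have anti: "H j i = - H i j" if "i < n" "j < n" for i j
    using that by (cases i j rule: linorder_cases) auto
  have "dr n (k + 1) (dr n k f) = (\<Sum>j<n. \<Sum>i<n. H i j)"
    by (simp add: pcmp_sum_left H_def)
  moreover have "(\<Sum>j<n. \<Sum>i<n. H i j) = (\<Sum>j<n. \<Sum>i<n. - H i j)"
    by (subst sum.swap, intro sum.cong HOL.refl, rule anti) auto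
  moreover have "(\<Sum>j<n. \<Sum>i<n. - H i j) = - (\<Sum>j<n. \<Sum>i<n. H i j)"
    by (simp only: sum_negf)
  ultimately have "dr n (k + 1) (dr n k f) = - dr n (k + 1) (dr n k f)" by metis
  then have "dr n (k + 1) (dr n k f) + dr n (k + 1) (dr n k f) = 0" by (metis add.right_inverse)
  then have "2 *\<^sub>R dr n (k + 1) (dr n k f) = 0" by (simp only: scaleR_2)
  then have 4: "dr n (k + 1) (dr n k f) = 0" by simp
  have "op_dif (End_operad X) n (k + 1) (op_dif (End_operad X) n k f) =
    dl n (k + 1) (dl n k f - (-1) powi k *\<^sub>R dr n k f)
      - (-1) powi (k + 1) *\<^sub>R dr n (k + 1) (dl n k f - (-1) powi k *\<^sub>R dr n k f)"
    unfolding op_dif_eq[OF f] by (rule op_dif_eq[OF ml_closed(4)[OF dl_in[OF f] ml_closed(3)[OF dr_in[OF f]]]])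
  also have "dl n (k + 1) (dl n k f - (-1) powi k *\<^sub>R dr n k f) = - ((-1) powi k *\<^sub>R dl n (k + 1) (dr n k f))"
    unfolding pcmp_diff_right[OF \<delta> dl_in[OF f] ml_closed(3)[OF dr_in[OF f]] zero_less_one]
      pcmp_scale_right[OF \<delta> dr_in[OF f] zero_less_one] 1 by simp
  also have "dr n (k + 1) (dl n k f - (-1) powi k *\<^sub>R dr n k f) = dl n (k + 1) (dr n k f)"
    unfolding pcmp_diff_left pcmp_scale_left sum_subtractf scaleR_sum_right[symmetric] 3 4 by simp
  finally show ?thesis by (simp add: minus_one_powi_add zero_fun_def)
qed

text \<open>Both parts of the commutator are composites, so that equivariance of compositions suffices.\<close>

lemma op_dif_pact:
  assumes f: "f \<in> ml n k" and \<tau>: "\<tau> permutes {..<n}"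
  shows "op_dif (End_operad X) n k (pact n k f \<tau>) = pact n (k + 1) (op_dif (End_operad X) n k f) \<tau>"
proof -
  note \<delta> = differential_op_in
  let ?\<delta> = "differential_op"
  have id: "pact 1 1 ?\<delta> id = ?\<delta>" by (rule pact_id[OF \<delta>])
  have "block_perm 1 n 0 id \<tau> = \<tau>"
    using permutes_not_in[OF \<tau>] by (auto simp: block_perm_def fun_eq_iff)
  then have 1: "dl n k (pact n k f \<tau>) = pact n (k + 1) (dl n k f) \<tau>"
    using pact_pcmp[OF \<delta> f, of 0 id \<tau>] \<tau> by (simp add: id permutes_id add.commute)
  have "pcmp n k 1 1 j (pact n k f \<tau>) ?\<delta> = pact n (k + 1) (pcmp n k 1 1 (\<tau> j) f ?\<delta>) \<tau>" if "j < n" for j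
  proof -
    have "block_perm n 1 j \<tau> id = \<tau>"
      using permutes_not_in[OF \<tau>] that by (auto simp: block_perm_def fun_eq_iff Let_def One_nat_def less_Suc_eq)
    then show ?thesis
      using pact_pcmp[OF f \<delta> that \<tau>, of id] by (simp add: id permutes_id)
  qed
  then have "dr n k (pact n k f \<tau>) = (\<Sum>j<n. pact n (k + 1) (pcmp n k 1 1 (\<tau> j) f ?\<delta>) \<tau>)" by simp
  also have "\<dots> = (\<Sum>j<n. pact n (k + 1) (pcmp n k 1 1 j f ?\<delta>) \<tau>)"
    using sum.permute[OF \<tau>, of "\<lambda>j. pact n (k + 1) (pcmp n k 1 1 j f ?\<delta>) \<tau>"] by (simp add: o_def)
  finally have 2: "dr n k (pact n k f \<tau>) = pact n (k + 1) (dr n k f) \<tau>" by (simp add: pact_sum)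
  show ?thesis
    unfolding op_dif_eq[OF f] op_dif_eq[OF pact_in[OF f \<tau>]] 1 2 pact_diff pact_scale ..
qed

lemma op_dif_linear:
  assumes "f \<in> ml n k" "g \<in> ml n k"
  shows "op_dif (End_operad X) n k (f + g) = op_dif (End_operad X) n k f + op_dif (End_operad X) n k g"
    and "op_dif (End_operad X) n k (a *\<^sub>R f) = a *\<^sub>R op_dif (End_operad X) n k f"
  using assms pcmp_add_right[OF differential_op_in assms zero_less_one]
    pcmp_scale_right[OF differential_op_in assms(1) zero_less_one, of a]
  by (simp_all add: op_dif_eq ml_closed pcmp_add_left pcmp_scale_left sum.distrib
      scaleR_sum_right[symmetric] algebra_simps)

lemma unit_pcmp: "g \<in> ml n l \<Longrightarrow> pcmp 1 0 n l 0 (op_unit (End_operad X)) g = g"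
  and pcmp_unit: "f \<in> ml m k \<Longrightarrow> i < m \<Longrightarrow> pcmp m k 1 0 i f (op_unit (End_operad X)) = f"
  and unit_in: "op_unit (End_operad X) \<in> ml 1 0"
proof -
  have u: "op_unit (End_operad X) [(k, x)] = x" if "x \<in> cx X k" for k x
    using that by (simp add: End_operad_def tuples_iff)
  show "op_unit (End_operad X) \<in> ml 1 0"
  proof (rule ml_I)
    fix zs :: "(int \<times> 'v) list" assume "length zs = 1" "hl zs"
    then show "op_unit (End_operad X) zs \<in> cx X (tdeg zs + 0)"
      by (cases zs) (auto simp: u)
  next
    fix us ws :: "(int \<times> 'v) list" and l a b x y
    assume *: "length us + 1 + length ws = 1" "x \<in> cx X l" "y \<in> cx X l"
    then have "a *\<^sub>R x + b *\<^sub>R y \<in> cx X l" by (auto simp: cx_closed)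
    then show "op_unit (End_operad X) (us @ (l, a *\<^sub>R x + b *\<^sub>R y) # ws) =
       a *\<^sub>R op_unit (End_operad X) (us @ (l, x) # ws) + b *\<^sub>R op_unit (End_operad X) (us @ (l, y) # ws)"
      using * by (simp add: u)
  qed (simp add: End_operad_def)
  show "pcmp 1 0 n l 0 (op_unit (End_operad X)) g = g" if g: "g \<in> ml n l" for g n l
    by (rule pcmp_eqI[where m = 1 and n = n and i = 0])
      (use g pcmp_split[of 0 1 "[]" _ n "[]" 0 l "op_unit (End_operad X)" g] in
        \<open>auto simp: pcmp_outside u ml_in[OF g] ml_zero[OF g]\<close>)
  show "pcmp m k 1 0 i f (op_unit (End_operad X)) = f" if f: "f \<in> ml m k" "i < m" for f m k i
  proof (rule pcmp_eqI[where m = m and n = 1 and i = i])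
    fix us vs ws assume *: "length us = i" "length vs = 1" "length ws = m - 1 - i" "hl us" "hl vs" "hl ws"
    then obtain k x where "vs = [(k, x)]" "x \<in> cx X k" by (cases vs) auto
    then show "pcmp m k' 1 0 i f (op_unit (End_operad X)) (us @ vs @ ws) = f (us @ vs @ ws)" for k'
      using * f(2) by (subst pcmp_split) (auto simp: u)
  qed (use f in \<open>auto simp: pcmp_outside ml_zero[OF f(1)]\<close>)
qed

lemma dg_operad_End: "dg_operad (End_operad X)"
proof -
  have [simp]: "op_car (End_operad X) = ml" "op_zero (End_operad X) n k = 0"
    "op_add (End_operad X) n k f g = f + g" "op_smul (End_operad X) n k a f = a *\<^sub>R f" for n k f g a
    by (simp_all add: End_operad_def)
  show ?thesis
  proof (unfold_locales, goal_cases)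
    case (18 x n k)
    then show ?case by (simp add: op_dif_op_dif)
  next
    case (28 f m k g n l i)
    then show ?case by (simp add: op_dif_pcmp)
  next
    case (29 f m k g n l h r s i j)
    then show ?case by (simp add: pcmp_assoc_seq)
  next
    case (30 f m k g n l h r s i j)
    then show ?case using pcmp_assoc_par[of f m k g n l h r s i j "m + r - 1" "k + s" "m + n - 1" "k + l" "j + n - 1"] by simp
  qed (simp_all add: ml_closed op_dif_in pact_in unit_in pcmp_in algebra_simps op_dif_linear pact_add
      pact_scale pact_id pact_pact op_dif_pact pcmp_add_left pcmp_scale_left pcmp_add_right
      pcmp_scale_right unit_pcmp pcmp_unit pact_pcmp)
qed

end

section \<open>The wedge product as a product of functions on lists\<close>

text \<open>A form at a point is a function on lists of vectors, and inserting a vector as the first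
  argument lowers the degree. The product below is defined by recursion on the list of arguments, from
  the rule that insertion is a derivation. The sign in this rule is supplied by \<open>grading_twist\<close>,
  so that most identities hold for arbitrary functions, homogeneous or not.\<close>

definition insert_first :: "'a \<Rightarrow> ('a list \<Rightarrow> real) \<Rightarrow> 'a list \<Rightarrow> real" where
  "insert_first v a = (\<lambda>vs. a (v # vs))"

definition grading_twist :: "('a list \<Rightarrow> real) \<Rightarrow> 'a list \<Rightarrow> real" where
  "grading_twist a = (\<lambda>vs. (-1) ^ length vs * a vs)"

fun list_wedge :: "('a list \<Rightarrow> real) \<Rightarrow> ('a list \<Rightarrow> real) \<Rightarrow> 'a list \<Rightarrow> real" where
  "list_wedge a b [] = a [] * b []"
| "list_wedge a b (v # vs) =
    list_wedge (insert_first v a) b vs + list_wedge (grading_twist a) (insert_first v b) vs"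

definition homogeneous :: "int \<Rightarrow> ('a list \<Rightarrow> real) \<Rightarrow> bool" where
  "homogeneous k a \<longleftrightarrow> (\<forall>vs. int (length vs) \<noteq> k \<longrightarrow> a vs = 0)"

lemma insert_first_apply [simp]: "insert_first v a vs = a (v # vs)"
  by (simp add: insert_first_def)

lemma insert_first_linear [simp]:
  "insert_first v (a + b) = insert_first v a + insert_first v b"
  "insert_first v (a - b) = insert_first v a - insert_first v b"
  "insert_first v (- a) = - insert_first v a"
  "insert_first v (r *\<^sub>R a) = r *\<^sub>R insert_first v a"
  "insert_first v 0 = 0"
  by (auto simp: insert_first_def)

lemma grading_twist_linear [simp]:
  "grading_twist (a + b) = grading_twist a + grading_twist b"
  "grading_twist (a - b) = grading_twist a - grading_twist b"
  "grading_twist (- a) = - grading_twist a"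
  "grading_twist (r *\<^sub>R a) = r *\<^sub>R grading_twist a"
  "grading_twist 0 = 0"
  by (auto simp: grading_twist_def algebra_simps)

lemma grading_twist_twist [simp]: "grading_twist (grading_twist a) = a"
  by (auto simp: grading_twist_def fun_eq_iff simp flip: power_mult_distrib mult.assoc)

lemma insert_first_twist [simp]: "insert_first v (grading_twist a) = - grading_twist (insert_first v a)"
  by (auto simp: grading_twist_def insert_first_def)

lemma list_wedge_add_left: "list_wedge (a + a') b vs = list_wedge a b vs + list_wedge a' b vs"
  by (induction vs arbitrary: a a' b) (simp_all add: algebra_simps)

lemma list_wedge_add_right: "list_wedge a (b + b') vs = list_wedge a b vs + list_wedge a b' vs"
  by (induction vs arbitrary: a b b') (simp_all add: algebra_simps)

lemma list_wedge_scale_left: "list_wedge (r *\<^sub>R a) b vs = r * list_wedge a b vs"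
  by (induction vs arbitrary: a b) (simp_all add: algebra_simps)

lemma list_wedge_scale_right: "list_wedge a (r *\<^sub>R b) vs = r * list_wedge a b vs"
  by (induction vs arbitrary: a b) (simp_all add: algebra_simps)

lemma list_wedge_linear [simp]:
  "list_wedge (a + a') b = list_wedge a b + list_wedge a' b"
  "list_wedge a (b + b') = list_wedge a b + list_wedge a b'"
  "list_wedge (r *\<^sub>R a) b = r *\<^sub>R list_wedge a b"
  "list_wedge a (r *\<^sub>R b) = r *\<^sub>R list_wedge a b"
  by (simp_all add: fun_eq_iff list_wedge_add_left list_wedge_add_right list_wedge_scale_left list_wedge_scale_right)

lemma list_wedge_zero [simp]: "list_wedge 0 b = 0" "list_wedge a 0 = 0"
  using list_wedge_linear(3)[of 0 0 b] list_wedge_linear(4)[of a 0 0] by simp_all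

lemma list_wedge_minus [simp]:
  "list_wedge (- a) b = - list_wedge a b" "list_wedge a (- b) = - list_wedge a b"
  using list_wedge_linear(3)[of "-1" a b] list_wedge_linear(4)[of a "-1" b] by simp_all

lemma list_wedge_diff [simp]:
  "list_wedge (a - a') b = list_wedge a b - list_wedge a' b"
  "list_wedge a (b - b') = list_wedge a b - list_wedge a b'"
  using list_wedge_linear(1)[of a "- a'" b] list_wedge_linear(2)[of a b "- b'"] by simp_all

lemma insert_first_list_wedge [simp]:
  "insert_first v (list_wedge a b) =
    list_wedge (insert_first v a) b + list_wedge (grading_twist a) (insert_first v b)"
  by (auto simp: insert_first_def)

lemma grading_twist_list_wedge: "grading_twist (list_wedge a b) vs = list_wedge (grading_twist a) (grading_twist b) vs"
proof (induction vs arbitrary: a b)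
  case Nil
  then show ?case by (simp add: grading_twist_def)
next
  case (Cons v vs)
  have "grading_twist (list_wedge a b) (v # vs) = - grading_twist (insert_first v (list_wedge a b)) vs"
    by (simp add: grading_twist_def)
  also have "grading_twist (insert_first v (list_wedge a b)) vs =
    list_wedge (grading_twist (insert_first v a)) (grading_twist b) vs
    + list_wedge a (grading_twist (insert_first v b)) vs"
    unfolding insert_first_list_wedge grading_twist_linear plus_fun_apply Cons.IH grading_twist_twist ..
  finally show ?case by (simp del: insert_first_apply)
qed

lemma grading_twist_list_wedge_eq [simp]:
  "grading_twist (list_wedge a b) = list_wedge (grading_twist a) (grading_twist b)"
  using grading_twist_list_wedge by blast

lemma list_wedge_assoc_apply: "list_wedge (list_wedge a b) c vs = list_wedge a (list_wedge b c) vs"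
  by (induction vs arbitrary: a b c) (simp_all add: algebra_simps)

lemma list_wedge_assoc: "list_wedge (list_wedge a b) c = list_wedge a (list_wedge b c)"
  using list_wedge_assoc_apply by blast

lemma homogeneous_insert_first: "homogeneous k a \<Longrightarrow> homogeneous (k - 1) (insert_first v a)"
  by (auto simp: homogeneous_def insert_first_def)

lemma grading_twist_homogeneous: "homogeneous k a \<Longrightarrow> grading_twist a = (-1) powi k *\<^sub>R a"
  by (auto simp: homogeneous_def grading_twist_def fun_eq_iff)

lemma homogeneous_zero [simp]: "homogeneous k 0"
  by (simp add: homogeneous_def)

lemma homogeneous_list_wedge_apply:
  "homogeneous p a \<Longrightarrow> homogeneous q b \<Longrightarrow> int (length vs) \<noteq> p + q \<Longrightarrow> list_wedge a b vs = 0"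
proof (induction vs arbitrary: a b p q)
  case Nil
  then show ?case by (cases "p = 0"; cases "q = 0") (auto simp: homogeneous_def)
next
  case (Cons v vs)
  have "list_wedge (insert_first v a) b vs = 0"
    by (rule Cons.IH[OF homogeneous_insert_first[OF Cons.prems(1), of v] Cons.prems(2)]) (use Cons.prems in simp)
  moreover have "list_wedge a (insert_first v b) vs = 0"
    by (rule Cons.IH[OF Cons.prems(1) homogeneous_insert_first[OF Cons.prems(2), of v]]) (use Cons.prems in simp)
  ultimately show ?case by (simp add: grading_twist_homogeneous[OF Cons.prems(1)])
qed

lemma homogeneous_list_wedge: "homogeneous p a \<Longrightarrow> homogeneous q b \<Longrightarrow> homogeneous (p + q) (list_wedge a b)"
  using homogeneous_list_wedge_apply unfolding homogeneous_def by blast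

lemma list_wedge_commute_apply:
  "homogeneous p a \<Longrightarrow> homogeneous q b \<Longrightarrow> list_wedge a b vs = (-1) powi (p * q) * list_wedge b a vs"
proof (induction vs arbitrary: a b p q)
  case Nil
  then show ?case
    by (cases "p = 0"; cases "q = 0") (auto simp: homogeneous_def)
next
  case (Cons v vs)
  have "list_wedge a b (v # vs) = (-1) powi ((p - 1) * q) * list_wedge b (insert_first v a) vs
    + (-1) powi p * ((-1) powi (p * (q - 1)) * list_wedge (insert_first v b) a vs)"
    unfolding list_wedge.simps grading_twist_homogeneous[OF Cons.prems(1)] list_wedge_scale_left
      Cons.IH[OF homogeneous_insert_first[OF Cons.prems(1), of v] Cons.prems(2)]
      Cons.IH[OF Cons.prems(1) homogeneous_insert_first[OF Cons.prems(2), of v]] ..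
  also have "\<dots> = (-1) powi (p * q) * list_wedge b a (v # vs)"
    unfolding list_wedge.simps grading_twist_homogeneous[OF Cons.prems(2)] list_wedge_scale_left
    by (auto simp: minus_one_powi_if)
  finally show ?case .
qed

lemma list_wedge_commute:
  assumes "homogeneous p a" "homogeneous q b"
  shows "list_wedge a b = (-1) powi (p * q) *\<^sub>R list_wedge b a"
  using list_wedge_commute_apply[OF assms] by (intro ext) simp

subsection \<open>Shuffles\<close>

text \<open>The smallest element is either the first element of the first block of a shuffle, which is then
  \<open>lift_perm \<sigma>\<close> for a shuffle \<open>\<sigma>\<close> of the remaining elements, or the first element of the second block,
  which begins at position \<open>p\<close>, so that the shuffle is \<open>lift_perm \<sigma> \<circ> cycle_perm p\<close>.\<close>

definition lift_perm :: "(nat \<Rightarrow> nat) \<Rightarrow> nat \<Rightarrow> nat" where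
  "lift_perm \<sigma> j = (case j of 0 \<Rightarrow> 0 | Suc i \<Rightarrow> Suc (\<sigma> i))"

definition cycle_perm :: "nat \<Rightarrow> nat \<Rightarrow> nat" where
  "cycle_perm p j = (if j < p then Suc j else if j = p then 0 else j)"

lemma lift_perm_simps [simp]: "lift_perm \<sigma> 0 = 0" "lift_perm \<sigma> (Suc j) = Suc (\<sigma> j)"
  by (simp_all add: lift_perm_def)

lemma lift_perm_permutes: "\<sigma> permutes {..<n} \<Longrightarrow> lift_perm \<sigma> permutes {..<Suc n}"
proof (rule inj_imp_permutes)
  assume \<sigma>: "\<sigma> permutes {..<n}"
  show "inj_on (lift_perm \<sigma>) {..<Suc n}"
  proof -
    have "\<sigma> a = \<sigma> b \<longleftrightarrow> a = b" for a b using permutes_inj[OF \<sigma>] by (auto dest: injD)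
    then show ?thesis by (auto simp: inj_on_def lift_perm_def split: nat.splits)
  qed
  show "lift_perm \<sigma> x \<in> {..<Suc n}" if "x \<in> {..<Suc n}" for x
    using that permutes_in_image[OF \<sigma>] by (auto simp: lift_perm_def split: nat.splits)
  show "lift_perm \<sigma> x = x" if "x \<notin> {..<Suc n}" for x
    using that permutes_not_in[OF \<sigma>] by (auto simp: lift_perm_def split: nat.splits)
qed simp

lemma lift_perm_exists:
  assumes \<tau>: "\<tau> permutes {..<Suc n}" and 0: "\<tau> 0 = 0"
  obtains \<sigma> where "\<sigma> permutes {..<n}" "\<tau> = lift_perm \<sigma>"
proof
  have inj: "\<tau> a = \<tau> b \<longleftrightarrow> a = b" for a b using permutes_inj[OF \<tau>] by (auto dest: injD)
  have pos: "\<tau> (Suc j) > 0" for j using inj[of "Suc j" 0] 0 by simp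
  define \<sigma> where "\<sigma> = (\<lambda>j. \<tau> (Suc j) - 1)"
  have S: "\<tau> (Suc j) = Suc (\<sigma> j)" for j using pos[of j] by (simp add: \<sigma>_def)
  show "\<tau> = lift_perm \<sigma>"
    by (auto simp: fun_eq_iff lift_perm_def S 0 split: nat.splits)
  show "\<sigma> permutes {..<n}"
  proof (rule inj_imp_permutes)
    show "inj_on \<sigma> {..<n}" using inj S by (metis inj_onI nat.inject)
    show "\<sigma> x \<in> {..<n}" if "x \<in> {..<n}" for x
      using that permutes_in_image[OF \<tau>, of "Suc x"] S by auto
    show "\<sigma> x = x" if "x \<notin> {..<n}" for x
      using that permutes_not_in[OF \<tau>, of "Suc x"] S by auto
  qed simp
qed

lemma lift_perm_transpose_comp:
  "lift_perm (Transposition.transpose a b \<circ> \<sigma>) = Transposition.transpose (Suc a) (Suc b) \<circ> lift_perm \<sigma>"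
  by (auto simp: fun_eq_iff lift_perm_def Transposition.transpose_def split: nat.splits)

lemma sign_lift_perm:
  assumes "\<sigma> permutes {..<n}"
  shows "sign (lift_perm \<sigma>) = sign \<sigma>"
  using assms finite_lessThan
proof (induction rule: permutes_induct)
  case id
  have "lift_perm id = id" by (auto simp: fun_eq_iff lift_perm_def split: nat.splits)
  then show ?case by (simp only:)
next
  case (swap a b p)
  have "permutation p" "permutation (lift_perm p)"
    using swap lift_perm_permutes by (auto simp: permutation_permutes)
  then show ?case
    unfolding lift_perm_transpose_comp using swap
    by (subst (1 2) sign_compose) (simp_all add: permutation_swap_id sign_swap_id)
qed

lemma cycle_perm_permutes: "p < n \<Longrightarrow> cycle_perm p permutes {..<n}"
  by (rule inj_imp_permutes) (auto simp: inj_on_def cycle_perm_def split: if_splits)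

lemma cycle_perm_Suc: "cycle_perm (Suc p) = cycle_perm p \<circ> Transposition.transpose p (Suc p)"
  by (auto simp: fun_eq_iff cycle_perm_def Transposition.transpose_def)

lemma sign_cycle_perm: "sign (cycle_perm p) = (-1) ^ p"
proof (induction p)
  case 0
  have "cycle_perm 0 = id" by (auto simp: fun_eq_iff cycle_perm_def)
  then show ?case by simp
next
  case (Suc p)
  have "permutation (cycle_perm p)" using cycle_perm_permutes[of p "Suc p"] by (auto simp: permutation_permutes)
  then show ?case unfolding cycle_perm_Suc using Suc
    by (subst sign_compose) (simp_all add: permutation_swap_id sign_swap_id)
qed

lemma shuffles_perm_lift_iff:
  "lift_perm \<sigma> \<in> shuffles_perm (Suc p) q \<longleftrightarrow> \<sigma> \<in> shuffles_perm p q" if "\<sigma> permutes {..<p + q}"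
proof -
  have 1: "strict_mono_on {..<Suc p} (lift_perm \<sigma>) \<longleftrightarrow> strict_mono_on {..<p} \<sigma>"
  proof
    assume *: "strict_mono_on {..<Suc p} (lift_perm \<sigma>)"
    show "strict_mono_on {..<p} \<sigma>"
    proof (rule strict_mono_onI)
      fix r s assume "r \<in> {..<p}" "s \<in> {..<p}" "r < s"
      then show "\<sigma> r < \<sigma> s" using strict_mono_onD[OF *, of "Suc r" "Suc s"] by simp
    qed
  next
    assume *: "strict_mono_on {..<p} \<sigma>"
    show "strict_mono_on {..<Suc p} (lift_perm \<sigma>)"
    proof (rule strict_mono_onI)
      fix r s assume "r \<in> {..<Suc p}" "s \<in> {..<Suc p}" "r < s"
      then show "lift_perm \<sigma> r < lift_perm \<sigma> s"
        using strict_mono_onD[OF *] by (auto simp: lift_perm_def split: nat.splits)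
    qed
  qed
  have 2: "strict_mono_on {Suc p..<Suc p + q} (lift_perm \<sigma>) \<longleftrightarrow> strict_mono_on {p..<p + q} \<sigma>"
  proof
    assume *: "strict_mono_on {Suc p..<Suc p + q} (lift_perm \<sigma>)"
    show "strict_mono_on {p..<p + q} \<sigma>"
    proof (rule strict_mono_onI)
      fix r s assume "r \<in> {p..<p + q}" "s \<in> {p..<p + q}" "r < s"
      then show "\<sigma> r < \<sigma> s" using strict_mono_onD[OF *, of "Suc r" "Suc s"] by simp
    qed
  next
    assume *: "strict_mono_on {p..<p + q} \<sigma>"
    show "strict_mono_on {Suc p..<Suc p + q} (lift_perm \<sigma>)"
    proof (rule strict_mono_onI)
      fix r s assume "r \<in> {Suc p..<Suc p + q}" "s \<in> {Suc p..<Suc p + q}" "r < s"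
      then show "lift_perm \<sigma> r < lift_perm \<sigma> s"
        using strict_mono_onD[OF *] by (auto simp: lift_perm_def split: nat.splits)
    qed
  qed
  show ?thesis unfolding shuffles_perm_def using 1 2 that lift_perm_permutes[OF that] by simp
qed

lemma shuffles_perm_cycle_iff:
  "lift_perm \<sigma> \<circ> cycle_perm p \<in> shuffles_perm p (Suc q) \<longleftrightarrow> \<sigma> \<in> shuffles_perm p q" if \<sigma>: "\<sigma> permutes {..<p + q}"
proof -
  let ?\<tau> = "lift_perm \<sigma> \<circ> cycle_perm p"
  have perm: "?\<tau> permutes {..<p + Suc q}"
    using permutes_compose[OF cycle_perm_permutes[of p "Suc (p + q)"] lift_perm_permutes[OF \<sigma>]] by simp
  have vA: "?\<tau> j = Suc (\<sigma> j)" if "j < p" for j using that by (simp add: cycle_perm_def)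
  have vp: "?\<tau> p = 0" by (simp add: cycle_perm_def)
  have vB: "?\<tau> (Suc j) = Suc (\<sigma> j)" if "p \<le> j" for j using that by (simp add: cycle_perm_def)
  have 1: "strict_mono_on {..<p} ?\<tau> \<longleftrightarrow> strict_mono_on {..<p} \<sigma>"
    by (auto simp: strict_mono_on_def vA simp del: comp_apply)
  have 2: "strict_mono_on {p..<p + Suc q} ?\<tau> \<longleftrightarrow> strict_mono_on {p..<p + q} \<sigma>"
  proof
    assume *: "strict_mono_on {p..<p + Suc q} ?\<tau>"
    show "strict_mono_on {p..<p + q} \<sigma>"
    proof (rule strict_mono_onI)
      fix r s assume "r \<in> {p..<p + q}" "s \<in> {p..<p + q}" "r < s"
      then show "\<sigma> r < \<sigma> s" using strict_mono_onD[OF *, of "Suc r" "Suc s"] vB[of r] vB[of s] by (simp del: comp_apply)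
    qed
  next
    assume *: "strict_mono_on {p..<p + q} \<sigma>"
    show "strict_mono_on {p..<p + Suc q} ?\<tau>"
    proof (rule strict_mono_onI)
      fix r s assume rs: "r \<in> {p..<p + Suc q}" "s \<in> {p..<p + Suc q}" "r < s"
      then obtain s' where s: "s = Suc s'" "p \<le> s'" by (cases s) auto
      show "?\<tau> r < ?\<tau> s"
      proof (cases "r = p")
        case True
        then show ?thesis using vp vB[OF s(2)] s by (simp del: comp_apply)
      next
        case False
        then obtain r' where r: "r = Suc r'" "p \<le> r'" using rs by (cases r) auto
        then show ?thesis using strict_mono_onD[OF *, of r' s'] vB[OF s(2)] vB[OF r(2)] s rs by (simp del: comp_apply)
      qed
    qed
  qed
  show ?thesis unfolding shuffles_perm_def using 1 2 \<sigma> perm by (simp del: comp_apply)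
qed

lemma shuffles_perm_zero [simp]: "shuffles_perm 0 q = {id}" "shuffles_perm p 0 = {id}"
proof -
  have "\<sigma> = id" if "\<sigma> permutes {..<n}" "strict_mono_on {..<n} \<sigma>" for \<sigma> :: "nat \<Rightarrow> nat" and n
    using that
  proof (induction n arbitrary: \<sigma>)
    case 0
    then show ?case by (simp add: lessThan_0)
  next
    case (Suc n)
    have "\<sigma> 0 = 0"
    proof (rule ccontr)
      assume *: "\<sigma> 0 \<noteq> 0"
      have "inv \<sigma> 0 < Suc n" using permutes_in_image[OF permutes_inv[OF Suc.prems(1)], of 0] by simp
      moreover have "\<sigma> (inv \<sigma> 0) = 0" using permutes_inverses[OF Suc.prems(1)] by simp
      ultimately show False
        using * strict_mono_onD[OF Suc.prems(2), of 0 "inv \<sigma> 0"] by (cases "inv \<sigma> 0") auto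
    qed
    then obtain \<tau> where \<tau>: "\<tau> permutes {..<n}" "\<sigma> = lift_perm \<tau>" using lift_perm_exists[OF Suc.prems(1)] by blast
    have "strict_mono_on {..<n} \<tau>"
    proof (rule strict_mono_onI)
      fix r s assume "r \<in> {..<n}" "s \<in> {..<n}" "r < s"
      then show "\<tau> r < \<tau> s" using strict_mono_onD[OF Suc.prems(2), of "Suc r" "Suc s"] \<tau> by simp
    qed
    then have "\<tau> = id" using Suc.IH \<tau> by blast
    then show ?case using \<tau> by (auto simp: fun_eq_iff lift_perm_def split: nat.splits)
  qed
  moreover have "{0..<q} = {..<q}" by auto
  ultimately show "shuffles_perm 0 q = {id}" "shuffles_perm p 0 = {id}"
    by (auto simp: shuffles_perm_def permutes_id strict_mono_on_def)
qed

lemma sum_shuffles_perm_Suc: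
  "sum F (shuffles_perm (Suc p) (Suc q)) =
    (\<Sum>\<sigma>\<in>shuffles_perm p (Suc q). F (lift_perm \<sigma>)) +
    (\<Sum>\<sigma>\<in>shuffles_perm (Suc p) q. F (lift_perm \<sigma> \<circ> cycle_perm (Suc p)))"
proof -
  let ?n = "Suc (p + q)"
  let ?A = "lift_perm ` shuffles_perm p (Suc q)" and ?B = "(\<lambda>\<sigma>. lift_perm \<sigma> \<circ> cycle_perm (Suc p)) ` shuffles_perm (Suc p) q"
  have A0: "\<sigma> 0 = 0" if "\<sigma> \<in> ?A" for \<sigma> using that by auto
  have B0: "\<sigma> (Suc p) = 0" if "\<sigma> \<in> ?B" for \<sigma> using that by (auto simp: cycle_perm_def)
  have perm: "\<sigma> permutes {..<Suc ?n}" if "\<sigma> \<in> shuffles_perm (Suc p) (Suc q)" for \<sigma>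
    using that by (simp add: shuffles_perm_def)
  have eq: "shuffles_perm (Suc p) (Suc q) = ?A \<union> ?B"
  proof (intro equalityI subsetI)
    fix \<sigma> assume \<sigma>: "\<sigma> \<in> shuffles_perm (Suc p) (Suc q)"
    note P = perm[OF \<sigma>]
    let ?j = "inv \<sigma> 0"
    have j: "\<sigma> ?j = 0" "?j < Suc ?n" using permutes_inverses[OF P] permutes_in_image[OF permutes_inv[OF P], of 0] by auto
    have m1: "strict_mono_on {..<Suc p} \<sigma>" and m2: "strict_mono_on {Suc p..<Suc p + Suc q} \<sigma>"
      using \<sigma> by (auto simp: shuffles_perm_def)
    show "\<sigma> \<in> ?A \<union> ?B"
    proof (cases "?j < Suc p")
      case True
      have "?j = 0" using strict_mono_onD[OF m1, of 0 ?j] True j by (cases ?j) auto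
      then have "\<sigma> 0 = 0" using j by simp
      then obtain \<tau> where \<tau>: "\<tau> permutes {..<?n}" "\<sigma> = lift_perm \<tau>" using lift_perm_exists[OF P] by blast
      then have "\<tau> \<in> shuffles_perm p (Suc q)" using \<sigma> shuffles_perm_lift_iff[of \<tau> p "Suc q"] by simp
      then show ?thesis using \<tau> by blast
    next
      case False
      have "?j = Suc p" using strict_mono_onD[OF m2, of "Suc p" ?j] False j by (cases "?j = Suc p") auto
      then have S0: "\<sigma> (Suc p) = 0" using j by simp
      have c: "cycle_perm (Suc p) permutes {..<Suc ?n}" by (rule cycle_perm_permutes) simp
      have "inv (cycle_perm (Suc p)) 0 = Suc p"
        using permutes_inv_eq[OF c] by (simp add: cycle_perm_def)
      then have "(\<sigma> \<circ> inv (cycle_perm (Suc p))) 0 = 0" using S0 by simp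
      then obtain \<tau> where \<tau>: "\<tau> permutes {..<?n}" "\<sigma> \<circ> inv (cycle_perm (Suc p)) = lift_perm \<tau>"
        using lift_perm_exists[OF permutes_compose[OF permutes_inv[OF c] P]] by blast
      have s: "\<sigma> = lift_perm \<tau> \<circ> cycle_perm (Suc p)"
        unfolding \<tau>(2)[symmetric] o_assoc[symmetric] using permutes_inv_o[OF c] by simp
      then have "\<tau> \<in> shuffles_perm (Suc p) q" using \<sigma> shuffles_perm_cycle_iff[of \<tau> "Suc p" q] \<tau> by simp
      then show ?thesis using s by blast
    qed
  next
    fix \<sigma> assume "\<sigma> \<in> ?A \<union> ?B"
    then show "\<sigma> \<in> shuffles_perm (Suc p) (Suc q)"
    proof
      assume "\<sigma> \<in> ?A"
      then obtain \<tau> where "\<tau> \<in> shuffles_perm p (Suc q)" "\<sigma> = lift_perm \<tau>" by blast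
      then show ?thesis using shuffles_perm_lift_iff[of \<tau> p "Suc q"] by (simp add: shuffles_perm_def[of p])
    next
      assume "\<sigma> \<in> ?B"
      then obtain \<tau> where "\<tau> \<in> shuffles_perm (Suc p) q" "\<sigma> = lift_perm \<tau> \<circ> cycle_perm (Suc p)" by blast
      then show ?thesis using shuffles_perm_cycle_iff[of \<tau> "Suc p" q] by (simp add: shuffles_perm_def[of _ q])
    qed
  qed
  have disj: "?A \<inter> ?B = {}"
  proof (rule ccontr)
    assume "?A \<inter> ?B \<noteq> {}"
    then obtain \<sigma> where "\<sigma> \<in> ?A" "\<sigma> \<in> ?B" by blast
    moreover from this have "\<sigma> permutes {..<Suc ?n}" using eq perm by blast
    ultimately have "\<sigma> 0 = \<sigma> (Suc p)" "\<sigma> permutes {..<Suc ?n}" using A0[of \<sigma>] B0[of \<sigma>] by simp_all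
    then show False using permutes_inj by (metis injD nat.distinct(1))
  qed
  have injl: "\<sigma> = \<tau>" if "lift_perm \<sigma> = lift_perm \<tau>" for \<sigma> \<tau>
    using that by (metis lift_perm_simps(2) nat.inject ext)
  have injA: "inj_on lift_perm (shuffles_perm p (Suc q))" using injl by (auto simp: inj_on_def)
  have injB: "inj_on (\<lambda>\<sigma>. lift_perm \<sigma> \<circ> cycle_perm (Suc p)) (shuffles_perm (Suc p) q)"
  proof (rule inj_onI)
    fix \<sigma> \<tau> assume *: "lift_perm \<sigma> \<circ> cycle_perm (Suc p) = lift_perm \<tau> \<circ> cycle_perm (Suc p)"
    have c: "cycle_perm (Suc p) permutes {..<Suc (Suc p)}" by (rule cycle_perm_permutes) simp
    have "lift_perm \<sigma> = lift_perm \<tau>"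
    proof
      fix x
      have "x \<in> range (cycle_perm (Suc p))" using permutes_surj[OF c] by simp
      then obtain y where "x = cycle_perm (Suc p) y" ..
      then show "lift_perm \<sigma> x = lift_perm \<tau> x" using fun_cong[OF *, of y] by simp
    qed
    then show "\<sigma> = \<tau>" by (rule injl)
  qed
  have "sum F (?A \<union> ?B) = sum F ?A + sum F ?B"
    by (rule sum.union_disjoint[OF _ _ disj]) (simp_all add: finite_shuffles_perm)
  then show ?thesis
    unfolding eq sum.reindex[OF injA] sum.reindex[OF injB] by (simp only: comp_def)
qed

lemma permute_list_lift: "permute_list (lift_perm \<sigma>) (v # vs) = v # permute_list \<sigma> vs"
proof (rule nth_equalityI)
  fix j assume "j < length (permute_list (lift_perm \<sigma>) (v # vs))"
  then show "permute_list (lift_perm \<sigma>) (v # vs) ! j = (v # permute_list \<sigma> vs) ! j"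
    by (cases j) (simp_all add: permute_list_def del: upt_Suc)
qed simp

lemma permute_list_cycle:
  assumes "p \<le> length vs"
  shows "permute_list (cycle_perm p) (v # vs) = take p vs @ v # drop p vs"
proof (rule nth_equalityI)
  fix j assume "j < length (permute_list (cycle_perm p) (v # vs))"
  then have j: "j < Suc (length vs)" by simp
  then have "permute_list (cycle_perm p) (v # vs) ! j = (v # vs) ! cycle_perm p j"
    by (simp add: permute_list_def del: upt_Suc)
  also have "\<dots> = (take p vs @ v # drop p vs) ! j"
    using assms j by (auto simp: cycle_perm_def nth_append nth_Cons')
  finally show "permute_list (cycle_perm p) (v # vs) ! j = (take p vs @ v # drop p vs) ! j" .
qed (use assms in simp)

lemma permute_list_cycle_lift:
  assumes "\<sigma> permutes {..<length vs}" "p \<le> length vs"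
  shows "permute_list (lift_perm \<sigma> \<circ> cycle_perm p) (v # vs) =
    take p (permute_list \<sigma> vs) @ v # drop p (permute_list \<sigma> vs)"
  using assms permute_list_cycle[of p "permute_list \<sigma> vs" v] cycle_perm_permutes[of p "Suc (length vs)"]
  by (subst permute_list_compose) (simp_all add: permute_list_lift)

lemma alt_wedge_zero:
  "homogeneous 0 a \<Longrightarrow> alt_wedge 0 q a b vs = (if length vs = q then a [] * b vs else 0)"
  "homogeneous 0 b \<Longrightarrow> alt_wedge p 0 a b vs = (if length vs = p then a vs * b [] else 0)"
  by (simp_all add: alt_wedge_def)

text \<open>The first argument goes either to the first or to the second factor.\<close>

lemma alt_wedge_Cons:
  assumes "length vs = Suc (p + q)"
  shows "alt_wedge (Suc p) (Suc q) a b (v # vs) =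
    alt_wedge p (Suc q) (insert_first v a) b vs - (-1) ^ p * alt_wedge (Suc p) q a (insert_first v b) vs"
proof -
  have perm: "\<sigma> permutes {..<Suc (p + q)}" if "\<sigma> \<in> shuffles_perm p (Suc q) \<or> \<sigma> \<in> shuffles_perm (Suc p) q" for \<sigma>
    using that by (auto simp: shuffles_perm_def)
  define F where "F = (\<lambda>\<sigma>. of_int (sign \<sigma>) * a (take (Suc p) (permute_list \<sigma> (v # vs))) * b (drop (Suc p) (permute_list \<sigma> (v # vs))))"
  have 1: "F (lift_perm \<sigma>) = of_int (sign \<sigma>) * insert_first v a (take p (permute_list \<sigma> vs)) * b (drop p (permute_list \<sigma> vs))"
    if "\<sigma> \<in> shuffles_perm p (Suc q)" for \<sigma>
    using perm[of \<sigma>] that by (simp add: F_def permute_list_lift sign_lift_perm)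
  have 2: "F (lift_perm \<sigma> \<circ> cycle_perm (Suc p)) = - ((-1) ^ p *
      (of_int (sign \<sigma>) * a (take (Suc p) (permute_list \<sigma> vs)) * insert_first v b (drop (Suc p) (permute_list \<sigma> vs))))"
    if "\<sigma> \<in> shuffles_perm (Suc p) q" for \<sigma>
  proof -
    have P: "\<sigma> permutes {..<length vs}" using perm that assms by simp
    have "permutation (lift_perm \<sigma>)" "permutation (cycle_perm (Suc p))"
      using lift_perm_permutes[OF P] cycle_perm_permutes[of "Suc p" "Suc (Suc p)"] by (auto simp: permutation_permutes)
    then have "sign (lift_perm \<sigma> \<circ> cycle_perm (Suc p)) = - ((-1) ^ p * sign \<sigma>)"
      by (simp add: sign_compose sign_cycle_perm sign_lift_perm[OF P])
    moreover have "permute_list (lift_perm \<sigma> \<circ> cycle_perm (Suc p)) (v # vs) =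
        take (Suc p) (permute_list \<sigma> vs) @ v # drop (Suc p) (permute_list \<sigma> vs)"
      using assms by (intro permute_list_cycle_lift P) simp
    ultimately show ?thesis using assms by (simp add: F_def)
  qed
  have "alt_wedge (Suc p) (Suc q) a b (v # vs) = sum F (shuffles_perm (Suc p) (Suc q))"
    using assms by (simp add: alt_wedge_def F_def)
  then show ?thesis
    using assms by (simp add: sum_shuffles_perm_Suc 1 2 alt_wedge_def sum_distrib_left sum_negf)
qed

lemma list_wedge_zero_left: "homogeneous 0 a \<Longrightarrow> list_wedge a b vs = a [] * b vs"
proof (induction vs arbitrary: b)
  case (Cons v vs)
  have "insert_first v a = 0" using Cons.prems by (auto simp: homogeneous_def insert_first_def)
  moreover have "grading_twist a = a" using grading_twist_homogeneous[OF Cons.prems] by simp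
  ultimately show ?case using Cons by simp
qed simp

lemma list_wedge_zero_right: "homogeneous 0 b \<Longrightarrow> list_wedge a b vs = a vs * b []"
proof (induction vs arbitrary: a)
  case (Cons v vs)
  have "insert_first v b = 0" using Cons.prems by (auto simp: homogeneous_def insert_first_def)
  then show ?case using Cons by simp
qed simp

lemma alt_wedge_eq_list_wedge_apply:
  "homogeneous (int p) a \<Longrightarrow> homogeneous (int q) b \<Longrightarrow> length vs = p + q \<Longrightarrow> alt_wedge p q a b vs = list_wedge a b vs"
proof (induction vs arbitrary: p q a b)
  case Nil
  then show ?case by (simp add: alt_wedge_def)
next
  case (Cons v vs)
  show ?case
  proof (cases p)
    case 0
    then show ?thesis using Cons.prems alt_wedge_zero(1)[of a q b "v # vs"] list_wedge_zero_left[of a b "v # vs"] by simp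
  next
    case p: (Suc p')
    show ?thesis
    proof (cases q)
      case 0
      then show ?thesis using Cons.prems alt_wedge_zero(2)[of b p a "v # vs"] list_wedge_zero_right[of b a "v # vs"] by simp
    next
      case q: (Suc q')
      have len: "length vs = Suc (p' + q')" using Cons.prems p q by simp
      have "alt_wedge p' (Suc q') (insert_first v a) b vs = list_wedge (insert_first v a) b vs"
        using homogeneous_insert_first[OF Cons.prems(1), of v] Cons.prems p q
        by (intro Cons.IH) (simp_all del: insert_first_apply)
      moreover have "alt_wedge (Suc p') q' a (insert_first v b) vs = list_wedge a (insert_first v b) vs"
        using homogeneous_insert_first[OF Cons.prems(2), of v] Cons.prems p q
        by (intro Cons.IH) (simp_all del: insert_first_apply)
      moreover have "(-1::real) powi (1 + int p') = - ((-1) ^ p')"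
        using power_int_of_nat[of "-1::real" "Suc p'"] by simp
      ultimately show ?thesis
        using alt_wedge_Cons[OF len, of a b v] grading_twist_homogeneous[OF Cons.prems(1)] p q by simp
    qed
  qed
qed

lemma alt_wedge_eq_list_wedge:
  assumes "homogeneous (int p) a" "homogeneous (int q) b"
  shows "alt_wedge p q a b = list_wedge a b"
proof
  fix vs :: "'a list"
  show "alt_wedge p q a b vs = list_wedge a b vs"
  proof (cases "length vs = p + q")
    case True
    then show ?thesis using alt_wedge_eq_list_wedge_apply assms by blast
  next
    case False
    then have "list_wedge a b vs = 0" using homogeneous_list_wedge_apply[OF assms, of vs] by simp
    then show ?thesis using False by (simp add: alt_wedge_def)
  qed
qed

subsection \<open>Second order operators\<close>

text \<open>Inserting a vector is a derivation of the wedge product, and the composite of two derivations is a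
  differential operator of order \<open>2\<close>.\<close>

definition insert_two :: "'a \<Rightarrow> 'a \<Rightarrow> ('a list \<Rightarrow> real) \<Rightarrow> 'a list \<Rightarrow> real" where
  "insert_two u v a = insert_first u (insert_first v a)"

lemma insert_two_order_two:
  fixes u v :: 'a
  assumes a: "homogeneous p a" and b: "homogeneous q b" and c: "homogeneous r c"
  defines "D \<equiv> insert_two u v"
  shows "D (list_wedge (list_wedge a b) c) =
    list_wedge (D (list_wedge a b)) c
    + (-1) powi (q * r) *\<^sub>R list_wedge (D (list_wedge a c)) b
    + (-1) powi (p * (q + r)) *\<^sub>R list_wedge (D (list_wedge b c)) a
    - list_wedge (list_wedge (D a) b) c
    - (-1) powi (p * q) *\<^sub>R list_wedge (list_wedge (D b) a) c
    - (-1) powi ((p + q) * r) *\<^sub>R list_wedge (list_wedge (D c) a) b"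
proof -
  let ?\<iota> = insert_first
  note hi = homogeneous_insert_first
  have Dh: "homogeneous (k - 2) (D x)" if "homogeneous k x" for k x
    using hi[OF hi[OF that, of v], of u] by (simp add: D_def insert_two_def)
  define B where "B = (\<lambda>x y. list_wedge (grading_twist (?\<iota> v x)) (?\<iota> u y) - list_wedge (grading_twist (?\<iota> u x)) (?\<iota> v y))"
  have D2: "D (list_wedge x y) = list_wedge (D x) y + list_wedge x (D y) + B x y" for x y
    by (simp add: D_def insert_two_def B_def)
  have par: "even k \<Longrightarrow> (-1::real) powi k = 1" "odd k \<Longrightarrow> (-1::real) powi k = -1" for k
    by (simp_all add: minus_one_powi_if)
  have c1: "(-1) powi (p * (q + r)) *\<^sub>R list_wedge (D (list_wedge b c)) a = list_wedge a (D (list_wedge b c))"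
    using list_wedge_commute[OF a Dh[OF homogeneous_list_wedge[OF b c]]]
    by (simp add: minus_one_powi_if)
  have c2: "(-1) powi (p * q) *\<^sub>R list_wedge (D b) a = list_wedge a (D b)"
    using list_wedge_commute[OF a Dh[OF b]] by (simp add: minus_one_powi_if)
  have c3: "(-1) powi ((p + q) * r) *\<^sub>R list_wedge (D c) (list_wedge a b) = list_wedge (list_wedge a b) (D c)"
    using list_wedge_commute[OF homogeneous_list_wedge[OF a b] Dh[OF c]] by (simp add: minus_one_powi_if)
  have c4: "(-1) powi (q * r) *\<^sub>R list_wedge (list_wedge (D a) c) b = list_wedge (list_wedge (D a) b) c"
    using list_wedge_commute[OF b c] by (simp add: list_wedge_assoc)
  have c5: "(-1) powi (q * r) *\<^sub>R list_wedge (D c) b = list_wedge b (D c)"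
    using list_wedge_commute[OF b Dh[OF c]] by (simp add: minus_one_powi_if)
  have c6: "(-1) powi (q * r) *\<^sub>R list_wedge (?\<iota> w c) b = list_wedge (grading_twist b) (?\<iota> w c)" for w
    using list_wedge_commute[OF b hi[OF c, of w]]
    by (simp add: grading_twist_homogeneous[OF b] minus_one_powi_if algebra_simps)
  have c7: "(-1) powi (q * r) *\<^sub>R list_wedge (B a c) b =
    list_wedge (grading_twist (?\<iota> v a)) (list_wedge (grading_twist b) (?\<iota> u c))
    - list_wedge (grading_twist (?\<iota> u a)) (list_wedge (grading_twist b) (?\<iota> v c))"
    by (simp add: B_def list_wedge_assoc scaleR_diff_right flip: c6)
  have BB: "B (list_wedge a b) c = list_wedge a (B b c) + (-1) powi (q * r) *\<^sub>R list_wedge (B a c) b"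
    unfolding c7 by (simp add: B_def list_wedge_assoc)
  have e1: "(-1) powi (q * r) *\<^sub>R list_wedge (D (list_wedge a c)) b =
    list_wedge (list_wedge (D a) b) c + list_wedge (list_wedge a b) (D c) + (-1) powi (q * r) *\<^sub>R list_wedge (B a c) b"
    using c4 c5 by (simp add: D2 scaleR_add_right list_wedge_assoc flip: list_wedge_linear(4))
  have e2: "(-1) powi (p * q) *\<^sub>R list_wedge (list_wedge (D b) a) c = list_wedge a (list_wedge (D b) c)"
  proof -
    have "(-1) powi (p * q) *\<^sub>R list_wedge (list_wedge (D b) a) c = list_wedge ((-1) powi (p * q) *\<^sub>R list_wedge (D b) a) c"
      by (simp only: list_wedge_linear(3))
    then show ?thesis by (simp only: c2 list_wedge_assoc)
  qed
  have e3: "(-1) powi ((p + q) * r) *\<^sub>R list_wedge (list_wedge (D c) a) b = list_wedge (list_wedge a b) (D c)"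
    using c3 by (simp add: list_wedge_assoc)
  show ?thesis
    unfolding c1 e1 e2 e3 D2[of "list_wedge a b" c] BB unfolding D2[of b c]
    by (simp add: list_wedge_assoc algebra_simps)
qed

section \<open>Alternating functions\<close>

lemma alternating_homogeneous: "a \<in> alternating k \<Longrightarrow> homogeneous (int k) a"
  by (auto simp: alternating_def homogeneous_def)

lemma alternating_0_iff: "a \<in> alternating 0 \<longleftrightarrow> homogeneous 0 a"
  by (auto simp: alternating_def homogeneous_def)

lemma alternating_repeat_first:
  assumes "a \<in> alternating k"
  shows "a (v # v # vs) = 0"
proof (cases "k = length vs + 2")
  case True
  have "\<forall>vs i j. length vs = k \<longrightarrow> i < j \<longrightarrow> j < k \<longrightarrow> vs ! i = vs ! j \<longrightarrow> a vs = 0"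
    using assms by (simp add: alternating_def)
  from this[rule_format, of "v # v # vs" 0 "Suc 0"] True show ?thesis by simp
next
  case False
  then show ?thesis using assms by (simp add: alternating_def)
qed

lemma alternating_linear_first:
  assumes "a \<in> alternating k"
  shows "linear (\<lambda>v. a (v # vs))"
proof (cases "k = Suc (length vs)")
  case True
  have "\<forall>vs. \<forall>j<k. length vs = k \<longrightarrow> linear (\<lambda>v. a (vs[j := v]))"
    using assms by (simp add: alternating_def)
  then have "linear (\<lambda>v. a ((undefined # vs)[0 := v]))" using True by (auto simp del: list_update.simps)
  then show ?thesis by simp
next
  case False
  then have "(\<lambda>v. a (v # vs)) = (\<lambda>v. 0)" using assms by (auto simp: alternating_def)
  then show ?thesis by (simp add: linear_zero)
qed

lemma subspace_alternating: "subspace (alternating k)"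
proof (rule subspaceI)
  show "0 \<in> alternating k" by (simp add: alternating_def linear_zero)
next
  fix a b :: "'a list \<Rightarrow> real" assume "a \<in> alternating k" "b \<in> alternating k"
  then show "a + b \<in> alternating k" by (auto simp: alternating_def intro: linear_compose_add)
next
  fix r and a :: "'a list \<Rightarrow> real" assume "a \<in> alternating k"
  then show "r *\<^sub>R a \<in> alternating k" by (auto simp: alternating_def intro: linear_compose_scale_right[where 'a = 'a and 'b = real, unfolded real_scaleR_def])
qed

lemma insert_first_alternating:
  assumes a: "a \<in> alternating (Suc k)"
  shows "insert_first v a \<in> alternating k"
proof -
  have "linear (\<lambda>w. a (v # vs[j := w]))" if "length vs = k" "j < k" for vs j
  proof -
    have "linear (\<lambda>w. a ((v # vs)[Suc j := w]))" using a that unfolding alternating_def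
      by (auto simp del: list_update.simps)
    then show ?thesis by simp
  qed
  moreover have "a (v # vs) = 0" if "length vs = k" "i < j" "j < k" "vs ! i = vs ! j" for vs i j
  proof -
    have "(v # vs) ! Suc i = (v # vs) ! Suc j" "Suc i < Suc j" "Suc j < Suc k" "length (v # vs) = Suc k"
      using that by auto
    then show ?thesis using a unfolding alternating_def by blast
  qed
  ultimately show ?thesis using a by (simp add: alternating_def)
qed

lemma antisymmetric_first:
  fixes a :: "'a::real_vector list \<Rightarrow> real"
  assumes "\<And>vs. linear (\<lambda>v. a (v # vs))" "\<And>u vs. linear (\<lambda>v. a (u # v # vs))" "\<And>v vs. a (v # v # vs) = 0"
  shows "a (v # w # vs) = - a (w # v # vs)"
proof -
  have "0 = a ((v + w) # (v + w) # vs)" using assms(3) by simp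
  also have "\<dots> = a (v # (v + w) # vs) + a (w # (v + w) # vs)"
    by (rule linear_add[OF assms(1)])
  also have "a (v # (v + w) # vs) = a (v # v # vs) + a (v # w # vs)"
    by (rule linear_add[OF assms(2)])
  also have "a (w # (v + w) # vs) = a (w # v # vs) + a (w # w # vs)"
    by (rule linear_add[OF assms(2)])
  finally show ?thesis by (simp add: assms(3))
qed

lemma alternating_swap_first: "a \<in> alternating k \<Longrightarrow> a (v # w # vs) = - a (w # v # vs)"
proof -
  assume a: "a \<in> alternating k"
  show ?thesis
  proof (cases k)
    case 0
    then show ?thesis using a by (simp add: alternating_def)
  next
    case (Suc k')
    then show ?thesis
      using antisymmetric_first[of a v w vs] a alternating_linear_first[OF a] alternating_repeat_first[OF a]
        alternating_linear_first[OF insert_first_alternating[of a k']]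
      by simp
  qed
qed

lemma alternating_move_first:
  "a \<in> alternating k \<Longrightarrow> a (xs @ v # ys) = (-1) ^ length xs * a (v # xs @ ys)"
proof (induction xs arbitrary: a k)
  case (Cons x xs)
  show ?case
  proof (cases k)
    case 0
    then show ?thesis using Cons.prems by (simp add: alternating_def)
  next
    case (Suc k')
    have "a (x # xs @ v # ys) = (-1) ^ length xs * a (x # v # xs @ ys)"
      using Cons.IH[OF insert_first_alternating[of a k']] Cons.prems Suc by simp
    then show ?thesis using alternating_swap_first[OF Cons.prems, of x v "xs @ ys"] by simp
  qed
qed simp

text \<open>It suffices to consider repetitions in the first two arguments: if one of two equal
  arguments is the first one, the other one can be moved next to it; otherwise both are arguments of
  the function in which the first one has been inserted.\<close>

lemma alternating_SucI:
  fixes a :: "'a::real_vector list \<Rightarrow> real"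
  assumes "a [] = 0" and ins: "\<And>v. insert_first v a \<in> alternating k"
    and lin: "\<And>vs. length vs = k \<Longrightarrow> linear (\<lambda>v. a (v # vs))" and rep: "\<And>v vs. a (v # v # vs) = 0"
  shows "a \<in> alternating (Suc k)"
  unfolding alternating_def mem_Collect_eq
proof (intro conjI allI impI)
  have hom: "a (v # vs) = 0" if "length vs \<noteq> k" for v vs
    using ins[of v] that by (simp add: alternating_def)
  then show "a vs = 0" if "length vs \<noteq> Suc k" for vs using that assms(1) by (cases vs) auto
  have lin': "linear (\<lambda>v. a (v # vs))" for vs
    using lin[of vs] hom linear_zero by (cases "length vs = k") auto
  fix vs :: "'a list"
  {
    fix j assume "j < Suc k" "length vs = Suc k"
    then show "linear (\<lambda>v. a (vs[j := v]))"
    proof (cases vs)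
      case (Cons w ws)
      show ?thesis
      proof (cases j)
        case 0
        then show ?thesis using Cons lin' by simp
      next
        case (Suc j')
        then show ?thesis using Cons ins[of w] \<open>j < Suc k\<close> \<open>length vs = Suc k\<close> by (auto simp: alternating_def)
      qed
    qed simp
  next
    fix i j assume *: "length vs = Suc k" "i < j" "j < Suc k" "vs ! i = vs ! j"
    then obtain w ws where vs: "vs = w # ws" by (cases vs) auto
    obtain j' where j: "j = Suc j'" using * by (cases j) auto
    show "a vs = 0"
    proof (cases i)
      case (Suc i')
      then have "length ws = k \<and> i' < j' \<and> j' < k \<and> ws ! i' = ws ! j'" using * vs j by auto
      then have "insert_first w a ws = 0" using ins[of w] unfolding alternating_def by blast
      then show ?thesis using vs by simp
    next
      case 0
      then have "ws = take j' ws @ w # drop (Suc j') ws" using * vs j id_take_nth_drop[of j' ws] by simp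
      then have "insert_first w a ws = insert_first w a (take j' ws @ w # drop (Suc j') ws)" by simp
      also have "\<dots> = 0" by (simp add: alternating_move_first[OF ins] rep del: insert_first_apply) (simp add: rep)
      finally show ?thesis using vs by simp
    qed
  }
qed

lemma insert_first_linear_alternating:
  assumes "a \<in> alternating k"
  shows "insert_first (v + w) a = insert_first v a + insert_first w a" "insert_first (r *\<^sub>R v) a = r *\<^sub>R insert_first v a"
  using linear_add[OF alternating_linear_first[OF assms]] linear_scale[OF alternating_linear_first[OF assms]]
  by (auto simp: fun_eq_iff)

lemma grading_twist_alternating: "a \<in> alternating k \<Longrightarrow> grading_twist a \<in> alternating k"
  by (simp add: grading_twist_homogeneous[OF alternating_homogeneous] subspace_scale[OF subspace_alternating])

text \<open>Inserting a vector turns the product into a sum of products of smaller total degree.\<close>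

lemma list_wedge_alternating:
  "a \<in> alternating p \<Longrightarrow> b \<in> alternating q \<Longrightarrow> list_wedge a b \<in> alternating (p + q)"
proof (induction "p + q" arbitrary: p q a b)
  case 0
  then show ?case using homogeneous_list_wedge[of 0 a 0 b] by (simp add: alternating_0_iff)
next
  case (Suc n)
  have twice: "insert_first v (insert_first v x) = 0" if "x \<in> alternating k" for x v and k
    using alternating_repeat_first[OF that] by (auto simp: insert_first_def)
  have A: "list_wedge (insert_first v a) b \<in> alternating n" for v
  proof (cases p)
    case 0
    then have "insert_first v a = 0" using Suc.prems(1) by (auto simp: alternating_def insert_first_def)
    then show ?thesis by (simp add: subspace_0[OF subspace_alternating])
  next
    case (Suc p')
    then show ?thesis using Suc.hyps Suc.prems insert_first_alternating[of a p'] by auto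
  qed
  have B: "list_wedge (grading_twist a) (insert_first v b) \<in> alternating n" for v
  proof (cases q)
    case 0
    then have "insert_first v b = 0" using Suc.prems(2) by (auto simp: alternating_def insert_first_def)
    then show ?thesis by (simp add: subspace_0[OF subspace_alternating])
  next
    case (Suc q')
    then show ?thesis
      using Suc.hyps(1)[of p q' "grading_twist a"] Suc.hyps(2) Suc.prems insert_first_alternating[of b q'] grading_twist_alternating
      by auto
  qed
  have "list_wedge a b \<in> alternating (Suc n)"
  proof (rule alternating_SucI)
    have "homogeneous (int (Suc n)) (list_wedge a b)"
      using homogeneous_list_wedge[OF alternating_homogeneous[OF Suc.prems(1)] alternating_homogeneous[OF Suc.prems(2)]] Suc.hyps(2) by simp
    then show "list_wedge a b [] = 0" unfolding homogeneous_def by (auto dest: spec[of _ "[]"] simp del: list_wedge.simps)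
    show "insert_first v (list_wedge a b) \<in> alternating n" for v
      unfolding insert_first_list_wedge by (rule subspace_add[OF subspace_alternating A B])
    show "linear (\<lambda>v. list_wedge a b (v # vs))" for vs
      by (rule linearI)
        (simp_all add: insert_first_linear_alternating[OF Suc.prems(1)] insert_first_linear_alternating[OF Suc.prems(2)] algebra_simps)
    show "list_wedge a b (v # v # vs) = 0" for v vs
      by (simp add: twice[OF Suc.prems(1)] twice[OF Suc.prems(2)])
  qed
  then show ?case using Suc.hyps(2) by simp
qed

section \<open>Smooth functions on open subsets of the model space\<close>

lemma frechet_derivative_eqI: "(f has_derivative f') (at x) \<Longrightarrow> frechet_derivative f (at x) = f'"
  using frechet_derivative_at[of f f' x] by simp

lemma has_derivative_frechet: "f differentiable (at x) \<Longrightarrow> (f has_derivative frechet_derivative f (at x)) (at x)"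
  by (simp add: frechet_derivative_works)

lemma differentiable_cong_open:
  assumes "open U" "x \<in> U" "\<And>y. y \<in> U \<Longrightarrow> f y = g y" "f differentiable (at x)"
  shows "g differentiable (at x)"
  using has_derivative_transform_within_open[OF has_derivative_frechet[OF assms(4)] assms(1,2)] assms(3)
  by (auto simp: differentiable_def)

lemma Ck_on_cong:
  assumes "open U" "\<And>x. x \<in> U \<Longrightarrow> f x = g x" "Ck_on k f U"
  shows "Ck_on k g U"
  using assms(2,3)
proof (induction k arbitrary: f g)
  case 0
  then show ?case using continuous_on_cong[of U U f g] by simp
next
  case (Suc k)
  have d: "f differentiable (at x)" if "x \<in> U" for x using Suc.prems(2) that by simp
  show ?case
    unfolding Ck_on.simps
  proof (intro conjI ballI allI)
    show "g differentiable (at x)" if "x \<in> U" for x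
      by (rule differentiable_cong_open[OF assms(1) that Suc.prems(1) d[OF that]])
    fix v
    have "Ck_on k (\<lambda>x. frechet_derivative f (at x) v) U" using Suc.prems(2) by simp
    moreover have "frechet_derivative f (at x) v = frechet_derivative g (at x) v" if "x \<in> U" for x
      by (rule fun_cong[OF frechet_derivative_transform_within_open[OF d[OF that] assms(1) that Suc.prems(1)]])
    ultimately show "Ck_on k (\<lambda>x. frechet_derivative g (at x) v) U" by (rule Suc.IH[rotated])
  qed
qed

lemma Ck_on_SucI:
  assumes "open U" "\<And>x. x \<in> U \<Longrightarrow> (f has_derivative f' x) (at x)" "\<And>v. Ck_on k (\<lambda>x. f' x v) U"
  shows "Ck_on (Suc k) f U"
  unfolding Ck_on.simps
proof (intro conjI ballI allI)
  show "f differentiable (at x)" if "x \<in> U" for x using assms(2)[OF that] by (auto simp: differentiable_def)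
  show "Ck_on k (\<lambda>x. frechet_derivative f (at x) v) U" for v
    by (rule Ck_on_cong[OF assms(1) _ assms(3)[of v]]) (simp add: frechet_derivative_eqI[OF assms(2)])
qed

lemma Ck_on_SucD: "Ck_on (Suc k) f U \<Longrightarrow> Ck_on k f U"
proof (induction k arbitrary: f)
  case 0
  then show ?case
    by (auto simp: intro!: continuous_at_imp_continuous_on differentiable_imp_continuous_within)
qed simp

lemma Ck_on_deriv: "Ck_on (Suc k) f U \<Longrightarrow> x \<in> U \<Longrightarrow> (f has_derivative frechet_derivative f (at x)) (at x)"
  by (auto intro: has_derivative_frechet)

lemma smooth_on_differentiable: "smooth_on f U \<Longrightarrow> x \<in> U \<Longrightarrow> f differentiable (at x)"
  unfolding smooth_on_def by (metis Ck_on.simps(2))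

lemma smooth_on_frechet_derivative: "smooth_on f U \<Longrightarrow> smooth_on (\<lambda>x. frechet_derivative f (at x) v) U"
  unfolding smooth_on_def by (metis Ck_on.simps(2))

lemma smooth_on_cong: "\<lbrakk>open U; \<And>x. x \<in> U \<Longrightarrow> f x = g x; smooth_on f U\<rbrakk> \<Longrightarrow> smooth_on g U"
  unfolding smooth_on_def using Ck_on_cong by blast

lemma Ck_on_const: "open U \<Longrightarrow> Ck_on k (\<lambda>x. c) U"
proof (induction k arbitrary: c)
  case (Suc k)
  then show ?case by (intro Ck_on_SucI[where f' = "\<lambda>x v. 0"]) auto
qed simp

lemma Ck_on_add: "open U \<Longrightarrow> Ck_on k f U \<Longrightarrow> Ck_on k g U \<Longrightarrow> Ck_on k (\<lambda>x. f x + g x) U"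
proof (induction k arbitrary: f g)
  case 0
  then show ?case by (simp add: continuous_on_add)
next
  case (Suc k)
  show ?case
    by (rule Ck_on_SucI[OF Suc.prems(1) has_derivative_add[OF Ck_on_deriv[OF Suc.prems(2)] Ck_on_deriv[OF Suc.prems(3)]]])
      (use Suc in auto)
qed

lemma Ck_on_bounded_linear:
  assumes L: "bounded_linear L"
  shows "open U \<Longrightarrow> Ck_on k f U \<Longrightarrow> Ck_on k (\<lambda>x. L (f x)) U"
proof (induction k arbitrary: f)
  case 0
  then show ?case by (simp add: bounded_linear.continuous_on[OF L])
next
  case (Suc k)
  show ?case
    by (rule Ck_on_SucI[OF Suc.prems(1) bounded_linear.has_derivative[OF L Ck_on_deriv[OF Suc.prems(2)]]])
      (use Suc in auto)
qed

lemma Ck_on_mult: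
  fixes f g :: "'a::real_normed_vector \<Rightarrow> real"
  shows "open U \<Longrightarrow> Ck_on k f U \<Longrightarrow> Ck_on k g U \<Longrightarrow> Ck_on k (\<lambda>x. f x * g x) U"
proof (induction k arbitrary: f g)
  case 0
  then show ?case by (simp add: continuous_on_mult)
next
  case (Suc k)
  show ?case
    by (rule Ck_on_SucI[OF Suc.prems(1) has_derivative_mult[OF Ck_on_deriv[OF Suc.prems(2)] Ck_on_deriv[OF Suc.prems(3)]]])
      (use Suc Ck_on_SucD[OF Suc.prems(2)] Ck_on_SucD[OF Suc.prems(3)] in \<open>auto intro!: Ck_on_add\<close>)
qed

lemma smooth_on_const: "open U \<Longrightarrow> smooth_on (\<lambda>x. c) U"
  and smooth_on_add: "open U \<Longrightarrow> smooth_on f U \<Longrightarrow> smooth_on g U \<Longrightarrow> smooth_on (\<lambda>x. f x + g x) U"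
  by (auto simp: smooth_on_def Ck_on_const Ck_on_add Ck_on_bounded_linear)

lemma smooth_on_mult:
  fixes f g :: "'a::real_normed_vector \<Rightarrow> real"
  shows "open U \<Longrightarrow> smooth_on f U \<Longrightarrow> smooth_on g U \<Longrightarrow> smooth_on (\<lambda>x. f x * g x) U"
  by (auto simp: smooth_on_def Ck_on_mult)

lemma smooth_on_sum: "open U \<Longrightarrow> (\<And>a. a \<in> S \<Longrightarrow> smooth_on (f a) U) \<Longrightarrow> smooth_on (\<lambda>x. \<Sum>a\<in>S. f a x) U"
  by (induction S rule: infinite_finite_induct) (auto simp: smooth_on_const smooth_on_add)

text \<open>Along a segment, a second difference is a mixed second derivative at an intermediate point.\<close>

lemma DERIV_along_line:
  assumes "f differentiable (at (p + s *\<^sub>R v))"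
  shows "((\<lambda>s. f (p + s *\<^sub>R v)) has_real_derivative frechet_derivative f (at (p + s *\<^sub>R v)) v) (at s)"
proof -
  have "((\<lambda>s. p + s *\<^sub>R v) has_derivative (\<lambda>h. h *\<^sub>R v)) (at s)"
    by (auto intro!: derivative_eq_intros)
  then have "((\<lambda>s. f (p + s *\<^sub>R v)) has_derivative (\<lambda>h. frechet_derivative f (at (p + s *\<^sub>R v)) (h *\<^sub>R v))) (at s)"
    by (rule has_derivative_compose[where g = f]) (rule has_derivative_frechet[OF assms])
  then show ?thesis
    unfolding has_field_derivative_def
    using linear_scale[OF linear_frechet_derivative[OF assms]] by (simp add: mult_commute_abs)
qed

lemma second_difference:
  fixes f :: "'a::real_normed_vector \<Rightarrow> real"
  assumes t: "0 < t" and in_U: "\<And>s r. \<lbrakk>0 \<le> s; s \<le> t; 0 \<le> r; r \<le> t\<rbrakk> \<Longrightarrow> x + s *\<^sub>R v + r *\<^sub>R w \<in> U"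
    and f: "Ck_on 2 f U"
  obtains s r where "0 \<le> s" "s \<le> t" "0 \<le> r" "r \<le> t"
    "f (x + t *\<^sub>R v + t *\<^sub>R w) - f (x + t *\<^sub>R v) - f (x + t *\<^sub>R w) + f x =
      t * t * frechet_derivative (\<lambda>y. frechet_derivative f (at y) v) (at (x + s *\<^sub>R v + r *\<^sub>R w)) w"
proof -
  have d1: "f differentiable (at y)" if "y \<in> U" for y
    using f that by (simp add: numeral_2_eq_2)
  have d2: "(\<lambda>y. frechet_derivative f (at y) v) differentiable (at y)" if "y \<in> U" for y
    using f that by (simp add: numeral_2_eq_2)
  have "\<exists>s>0. s < t \<and> (f ((x + t *\<^sub>R w) + t *\<^sub>R v) - f (x + t *\<^sub>R v)) - (f ((x + t *\<^sub>R w) + 0 *\<^sub>R v) - f (x + 0 *\<^sub>R v)) =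
    (t - 0) * (frechet_derivative f (at ((x + t *\<^sub>R w) + s *\<^sub>R v)) v - frechet_derivative f (at (x + s *\<^sub>R v)) v)"
  proof (rule MVT2[OF t])
    fix s assume s: "0 \<le> s" "s \<le> t"
    have "(x + t *\<^sub>R w) + s *\<^sub>R v \<in> U" "x + s *\<^sub>R v \<in> U"
      using in_U[OF s, of t] in_U[OF s, of 0] t by (simp_all add: algebra_simps)
    then show "((\<lambda>s. f ((x + t *\<^sub>R w) + s *\<^sub>R v) - f (x + s *\<^sub>R v)) has_real_derivative
       frechet_derivative f (at ((x + t *\<^sub>R w) + s *\<^sub>R v)) v - frechet_derivative f (at (x + s *\<^sub>R v)) v) (at s)"
      by (intro DERIV_diff DERIV_along_line d1)
  qed
  then obtain s where s: "0 < s" "s < t"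
    "f (x + t *\<^sub>R v + t *\<^sub>R w) - f (x + t *\<^sub>R v) - f (x + t *\<^sub>R w) + f x =
      t * (frechet_derivative f (at (x + s *\<^sub>R v + t *\<^sub>R w)) v - frechet_derivative f (at (x + s *\<^sub>R v)) v)"
    by (auto simp: algebra_simps)
  have "\<exists>r>0. r < t \<and> frechet_derivative f (at ((x + s *\<^sub>R v) + t *\<^sub>R w)) v - frechet_derivative f (at ((x + s *\<^sub>R v) + 0 *\<^sub>R w)) v =
    (t - 0) * frechet_derivative (\<lambda>y. frechet_derivative f (at y) v) (at ((x + s *\<^sub>R v) + r *\<^sub>R w)) w"
    by (rule MVT2[OF t], rule DERIV_along_line[where f = "\<lambda>y. frechet_derivative f (at y) v"], rule d2, rule in_U)
      (use s in auto)
  then obtain r where "0 < r" "r < t" "frechet_derivative f (at (x + s *\<^sub>R v + t *\<^sub>R w)) v - frechet_derivative f (at (x + s *\<^sub>R v)) v =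
    t * frechet_derivative (\<lambda>y. frechet_derivative f (at y) v) (at (x + s *\<^sub>R v + r *\<^sub>R w)) w"
    by auto
  then show thesis using that[of s r] s by simp
qed

text \<open>The second difference of \<open>f\<close> in two directions does not depend on their order. For
  increments of size \<open>t\<close>, it is \<open>t\<^sup>2\<close> times either of the mixed derivatives at a point near \<open>x\<close>.\<close>

lemma second_derivative_symmetric:
  fixes f :: "'a::real_normed_vector \<Rightarrow> real"
  assumes U: "open U" "x \<in> U" and f: "Ck_on 2 f U"
  shows "frechet_derivative (\<lambda>y. frechet_derivative f (at y) v) (at x) w =
    frechet_derivative (\<lambda>y. frechet_derivative f (at y) w) (at x) v"
proof -
  define G where "G = (\<lambda>v w y. frechet_derivative (\<lambda>y. frechet_derivative f (at y) v) (at y) w)"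
  have cont: "continuous_on U (G v w)" for v w
    using f unfolding G_def by (simp add: numeral_2_eq_2)
  have "\<bar>G v w x - G w v x\<bar> \<le> e" if e: "e > 0" for e
  proof -
    have "isCont (G v w) x" "isCont (G w v) x"
      using cont U continuous_on_eq_continuous_at by blast+
    moreover have "e / 2 > 0" using e by simp
    ultimately have "\<exists>d>0. \<forall>y. dist y x < d \<longrightarrow> dist (G v w y) (G v w x) < e / 2"
      "\<exists>d>0. \<forall>y. dist y x < d \<longrightarrow> dist (G w v y) (G w v x) < e / 2"
      unfolding continuous_at_eps_delta dist_norm by blast+
    then obtain d1 d2 where d: "d1 > 0" "\<And>y. dist y x < d1 \<Longrightarrow> dist (G v w y) (G v w x) < e / 2"
      "d2 > 0" "\<And>y. dist y x < d2 \<Longrightarrow> dist (G w v y) (G w v x) < e / 2" by blast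
    obtain d0 where d0: "d0 > 0" "\<And>y. dist y x < d0 \<Longrightarrow> y \<in> U"
      using U by (meson open_dist)
    define \<delta> where "\<delta> = min d0 (min d1 d2)"
    have \<delta>: "\<delta> > 0" using d d0 by (simp add: \<delta>_def)
    \<comment> \<open>small enough for the parallelogram at \<open>x\<close> spanned by \<open>t v\<close> and \<open>t w\<close> to lie in the ball of radius \<open>\<delta>\<close>\<close>
    define t where "t = \<delta> / (2 * (norm v + norm w + 1))"
    have pos: "norm v + norm w + 1 > 0" by (smt (verit) norm_ge_zero)
    have t: "t > 0" using \<delta> pos by (simp add: t_def)
    have near: "dist (x + s *\<^sub>R v + r *\<^sub>R w) x < \<delta>" if "0 \<le> s" "s \<le> t" "0 \<le> r" "r \<le> t" for s r
    proof -
      have "dist (x + s *\<^sub>R v + r *\<^sub>R w) x = norm (s *\<^sub>R v + r *\<^sub>R w)" by (simp add: dist_norm algebra_simps)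
      also have "\<dots> \<le> s * norm v + r * norm w"
        using norm_triangle_ineq[of "s *\<^sub>R v" "r *\<^sub>R w"] that by simp
      also have "\<dots> \<le> t * norm v + t * norm w" using that by (intro add_mono mult_right_mono) auto
      also have "\<dots> \<le> t * (norm v + norm w + 1)" using t by (simp add: algebra_simps)
      also have "\<dots> = \<delta> / 2" using pos by (simp only: t_def) (simp add: field_split_simps)
      also have "\<dots> < \<delta>" using \<delta> by simp
      finally show ?thesis .
    qed
    have near': "dist (x + s *\<^sub>R w + r *\<^sub>R v) x < \<delta>" if "0 \<le> s" "s \<le> t" "0 \<le> r" "r \<le> t" for s r
      using near[OF that(3,4,1,2)] by (simp add: algebra_simps)
    obtain s r where sr: "0 \<le> s" "s \<le> t" "0 \<le> r" "r \<le> t"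
      "f (x + t *\<^sub>R v + t *\<^sub>R w) - f (x + t *\<^sub>R v) - f (x + t *\<^sub>R w) + f x = t * t * G v w (x + s *\<^sub>R v + r *\<^sub>R w)"
      unfolding G_def
      by (rule second_difference[OF t _ f, of x v w]) (use near d0 in \<open>auto simp: \<delta>_def\<close>)
    obtain s' r' where sr': "0 \<le> s'" "s' \<le> t" "0 \<le> r'" "r' \<le> t"
      "f (x + t *\<^sub>R w + t *\<^sub>R v) - f (x + t *\<^sub>R w) - f (x + t *\<^sub>R v) + f x = t * t * G w v (x + s' *\<^sub>R w + r' *\<^sub>R v)"
      unfolding G_def
      by (rule second_difference[OF t _ f, of x w v]) (use near' d0 in \<open>auto simp: \<delta>_def\<close>)
    have "t * t * G v w (x + s *\<^sub>R v + r *\<^sub>R w) = t * t * G w v (x + s' *\<^sub>R w + r' *\<^sub>R v)"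
      unfolding sr(5)[symmetric] sr'(5)[symmetric] by (simp add: algebra_simps)
    then have "G v w (x + s *\<^sub>R v + r *\<^sub>R w) = G w v (x + s' *\<^sub>R w + r' *\<^sub>R v)" using t by simp
    moreover have "dist (G v w (x + s *\<^sub>R v + r *\<^sub>R w)) (G v w x) < e / 2"
      using near[OF sr(1-4)] by (intro d) (simp add: \<delta>_def)
    moreover have "dist (G w v (x + s' *\<^sub>R w + r' *\<^sub>R v)) (G w v x) < e / 2"
      using near'[OF sr'(1-4)] by (intro d) (simp add: \<delta>_def)
    ultimately show ?thesis unfolding dist_real_def by linarith
  qed
  then have "\<bar>G v w x - G w v x\<bar> \<le> 0" by (rule field_le_epsilon) simp
  then show ?thesis by (simp add: G_def)
qed

lemma second_derivative_symmetric_vector: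
  fixes f :: "'a::real_normed_vector \<Rightarrow> 'b::real_inner"
  assumes U: "open U" "x \<in> U" and f: "Ck_on 2 f U"
  shows "frechet_derivative (\<lambda>y. frechet_derivative f (at y) v) (at x) w =
    frechet_derivative (\<lambda>y. frechet_derivative f (at y) w) (at x) v"
proof -
  have "frechet_derivative (\<lambda>y. frechet_derivative f (at y) v) (at x) w \<bullet> z =
    frechet_derivative (\<lambda>y. frechet_derivative f (at y) w) (at x) v \<bullet> z" for z
  proof -
    have L: "bounded_linear (\<lambda>y. y \<bullet> z)" by (rule bounded_linear_inner_left)
    have d1: "f differentiable (at y)" if "y \<in> U" for y
      using f that by (simp add: numeral_2_eq_2)
    have d2: "(\<lambda>y. frechet_derivative f (at y) v) differentiable (at x)" for v
      using f U by (simp add: numeral_2_eq_2)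
    have e1: "frechet_derivative (\<lambda>y. f y \<bullet> z) (at y) v = frechet_derivative f (at y) v \<bullet> z" if "y \<in> U" for y v
      using frechet_derivative_eqI[OF bounded_linear.has_derivative[OF L has_derivative_frechet[OF d1[OF that]]]] by simp
    have e2: "frechet_derivative (\<lambda>y. frechet_derivative f (at y) v \<bullet> z) (at x) w =
      frechet_derivative (\<lambda>y. frechet_derivative f (at y) v) (at x) w \<bullet> z" for v w
      using frechet_derivative_eqI[OF bounded_linear.has_derivative[OF L has_derivative_frechet[OF d2]]] by simp
    have e3: "frechet_derivative (\<lambda>y. frechet_derivative (\<lambda>y. f y \<bullet> z) (at y) v) (at x) =
      frechet_derivative (\<lambda>y. frechet_derivative f (at y) v \<bullet> z) (at x)" for v
      by (rule frechet_derivative_transform_within_open[OF _ U, symmetric])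
        (use e1 bounded_linear_imp_differentiable[OF L] d2 in \<open>auto intro!: differentiable_inner\<close>)
    show ?thesis
      using second_derivative_symmetric[OF U Ck_on_bounded_linear[OF L U(1) f], of v w] by (simp add: e2 e3)
  qed
  then have "(frechet_derivative (\<lambda>y. frechet_derivative f (at y) v) (at x) w -
    frechet_derivative (\<lambda>y. frechet_derivative f (at y) w) (at x) v) \<bullet> z = 0" for z
    by (simp add: inner_diff_left)
  then show ?thesis using inner_eq_zero_iff by (metis eq_iff_diff_eq_0)
qed

section \<open>The exterior differential on a coordinate domain\<close>

definition local_d :: "('e::real_normed_vector \<Rightarrow> 'e list \<Rightarrow> real) \<Rightarrow> 'e \<Rightarrow> 'e list \<Rightarrow> real" where
  "local_d w x vs = (\<Sum>i<length vs. (-1) ^ i *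
     frechet_derivative (\<lambda>y. w y (take i vs @ drop (Suc i) vs)) (at x) (vs ! i))"

definition coeff_deriv :: "'e::real_normed_vector \<Rightarrow> ('e \<Rightarrow> 'b list \<Rightarrow> real) \<Rightarrow> 'e \<Rightarrow> 'b list \<Rightarrow> real" where
  "coeff_deriv v w x vs = frechet_derivative (\<lambda>y. w y vs) (at x) v"

definition coeff_differentiable :: "('e::real_normed_vector \<Rightarrow> 'b list \<Rightarrow> real) \<Rightarrow> 'e \<Rightarrow> bool" where
  "coeff_differentiable w x \<longleftrightarrow> (\<forall>vs. (\<lambda>y. w y vs) differentiable (at x))"

definition coeff_smooth :: "('e::real_normed_vector \<Rightarrow> 'b list \<Rightarrow> real) \<Rightarrow> 'e set \<Rightarrow> bool" where
  "coeff_smooth w U \<longleftrightarrow> (\<forall>vs. smooth_on (\<lambda>y. w y vs) U)"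

lemma coeff_smooth_differentiable: "coeff_smooth w U \<Longrightarrow> x \<in> U \<Longrightarrow> coeff_differentiable w x"
  unfolding coeff_smooth_def coeff_differentiable_def using smooth_on_differentiable by blast

lemma has_derivative_coeff:
  "coeff_differentiable w x \<Longrightarrow> ((\<lambda>y. w y vs) has_derivative (\<lambda>v. coeff_deriv v w x vs)) (at x)"
  by (simp add: coeff_differentiable_def coeff_deriv_def has_derivative_frechet)

lemma coeff_derivI: "((\<lambda>y. w y vs) has_derivative f') (at x) \<Longrightarrow> coeff_deriv v w x vs = f' v"
  by (simp add: coeff_deriv_def frechet_derivative_eqI)

lemma local_d_Nil [simp]: "local_d w x [] = 0"
  by (simp add: local_d_def)

text \<open>For a constant vector field \<open>v\<close> this is the formula \<open>L\<^sub>v = \<iota>\<^sub>v d + d \<iota>\<^sub>v\<close>. Together with the value on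
  the empty list it determines \<open>d\<close>, and it is what all identities for \<open>d\<close> are derived from.\<close>

lemma local_d_Cons:
  "local_d w x (v # vs) = coeff_deriv v w x vs - local_d (\<lambda>y. insert_first v (w y)) x vs"
  by (simp add: local_d_def coeff_deriv_def sum.lessThan_Suc_shift sum_negf del: sum.lessThan_Suc)

lemma insert_first_local_d:
  "insert_first v (local_d w x) = coeff_deriv v w x - local_d (\<lambda>y. insert_first v (w y)) x"
  by (auto simp: local_d_Cons)

lemma coeff_deriv_insert_first: "coeff_deriv v (\<lambda>y. insert_first u (w y)) x vs = coeff_deriv v w x (u # vs)"
  by (simp add: coeff_deriv_def)

lemma coeff_differentiable_insert_first: "coeff_differentiable w x \<Longrightarrow> coeff_differentiable (\<lambda>y. insert_first v (w y)) x"
  by (simp add: coeff_differentiable_def)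

lemma coeff_differentiable_grading_twist: "coeff_differentiable w x \<Longrightarrow> coeff_differentiable (\<lambda>y. grading_twist (w y)) x"
  by (simp add: coeff_differentiable_def grading_twist_def differentiable_mult)

lemma coeff_differentiable_linear:
  "coeff_differentiable w x \<Longrightarrow> coeff_differentiable w' x \<Longrightarrow> coeff_differentiable (\<lambda>y. w y + w' y) x"
  "coeff_differentiable w x \<Longrightarrow> coeff_differentiable w' x \<Longrightarrow> coeff_differentiable (\<lambda>y. w y - w' y) x"
  "coeff_differentiable w x \<Longrightarrow> coeff_differentiable (\<lambda>y. r *\<^sub>R w y) x"
  by (simp_all add: coeff_differentiable_def differentiable_mult)

lemma coeff_deriv_linear:
  assumes "coeff_differentiable w x" "coeff_differentiable w' x"
  shows "coeff_deriv v (\<lambda>y. w y + w' y) x = coeff_deriv v w x + coeff_deriv v w' x"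
    and "coeff_deriv v (\<lambda>y. w y - w' y) x = coeff_deriv v w x - coeff_deriv v w' x"
    and "coeff_deriv v (\<lambda>y. r *\<^sub>R w y) x = r *\<^sub>R coeff_deriv v w x"
proof -
  note d = has_derivative_coeff[OF assms(1)] has_derivative_coeff[OF assms(2)]
  have "((\<lambda>y. (w y + w' y) vs) has_derivative (\<lambda>v. coeff_deriv v w x vs + coeff_deriv v w' x vs)) (at x)" for vs
    using has_derivative_add[OF d(1)[of vs] d(2)[of vs]] by simp
  from coeff_derivI[where w = "\<lambda>y. w y + w' y", OF this] show "coeff_deriv v (\<lambda>y. w y + w' y) x = coeff_deriv v w x + coeff_deriv v w' x"
    by (intro ext) simp
  have "((\<lambda>y. (w y - w' y) vs) has_derivative (\<lambda>v. coeff_deriv v w x vs - coeff_deriv v w' x vs)) (at x)" for vs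
    using has_derivative_diff[OF d(1)[of vs] d(2)[of vs]] by simp
  from coeff_derivI[where w = "\<lambda>y. w y - w' y", OF this] show "coeff_deriv v (\<lambda>y. w y - w' y) x = coeff_deriv v w x - coeff_deriv v w' x"
    by (intro ext) simp
  have "((\<lambda>y. (r *\<^sub>R w y) vs) has_derivative (\<lambda>v. r * coeff_deriv v w x vs)) (at x)" for vs
    using has_derivative_mult_right[OF d(1)[of vs], of r] by simp
  from coeff_derivI[where w = "\<lambda>y. r *\<^sub>R w y", OF this] show "coeff_deriv v (\<lambda>y. r *\<^sub>R w y) x = r *\<^sub>R coeff_deriv v w x"
    by (intro ext) simp
qed

lemma coeff_deriv_grading_twist:
  assumes "coeff_differentiable w x"
  shows "coeff_deriv v (\<lambda>y. grading_twist (w y)) x = grading_twist (coeff_deriv v w x)"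
proof
  fix vs
  show "coeff_deriv v (\<lambda>y. grading_twist (w y)) x vs = grading_twist (coeff_deriv v w x) vs"
    unfolding grading_twist_def
    by (rule coeff_derivI) (rule has_derivative_mult_right[OF has_derivative_coeff[OF assms]])
qed

lemma local_d_eq: "local_d w x vs = (\<Sum>i<length vs. (-1) ^ i * coeff_deriv (vs ! i) w x (take i vs @ drop (Suc i) vs))"
  by (simp add: local_d_def coeff_deriv_def)

lemma local_d_linear:
  assumes "coeff_differentiable w x" "coeff_differentiable w' x"
  shows "local_d (\<lambda>y. w y + w' y) x = local_d w x + local_d w' x"
    and "local_d (\<lambda>y. w y - w' y) x = local_d w x - local_d w' x"
    and "local_d (\<lambda>y. r *\<^sub>R w y) x = r *\<^sub>R local_d w x"
  by (auto simp: fun_eq_iff local_d_eq coeff_deriv_linear[OF assms] sum.distrib sum_subtractf sum_distrib_left algebra_simps)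

lemma local_d_cong:
  assumes "open U" "x \<in> U" "\<And>y. y \<in> U \<Longrightarrow> w y = w' y" "coeff_differentiable w x"
  shows "local_d w x = local_d w' x"
proof -
  have "coeff_deriv v w x vs = coeff_deriv v w' x vs" for v vs
    unfolding coeff_deriv_def
    by (rule fun_cong[OF frechet_derivative_transform_within_open[OF _ assms(1,2)]])
      (use assms in \<open>auto simp: coeff_differentiable_def\<close>)
  then show ?thesis by (simp add: fun_eq_iff local_d_eq)
qed

lemma local_d_grading_twist:
  assumes "coeff_differentiable w x"
  shows "local_d (\<lambda>y. grading_twist (w y)) x = - grading_twist (local_d w x)"
proof
  fix vs :: "'a list"
  have tw: "grading_twist f (take i vs @ drop (Suc i) vs) = - ((-1) ^ length vs * f (take i vs @ drop (Suc i) vs))"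
    if "i < length vs" for i and f :: "'a list \<Rightarrow> real"
    using that by (cases "length vs") (auto simp: grading_twist_def)
  have "local_d (\<lambda>y. grading_twist (w y)) x vs =
    (\<Sum>i<length vs. - ((-1) ^ length vs * ((-1) ^ i * coeff_deriv (vs ! i) w x (take i vs @ drop (Suc i) vs))))"
    unfolding local_d_eq coeff_deriv_grading_twist[OF assms] by (rule sum.cong) (simp_all add: tw)
  also have "\<dots> = (- grading_twist (local_d w x)) vs"
    by (simp add: grading_twist_def local_d_eq sum_negf sum_distrib_left)
  finally show "local_d (\<lambda>y. grading_twist (w y)) x vs = (- grading_twist (local_d w x)) vs" .
qed

lemma coeff_differentiable_list_wedge:
  assumes "coeff_differentiable w x" "coeff_differentiable w' x"
  shows "coeff_differentiable (\<lambda>y. list_wedge (w y) (w' y)) x"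
proof -
  have "(\<lambda>y. list_wedge (w y) (w' y) vs) differentiable (at x)"
    if "coeff_differentiable w x" "coeff_differentiable w' x" for vs and w w' :: "'a \<Rightarrow> 'b list \<Rightarrow> real"
    using that
  proof (induction vs arbitrary: w w')
    case Nil
    then show ?case by (simp add: coeff_differentiable_def differentiable_mult)
  next
    case (Cons v vs)
    show ?case
      unfolding list_wedge.simps
      by (intro differentiable_add Cons.IH coeff_differentiable_insert_first coeff_differentiable_grading_twist Cons.prems)
  qed
  then show ?thesis using assms by (simp add: coeff_differentiable_def)
qed

lemma coeff_deriv_list_wedge_apply:
  "coeff_differentiable w x \<Longrightarrow> coeff_differentiable w' x \<Longrightarrow>
    coeff_deriv v (\<lambda>y. list_wedge (w y) (w' y)) x vs =
      list_wedge (coeff_deriv v w x) (w' x) vs + list_wedge (w x) (coeff_deriv v w' x) vs"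
proof (induction vs arbitrary: w w')
  case Nil
  have "((\<lambda>y. list_wedge (w y) (w' y) []) has_derivative
     (\<lambda>v. w x [] * coeff_deriv v w' x [] + coeff_deriv v w x [] * w' x [])) (at x)"
    unfolding list_wedge.simps
    by (rule has_derivative_mult[OF has_derivative_coeff[OF Nil(1)] has_derivative_coeff[OF Nil(2)]])
  from coeff_derivI[where w = "\<lambda>y. list_wedge (w y) (w' y)", OF this] show ?case by simp
next
  case (Cons u vs)
  note d = coeff_differentiable_insert_first[OF Cons.prems(1), of u] coeff_differentiable_insert_first[OF Cons.prems(2), of u]
    coeff_differentiable_grading_twist[OF Cons.prems(1)]
  have ins: "coeff_deriv v (\<lambda>y. insert_first u (w y)) x = insert_first u (coeff_deriv v w x)" for w :: "'a \<Rightarrow> 'b list \<Rightarrow> real"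
    by (auto simp: coeff_deriv_insert_first)
  have "((\<lambda>y. list_wedge (w y) (w' y) (u # vs)) has_derivative (\<lambda>v.
     coeff_deriv v (\<lambda>y. list_wedge (insert_first u (w y)) (w' y)) x vs +
     coeff_deriv v (\<lambda>y. list_wedge (grading_twist (w y)) (insert_first u (w' y))) x vs)) (at x)"
    unfolding list_wedge.simps
    by (intro has_derivative_add has_derivative_coeff coeff_differentiable_list_wedge d Cons.prems)
  then have "coeff_deriv v (\<lambda>y. list_wedge (w y) (w' y)) x (u # vs) =
     coeff_deriv v (\<lambda>y. list_wedge (insert_first u (w y)) (w' y)) x vs +
     coeff_deriv v (\<lambda>y. list_wedge (grading_twist (w y)) (insert_first u (w' y))) x vs"
    by (rule coeff_derivI)
  then show ?case
    unfolding Cons.IH[OF d(1) Cons.prems(2)] Cons.IH[OF d(3) d(2)] ins coeff_deriv_grading_twist[OF Cons.prems(1)]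
    by simp
qed

lemma coeff_deriv_list_wedge:
  "coeff_differentiable w x \<Longrightarrow> coeff_differentiable w' x \<Longrightarrow>
    coeff_deriv v (\<lambda>y. list_wedge (w y) (w' y)) x =
      list_wedge (coeff_deriv v w x) (w' x) + list_wedge (w x) (coeff_deriv v w' x)"
  by (rule ext) (simp add: coeff_deriv_list_wedge_apply)

text \<open>Inserting a vector on both sides yields a Leibniz rule in lower degree, by \<open>local_d_Cons\<close>.\<close>

lemma local_d_list_wedge_apply:
  "coeff_differentiable w x \<Longrightarrow> coeff_differentiable w' x \<Longrightarrow>
    local_d (\<lambda>y. list_wedge (w y) (w' y)) x vs =
      list_wedge (local_d w x) (w' x) vs + list_wedge (grading_twist (w x)) (local_d w' x) vs"
proof (induction vs arbitrary: w w')
  case Nil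
  then show ?case by simp
next
  case (Cons v vs)
  note d = coeff_differentiable_insert_first[OF Cons.prems(1), of v] coeff_differentiable_insert_first[OF Cons.prems(2), of v]
    coeff_differentiable_grading_twist[OF Cons.prems(1)]
  have "local_d (\<lambda>y. list_wedge (w y) (w' y)) x (v # vs) = coeff_deriv v (\<lambda>y. list_wedge (w y) (w' y)) x vs
     - (local_d (\<lambda>y. list_wedge (insert_first v (w y)) (w' y)) x vs
        + local_d (\<lambda>y. list_wedge (grading_twist (w y)) (insert_first v (w' y))) x vs)"
    unfolding local_d_Cons insert_first_list_wedge
      local_d_linear(1)[OF coeff_differentiable_list_wedge[OF d(1) Cons.prems(2)] coeff_differentiable_list_wedge[OF d(3) d(2)]]
    by simp
  also have "\<dots> = (insert_first v (list_wedge (local_d w x) (w' x)) + insert_first v (list_wedge (grading_twist (w x)) (local_d w' x))) vs"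
    unfolding Cons.IH[OF d(1) Cons.prems(2)] Cons.IH[OF d(3) d(2)] coeff_deriv_list_wedge[OF Cons.prems]
      insert_first_list_wedge insert_first_twist insert_first_local_d local_d_grading_twist[OF Cons.prems(1)]
    by (simp del: insert_first_apply)
  finally show ?case by (simp only: plus_fun_apply insert_first_apply)
qed

lemma local_d_list_wedge:
  "coeff_differentiable w x \<Longrightarrow> coeff_differentiable w' x \<Longrightarrow>
    local_d (\<lambda>y. list_wedge (w y) (w' y)) x =
      list_wedge (local_d w x) (w' x) + list_wedge (grading_twist (w x)) (local_d w' x)"
  by (rule ext) (simp add: local_d_list_wedge_apply)

lemma coeff_smooth_coeff_deriv: "coeff_smooth w U \<Longrightarrow> coeff_smooth (coeff_deriv v w) U"
  unfolding coeff_smooth_def coeff_deriv_def using smooth_on_frechet_derivative by blast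

lemma coeff_smooth_insert_first: "coeff_smooth w U \<Longrightarrow> coeff_smooth (\<lambda>y. insert_first v (w y)) U"
  by (simp add: coeff_smooth_def)

lemma coeff_smooth_local_d:
  assumes "open U" "coeff_smooth w U"
  shows "coeff_smooth (local_d w) U"
proof -
  have "smooth_on (\<lambda>y. coeff_deriv v w y vs) U" for v vs
    using coeff_smooth_coeff_deriv[OF assms(2)] by (simp add: coeff_smooth_def)
  then show ?thesis
    unfolding coeff_smooth_def local_d_eq using assms(1)
    by (auto intro!: smooth_on_sum smooth_on_mult smooth_on_const)
qed

lemma coeff_smooth_list_wedge:
  assumes U: "open U" and "coeff_smooth w U" "coeff_smooth w' U"
  shows "coeff_smooth (\<lambda>y. list_wedge (w y) (w' y)) U"
proof -
  have "smooth_on (\<lambda>y. list_wedge (w y) (w' y) vs) U" if "coeff_smooth w U" "coeff_smooth w' U"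
    for vs and w w' :: "'a \<Rightarrow> 'b list \<Rightarrow> real"
    using that
  proof (induction vs arbitrary: w w')
    case Nil
    then show ?case by (simp add: coeff_smooth_def smooth_on_mult U)
  next
    case (Cons v vs)
    have "coeff_smooth (\<lambda>y. grading_twist (w y)) U"
      using Cons.prems by (simp add: coeff_smooth_def grading_twist_def smooth_on_mult smooth_on_const U)
    then show ?case
      unfolding list_wedge.simps
      by (intro smooth_on_add U Cons.IH coeff_smooth_insert_first Cons.prems)
  qed
  then show ?thesis using assms by (simp add: coeff_smooth_def)
qed

text \<open>By \<open>local_d_Cons\<close>, this amounts to \<open>d\<close> commuting with derivatives of the coefficients in
  constant directions, and thus to the symmetry of second derivatives.\<close>

lemma local_d_local_d:
  assumes U: "open U" "x \<in> U"
  shows "coeff_smooth w U \<Longrightarrow> local_d (local_d w) x vs = 0"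
proof (induction vs arbitrary: w)
  case Nil
  then show ?case by simp
next
  case (Cons v vs)
  note diff = coeff_smooth_differentiable[OF _ U(2)]
  have d1: "coeff_differentiable (coeff_deriv v w) x"
    by (intro diff coeff_smooth_coeff_deriv Cons.prems)
  have d2: "coeff_differentiable (local_d (\<lambda>y. insert_first v (w y))) x"
    by (intro diff coeff_smooth_local_d coeff_smooth_insert_first U Cons.prems)
  have second: "coeff_deriv v (coeff_deriv u w) x us = coeff_deriv u (coeff_deriv v w) x us" for u us
    unfolding coeff_deriv_def
    by (rule second_derivative_symmetric[OF U]) (use Cons.prems in \<open>simp add: coeff_smooth_def smooth_on_def\<close>)
  have c1: "coeff_differentiable (coeff_deriv u w) x" for u
    by (intro diff coeff_smooth_coeff_deriv Cons.prems)
  have "((\<lambda>y. local_d w y vs) has_derivative (\<lambda>v. \<Sum>i<length vs. (-1) ^ i *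
     coeff_deriv v (coeff_deriv (vs ! i) w) x (take i vs @ drop (Suc i) vs))) (at x)"
    unfolding local_d_eq
    by (intro has_derivative_sum has_derivative_mult_right has_derivative_coeff c1)
  then have comm: "coeff_deriv v (local_d w) x vs = local_d (coeff_deriv v w) x vs"
    using coeff_derivI[of "local_d w" vs] by (simp add: local_d_eq second)
  have "local_d (local_d w) x (v # vs) = coeff_deriv v (local_d w) x vs
     - local_d (\<lambda>y. coeff_deriv v w y - local_d (\<lambda>y. insert_first v (w y)) y) x vs"
    by (simp only: local_d_Cons insert_first_local_d)
  also have "\<dots> = local_d (local_d (\<lambda>y. insert_first v (w y))) x vs"
    unfolding comm local_d_linear(2)[OF d1 d2] by simp
  also have "\<dots> = 0" by (rule Cons.IH) (rule coeff_smooth_insert_first[OF Cons.prems])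
  finally show ?case .
qed

lemma coeff_deriv_add_vector:
  assumes "coeff_differentiable w x"
  shows "coeff_deriv (u + v) w x vs = coeff_deriv u w x vs + coeff_deriv v w x vs"
    and "coeff_deriv (r *\<^sub>R u) w x vs = r * coeff_deriv u w x vs"
  using has_derivative_linear[OF has_derivative_coeff[OF assms, of vs]] by (auto dest: linear_add linear_scale)

lemma coeff_deriv_alternating:
  assumes w: "\<And>y. w y \<in> alternating k" and d: "coeff_differentiable w x"
  shows "coeff_deriv v w x \<in> alternating k"
proof -
  have z: "coeff_deriv v w x vs = 0" if "\<And>y. w y vs = 0" for vs using that by (simp add: coeff_deriv_def)
  have lin: "linear (\<lambda>u. coeff_deriv v w x (vs[j := u]))" if "length vs = k" "j < k" for vs j
  proof (rule linearI)
    have l: "linear (\<lambda>u. w y (vs[j := u]))" for y using w that by (simp add: alternating_def)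
    have D: "((\<lambda>y. w y (vs[j := u])) has_derivative (\<lambda>v. coeff_deriv v w x (vs[j := u]))) (at x)" for u
      by (rule has_derivative_coeff[OF d])
    show "coeff_deriv v w x (vs[j := a + b]) = coeff_deriv v w x (vs[j := a]) + coeff_deriv v w x (vs[j := b])" for a b
      by (rule coeff_derivI) (use has_derivative_add[OF D[of a] D[of b]] in \<open>simp add: linear_add[OF l]\<close>)
    show "coeff_deriv v w x (vs[j := r *\<^sub>R a]) = r *\<^sub>R coeff_deriv v w x (vs[j := a])" for r a
      by (rule coeff_derivI) (use has_derivative_mult_right[OF D[of a], of r] in \<open>simp add: linear_scale[OF l]\<close>)
  qed
  show ?thesis
    unfolding alternating_def mem_Collect_eq
  proof (intro conjI allI impI)
    show "coeff_deriv v w x vs = 0" if "length vs \<noteq> k" for vs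
      by (rule z) (use w that in \<open>simp add: alternating_def\<close>)
    show "coeff_deriv v w x vs = 0" if "length vs = k" "i < j" "j < k" "vs ! i = vs ! j" for vs i j
      by (rule z) (use w that in \<open>unfold alternating_def, blast\<close>)
  qed (rule lin)
qed

lemma local_d_zero: "local_d (\<lambda>y. 0) x = 0"
  by (auto simp: local_d_eq coeff_deriv_def)

lemma local_d_alternating:
  "\<lbrakk>\<And>y. w y \<in> alternating k; coeff_differentiable w x\<rbrakk> \<Longrightarrow> local_d w x \<in> alternating (Suc k)"
proof (induction k arbitrary: w)
  have step: "local_d w x \<in> alternating (Suc k)"
    if w: "\<And>y. w y \<in> alternating k" and d: "coeff_differentiable w x"
      and ins: "\<And>v. local_d (\<lambda>y. insert_first v (w y)) x \<in> alternating k" for w k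
  proof (rule alternating_SucI)
    show "insert_first v (local_d w x) \<in> alternating k" for v
      unfolding insert_first_local_d
      by (rule subspace_diff[OF subspace_alternating coeff_deriv_alternating[OF w d] ins])
    show "linear (\<lambda>v. local_d w x (v # vs))" for vs
    proof (rule linearI)
      note di = coeff_differentiable_insert_first[OF d]
      show "local_d w x ((u + v) # vs) = local_d w x (u # vs) + local_d w x (v # vs)" for u v
        unfolding local_d_Cons insert_first_linear_alternating[OF w] local_d_linear(1)[OF di di]
          coeff_deriv_add_vector[OF d] by simp
      show "local_d w x ((r *\<^sub>R u) # vs) = r *\<^sub>R local_d w x (u # vs)" for r u
        unfolding local_d_Cons insert_first_linear_alternating[OF w] local_d_linear(3)[OF di di]
          coeff_deriv_add_vector[OF d] by (simp add: algebra_simps)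
    qed
    show "local_d w x (v # v # vs) = 0" for v vs
    proof -
      have "insert_first v (insert_first v (w y)) = 0" for y
        using alternating_repeat_first[OF w] by (auto simp: insert_first_def)
      then show ?thesis by (simp add: local_d_Cons coeff_deriv_insert_first local_d_zero del: insert_first_apply)
    qed
  qed simp
  {
    case 0
    have "insert_first v (w y) = 0" for v y using 0(1)[of y] by (auto simp: alternating_def)
    then show ?case by (intro step 0) (simp add: local_d_zero subspace_0[OF subspace_alternating])
  next
    case (Suc k)
    show ?case
      by (intro step Suc insert_first_alternating coeff_differentiable_insert_first)
  }
qed

section \<open>Contraction with a bivector\<close>

text \<open>Functions as forms of degree \<open>0\<close>: products with functions and differentials of functions
  become special cases of \<open>list_wedge\<close> and \<open>local_d\<close>.\<close>

definition scalar_form :: "('e \<Rightarrow> real) \<Rightarrow> 'e \<Rightarrow> 'b list \<Rightarrow> real" where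
  "scalar_form f y vs = (if vs = [] then f y else 0)"

lemma list_wedge_scalar_form: "list_wedge (scalar_form f y) a = f y *\<^sub>R a"
proof
  fix vs
  have "homogeneous 0 (scalar_form f y)" by (auto simp: homogeneous_def scalar_form_def)
  from list_wedge_zero_left[OF this] show "list_wedge (scalar_form f y) a vs = (f y *\<^sub>R a) vs"
    by (simp add: scalar_form_def)
qed

lemma coeff_differentiable_scalar_form:
  assumes "f differentiable (at x)"
  shows "coeff_differentiable (scalar_form f) x"
  unfolding coeff_differentiable_def
proof
  fix vs
  show "(\<lambda>y. scalar_form f y vs) differentiable (at x)"
    using assms by (cases vs) (simp_all add: scalar_form_def)
qed

lemma grading_twist_scalar_form: "grading_twist (scalar_form f x) = scalar_form f x"
  by (auto simp: grading_twist_def scalar_form_def)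

lemma insert_first_d_scalar_form:
  "insert_first v (local_d (scalar_form f) x) = scalar_form (\<lambda>x. frechet_derivative f (at x) v) x"
proof
  fix vs
  have "(\<lambda>y. insert_first v (scalar_form f y)) = (\<lambda>y. 0)"
    by (auto simp: fun_eq_iff scalar_form_def)
  then show "insert_first v (local_d (scalar_form f) x) vs = scalar_form (\<lambda>x. frechet_derivative f (at x) v) x vs"
    unfolding insert_first_local_d by (simp add: local_d_zero coeff_deriv_def scalar_form_def)
qed

lemma grading_twist_d_scalar_form: "grading_twist (local_d (scalar_form f) x) = - local_d (scalar_form f) x"
proof
  fix vs
  have "insert_first v (grading_twist (local_d (scalar_form f) x)) = - scalar_form (\<lambda>x. frechet_derivative f (at x) v) x" for v
    by (simp add: insert_first_d_scalar_form del: insert_first_apply)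
      (auto simp: grading_twist_def scalar_form_def)
  then have "insert_first v (grading_twist (local_d (scalar_form f) x)) = insert_first v (- local_d (scalar_form f) x)" for v
    by (simp add: insert_first_d_scalar_form del: insert_first_apply)
  then show "grading_twist (local_d (scalar_form f) x) vs = (- local_d (scalar_form f) x) vs"
    by (cases vs) (auto simp: grading_twist_def fun_eq_iff)
qed

text \<open>The exterior product with \<open>df\<close>.\<close>

definition grad_wedge :: "('e::real_normed_vector \<Rightarrow> real) \<Rightarrow> 'e \<Rightarrow> ('e list \<Rightarrow> real) \<Rightarrow> 'e list \<Rightarrow> real" where
  "grad_wedge f x a = list_wedge (local_d (scalar_form f) x) a"

lemma grad_wedge_Cons:
  "grad_wedge f x a (v # vs) = frechet_derivative f (at x) v * a vs - grad_wedge f x (insert_first v a) vs"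
  unfolding grad_wedge_def list_wedge.simps insert_first_d_scalar_form list_wedge_scalar_form grading_twist_d_scalar_form
  by simp

lemma grad_wedge_linear:
  "grad_wedge f x (a + b) = grad_wedge f x a + grad_wedge f x b"
  "grad_wedge f x (r *\<^sub>R a) = r *\<^sub>R grad_wedge f x a"
  "grad_wedge f x 0 = 0"
  by (simp_all add: grad_wedge_def)

lemma grad_wedge_sum: "grad_wedge f x (\<Sum>p\<in>S. F p) = (\<Sum>p\<in>S. grad_wedge f x (F p))"
  by (induction S rule: infinite_finite_induct) (simp_all only: simp_thms sum.infinite sum.empty sum.insert grad_wedge_linear)

lemma local_d_function_mult:
  assumes "f differentiable (at x)" "coeff_differentiable w x"
  shows "local_d (\<lambda>y. f y *\<^sub>R w y) x = grad_wedge f x (w x) + f x *\<^sub>R local_d w x"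
  using local_d_list_wedge[OF coeff_differentiable_scalar_form[OF assms(1)] assms(2)]
  by (simp add: grading_twist_scalar_form list_wedge_scalar_form grad_wedge_def)

lemma coeff_deriv_function_mult:
  assumes "f differentiable (at x)" "coeff_differentiable w x"
  shows "coeff_deriv v (\<lambda>y. f y *\<^sub>R w y) x vs = frechet_derivative f (at x) v * w x vs + f x * coeff_deriv v w x vs"
proof -
  have "((\<lambda>y. (f y *\<^sub>R w y) vs) has_derivative
     (\<lambda>v. f x * coeff_deriv v w x vs + frechet_derivative f (at x) v * w x vs)) (at x)"
    using has_derivative_mult[OF has_derivative_frechet[OF assms(1)] has_derivative_coeff[OF assms(2), of vs]]
    by simp
  from coeff_derivI[where w = "\<lambda>y. f y *\<^sub>R w y", OF this] show ?thesis by simp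
qed

lemma coeff_differentiable_function_mult:
  "f differentiable (at x) \<Longrightarrow> coeff_differentiable w x \<Longrightarrow> coeff_differentiable (\<lambda>y. f y *\<^sub>R w y) x"
  by (simp add: coeff_differentiable_def differentiable_mult)

lemma coeff_differentiable_sum:
  "(\<And>p. p \<in> S \<Longrightarrow> coeff_differentiable (w p) x) \<Longrightarrow> coeff_differentiable (\<lambda>y. \<Sum>p\<in>S. w p y) x"
  by (cases "finite S") (auto simp: coeff_differentiable_def sum_fun_apply intro!: differentiable_sum)

lemma coeff_deriv_sum:
  assumes "\<And>p. p \<in> S \<Longrightarrow> coeff_differentiable (w p) x"
  shows "coeff_deriv v (\<lambda>y. \<Sum>p\<in>S. w p y) x vs = (\<Sum>p\<in>S. coeff_deriv v (w p) x vs)"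
proof -
  have "((\<lambda>y. (\<Sum>p\<in>S. w p y) vs) has_derivative (\<lambda>v. \<Sum>p\<in>S. coeff_deriv v (w p) x vs)) (at x)"
    unfolding sum_fun_apply by (intro has_derivative_sum has_derivative_coeff assms)
  from coeff_derivI[where w = "\<lambda>y. \<Sum>p\<in>S. w p y", OF this] show ?thesis .
qed

lemma local_d_sum:
  assumes "\<And>p. p \<in> S \<Longrightarrow> coeff_differentiable (w p) x"
  shows "local_d (\<lambda>y. \<Sum>p\<in>S. w p y) x vs = (\<Sum>p\<in>S. local_d (w p) x vs)"
  unfolding local_d_eq using assms
  by (simp add: coeff_deriv_sum sum_distrib_left) (rule sum.swap)

abbreviation insert_pair :: "'a \<times> 'a \<Rightarrow> ('a list \<Rightarrow> real) \<Rightarrow> 'a list \<Rightarrow> real" where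
  "insert_pair p a \<equiv> insert_two (fst p) (snd p) a"

lemma insert_two_apply: "insert_two u v a vs = a (v # u # vs)"
  by (simp add: insert_two_def)

lemma coeff_differentiable_insert_two:
  "coeff_differentiable w x \<Longrightarrow> coeff_differentiable (\<lambda>y. insert_two u v (w y)) x"
  by (simp add: insert_two_def coeff_differentiable_insert_first)

text \<open>The contraction with the bivector \<open>1/2 \<Sum> P\<^bsub>uv\<^esub> u \<and> v\<close>, for a pair of vectors \<open>(u, v)\<close> in
  \<open>B \<times> B\<close> and an antisymmetric family of functions \<open>P\<close>.\<close>

definition bivector_contract :: "'e set \<Rightarrow> ('e \<times> 'e \<Rightarrow> 'e \<Rightarrow> real) \<Rightarrow> 'e \<Rightarrow> ('e list \<Rightarrow> real) \<Rightarrow> 'e list \<Rightarrow> real" where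
  "bivector_contract B P y a = (\<Sum>p\<in>B \<times> B. (1 / 2 * P p y) *\<^sub>R insert_pair p a)"

text \<open>This is \<open>[i\<^sub>P, d]\<close>.\<close>

definition bivector_Lie :: "'e::real_normed_vector set \<Rightarrow> ('e \<times> 'e \<Rightarrow> 'e \<Rightarrow> real) \<Rightarrow> ('e \<Rightarrow> 'e list \<Rightarrow> real) \<Rightarrow> 'e \<Rightarrow> 'e list \<Rightarrow> real" where
  "bivector_Lie B P w x = bivector_contract B P x (local_d w x) - local_d (\<lambda>y. bivector_contract B P y (w y)) x"

lemma bivector_contract_apply:
  "bivector_contract B P y a vs = (\<Sum>p\<in>B \<times> B. 1 / 2 * P p y * a (snd p # fst p # vs))"
  by (simp add: bivector_contract_def sum_fun_apply insert_two_apply)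

lemma sum_swap_pair: "(\<Sum>p\<in>B \<times> B. F (snd p, fst p)) = (\<Sum>p\<in>B \<times> B. F p)"
  by (rule sum.reindex_bij_witness[where i = "\<lambda>p. (snd p, fst p)" and j = "\<lambda>p. (snd p, fst p)"]) auto

text \<open>The Cartan formula for constant vector fields gives the terms in which the form is
  differentiated; in the others, \<open>d\<close> falls on the coefficients of \<open>P\<close>.\<close>

lemma bivector_Lie_apply:
  assumes P: "\<And>p y. P (snd p, fst p) y = - P p y" "\<And>p. P p differentiable (at x)"
    and w: "coeff_differentiable w x"
  shows "bivector_Lie B P w x vs =
    (\<Sum>p\<in>B \<times> B. P p x * coeff_deriv (snd p) w x (fst p # vs))
    - (\<Sum>p\<in>B \<times> B. 1 / 2 * grad_wedge (P p) x (insert_pair p (w x)) vs)"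
proof -
  let ?I = "B \<times> B"
  define H where "H = (\<lambda>p y. 1 / 2 * P p y)"
  have bc: "bivector_contract B P y a = (\<Sum>p\<in>?I. H p y *\<^sub>R insert_pair p a)" for y a
    by (simp add: bivector_contract_def H_def)
  have dH: "H p differentiable (at x)" for p
    unfolding H_def using P(2) by (intro differentiable_mult) auto
  have dP': "frechet_derivative (\<lambda>y. 1 / 2 * P p y) (at x) = (\<lambda>v. 1 / 2 * frechet_derivative (P p) (at x) v)" for p
    by (rule frechet_derivative_eqI) (rule has_derivative_mult_right[OF has_derivative_frechet[OF P(2)]])
  have gw: "grad_wedge (H p) x a = (1 / 2) *\<^sub>R grad_wedge (P p) x a" for p a
  proof -
    have "local_d (scalar_form (\<lambda>y. 1 / 2 * P p y)) x us = ((1 / 2) *\<^sub>R local_d (scalar_form (P p)) x) us" for us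
    proof (cases us)
      case (Cons u us')
      have "insert_first u (local_d (scalar_form (\<lambda>y. 1 / 2 * P p y)) x) us' = (1 / 2) * insert_first u (local_d (scalar_form (P p)) x) us'"
        unfolding insert_first_d_scalar_form scalar_form_def dP' by simp
      then show ?thesis using Cons by simp
    qed simp
    then have "local_d (scalar_form (\<lambda>y. 1 / 2 * P p y)) x = (1 / 2) *\<^sub>R local_d (scalar_form (P p)) x" by blast
    then show ?thesis unfolding grad_wedge_def H_def by (simp only: list_wedge_linear)
  qed
  have 1: "local_d (\<lambda>y. bivector_contract B P y (w y)) x vs =
    (\<Sum>p\<in>?I. 1 / 2 * grad_wedge (P p) x (insert_pair p (w x)) vs) +
    (\<Sum>p\<in>?I. 1 / 2 * P p x * local_d (\<lambda>y. insert_pair p (w y)) x vs)"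
    unfolding bc sum.distrib[symmetric]
    by (subst local_d_sum)
      (simp_all add: coeff_differentiable_function_mult[OF dH] coeff_differentiable_insert_two[OF w]
        local_d_function_mult[OF dH coeff_differentiable_insert_two[OF w]] gw, simp add: H_def)
  have 2: "local_d w x (snd p # fst p # vs) = coeff_deriv (snd p) w x (fst p # vs)
      - coeff_deriv (fst p) w x (snd p # vs) + local_d (\<lambda>y. insert_pair p (w y)) x vs" for p
    by (simp add: local_d_Cons coeff_deriv_insert_first insert_two_def del: insert_first_apply)
  have 3: "(\<Sum>p\<in>?I. 1 / 2 * P p x * coeff_deriv (fst p) w x (snd p # vs)) =
     - (\<Sum>p\<in>?I. 1 / 2 * P p x * coeff_deriv (snd p) w x (fst p # vs))"
    using sum_swap_pair[of "\<lambda>p. 1 / 2 * P p x * coeff_deriv (fst p) w x (snd p # vs)" B]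
    by (simp add: P(1) sum_negf)
  have "bivector_contract B P x (local_d w x) vs =
    (\<Sum>p\<in>?I. 1 / 2 * P p x * coeff_deriv (snd p) w x (fst p # vs))
    - (\<Sum>p\<in>?I. 1 / 2 * P p x * coeff_deriv (fst p) w x (snd p # vs))
    + (\<Sum>p\<in>?I. 1 / 2 * P p x * local_d (\<lambda>y. insert_pair p (w y)) x vs)"
    unfolding bivector_contract_apply 2 by (simp add: algebra_simps sum.distrib sum_subtractf)
  then show ?thesis
    unfolding bivector_Lie_def minus_apply 1 3 by (simp add: sum_distrib_left)
qed

text \<open>The only terms of \<open>[i\<^sub>P, [i\<^sub>P, d]]\<close> that do not cancel are those in which one factor \<open>P\<close>
  differentiates the coefficients of the other. Since contractions with vectors anticommute, only their
  cyclic sum matters, which is the Jacobi identity.\<close>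

lemma bivector_contract_Lie_commute:
  assumes B: "finite B"
    and P: "\<And>p y. P (snd p, fst p) y = - P p y" "\<And>p. P p differentiable (at x)"
    and Jacobi: "\<And>i j k. \<lbrakk>i \<in> B; j \<in> B; k \<in> B\<rbrakk> \<Longrightarrow> (\<Sum>c\<in>B.
      P (i, c) x * frechet_derivative (P (j, k)) (at x) c + P (j, c) x * frechet_derivative (P (k, i)) (at x) c
      + P (k, c) x * frechet_derivative (P (i, j)) (at x) c) = 0"
    and w: "\<And>y. w y \<in> alternating k" "coeff_differentiable w x"
  shows "bivector_contract B P x (bivector_Lie B P w x) vs = bivector_Lie B P (\<lambda>y. bivector_contract B P y (w y)) x vs"
proof -
  let ?I = "B \<times> B"
  define a where "a = w x"
  define D where "D = (\<lambda>v. coeff_deriv v w x)"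
  define dP where "dP = (\<lambda>p v. frechet_derivative (P p) (at x) v)"
  have dP_swap: "dP (snd p, fst p) v = - dP p v" for p v
  proof -
    have "P (snd p, fst p) = (\<lambda>y. - P p y)" using P(1) by blast
    then show ?thesis
      unfolding dP_def
      using frechet_derivative_eqI[OF has_derivative_minus[OF has_derivative_frechet[OF P(2)[of p]]]] by simp
  qed
  have D_alt: "D v \<in> alternating k" for v unfolding D_def by (rule coeff_deriv_alternating[OF w])
  have a_alt: "a \<in> alternating k" using w by (simp add: a_def)
  \<comment> \<open>a vector moves past a pair of vectors without a sign\<close>
  have rot: "f (u # v # v' # us) = f (v # v' # u # us)" if "f \<in> alternating k" for f u v v' us k
    using alternating_move_first[OF that, of "[v, v']" u us] by simp
  have rot2: "a (v # v' # u # u' # us) = a (u # u' # v # v' # us)" for u u' v v' us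
    using alternating_move_first[OF a_alt, of "[v, v']" u "u' # us"]
      alternating_move_first[OF a_alt, of "[u, v, v']" u' us] alternating_move_first[OF a_alt, of "[u]" u' "v # v' # us"]
    by simp
  have W_diff: "coeff_differentiable (\<lambda>y. bivector_contract B P y (w y)) x"
    unfolding bivector_contract_def
    by (intro coeff_differentiable_sum coeff_differentiable_function_mult coeff_differentiable_insert_two w(2)
        differentiable_mult P(2)) simp
  have W_deriv: "coeff_deriv v (\<lambda>y. bivector_contract B P y (w y)) x us =
    (\<Sum>q\<in>?I. 1 / 2 * (dP q v * a (snd q # fst q # us) + P q x * D v (snd q # fst q # us)))" for v us
  proof -
    define H where "H = (\<lambda>p y. 1 / 2 * P p y)"
    have bc: "bivector_contract B P y a = (\<Sum>p\<in>?I. H p y *\<^sub>R insert_pair p a)" for y a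
      by (simp add: bivector_contract_def H_def)
    have d: "H p differentiable (at x)" for p
      unfolding H_def using P(2) by (intro differentiable_mult) auto
    have d': "frechet_derivative (H q) (at x) v = 1 / 2 * dP q v" for q
      unfolding dP_def H_def
      by (rule fun_cong[OF frechet_derivative_eqI[OF has_derivative_mult_right[OF has_derivative_frechet[OF P(2)]]]])
    have c: "coeff_deriv v (\<lambda>y. insert_pair q (w y)) x us = D v (snd q # fst q # us)" for q
      by (simp add: coeff_deriv_def D_def insert_two_apply)
    show ?thesis
      unfolding bc
      by (subst coeff_deriv_sum)
        (simp_all add: coeff_differentiable_function_mult[OF d] coeff_differentiable_insert_two[OF w(2)]
          coeff_deriv_function_mult[OF d coeff_differentiable_insert_two[OF w(2)]] d' c insert_two_apply a_def
          algebra_simps, simp add: H_def)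
  qed
  \<comment> \<open>the differential of a coefficient is not contracted with the other factor \<open>P\<close>\<close>
  define g where "g = (\<lambda>q p. grad_wedge (P p) x (insert_pair q (insert_pair p a)) vs)"
  have g_swap: "g q p = grad_wedge (P p) x (insert_pair p (insert_pair q a)) vs" for q p
  proof -
    have "insert_pair q (insert_pair p a) = insert_pair p (insert_pair q a)"
      by (auto simp: fun_eq_iff insert_two_apply rot2)
    then show ?thesis by (simp add: g_def)
  qed
  have g_Cons: "grad_wedge (P p) x (insert_pair p a) (snd q # fst q # vs) =
    dP p (snd q) * a (snd p # fst p # fst q # vs) - dP p (fst q) * a (snd p # fst p # snd q # vs) + g q p" for q p
    by (simp add: grad_wedge_Cons g_def dP_def insert_two_apply insert_two_def[of _ _ "insert_two _ _ a"] del: insert_first_apply)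
      (simp add: insert_two_apply)
  \<comment> \<open>one factor \<open>P\<close> differentiates the coefficients of the other one\<close>
  define Z where "Z = (\<Sum>p\<in>?I. \<Sum>q\<in>?I. P p x * dP q (snd p) * a (snd q # fst q # fst p # vs))"
  have Lie: "bivector_Lie B P w x us = (\<Sum>p\<in>?I. P p x * D (snd p) (fst p # us))
      - (\<Sum>p\<in>?I. 1 / 2 * grad_wedge (P p) x (insert_pair p a) us)" for us
    unfolding D_def a_def by (rule bivector_Lie_apply[where P = P, OF P(1) P(2) w(2)])
  \<comment> \<open>both sides contain the same terms \<open>T\<close>, where the form is differentiated, and \<open>G\<close>\<close>
  define T where "T = (\<Sum>q\<in>?I. \<Sum>p\<in>?I. 1 / 2 * (P q x * (P p x * D (snd p) (snd q # fst q # fst p # vs))))"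
  define G where "G = (\<Sum>q\<in>?I. \<Sum>p\<in>?I. 1 / 4 * (P q x * g q p))"
  have D_rot: "D (snd p) (fst p # snd q # fst q # vs) = D (snd p) (snd q # fst q # fst p # vs)" for p q
    by (rule rot[OF D_alt])
  have "bivector_contract B P x (bivector_Lie B P w x) vs =
    (\<Sum>q\<in>?I. \<Sum>p\<in>?I. 1 / 2 * (P q x * (P p x * D (snd p) (snd q # fst q # fst p # vs)))
      - 1 / 4 * (P q x * (dP p (snd q) * a (snd p # fst p # fst q # vs)))
      + 1 / 4 * (P q x * (dP p (fst q) * a (snd p # fst p # snd q # vs)))
      - 1 / 4 * (P q x * g q p))"
    unfolding bivector_contract_apply Lie g_Cons sum_subtractf[symmetric] sum_distrib_left
    by (intro sum.cong HOL.refl) (simp add: D_rot algebra_simps)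
  also have "\<dots> = T - 1 / 4 * Z + 1 / 4 * (\<Sum>q\<in>?I. \<Sum>p\<in>?I. P q x * dP p (fst q) * a (snd p # fst p # snd q # vs)) - G"
    by (simp add: T_def G_def Z_def sum.distrib sum_subtractf sum_distrib_left mult.assoc)
  also have "(\<Sum>q\<in>?I. \<Sum>p\<in>?I. P q x * dP p (fst q) * a (snd p # fst p # snd q # vs)) = - Z"
    using sum_swap_pair[of "\<lambda>q. \<Sum>p\<in>?I. P q x * dP p (fst q) * a (snd p # fst p # snd q # vs)" B]
    by (simp add: P(1) Z_def sum_negf)
  finally have L: "bivector_contract B P x (bivector_Lie B P w x) vs = T - 1 / 2 * Z - G" by simp
  have "bivector_Lie B P (\<lambda>y. bivector_contract B P y (w y)) x vs =
    (\<Sum>p\<in>?I. \<Sum>q\<in>?I. 1 / 2 * (P p x * dP q (snd p) * a (snd q # fst q # fst p # vs))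
      + 1 / 2 * (P p x * (P q x * D (snd p) (snd q # fst q # fst p # vs))))
    - (\<Sum>p\<in>?I. 1 / 2 * grad_wedge (P p) x (insert_pair p (bivector_contract B P x a)) vs)"
    unfolding bivector_Lie_apply[where P = P, OF P(1) P(2) W_diff] W_deriv sum_distrib_left a_def[symmetric]
    by (simp add: algebra_simps)
  also have "(\<Sum>p\<in>?I. 1 / 2 * grad_wedge (P p) x (insert_pair p (bivector_contract B P x a)) vs) = (\<Sum>p\<in>?I. \<Sum>q\<in>?I. 1 / 4 * (P q x * g q p))"
  proof (rule sum.cong[OF HOL.refl])
    fix p
    have "insert_pair p (bivector_contract B P x a) = (\<Sum>q\<in>?I. (1 / 2 * P q x) *\<^sub>R insert_pair p (insert_pair q a))"
      by (auto simp: fun_eq_iff insert_two_apply bivector_contract_apply sum_fun_apply)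
    then show "1 / 2 * grad_wedge (P p) x (insert_pair p (bivector_contract B P x a)) vs = (\<Sum>q\<in>?I. 1 / 4 * (P q x * g q p))"
      by (simp add: grad_wedge_sum grad_wedge_linear sum_fun_apply g_swap sum_distrib_left)
  qed
  also have "\<dots> = G" unfolding G_def by (rule sum.swap)
  also have "(\<Sum>p\<in>?I. \<Sum>q\<in>?I. 1 / 2 * (P p x * dP q (snd p) * a (snd q # fst q # fst p # vs))
      + 1 / 2 * (P p x * (P q x * D (snd p) (snd q # fst q # fst p # vs)))) = 1 / 2 * Z + T"
  proof -
    have "T = (\<Sum>p\<in>?I. \<Sum>q\<in>?I. 1 / 2 * (P q x * (P p x * D (snd p) (snd q # fst q # fst p # vs))))"
      unfolding T_def by (rule sum.swap)
    also have "\<dots> = (\<Sum>p\<in>?I. \<Sum>q\<in>?I. 1 / 2 * (P p x * (P q x * D (snd p) (snd q # fst q # fst p # vs))))"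
      by (intro sum.cong HOL.refl) simp
    finally show ?thesis by (simp only: Z_def sum.distrib sum_distrib_left)
  qed
  finally have R: "bivector_Lie B P (\<lambda>y. bivector_contract B P y (w y)) x vs = 1 / 2 * Z + T - G" .
  \<comment> \<open>the sides differ by \<open>Z\<close>; as contractions anticommute, \<open>3 Z\<close> is a combination of cyclic sums of these coefficients\<close>
  define J where "J = (\<lambda>b d e. \<Sum>c\<in>B. P (b, c) x * dP (d, e) c)"
  define t where "t = (\<lambda>b d e. a (e # d # b # vs))"
  have t_rot: "t b d e = t d e b" for b d e
    unfolding t_def by (rule rot[OF a_alt, symmetric])
  have Z1: "Z = (\<Sum>b\<in>B. \<Sum>d\<in>B. \<Sum>e\<in>B. J b d e * t b d e)"
  proof -
    have pair: "(\<Sum>p\<in>?I. F (fst p) (snd p)) = (\<Sum>b\<in>B. \<Sum>c\<in>B. F b c)" for F :: "'a \<Rightarrow> 'a \<Rightarrow> real"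
      by (simp add: sum.cartesian_product case_prod_unfold)
    have "Z = (\<Sum>p\<in>?I. \<Sum>q\<in>?I. P (fst p, snd p) x * dP (fst q, snd q) (snd p) * t (fst p) (fst q) (snd q))"
      by (simp add: Z_def t_def)
    also have "\<dots> = (\<Sum>b\<in>B. \<Sum>c\<in>B. \<Sum>q\<in>?I. P (b, c) x * dP (fst q, snd q) c * t b (fst q) (snd q))"
      by (rule pair[of "\<lambda>b c. \<Sum>q\<in>?I. P (b, c) x * dP (fst q, snd q) c * t b (fst q) (snd q)"])
    also have "\<dots> = (\<Sum>b\<in>B. \<Sum>c\<in>B. \<Sum>d\<in>B. \<Sum>e\<in>B. P (b, c) x * dP (d, e) c * t b d e)"
      by (rule sum.cong[OF HOL.refl], rule sum.cong[OF HOL.refl], rule pair)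
    also have "\<dots> = (\<Sum>b\<in>B. \<Sum>d\<in>B. \<Sum>e\<in>B. \<Sum>c\<in>B. P (b, c) x * dP (d, e) c * t b d e)"
      by (rule sum.cong[OF HOL.refl], subst sum.swap, rule sum.cong[OF HOL.refl], rule sum.swap)
    finally show ?thesis by (simp add: J_def sum_distrib_right)
  qed
  have Z2: "Z = (\<Sum>b\<in>B. \<Sum>d\<in>B. \<Sum>e\<in>B. J d e b * t b d e)"
  proof -
    have "Z = (\<Sum>d\<in>B. \<Sum>e\<in>B. \<Sum>b\<in>B. J d e b * t b d e)" unfolding Z1 by (simp only: t_rot)
    also have "\<dots> = (\<Sum>d\<in>B. \<Sum>b\<in>B. \<Sum>e\<in>B. J d e b * t b d e)" by (rule sum.cong[OF HOL.refl], rule sum.swap)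
    also have "\<dots> = (\<Sum>b\<in>B. \<Sum>d\<in>B. \<Sum>e\<in>B. J d e b * t b d e)" by (rule sum.swap)
    finally show ?thesis .
  qed
  have Z3: "Z = (\<Sum>b\<in>B. \<Sum>d\<in>B. \<Sum>e\<in>B. J e b d * t b d e)"
  proof -
    have "Z = (\<Sum>e\<in>B. \<Sum>b\<in>B. \<Sum>d\<in>B. J e b d * t b d e)" unfolding Z1 by (simp only: t_rot[symmetric])
    also have "\<dots> = (\<Sum>b\<in>B. \<Sum>e\<in>B. \<Sum>d\<in>B. J e b d * t b d e)" by (rule sum.swap)
    also have "\<dots> = (\<Sum>b\<in>B. \<Sum>d\<in>B. \<Sum>e\<in>B. J e b d * t b d e)" by (rule sum.cong[OF HOL.refl], rule sum.swap)
    finally show ?thesis .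
  qed
  have "3 * Z = (\<Sum>b\<in>B. \<Sum>d\<in>B. \<Sum>e\<in>B. (J b d e + J d e b + J e b d) * t b d e)"
    using Z1 Z2 Z3 by (simp add: sum.distrib algebra_simps)
  also have "\<dots> = 0"
    using Jacobi by (intro sum.neutral ballI) (simp add: J_def dP_def sum.distrib)
  finally show ?thesis unfolding L R by simp
qed

section \<open>Linear algebra of the model space\<close>

lemma linear_const_mult:
  fixes f :: "'a::real_vector \<Rightarrow> real"
  assumes "linear f"
  shows "linear (\<lambda>v. c * f v)" "linear (\<lambda>v. f v * c)"
  using linear_compose_scale_right[OF assms, of c] by (simp_all add: mult.commute)

locale finite_dim_model =
  fixes model :: "'e::real_inner itself"
  assumes finite_dim: "\<exists>B::'e set. finite B \<and> span B = UNIV"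
begin

text \<open>The coordinates with respect to an orthogonal basis are inner products.\<close>

lemma linear_imp_bounded_linear:
  fixes f :: "'e \<Rightarrow> 'b::real_normed_vector"
  assumes f: "linear f"
  shows "bounded_linear f"
proof -
  obtain B :: "'e set" where "finite B" "span B = UNIV" using finite_dim by blast
  then obtain C :: "'e set" where C: "finite C" "span C = UNIV" "pairwise orthogonal C"
    using basis_orthogonal[of B] by auto
  have expand: "v = (\<Sum>c\<in>C. (v \<bullet> c / (c \<bullet> c)) *\<^sub>R c)" for v
  proof -
    let ?r = "v - (\<Sum>c\<in>C. (v \<bullet> c / (c \<bullet> c)) *\<^sub>R c)"
    have "orthogonal ?r x" if "x \<in> C" for x
    proof -
      have "(\<Sum>c\<in>C. (v \<bullet> c / (c \<bullet> c)) *\<^sub>R c) \<bullet> x = (\<Sum>c\<in>C. if c = x then v \<bullet> x else 0)"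
        unfolding inner_sum_left
        using C(3) that by (intro sum.cong) (auto simp: pairwise_def orthogonal_def)
      then show ?thesis using C(1) that by (simp add: orthogonal_def inner_diff_left)
    qed
    then have "orthogonal ?r ?r" using C(2) orthogonal_to_span[of ?r C ?r] by (simp add: orthogonal_commute)
    then show ?thesis by (simp add: orthogonal_def)
  qed
  have "f v = (\<Sum>c\<in>C. (v \<bullet> c / (c \<bullet> c)) *\<^sub>R f c)" for v
    by (subst expand) (simp add: linear_sum[OF f] linear_scale[OF f])
  then have "f = (\<lambda>v. \<Sum>c\<in>C. (v \<bullet> c / (c \<bullet> c)) *\<^sub>R f c)" by blast
  moreover have "bounded_linear (\<lambda>v::'e. \<Sum>c\<in>C. (v \<bullet> c / (c \<bullet> c)) *\<^sub>R f c)"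
    by (intro bounded_linear_sum bounded_linear_compose[OF bounded_linear_scaleR_left]
        bounded_linear_compose[OF bounded_linear_divide] bounded_linear_inner_left)
  ultimately show ?thesis by metis
qed

lemma model_basis: "independent (model_basis :: 'e set)" "span (model_basis :: 'e set) = UNIV" "finite (model_basis :: 'e set)"
proof -
  show i: "independent (model_basis :: 'e set)" and s: "span (model_basis :: 'e set) = UNIV"
    unfolding model_basis_def
    by (rule independent_extend_basis[OF independent_empty], rule span_extend_basis[OF independent_empty])
  obtain B :: "'e set" where "finite B" "span B = UNIV" using finite_dim by blast
  then show "finite (model_basis :: 'e set)"
    using independent_span_bound[OF _ i, of B] by simp
qed

lemma dual_basis_apply: "blinfun_apply (dual_basis b) v = representation model_basis (v::'e) b"
proof -
  have "linear (\<lambda>v::'e. representation model_basis v b)"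
    by (rule linearI) (simp_all add: representation_add representation_scale model_basis)
  then show ?thesis
    unfolding dual_basis_def by (simp add: bounded_linear_Blinfun_apply linear_imp_bounded_linear)
qed

lemma dual_basis_expand: "(\<Sum>b\<in>model_basis. dual_basis b v *\<^sub>R b) = (v::'e)"
  unfolding dual_basis_apply
  by (rule sum_representation_eq) (simp_all add: model_basis)

lemma linear_expand:
  fixes f :: "'e \<Rightarrow> real"
  assumes "linear f"
  shows "(\<Sum>b\<in>model_basis. dual_basis b v * f b) = f v"
proof -
  have "f v = f (\<Sum>b\<in>model_basis. dual_basis b v *\<^sub>R b)" by (simp add: dual_basis_expand)
  then show ?thesis by (simp add: linear_sum[OF assms] linear_scale[OF assms])
qed

lemma covector_expand:
  fixes \<alpha> :: "'e \<Rightarrow>\<^sub>L real"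
  shows "(\<Sum>b\<in>model_basis. \<alpha> b *\<^sub>R dual_basis b) = \<alpha>"
proof (rule blinfun_eqI)
  fix v
  show "blinfun_apply (\<Sum>b\<in>model_basis. \<alpha> b *\<^sub>R dual_basis b) v = \<alpha> v"
    using linear_expand[OF bounded_linear.linear[OF blinfun.bounded_linear_right[of \<alpha>]], of v]
    by (simp add: blinfun.sum_left blinfun.scaleR_left mult.commute)
qed

text \<open>The canonical element of \<open>E\<^sup>* \<otimes> E\<close> can absorb an endomorphism on either side.\<close>

lemma dual_basis_transfer:
  fixes \<phi> :: "('e \<Rightarrow>\<^sub>L real) \<Rightarrow> 'e \<Rightarrow> real" and L :: "'e \<Rightarrow>\<^sub>L 'e"
  assumes "\<And>v. linear (\<lambda>\<alpha>. \<phi> \<alpha> v)" "\<And>\<alpha>. linear (\<phi> \<alpha>)"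
  shows "(\<Sum>b\<in>model_basis. \<phi> (dual_basis b) (L b)) = (\<Sum>b\<in>model_basis. \<phi> (dual_basis b o\<^sub>L L) b)"
proof -
  have "(\<Sum>b\<in>model_basis. \<phi> (dual_basis b) (L b)) = (\<Sum>b\<in>model_basis. \<Sum>c\<in>model_basis. dual_basis c (L b) * \<phi> (dual_basis b) c)"
    by (simp add: linear_expand[OF assms(2)])
  also have "\<dots> = (\<Sum>c\<in>model_basis. \<Sum>b\<in>model_basis. dual_basis c (L b) * \<phi> (dual_basis b) c)"
    by (rule sum.swap)
  also have "\<dots> = (\<Sum>c\<in>model_basis. \<phi> (dual_basis c o\<^sub>L L) c)"
  proof (rule sum.cong[OF HOL.refl])
    fix c :: 'e
    have "\<phi> (dual_basis c o\<^sub>L L) c = \<phi> (\<Sum>b\<in>model_basis. (dual_basis c o\<^sub>L L) b *\<^sub>R dual_basis b) c"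
      by (simp only: covector_expand)
    also have "\<dots> = (\<Sum>b\<in>model_basis. dual_basis c (L b) * \<phi> (dual_basis b) c)"
      by (simp add: linear_sum[OF assms(1)] linear_scale[OF assms(1)])
    finally show "(\<Sum>b\<in>model_basis. dual_basis c (L b) * \<phi> (dual_basis b) c) = \<phi> (dual_basis c o\<^sub>L L) c" ..
  qed
  finally show ?thesis .
qed

lemma two_lists: "{bs. length bs = 2 \<and> set bs \<subseteq> S} = (\<lambda>(b, c). [b, c]) ` (S \<times> S)"
proof -
  have "bs \<in> (\<lambda>(b, c). [b, c]) ` (S \<times> S)" if "length bs = 2" "set bs \<subseteq> S" for bs
  proof -
    obtain b c where "bs = [b, c]" using \<open>length bs = 2\<close> by (auto simp: numeral_2_eq_2 length_Suc_conv)
    then show ?thesis using that by auto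
  qed
  then show ?thesis by auto
qed

lemma contract_two:
  "contract 2 P a vs = (\<Sum>p\<in>model_basis \<times> model_basis. 1 / 2 * P [dual_basis (fst p), dual_basis (snd p)] * a (snd p # fst p # vs))"
proof -
  have inj: "inj_on (\<lambda>(b, c). [b, c]) (S \<times> S)" for S :: "'z set" by (auto simp: inj_on_def)
  show ?thesis
    unfolding contract_def two_lists sum.reindex[OF inj]
    by (simp add: sum_distrib_left case_prod_unfold mult.assoc)
qed

text \<open>The linear map is moved from the vectors to the covectors in one slot at a time.\<close>

lemma contract_two_natural:
  fixes L :: "'e \<Rightarrow>\<^sub>L 'e"
  assumes P: "P \<in> alternating 2" and a: "a \<in> alternating k"
  shows "contract 2 P (\<lambda>vs. a (map L vs)) vs = contract 2 (\<lambda>\<alpha>s. P (map (\<lambda>\<alpha>. \<alpha> o\<^sub>L L) \<alpha>s)) a (map L vs)"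
proof -
  let ?B = "model_basis :: 'e set"
  have P1: "linear (\<lambda>\<alpha>. P [\<alpha>, \<beta>])" and P2: "linear (\<lambda>\<beta>. P [\<alpha>, \<beta>])" for \<alpha> \<beta>
  proof -
    have "\<forall>vs. \<forall>j<2. length vs = 2 \<longrightarrow> linear (\<lambda>v. P (vs[j := v]))" using P by (simp add: alternating_def)
    from this[rule_format, of 0 "[\<alpha>, \<beta>]"] this[rule_format, of "Suc 0" "[\<alpha>, \<beta>]"]
    show "linear (\<lambda>\<alpha>. P [\<alpha>, \<beta>])" "linear (\<lambda>\<beta>. P [\<alpha>, \<beta>])" by simp_all
  qed
  have a1: "linear (\<lambda>v. a (v # us))" for us by (rule alternating_linear_first[OF a])
  have a2: "linear (\<lambda>v. a (u # v # us))" for u us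
    using linear_compose_neg[OF a1, of "u # us"] alternating_swap_first[OF a, of u _ us] by simp
  have comp: "linear (\<lambda>\<alpha> :: 'e \<Rightarrow>\<^sub>L real. \<alpha> o\<^sub>L L)"
    by (rule linearI) (auto intro!: blinfun_eqI simp: blinfun.add_left blinfun.scaleR_left)
  have "(\<Sum>b\<in>?B. \<Sum>c\<in>?B. P [dual_basis b, dual_basis c] * a (L c # L b # map L vs)) =
    (\<Sum>b\<in>?B. \<Sum>c\<in>?B. P [dual_basis b, dual_basis c o\<^sub>L L] * a (c # L b # map L vs))"
    by (rule sum.cong[OF HOL.refl], rule dual_basis_transfer)
      (intro linear_const_mult P2 a1)+
  also have "\<dots> = (\<Sum>c\<in>?B. \<Sum>b\<in>?B. P [dual_basis b, dual_basis c o\<^sub>L L] * a (c # L b # map L vs))"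
    by (rule sum.swap)
  also have "\<dots> = (\<Sum>c\<in>?B. \<Sum>b\<in>?B. P [dual_basis b o\<^sub>L L, dual_basis c o\<^sub>L L] * a (c # b # map L vs))"
    by (rule sum.cong[OF HOL.refl], rule dual_basis_transfer)
      (intro linear_const_mult P1 a2)+
  also have "\<dots> = (\<Sum>b\<in>?B. \<Sum>c\<in>?B. P [dual_basis b o\<^sub>L L, dual_basis c o\<^sub>L L] * a (c # b # map L vs))"
    by (rule sum.swap)
  finally show ?thesis
    unfolding contract_two
    by (simp add: sum.cartesian_product' sum_divide_distrib[symmetric])
qed

section \<open>Naturality\<close>

lemma insert_first_map: "insert_first v (\<lambda>vs. a (map L vs)) = (\<lambda>vs. insert_first (L v) a (map L vs))"
  by auto

lemma list_wedge_map: "list_wedge (\<lambda>vs. a (map L vs)) (\<lambda>vs. b (map L vs)) vs = list_wedge a b (map L vs)"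
proof (induction vs arbitrary: a b)
  case (Cons v vs)
  have "grading_twist (\<lambda>vs. a (map L vs)) = (\<lambda>vs. grading_twist a (map L vs))" by (auto simp: grading_twist_def)
  then show ?case
    unfolding list_wedge.simps list.map insert_first_map by (simp only: Cons.IH)
qed simp

lemma insert_first_alternating_any: "a \<in> alternating k \<Longrightarrow> insert_first v a \<in> alternating (k - 1)"
proof (cases k)
  case 0
  assume "a \<in> alternating k"
  then have "insert_first v a = 0" using 0 by (auto simp: alternating_def)
  then show ?thesis using subspace_0[OF subspace_alternating] by metis
qed (simp add: insert_first_alternating)

text \<open>The product rule for a form at a moving point that is applied to moving vectors.\<close>

lemma has_derivative_pullback:
  fixes w :: "'e \<Rightarrow> 'e list \<Rightarrow> real" and T :: "'e \<Rightarrow> 'e"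
  assumes T: "(T has_derivative T') (at x)"
    and gs: "\<And>g. g \<in> set gs \<Longrightarrow> (g has_derivative Dg g) (at x)"
    and w: "\<And>y. w y \<in> alternating k" "coeff_differentiable w (T x)"
  shows "((\<lambda>y. w (T y) (map (\<lambda>g. g y) gs)) has_derivative
    (\<lambda>u. coeff_deriv (T' u) w (T x) (map (\<lambda>g. g x) gs) +
      (\<Sum>j<length gs. w (T x) ((map (\<lambda>g. g x) gs)[j := Dg (gs ! j) u])))) (at x)"
  using gs w
proof (induction gs arbitrary: w k)
  case Nil
  have "((\<lambda>y. w (T y) []) has_derivative (\<lambda>u. coeff_deriv (T' u) w (T x) [])) (at x)"
    by (rule has_derivative_compose[where g = "\<lambda>z. w z []", OF T has_derivative_coeff[OF Nil(3)]])
  then show ?case by simp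
next
  case (Cons g gs)
  let ?B = "model_basis :: 'e set"
  let ?m = "\<lambda>y. map (\<lambda>g. g y) gs"
  have lin: "linear (\<lambda>v. w y (v # us))" for y us by (rule alternating_linear_first[OF Cons.prems(2)])
  have lin': "linear (\<lambda>v. coeff_deriv u w (T x) (v # us))" for u us
    by (rule alternating_linear_first[OF coeff_deriv_alternating[OF Cons.prems(2,3)]])
  have coord: "((\<lambda>y. dual_basis b (g y)) has_derivative (\<lambda>u. dual_basis b (Dg g u))) (at x)" for b
    by (rule bounded_linear.has_derivative[OF blinfun.bounded_linear_right]) (use Cons.prems(1) in simp)
  have IH: "((\<lambda>y. insert_first b (w (T y)) (?m y)) has_derivative
    (\<lambda>u. coeff_deriv (T' u) w (T x) (b # ?m x) + (\<Sum>j<length gs. w (T x) (b # (?m x)[j := Dg (gs ! j) u])))) (at x)" for b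
  proof -
    have "((\<lambda>y. insert_first b (w (T y)) (?m y)) has_derivative
      (\<lambda>u. coeff_deriv (T' u) (\<lambda>y. insert_first b (w y)) (T x) (?m x) +
        (\<Sum>j<length gs. insert_first b (w (T x)) ((?m x)[j := Dg (gs ! j) u])))) (at x)"
      by (rule Cons.IH[of "\<lambda>y. insert_first b (w y)" "k - 1"])
        (rule Cons.prems(1), simp, rule insert_first_alternating_any[OF Cons.prems(2)],
          rule coeff_differentiable_insert_first[OF Cons.prems(3)])
    then show ?thesis by (simp only: coeff_deriv_insert_first insert_first_apply)
  qed
  have "((\<lambda>y. \<Sum>b\<in>?B. dual_basis b (g y) * insert_first b (w (T y)) (?m y)) has_derivative
    (\<lambda>u. \<Sum>b\<in>?B. dual_basis b (g x) * (coeff_deriv (T' u) w (T x) (b # ?m x) + (\<Sum>j<length gs. w (T x) (b # (?m x)[j := Dg (gs ! j) u])))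
       + dual_basis b (Dg g u) * insert_first b (w (T x)) (?m x))) (at x)"
    by (intro has_derivative_sum has_derivative_mult coord IH)
  moreover have "(\<Sum>b\<in>?B. dual_basis b (g y) * insert_first b (w (T y)) (?m y)) = w (T y) (map (\<lambda>g. g y) (g # gs))" for y
    using linear_expand[OF lin] by simp
  moreover have "(\<Sum>b\<in>?B. dual_basis b (g x) * (coeff_deriv (T' u) w (T x) (b # ?m x) + (\<Sum>j<length gs. w (T x) (b # (?m x)[j := Dg (gs ! j) u])))
       + dual_basis b (Dg g u) * insert_first b (w (T x)) (?m x)) =
     coeff_deriv (T' u) w (T x) (map (\<lambda>g. g x) (g # gs)) +
      (\<Sum>j<length (g # gs). w (T x) ((map (\<lambda>g. g x) (g # gs))[j := Dg ((g # gs) ! j) u]))" for u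
  proof -
    have "(\<Sum>b\<in>?B. dual_basis b (g x) * (\<Sum>j<length gs. w (T x) (b # (?m x)[j := Dg (gs ! j) u]))) =
      (\<Sum>j<length gs. w (T x) (g x # (?m x)[j := Dg (gs ! j) u]))"
      unfolding sum_distrib_left by (subst sum.swap) (simp add: linear_expand[OF lin])
    then show ?thesis
      using linear_expand[OF lin'] linear_expand[OF lin]
      by (simp add: distrib_left sum.distrib sum.lessThan_Suc_shift del: sum.lessThan_Suc)
  qed
  ultimately show ?case by (simp only:)
qed

text \<open>The terms with second derivatives of the coordinate change cancel in pairs: the Hessian is
  symmetric, and the form is alternating.\<close>

lemma hessian_terms_cancel:
  fixes S :: "'a \<Rightarrow> 'a \<Rightarrow> 'b::real_vector"
  assumes S: "\<And>u v. S u v = S v u"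
  shows "a \<in> alternating k \<Longrightarrow> (\<Sum>i<length vs. (-1) ^ i * (\<Sum>j<length vs - 1.
    a ((map L (take i vs @ drop (Suc i) vs))[j := S (vs ! i) ((take i vs @ drop (Suc i) vs) ! j)]))) = 0"
proof (induction vs arbitrary: a k)
  case (Cons v vs)
  let ?r = "\<lambda>i. take i vs @ drop (Suc i) vs"
  have len: "length vs = Suc (length vs - 1)" if "i < length vs" for i using that by simp
  have move: "a ((map L vs)[j := s]) = (-1) ^ j * a (s # map L (?r j))" if "j < length vs" for j s
  proof -
    have "(map L vs)[j := s] = map L (take j vs) @ s # map L (drop (Suc j) vs)"
      using that by (simp add: upd_conv_take_nth_drop take_map drop_map)
    then show ?thesis using alternating_move_first[OF Cons.prems, of "map L (take j vs)" s "map L (drop (Suc j) vs)"] that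
      by simp
  qed
  have "(\<Sum>i<length (v # vs). (-1) ^ i * (\<Sum>j<length (v # vs) - 1.
      a ((map L (take i (v # vs) @ drop (Suc i) (v # vs)))[j := S ((v # vs) ! i) ((take i (v # vs) @ drop (Suc i) (v # vs)) ! j)]))) =
    (\<Sum>j<length vs. a ((map L vs)[j := S v (vs ! j)])) - (\<Sum>i<length vs. (-1) ^ i * (\<Sum>j<length vs.
      a ((L v # map L (?r i))[j := S (vs ! i) ((v # ?r i) ! j)])))"
    by (simp add: sum.lessThan_Suc_shift sum_negf del: sum.lessThan_Suc)
  also have "(\<Sum>i<length vs. (-1) ^ i * (\<Sum>j<length vs. a ((L v # map L (?r i))[j := S (vs ! i) ((v # ?r i) ! j)]))) =
    (\<Sum>i<length vs. (-1) ^ i * (a (S (vs ! i) v # map L (?r i)) + (\<Sum>j<length vs - 1.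
      insert_first (L v) a ((map L (?r i))[j := S (vs ! i) (?r i ! j)]))))"
  proof (rule sum.cong[OF HOL.refl])
    fix i assume "i \<in> {..<length vs}"
    then have n: "{..<length vs} = {..<Suc (length vs - 1)}" using len[of i] by simp
    show "(-1) ^ i * (\<Sum>j<length vs. a ((L v # map L (?r i))[j := S (vs ! i) ((v # ?r i) ! j)])) =
      (-1) ^ i * (a (S (vs ! i) v # map L (?r i)) + (\<Sum>j<length vs - 1.
        insert_first (L v) a ((map L (?r i))[j := S (vs ! i) (?r i ! j)])))"
      unfolding n sum.lessThan_Suc_shift by simp
  qed
  also have "\<dots> = (\<Sum>i<length vs. (-1) ^ i * a (S (vs ! i) v # map L (?r i)))"
    using Cons.IH[OF insert_first_alternating_any[OF Cons.prems], of "L v"]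
    by (simp add: distrib_left sum.distrib)
  also have "\<dots> = (\<Sum>j<length vs. a ((map L vs)[j := S v (vs ! j)]))"
    using move S by (intro sum.cong) auto
  finally show ?case by simp
qed simp

text \<open>The derivatives of the pulled back coefficients are the pulled back derivatives and the
  Hessian terms of \<open>hessian_terms_cancel\<close>.\<close>

lemma local_d_natural:
  fixes w w' :: "'e \<Rightarrow> 'e list \<Rightarrow> real" and T :: "'e \<Rightarrow> 'e"
  assumes U: "open U" "x \<in> U" and T: "Ck_on 2 T U"
    and w: "\<And>y vs. y \<in> U \<Longrightarrow> w y vs = w' (T y) (map (frechet_derivative T (at y)) vs)"
    and w': "\<And>y. w' y \<in> alternating k" "coeff_differentiable w' (T x)"
  shows "local_d w x vs = local_d w' (T x) (map (frechet_derivative T (at x)) vs)"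
proof -
  let ?D = "\<lambda>y. frechet_derivative T (at y)"
  define S where "S = (\<lambda>u v. frechet_derivative (\<lambda>y. ?D y v) (at x) u)"
  have Td: "(T has_derivative ?D x) (at x)" using T U by (auto simp: numeral_2_eq_2 intro: has_derivative_frechet)
  have Dd: "((\<lambda>y. ?D y v) has_derivative (\<lambda>u. S u v)) (at x)" for v
    using T U unfolding S_def by (auto simp: numeral_2_eq_2 intro!: has_derivative_frechet)
  have Ssym: "S u v = S v u" for u v
    unfolding S_def by (rule second_derivative_symmetric_vector[OF U T])
  have deriv: "coeff_deriv u w x us = coeff_deriv (?D x u) w' (T x) (map (?D x) us) +
      (\<Sum>j<length us. w' (T x) ((map (?D x) us)[j := S u (us ! j)]))" for u us
  proof -
    have *: "((\<lambda>y. w' (T y) (map (\<lambda>g. g y) (map (\<lambda>v y. ?D y v) us))) has_derivative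
      (\<lambda>u. coeff_deriv (?D x u) w' (T x) (map (\<lambda>g. g x) (map (\<lambda>v y. ?D y v) us)) +
      (\<Sum>j<length (map (\<lambda>v y. ?D y v) us). w' (T x) ((map (\<lambda>g. g x) (map (\<lambda>v y. ?D y v) us))
         [j := frechet_derivative ((map (\<lambda>v y. ?D y v) us) ! j) (at x) u])))) (at x)"
      by (rule has_derivative_pullback[OF Td _ w'])
        (use Dd in \<open>auto simp: frechet_derivative_eqI[OF Dd]\<close>)
    have **: "((\<lambda>y. w' (T y) (map (?D y) us)) has_derivative
      (\<lambda>u. coeff_deriv (?D x u) w' (T x) (map (?D x) us) +
      (\<Sum>j<length us. w' (T x) ((map (?D x) us)[j := S u (us ! j)])))) (at x)"
    proof -
      have "(\<Sum>j<length us. w' (T x) ((map (?D x) us)[j := frechet_derivative ((map (\<lambda>v y. ?D y v) us) ! j) (at x) u])) =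
        (\<Sum>j<length us. w' (T x) ((map (?D x) us)[j := S u (us ! j)]))" for u
        by (rule sum.cong[OF HOL.refl]) (simp add: frechet_derivative_eqI[OF Dd])
      then show ?thesis using * by (simp add: comp_def)
    qed
    show ?thesis
      by (rule coeff_derivI) (rule has_derivative_transform_within_open[OF ** U], simp add: w)
  qed
  have len: "length (take i vs @ drop (Suc i) vs) = length vs - 1" if "i < length vs" for i using that by simp
  have "local_d w x vs = (\<Sum>i<length vs. (-1) ^ i * coeff_deriv (?D x (vs ! i)) w' (T x) (map (?D x) (take i vs @ drop (Suc i) vs)))
    + (\<Sum>i<length vs. (-1) ^ i * (\<Sum>j<length vs - 1.
       w' (T x) ((map (?D x) (take i vs @ drop (Suc i) vs))[j := S (vs ! i) ((take i vs @ drop (Suc i) vs) ! j)])))"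
    unfolding local_d_eq deriv sum.distrib[symmetric]
    by (rule sum.cong[OF HOL.refl]) (simp add: distrib_left One_nat_def)
  also have "(\<Sum>i<length vs. (-1) ^ i * (\<Sum>j<length vs - 1.
       w' (T x) ((map (?D x) (take i vs @ drop (Suc i) vs))[j := S (vs ! i) ((take i vs @ drop (Suc i) vs) ! j)]))) = 0"
    by (rule hessian_terms_cancel[OF Ssym w'(1)])
  also have "(\<Sum>i<length vs. (-1) ^ i * coeff_deriv (?D x (vs ! i)) w' (T x) (map (?D x) (take i vs @ drop (Suc i) vs))) + 0 =
    local_d w' (T x) (map (?D x) vs)"
    unfolding local_d_eq by (simp add: take_map drop_map)
  finally show ?thesis .
qed

end

section \<open>The de Rham complex\<close>

sublocale smooth_manifold \<subseteq> finite_dim_model "TYPE('e)"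
  by unfold_locales (rule model_finite_dim)

context smooth_manifold
begin

abbreviation "dR \<equiv> de_Rham A"

lemma chart_image_open: "c \<in> A \<Longrightarrow> open (chart_image c)"
  using chart by blast

lemma chart_inj: "c \<in> A \<Longrightarrow> inj_on (snd c) (fst c)"
proof -
  assume c: "c \<in> A"
  have "topspace (subtopology M (fst c)) = fst c"
    using chart[OF c] openin_subset by (fastforce simp: topspace_subtopology)
  then show ?thesis
    using homeomorphic_imp_injective_map chart[OF c] by metis
qed

lemma chart_overlap_subset: "chart_overlap c c' \<subseteq> chart_image c"
  by (auto simp: chart_overlap_def chart_image_def)

lemma chart_overlap_open:
  assumes c: "c \<in> A" and c': "c' \<in> A"
  shows "open (chart_overlap c c')"
proof -
  have "openin (subtopology M (fst c)) (fst c \<inter> fst c')"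
    using chart[OF c'] by (simp add: openin_subtopology_Int2)
  then have "openin (top_of_set (chart_image c)) (snd c ` (fst c \<inter> fst c'))"
    using homeomorphic_imp_open_map chart[OF c] unfolding open_map_def by blast
  then show ?thesis
    using chart_image_open[OF c] by (simp add: chart_overlap_def openin_open_eq)
qed

lemma transition_in:
  assumes "c \<in> A" "x \<in> chart_overlap c c'"
  shows "transition c c' x \<in> chart_image c'"
proof -
  obtain m where "x = snd c m" "m \<in> fst c" "m \<in> fst c'" using assms(2) by (auto simp: chart_overlap_def)
  then show ?thesis
    using chart_inj[OF assms(1)] by (simp add: transition_def chart_image_def inv_into_f_f)
qed

lemma transition_Ck: "c \<in> A \<Longrightarrow> c' \<in> A \<Longrightarrow> Ck_on k (transition c c') (chart_overlap c c')"
  using smooth_transition by (simp add: smooth_on_def)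

lemma transition_differentiable:
  "\<lbrakk>c \<in> A; c' \<in> A; x \<in> chart_overlap c c'\<rbrakk> \<Longrightarrow> transition c c' differentiable (at x)"
  using smooth_transition smooth_on_differentiable by blast

lemma forms_alternating: "\<omega> \<in> forms A k \<Longrightarrow> \<omega> c x \<in> alternating k"
  and forms_outside: "\<omega> \<in> forms A k \<Longrightarrow> \<not> (c \<in> A \<and> x \<in> chart_image c) \<Longrightarrow> \<omega> c x = 0"
  and forms_smooth: "\<omega> \<in> forms A k \<Longrightarrow> c \<in> A \<Longrightarrow> coeff_smooth (\<omega> c) (chart_image c)"
  and forms_natural: "\<lbrakk>\<omega> \<in> forms A k; c \<in> A; c' \<in> A; x \<in> chart_overlap c c'\<rbrakk>
    \<Longrightarrow> \<omega> c x vs = \<omega> c' (transition c c' x) (map (frechet_derivative (transition c c') (at x)) vs)"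
  by (simp_all add: forms_def coeff_smooth_def del: split_paired_All)

lemma formsI:
  assumes "\<And>c x. \<omega> c x \<in> alternating k"
    and "\<And>c x. \<not> (c \<in> A \<and> x \<in> chart_image c) \<Longrightarrow> \<omega> c x = 0"
    and "\<And>c. c \<in> A \<Longrightarrow> coeff_smooth (\<omega> c) (chart_image c)"
    and "\<And>c c' x vs. \<lbrakk>c \<in> A; c' \<in> A; x \<in> chart_overlap c c'; x \<in> chart_image c; transition c c' x \<in> chart_image c'\<rbrakk>
      \<Longrightarrow> \<omega> c x vs = \<omega> c' (transition c c' x) (map (frechet_derivative (transition c c') (at x)) vs)"
  shows "\<omega> \<in> forms A k"
  unfolding forms_def mem_Collect_eq
proof (intro conjI allI ballI impI)
  show "smooth_on (\<lambda>x. \<omega> c x vs) (chart_image c)" if "c \<in> A" for c vs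
    using assms(3)[OF that] by (simp add: coeff_smooth_def)
  show "\<omega> c x vs = \<omega> c' (transition c c' x) (map (frechet_derivative (transition c c') (at x)) vs)"
    if "c \<in> A" "c' \<in> A" "x \<in> chart_overlap c c'" for c c' x vs
    using assms(4)[OF that] transition_in[OF that(1,3)] chart_overlap_subset[of c c'] that(3) by auto
qed (rule assms(1), rule assms(2))

lemma subspace_forms: "subspace (forms A k)"
proof (rule subspaceI)
  show "0 \<in> forms A k"
    by (rule formsI) (auto simp: coeff_smooth_def smooth_on_const chart_image_open subspace_0[OF subspace_alternating])
next
  fix \<alpha> \<beta> assume *: "\<alpha> \<in> forms A k" "\<beta> \<in> forms A k"
  show "\<alpha> + \<beta> \<in> forms A k"
  proof (rule formsI)
    show "(\<alpha> + \<beta>) c x \<in> alternating k" for c x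
      using subspace_add[OF subspace_alternating forms_alternating[OF *(1)] forms_alternating[OF *(2)]] by simp
    show "(\<alpha> + \<beta>) c x = 0" if "\<not> (c \<in> A \<and> x \<in> chart_image c)" for c x
      using forms_outside[OF *(1) that] forms_outside[OF *(2) that] by simp
    show "coeff_smooth ((\<alpha> + \<beta>) c) (chart_image c)" if "c \<in> A" for c
      using forms_smooth[OF *(1) that] forms_smooth[OF *(2) that] that
      by (simp add: coeff_smooth_def smooth_on_add chart_image_open)
  qed (simp add: forms_natural[OF *(1)] forms_natural[OF *(2)])
next
  fix r and \<alpha> assume *: "\<alpha> \<in> forms A k"
  show "r *\<^sub>R \<alpha> \<in> forms A k"
  proof (rule formsI)
    show "(r *\<^sub>R \<alpha>) c x \<in> alternating k" for c x
      using subspace_scale[OF subspace_alternating forms_alternating[OF *]] by simp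
    show "(r *\<^sub>R \<alpha>) c x = 0" if "\<not> (c \<in> A \<and> x \<in> chart_image c)" for c x
      using forms_outside[OF * that] by simp
    show "coeff_smooth ((r *\<^sub>R \<alpha>) c) (chart_image c)" if "c \<in> A" for c
      using forms_smooth[OF * that] that
      by (simp add: coeff_smooth_def smooth_on_mult smooth_on_const chart_image_open)
  qed (simp add: forms_natural[OF *])
qed

lemma ext_d_inside: "c \<in> A \<Longrightarrow> x \<in> chart_image c \<Longrightarrow> ext_d A \<omega> c x = local_d (\<omega> c) x"
  and ext_d_outside: "\<not> (c \<in> A \<and> x \<in> chart_image c) \<Longrightarrow> ext_d A \<omega> c x = 0"
  by (auto simp: ext_d_def local_d_def fun_eq_iff)

lemma forms_coeff_differentiable:
  "\<omega> \<in> forms A k \<Longrightarrow> c \<in> A \<Longrightarrow> x \<in> chart_image c \<Longrightarrow> coeff_differentiable (\<omega> c) x"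
  using forms_smooth coeff_smooth_differentiable by blast

lemma ext_d_forms:
  assumes \<omega>: "\<omega> \<in> forms A k"
  shows "ext_d A \<omega> \<in> forms A (Suc k)"
proof (rule formsI)
  show "ext_d A \<omega> c x \<in> alternating (Suc k)" for c x
    using local_d_alternating[OF forms_alternating[OF \<omega>] forms_coeff_differentiable[OF \<omega>], of c x]
    by (cases "c \<in> A \<and> x \<in> chart_image c")
      (simp_all add: ext_d_inside ext_d_outside subspace_0[OF subspace_alternating])
  show "ext_d A \<omega> c x = 0" if "\<not> (c \<in> A \<and> x \<in> chart_image c)" for c x
    using that by (rule ext_d_outside)
  show "coeff_smooth (ext_d A \<omega> c) (chart_image c)" if c: "c \<in> A" for c
    unfolding coeff_smooth_def
  proof
    fix vs
    have "smooth_on (\<lambda>x. local_d (\<omega> c) x vs) (chart_image c)"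
      using coeff_smooth_local_d[OF chart_image_open[OF c] forms_smooth[OF \<omega> c]] by (simp add: coeff_smooth_def)
    then show "smooth_on (\<lambda>x. ext_d A \<omega> c x vs) (chart_image c)"
      by (rule smooth_on_cong[OF chart_image_open[OF c], rotated]) (simp add: ext_d_inside c)
  qed
  fix c c' x vs
  assume *: "c \<in> A" "c' \<in> A" "x \<in> chart_overlap c c'" "x \<in> chart_image c" "transition c c' x \<in> chart_image c'"
  have "local_d (\<omega> c) x vs = local_d (\<omega> c') (transition c c' x) (map (frechet_derivative (transition c c') (at x)) vs)"
    by (rule local_d_natural[OF chart_overlap_open[OF *(1,2)] *(3) transition_Ck[OF *(1,2)] _ forms_alternating[OF \<omega>]
          forms_coeff_differentiable[OF \<omega> *(2,5)]])
      (rule forms_natural[OF \<omega> *(1,2)])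
  then show "ext_d A \<omega> c x vs = ext_d A \<omega> c' (transition c c' x) (map (frechet_derivative (transition c c') (at x)) vs)"
    by (simp add: ext_d_inside *)
qed

lemma cx_de_Rham: "cx dR k = (if 0 \<le> k then forms A (nat k) else {0})" and cx_d_de_Rham: "cx_d dR k = ext_d A"
  by (simp_all add: de_Rham_def)

lemma cx_forms: "\<omega> \<in> cx dR k \<Longrightarrow> \<omega> \<in> forms A (nat k)"
  using subspace_0[OF subspace_forms] by (auto simp: cx_de_Rham split: if_splits)

lemma cx_homogeneous:
  assumes "\<omega> \<in> cx dR k"
  shows "homogeneous k (\<omega> c x)"
proof (cases "0 \<le> k")
  case True
  then show ?thesis using alternating_homogeneous[OF forms_alternating[OF cx_forms[OF assms]], of c x] by simp
next
  case False
  then show ?thesis using assms by (simp add: cx_de_Rham)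
qed

lemma ext_d_linear:
  assumes "\<alpha> \<in> forms A k" "\<beta> \<in> forms A l"
  shows "ext_d A (a *\<^sub>R \<alpha> + b *\<^sub>R \<beta>) = a *\<^sub>R ext_d A \<alpha> + b *\<^sub>R ext_d A \<beta>"
proof (intro ext)
  fix c x vs
  show "ext_d A (a *\<^sub>R \<alpha> + b *\<^sub>R \<beta>) c x vs = (a *\<^sub>R ext_d A \<alpha> + b *\<^sub>R ext_d A \<beta>) c x vs"
  proof (cases "c \<in> A \<and> x \<in> chart_image c")
    case True
    then have d: "coeff_differentiable (\<alpha> c) x" "coeff_differentiable (\<beta> c) x"
      using forms_coeff_differentiable assms by blast+
    have "local_d ((a *\<^sub>R \<alpha> + b *\<^sub>R \<beta>) c) x = local_d (\<lambda>y. a *\<^sub>R \<alpha> c y + b *\<^sub>R \<beta> c y) x"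
      by (simp add: plus_fun_def scaleR_fun_def)
    also have "\<dots> = a *\<^sub>R local_d (\<alpha> c) x + b *\<^sub>R local_d (\<beta> c) x"
      by (simp only: local_d_linear(1)[OF coeff_differentiable_linear(3)[OF d(1)] coeff_differentiable_linear(3)[OF d(2)]]
          local_d_linear(3)[OF d(1) d(1)] local_d_linear(3)[OF d(2) d(2)])
    finally show ?thesis using True by (simp add: ext_d_inside)
  qed (simp add: ext_d_outside)
qed

lemma ext_d_ext_d:
  assumes "\<omega> \<in> forms A k"
  shows "ext_d A (ext_d A \<omega>) = 0"
proof (intro ext)
  fix c x vs
  show "ext_d A (ext_d A \<omega>) c x vs = 0 c x vs"
  proof (cases "c \<in> A \<and> x \<in> chart_image c")
    case True
    then have U: "open (chart_image c)" "x \<in> chart_image c" using chart_image_open by auto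
    have "local_d (ext_d A \<omega> c) x = local_d (local_d (\<omega> c)) x"
      by (rule local_d_cong[OF U]) (use True ext_d_forms[OF assms] forms_coeff_differentiable in \<open>auto simp: ext_d_inside\<close>)
    then show ?thesis using True local_d_local_d[OF U forms_smooth[OF assms]] by (simp add: ext_d_inside)
  qed (simp add: ext_d_outside)
qed

lemma de_Rham_is_cochain_complex: "is_cochain_complex dR"
  unfolding is_cochain_complex_def
proof (intro conjI allI ballI)
  show "subspace (cx dR k)" for k by (simp add: cx_de_Rham subspace_forms subspace_single_0)
  have d0: "ext_d A 0 = 0" using ext_d_linear[of 0 0 0 0 0 0] subspace_0[OF subspace_forms] by simp
  fix k x assume x: "x \<in> cx dR k"
  show "cx_d dR k x \<in> cx dR (k + 1)"
  proof (cases "0 \<le> k")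
    case True
    then have "nat (k + 1) = Suc (nat k)" by simp
    then show ?thesis using True ext_d_forms[OF cx_forms[OF x]] by (simp add: cx_de_Rham cx_d_de_Rham)
  next
    case False
    then show ?thesis using x d0 subspace_0[OF subspace_forms] by (simp add: cx_de_Rham cx_d_de_Rham)
  qed
  show "cx_d dR (k + 1) (cx_d dR k x) = 0"
    unfolding cx_d_de_Rham by (rule ext_d_ext_d[OF cx_forms[OF x]])
  show "cx_d dR k (a *\<^sub>R x + b *\<^sub>R y) = a *\<^sub>R cx_d dR k x + b *\<^sub>R cx_d dR k y" if "y \<in> cx dR k" for a b y
    unfolding cx_d_de_Rham by (rule ext_d_linear[OF cx_forms[OF x] cx_forms[OF that]])
qed

sublocale cochain_complex dR
  by unfold_locales (rule de_Rham_is_cochain_complex)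

subsection \<open>The exterior product\<close>

definition wedge :: "('m, 'e) form \<Rightarrow> ('m, 'e) form \<Rightarrow> ('m, 'e) form" where
  "wedge \<alpha> \<beta> c x = list_wedge (\<alpha> c x) (\<beta> c x)"

lemma form_wedge_eq:
  assumes "\<alpha> \<in> cx dR k" "\<beta> \<in> cx dR l"
  shows "form_wedge (nat k) (nat l) \<alpha> \<beta> = wedge \<alpha> \<beta>"
  unfolding form_wedge_def wedge_def
  by (intro ext fun_cong[OF alt_wedge_eq_list_wedge] alternating_homogeneous forms_alternating cx_forms assms)

lemma wedge_op_eq: "\<lbrakk>\<alpha> \<in> cx dR k; \<beta> \<in> cx dR l\<rbrakk> \<Longrightarrow> wedge_op A [(k, \<alpha>), (l, \<beta>)] = wedge \<alpha> \<beta>"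
  using form_wedge_eq by (simp add: wedge_op_def tuples_iff One_nat_def)

lemma wedge_zero: "wedge 0 \<beta> = 0" "wedge \<alpha> 0 = 0"
  by (simp_all add: wedge_def fun_eq_iff)

lemma wedge_linear:
  "wedge (a *\<^sub>R \<alpha> + b *\<^sub>R \<alpha>') \<beta> = a *\<^sub>R wedge \<alpha> \<beta> + b *\<^sub>R wedge \<alpha>' \<beta>"
  "wedge \<alpha> (a *\<^sub>R \<beta> + b *\<^sub>R \<beta>') = a *\<^sub>R wedge \<alpha> \<beta> + b *\<^sub>R wedge \<alpha> \<beta>'"
  by (simp_all add: wedge_def fun_eq_iff)

lemma wedge_forms:
  assumes \<alpha>: "\<alpha> \<in> forms A k" and \<beta>: "\<beta> \<in> forms A l"
  shows "wedge \<alpha> \<beta> \<in> forms A (k + l)"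
proof (rule formsI)
  show "wedge \<alpha> \<beta> c x \<in> alternating (k + l)" for c x
    unfolding wedge_def by (intro list_wedge_alternating forms_alternating \<alpha> \<beta>)
  show "wedge \<alpha> \<beta> c x = 0" if "\<not> (c \<in> A \<and> x \<in> chart_image c)" for c x
    using forms_outside[OF \<alpha> that] by (simp add: wedge_def)
  show "coeff_smooth (wedge \<alpha> \<beta> c) (chart_image c)" if "c \<in> A" for c
    using coeff_smooth_list_wedge[OF chart_image_open[OF that] forms_smooth[OF \<alpha> that] forms_smooth[OF \<beta> that]]
    by (simp add: wedge_def[abs_def])
  fix c c' x vs
  assume *: "c \<in> A" "c' \<in> A" "x \<in> chart_overlap c c'"
  let ?L = "frechet_derivative (transition c c') (at x)"
  have "\<alpha> c x = (\<lambda>vs. \<alpha> c' (transition c c' x) (map ?L vs))" "\<beta> c x = (\<lambda>vs. \<beta> c' (transition c c' x) (map ?L vs))"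
    using forms_natural[OF \<alpha> *] forms_natural[OF \<beta> *] by blast+
  then show "wedge \<alpha> \<beta> c x vs = wedge \<alpha> \<beta> c' (transition c c' x) (map ?L vs)"
    unfolding wedge_def by (simp only: list_wedge_map)
qed

lemma wedge_in:
  assumes "\<alpha> \<in> cx dR k" "\<beta> \<in> cx dR l"
  shows "wedge \<alpha> \<beta> \<in> cx dR (k + l)"
proof (cases "0 \<le> k \<and> 0 \<le> l")
  case True
  then show ?thesis using wedge_forms[of \<alpha> "nat k" \<beta> "nat l"] assms by (simp add: cx_de_Rham nat_add_distrib)
next
  case False
  then have "wedge \<alpha> \<beta> = 0" using assms wedge_zero by (auto simp: cx_de_Rham split: if_splits)
  then show ?thesis using cx_closed(1) by metis
qed

lemma wedge_assoc: "wedge (wedge \<alpha> \<beta>) \<gamma> = wedge \<alpha> (wedge \<beta> \<gamma>)"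
  by (simp add: wedge_def fun_eq_iff list_wedge_assoc)

lemma wedge_commute:
  assumes "\<alpha> \<in> cx dR k" "\<beta> \<in> cx dR l"
  shows "(-1) powi (k * l) *\<^sub>R wedge \<beta> \<alpha> = wedge \<alpha> \<beta>"
  unfolding wedge_def fun_eq_iff
  using list_wedge_commute[OF cx_homogeneous[OF assms(1)] cx_homogeneous[OF assms(2)]] by (simp add: wedge_def)

lemma ext_d_wedge:
  assumes \<alpha>: "\<alpha> \<in> cx dR k" and \<beta>: "\<beta> \<in> cx dR l"
  shows "ext_d A (wedge \<alpha> \<beta>) = wedge (ext_d A \<alpha>) \<beta> + (-1) powi k *\<^sub>R wedge \<alpha> (ext_d A \<beta>)"
proof (intro ext)
  fix c x vs
  show "ext_d A (wedge \<alpha> \<beta>) c x vs = (wedge (ext_d A \<alpha>) \<beta> + (-1) powi k *\<^sub>R wedge \<alpha> (ext_d A \<beta>)) c x vs"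
  proof (cases "c \<in> A \<and> x \<in> chart_image c")
    case True
    then have d: "coeff_differentiable (\<alpha> c) x" "coeff_differentiable (\<beta> c) x"
      using forms_coeff_differentiable[OF cx_forms] \<alpha> \<beta> by blast+
    have "local_d (wedge \<alpha> \<beta> c) x = local_d (\<lambda>y. list_wedge (\<alpha> c y) (\<beta> c y)) x"
      by (simp add: wedge_def[abs_def])
    then show ?thesis
      using True local_d_list_wedge[OF d]
      by (simp add: ext_d_inside wedge_def grading_twist_homogeneous[OF cx_homogeneous[OF \<alpha>]])
  qed (simp add: ext_d_outside wedge_def)
qed

lemma wedge_op_in: "wedge_op A \<in> ml 2 0"
proof (rule ml_I)
  fix zs assume "length zs = 2" "hl zs"
  then obtain k \<alpha> l \<beta> where "zs = [(k, \<alpha>), (l, \<beta>)]" "\<alpha> \<in> cx dR k" "\<beta> \<in> cx dR l"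
    by (auto simp: numeral_2_eq_2 length_Suc_conv)
  then show "wedge_op A zs \<in> cx dR (tdeg zs + 0)" by (simp add: wedge_op_eq wedge_in)
next
  fix us ws l a b x y
  assume *: "hl us" "hl ws" "length us + 1 + length ws = 2" "x \<in> cx dR l" "y \<in> cx dR l"
  then have z: "a *\<^sub>R x + b *\<^sub>R y \<in> cx dR l" by (auto simp: cx_closed)
  consider k \<gamma> where "us = []" "ws = [(k, \<gamma>)]" "\<gamma> \<in> cx dR k" | k \<gamma> where "us = [(k, \<gamma>)]" "ws = []" "\<gamma> \<in> cx dR k"
    using * by (cases us; cases ws) (auto simp: numeral_2_eq_2 One_nat_def)
  then show "wedge_op A (us @ (l, a *\<^sub>R x + b *\<^sub>R y) # ws) =
     a *\<^sub>R wedge_op A (us @ (l, x) # ws) + b *\<^sub>R wedge_op A (us @ (l, y) # ws)"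
    by cases (use * z in \<open>simp_all add: wedge_op_eq wedge_linear\<close>)
qed (simp add: wedge_op_def)

lemma unary_op_in:
  assumes "\<And>k \<omega>. \<omega> \<in> cx dR k \<Longrightarrow> T \<omega> \<in> cx dR (k + m)"
    and "\<And>k \<alpha> \<beta> a b. \<alpha> \<in> cx dR k \<Longrightarrow> \<beta> \<in> cx dR k \<Longrightarrow> T (a *\<^sub>R \<alpha> + b *\<^sub>R \<beta>) = a *\<^sub>R T \<alpha> + b *\<^sub>R T \<beta>"
  shows "unary_op A T \<in> ml 1 m"
proof (rule ml_I)
  fix zs assume "length zs = 1" "hl zs"
  then obtain k \<omega> where "zs = [(k, \<omega>)]" "\<omega> \<in> cx dR k" by (cases zs) auto
  then show "unary_op A T zs \<in> cx dR (tdeg zs + m)" using assms(1) by (simp add: unary_op_def tuples_iff)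
next
  fix us ws l a b x y
  assume *: "hl us" "hl ws" "length us + 1 + length ws = 1" "x \<in> cx dR l" "y \<in> cx dR l"
  then have "a *\<^sub>R x + b *\<^sub>R y \<in> cx dR l" by (auto simp: cx_closed)
  then show "unary_op A T (us @ (l, a *\<^sub>R x + b *\<^sub>R y) # ws) =
     a *\<^sub>R unary_op A T (us @ (l, x) # ws) + b *\<^sub>R unary_op A T (us @ (l, y) # ws)"
    using * assms(2) by (simp add: unary_op_def tuples_iff)
qed (simp add: unary_op_def)

lemma unary_op_apply: "\<omega> \<in> cx dR k \<Longrightarrow> unary_op A T [(k, \<omega>)] = T \<omega>"
  by (simp add: unary_op_def tuples_iff)

end

subsection \<open>Contraction with the Poisson bivector\<close>

context Poisson_manifold
begin

abbreviation "\<iota> \<equiv> interior_product 2 \<pi>"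

definition coefficient :: "('m, 'e) chart \<Rightarrow> 'e \<times> 'e \<Rightarrow> 'e \<Rightarrow> real" where
  "coefficient c p y = \<pi> c y [dual_basis (fst p), dual_basis (snd p)]"

lemma bivector_alternating: "\<pi> c x \<in> alternating 2"
  and bivector_smooth: "c \<in> A \<Longrightarrow> smooth_on (\<lambda>x. \<pi> c x \<alpha>s) (chart_image c)"
  and bivector_natural: "\<lbrakk>c \<in> A; c' \<in> A; x \<in> chart_overlap c c'\<rbrakk> \<Longrightarrow> \<pi> c' (transition c c' x) \<alpha>s =
      \<pi> c x (map (\<lambda>\<alpha>. \<alpha> o\<^sub>L Blinfun (frechet_derivative (transition c c') (at x))) \<alpha>s)"
  using bivector by (simp_all add: polyvector_fields_def del: split_paired_All)

lemma interior_product_eq: "\<iota> \<omega> c x = bivector_contract model_basis (coefficient c) x (\<omega> c x)"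
  by (simp add: fun_eq_iff interior_product_def contract_two bivector_contract_apply coefficient_def)

lemma interior_product_linear: "\<iota> (a *\<^sub>R \<alpha> + b *\<^sub>R \<beta>) = a *\<^sub>R \<iota> \<alpha> + b *\<^sub>R \<iota> \<beta>"
  by (simp add: fun_eq_iff interior_product_eq bivector_contract_apply sum.distrib sum_distrib_left algebra_simps)

lemma insert_two_alternating: "a \<in> alternating k \<Longrightarrow> insert_two u v a \<in> alternating (k - 2)"
  using insert_first_alternating_any[OF insert_first_alternating_any, of a k u v]
  by (simp add: insert_two_def numeral_2_eq_2)

lemma interior_product_forms:
  assumes \<omega>: "\<omega> \<in> forms A k"
  shows "\<iota> \<omega> \<in> forms A (k - 2)"
proof (rule formsI)
  show "\<iota> \<omega> c x \<in> alternating (k - 2)" for c x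
    unfolding interior_product_eq bivector_contract_def
    by (intro subspace_sum[OF subspace_alternating] subspace_scale[OF subspace_alternating]
        insert_two_alternating forms_alternating \<omega>)
  show "\<iota> \<omega> c x = 0" if "\<not> (c \<in> A \<and> x \<in> chart_image c)" for c x
    using forms_outside[OF \<omega> that] by (simp add: interior_product_eq fun_eq_iff bivector_contract_apply)
  show "coeff_smooth (\<iota> \<omega> c) (chart_image c)" if c: "c \<in> A" for c
    unfolding coeff_smooth_def interior_product_eq bivector_contract_apply coefficient_def
    using forms_smooth[OF \<omega> c, unfolded coeff_smooth_def]
    by (intro allI smooth_on_sum smooth_on_mult smooth_on_const chart_image_open[OF c] bivector_smooth[OF c]) blast
  fix c c' x vs
  assume *: "c \<in> A" "c' \<in> A" "x \<in> chart_overlap c c'"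
  let ?L = "frechet_derivative (transition c c') (at x)"
  have "bounded_linear ?L"
    using transition_differentiable[OF *] has_derivative_frechet has_derivative_bounded_linear by blast
  then have L: "blinfun_apply (Blinfun ?L) = ?L" by (rule bounded_linear_Blinfun_apply)
  have 1: "\<omega> c x = (\<lambda>vs. \<omega> c' (transition c c' x) (map (Blinfun ?L) vs))"
    unfolding L using forms_natural[OF \<omega> *] by blast
  have 2: "\<pi> c' (transition c c' x) = (\<lambda>\<alpha>s. \<pi> c x (map (\<lambda>\<alpha>. \<alpha> o\<^sub>L Blinfun ?L) \<alpha>s))"
    using bivector_natural[OF *] by blast
  show "\<iota> \<omega> c x vs = \<iota> \<omega> c' (transition c c' x) (map ?L vs)"
    unfolding interior_product_def 1 2
    using contract_two_natural[OF bivector_alternating forms_alternating[OF \<omega>], of c x c' "transition c c' x" "Blinfun ?L" vs]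
    by (simp add: L)
qed

lemma interior_product_in:
  assumes \<omega>: "\<omega> \<in> cx dR k"
  shows "\<iota> \<omega> \<in> cx dR (k - 2)"
proof (cases "2 \<le> k")
  case True
  then have "nat (k - 2) = nat k - 2" by simp
  then show ?thesis using True interior_product_forms[OF cx_forms[OF \<omega>]] by (simp add: cx_de_Rham)
next
  case False
  have "\<omega> c x (u # v # vs) = 0" for c x u v vs
    using cx_homogeneous[OF \<omega>, of c x] False by (auto simp: homogeneous_def)
  then have "\<iota> \<omega> = 0" by (simp add: fun_eq_iff interior_product_eq bivector_contract_apply)
  then show ?thesis using cx_closed(1) by metis
qed

lemma interior_op_in: "unary_op A \<iota> \<in> ml 1 (-2)"
  by (rule unary_op_in) (use interior_product_in in \<open>auto simp: interior_product_linear\<close>)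

lemma coefficient_swap: "coefficient c (snd p, fst p) y = - coefficient c p y"
  unfolding coefficient_def fst_conv snd_conv by (rule alternating_swap_first[OF bivector_alternating])

lemma coefficient_differentiable:
  "c \<in> A \<Longrightarrow> x \<in> chart_image c \<Longrightarrow> coefficient c p differentiable (at x)"
  unfolding coefficient_def[abs_def] using smooth_on_differentiable[OF bivector_smooth] by blast

text \<open>This is the value of \<open>[\<pi>, \<pi>]\<close> on three elements of the dual basis, up to the factor \<open>2\<close>. The
  cyclic sum comes from the three shuffles in the exterior product of \<open>\<pi>\<^sup>b\<close> and \<open>\<partial>\<^sub>b\<pi>\<close>.\<close>

lemma Jacobi_coefficients:
  assumes c: "c \<in> A" and x: "x \<in> chart_image c"
  shows "(\<Sum>b\<in>model_basis.
      coefficient c (i, b) x * frechet_derivative (coefficient c (j, k)) (at x) b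
      + coefficient c (j, b) x * frechet_derivative (coefficient c (k, i)) (at x) b
      + coefficient c (k, b) x * frechet_derivative (coefficient c (i, j)) (at x) b) = 0"
proof -
  let ?\<alpha>s = "[dual_basis i, dual_basis j, dual_basis k] :: ('e \<Rightarrow>\<^sub>L real) list"
  have "Schouten A 2 2 \<pi> \<pi> c x ?\<alpha>s = 0" by (simp add: Jacobi)
  then have 0: "Schouten_half 2 2 \<pi> \<pi> c x ?\<alpha>s = 0" using c x by (simp add: Schouten_def)
  have d: "(\<lambda>y. \<pi> c y \<beta>s) differentiable (at x)" for \<beta>s
    using smooth_on_differentiable[OF bivector_smooth[OF c] x] .
  have summand: "alt_wedge 1 2 (\<lambda>\<beta>s. \<pi> c x (\<beta>s @ [dual_basis b])) (\<lambda>\<beta>s. frechet_derivative (\<lambda>y. \<pi> c y \<beta>s) (at x) b) ?\<alpha>s =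
      coefficient c (i, b) x * frechet_derivative (coefficient c (j, k)) (at x) b
      + coefficient c (j, b) x * frechet_derivative (coefficient c (k, i)) (at x) b
      + coefficient c (k, b) x * frechet_derivative (coefficient c (i, j)) (at x) b" for b
  proof -
    have h1: "homogeneous (int 1) (\<lambda>\<beta>s. \<pi> c x (\<beta>s @ [dual_basis b]))"
      using alternating_homogeneous[OF bivector_alternating, of c x] by (auto simp: homogeneous_def)
    have h2: "homogeneous (int 2) (\<lambda>\<beta>s. frechet_derivative (\<lambda>y. \<pi> c y \<beta>s) (at x) b)"
    proof -
      have "(\<lambda>y. \<pi> c y \<beta>s) = (\<lambda>y. 0)" if "length \<beta>s \<noteq> 2" for \<beta>s
        using alternating_homogeneous[OF bivector_alternating] that by (auto simp: homogeneous_def)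
      then show ?thesis by (auto simp: homogeneous_def)
    qed
    have z: "\<pi> c y \<beta>s = 0" if "length \<beta>s \<noteq> 2" for y \<beta>s
      using alternating_homogeneous[OF bivector_alternating] that by (auto simp: homogeneous_def)
    have "(\<lambda>y. \<pi> c y [dual_basis i, dual_basis k]) = (\<lambda>y. - coefficient c (k, i) y)"
      using coefficient_swap[of c "(k, i)"] by (simp add: coefficient_def fun_eq_iff)
    then have sw: "frechet_derivative (\<lambda>y. \<pi> c y [dual_basis i, dual_basis k]) (at x) = (\<lambda>v. - frechet_derivative (coefficient c (k, i)) (at x) v)"
      using frechet_derivative_eqI[OF has_derivative_minus[OF has_derivative_frechet[OF coefficient_differentiable[OF c x]]], of "(k, i)"]
      by simp
    show ?thesis
      unfolding alt_wedge_eq_list_wedge[OF h1 h2]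
      by (simp add: z grading_twist_def sw) (simp add: coefficient_def[abs_def])
  qed
  show ?thesis
    using 0 unfolding Schouten_half_def by (simp add: summand One_nat_def[symmetric] del: One_nat_def)
qed

text \<open>As \<open>L\<^sub>\<pi> = [i\<^sub>\<pi>, d]\<close>, this is \<open>[i\<^sub>\<pi>, L\<^sub>\<pi>] = 0\<close>, in the form in which both sides have the sign of
  \<open>d(i\<^sub>\<pi>) = [d, i\<^sub>\<pi>]\<close>.\<close>

lemma interior_product_Lie_commute:
  assumes \<omega>: "\<omega> \<in> cx dR k"
  shows "\<iota> (ext_d A (\<iota> \<omega>) - \<iota> (ext_d A \<omega>)) = ext_d A (\<iota> (\<iota> \<omega>)) - \<iota> (ext_d A (\<iota> \<omega>))"
proof (intro ext)
  fix c x vs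
  note f = cx_forms[OF \<omega>]
  show "\<iota> (ext_d A (\<iota> \<omega>) - \<iota> (ext_d A \<omega>)) c x vs = (ext_d A (\<iota> (\<iota> \<omega>)) - \<iota> (ext_d A (\<iota> \<omega>))) c x vs"
  proof (cases "c \<in> A \<and> x \<in> chart_image c")
    case True
    then have c: "c \<in> A" and x: "x \<in> chart_image c" by auto
    let ?B = "model_basis :: 'e set" and ?P = "coefficient c"
    have d: "coeff_differentiable (\<omega> c) x" by (rule forms_coeff_differentiable[OF f c x])
    have io: "\<iota> \<omega>' c = (\<lambda>y. bivector_contract ?B ?P y (\<omega>' c y))" for \<omega>'
      by (simp add: fun_eq_iff interior_product_eq)
    have "bivector_contract ?B ?P x (bivector_Lie ?B ?P (\<omega> c) x) vs =
        bivector_Lie ?B ?P (\<lambda>y. bivector_contract ?B ?P y (\<omega> c y)) x vs"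
      by (rule bivector_contract_Lie_commute[OF model_basis(3) coefficient_swap coefficient_differentiable[OF c x]
            Jacobi_coefficients[OF c x] forms_alternating[OF f] d])
    moreover have "\<iota> (ext_d A (\<iota> \<omega>) - \<iota> (ext_d A \<omega>)) c x vs =
       - bivector_contract ?B ?P x (bivector_Lie ?B ?P (\<omega> c) x) vs"
      by (simp add: interior_product_eq bivector_contract_apply bivector_Lie_def ext_d_inside[OF c x] io
          sum_negf[symmetric] algebra_simps del: sum_negf)
    moreover have "(ext_d A (\<iota> (\<iota> \<omega>)) - \<iota> (ext_d A (\<iota> \<omega>))) c x vs =
       - bivector_Lie ?B ?P (\<lambda>y. bivector_contract ?B ?P y (\<omega> c y)) x vs"
      by (simp add: interior_product_eq bivector_Lie_def ext_d_inside[OF c x] io)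
    ultimately show ?thesis by simp
  next
    case False
    then show ?thesis
      using forms_outside[OF interior_product_forms[OF f] False] ext_d_outside[OF False]
      by (simp add: interior_product_eq bivector_contract_apply)
  qed
qed

text \<open>In each chart, \<open>i\<^sub>\<pi>\<close> is a combination of operators \<open>insert_two u v\<close>, with functions as
  coefficients.\<close>

lemma interior_product_order_two:
  assumes \<alpha>: "\<alpha> \<in> cx dR p" and \<beta>: "\<beta> \<in> cx dR q" and \<gamma>: "\<gamma> \<in> cx dR r"
  shows "\<iota> (wedge (wedge \<alpha> \<beta>) \<gamma>) =
    wedge (\<iota> (wedge \<alpha> \<beta>)) \<gamma>
    + (-1) powi (q * r) *\<^sub>R wedge (\<iota> (wedge \<alpha> \<gamma>)) \<beta>
    + (-1) powi (p * (q + r)) *\<^sub>R wedge (\<iota> (wedge \<beta> \<gamma>)) \<alpha>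
    - wedge (wedge (\<iota> \<alpha>) \<beta>) \<gamma>
    - (-1) powi (p * q) *\<^sub>R wedge (wedge (\<iota> \<beta>) \<alpha>) \<gamma>
    - (-1) powi ((p + q) * r) *\<^sub>R wedge (wedge (\<iota> \<gamma>) \<alpha>) \<beta>"
proof (intro ext)
  fix c x vs
  note h = cx_homogeneous[OF \<alpha>, of c x] cx_homogeneous[OF \<beta>, of c x] cx_homogeneous[OF \<gamma>, of c x]
  have sum_left: "list_wedge (\<Sum>i\<in>S. F i) b = (\<Sum>i\<in>S. list_wedge (F i) b)" for F :: "'e \<times> 'e \<Rightarrow> 'e list \<Rightarrow> real" and S b
    by (induction S rule: infinite_finite_induct) (simp_all only: simp_thms sum.infinite sum.empty sum.insert list_wedge_zero list_wedge_linear)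
  show "\<iota> (wedge (wedge \<alpha> \<beta>) \<gamma>) c x vs =
    (wedge (\<iota> (wedge \<alpha> \<beta>)) \<gamma>
    + (-1) powi (q * r) *\<^sub>R wedge (\<iota> (wedge \<alpha> \<gamma>)) \<beta>
    + (-1) powi (p * (q + r)) *\<^sub>R wedge (\<iota> (wedge \<beta> \<gamma>)) \<alpha>
    - wedge (wedge (\<iota> \<alpha>) \<beta>) \<gamma>
    - (-1) powi (p * q) *\<^sub>R wedge (wedge (\<iota> \<beta>) \<alpha>) \<gamma>
    - (-1) powi ((p + q) * r) *\<^sub>R wedge (wedge (\<iota> \<gamma>) \<alpha>) \<beta>) c x vs"
    unfolding wedge_def interior_product_eq bivector_contract_def plus_fun_apply minus_apply scaleR_fun_apply
      sum_left insert_two_order_two[OF h] list_wedge_linear sum_fun_apply real_scaleR_def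
    by (simp add: sum.distrib sum_subtractf sum_distrib_left algebra_simps)
qed

end

section \<open>Calculations in a DG operad\<close>

context dg_operad
begin

lemma smul_zero: "op_smul P n k a (op_zero P n k) = op_zero P n k"
  by (metis smul_smul zero_closed zero_smul mult_zero_right)

lemma cmp_zero_left: "g \<in> op_car P n l \<Longrightarrow> i < m \<Longrightarrow> op_cmp P m k n l i (op_zero P m k) g = op_zero P (m + n - 1) (k + l)"
  using cmp_smul_left[OF zero_closed, of g n l i m k 0] zero_smul[OF zero_closed, of m k]
    zero_smul[OF cmp_closed[OF zero_closed, of g n l i m k]] by metis

lemma cmp_zero_right: "f \<in> op_car P m k \<Longrightarrow> i < m \<Longrightarrow> op_cmp P m k n l i f (op_zero P n l) = op_zero P (m + n - 1) (k + l)"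
  using cmp_smul_right[of f m k "op_zero P n l" n l i 0] zero_smul[OF zero_closed, of n l]
    zero_smul[OF cmp_closed[of f m k "op_zero P n l" n l i]] zero_closed by metis

lemma dif_zero: "op_dif P n k (op_zero P n k) = op_zero P n (k + 1)"
  using dif_smul[OF zero_closed, of n k 0] zero_smul[OF zero_closed, of n k] zero_smul[OF dif_closed[OF zero_closed]] by metis

lemma zero_add: "op_add P n k (op_zero P n k) (op_zero P n k) = op_zero P n k"
  by (rule add_zero[OF zero_closed])

lemma eq_zero_if_eq_double:
  assumes x: "x \<in> op_car P n k" and "x = op_add P n k x x"
  shows "x = op_zero P n k"
proof -
  have m: "op_smul P n k (-1) x \<in> op_car P n k" by (rule smul_closed[OF x])
  have "op_zero P n k = op_add P n k (op_add P n k x x) (op_smul P n k (-1) x)"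
    using assms add_minus[OF x] by simp
  also have "\<dots> = x" by (simp add: add_assoc x m add_minus add_zero)
  finally show ?thesis ..
qed

text \<open>Differentiating \<open>1 \<circ> 1 = 1\<close> gives \<open>d(1) = d(1) + d(1)\<close>.\<close>

lemma dif_unit: "op_dif P 1 0 (op_unit P) = op_zero P 1 1"
proof (rule eq_zero_if_eq_double)
  note u = unit_closed
  have du: "op_dif P 1 0 (op_unit P) \<in> op_car P 1 1" using dif_closed[OF u] by simp
  show "op_dif P 1 0 (op_unit P) \<in> op_car P 1 1" by (rule du)
  have "op_dif P 1 0 (op_cmp P 1 0 1 0 0 (op_unit P) (op_unit P)) = op_add P 1 1
      (op_cmp P 1 1 1 0 0 (op_dif P 1 0 (op_unit P)) (op_unit P))
      (op_smul P 1 1 1 (op_cmp P 1 0 1 1 0 (op_unit P) (op_dif P 1 0 (op_unit P))))"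
    using dif_cmp[OF u u, of 0] by (simp add: One_nat_def[symmetric])
  then show "op_dif P 1 0 (op_unit P) = op_add P 1 1 (op_dif P 1 0 (op_unit P)) (op_dif P 1 0 (op_unit P))"
    using cmp_unit_left[OF u] cmp_unit_left[OF du] cmp_unit_right[OF du] by (simp add: smul_one du)
qed

lemma foldr_closed: "(\<And>a. a \<in> set xs \<Longrightarrow> f a \<in> op_car P n k) \<Longrightarrow> foldr (\<lambda>a. op_add P n k (f a)) xs (op_zero P n k) \<in> op_car P n k"
  by (induction xs) (auto simp: zero_closed add_closed)

lemma foldr_zero: "(\<And>a. a \<in> set xs \<Longrightarrow> f a = op_zero P n k) \<Longrightarrow> foldr (\<lambda>a. op_add P n k (f a)) xs (op_zero P n k) = op_zero P n k"
  by (induction xs) (auto simp: zero_add)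

end

text \<open>In the presented operad itself, every term has its own class as value.\<close>

lemma term_value_gen_class:
  "oterm_of R n k t \<Longrightarrow> term_value R (presented_operad R) (gen_class R) t = ocls R n k t"
proof (induction rule: oterm_of.induct)
  case (cmp m k s n l t i)
  then show ?case by (simp add: term_arity_degree presented_cmp)
qed (simp_all add: term_arity_degree presented_ops gen_class_def)

lemma term_value_relation:
  assumes "(s, t) \<in> rels R" "oterm_of R n k s" "oterm_of R n k t"
  shows "term_value R (presented_operad R) (gen_class R) s = term_value R (presented_operad R) (gen_class R) t"
  using ocls_eqI[OF oeq.rel[OF assms]] assms by (simp add: term_value_gen_class)

lemma gen_class_in: "g \<in> gens R \<Longrightarrow> gen_class R g \<in> op_car (presented_operad R) (gen_arity R g) (gen_degree R g)"
  unfolding gen_class_def by (rule presented_carI[OF oterm_of.gen])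

section \<open>The morphism from \<open>BV/\<Delta>\<close> to \<open>EBV\<close>\<close>

interpretation EBV: dg_operad EBV
  unfolding EBV_def by (rule dg_operad_presented_operad)

abbreviation "ebv_mu \<equiv> gen_class EBV_presentation EBV_mu"
abbreviation "ebv_i \<equiv> gen_class EBV_presentation EBV_i"

lemma EBV_presentation_simps:
  "gens EBV_presentation = UNIV"
  "gen_arity EBV_presentation EBV_mu = 2" "gen_degree EBV_presentation EBV_mu = 0"
  "gen_arity EBV_presentation EBV_i = 1" "gen_degree EBV_presentation EBV_i = -2"
  by (simp_all add: EBV_presentation_def)

lemma BVD_presentation_simps:
  "gens BVD_presentation = {BVD_mu, BVD_Delta} \<union> {BVD_phi n | n. 1 \<le> n}"
  "gen_arity BVD_presentation BVD_mu = 2" "gen_degree BVD_presentation BVD_mu = 0"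
  "gen_arity BVD_presentation BVD_Delta = 1" "gen_degree BVD_presentation BVD_Delta = -1"
  "gen_arity BVD_presentation (BVD_phi n) = 1" "gen_degree BVD_presentation (BVD_phi n) = - 2 * int n"
  by (simp_all add: BVD_presentation_def)

lemma oterm_of_EBV_gens: "oterm_of EBV_presentation 2 0 (Gen EBV_mu)" "oterm_of EBV_presentation 1 (-2) (Gen EBV_i)"
  using oterm_of.gen[of EBV_mu EBV_presentation] oterm_of.gen[of EBV_i EBV_presentation]
  by (simp_all add: EBV_presentation_simps)

lemma oterm_of_BVD_gens: "oterm_of BVD_presentation 2 0 (Gen BVD_mu)" "oterm_of BVD_presentation 1 (-1) (Gen BVD_Delta)"
  "1 \<le> n \<Longrightarrow> oterm_of BVD_presentation 1 (- 2 * int n) (Gen (BVD_phi n))"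
  using oterm_of.gen[of BVD_mu BVD_presentation] oterm_of.gen[of BVD_Delta BVD_presentation] oterm_of.gen[of "BVD_phi n" BVD_presentation]
  by (simp_all add: BVD_presentation_simps)

lemma EBV_gens_in: "ebv_mu \<in> op_car EBV 2 0" "ebv_i \<in> op_car EBV 1 (-2)"
  using gen_class_in[of EBV_mu EBV_presentation] gen_class_in[of EBV_i EBV_presentation]
  by (simp_all add: EBV_def EBV_presentation_simps)

abbreviation "ebv_di \<equiv> op_dif EBV 1 (-2) ebv_i"

lemma ebv_di_in: "ebv_di \<in> op_car EBV 1 (-1)"
  using EBV.dif_closed[OF EBV_gens_in(2)] by simp

abbreviation "ebv_value \<equiv> term_value EBV_presentation EBV (gen_class EBV_presentation)"

lemma EBV_relation:
  assumes "(s, t) \<in> rels EBV_presentation" "oterm_of EBV_presentation n k s" "oterm_of EBV_presentation n k t"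
  shows "ebv_value s = ebv_value t"
  using term_value_relation[OF assms] by (simp add: EBV_def)

lemma EBV_relations:
  "op_act EBV 2 0 ebv_mu (Transposition.transpose 0 1) = ebv_mu"
  "op_dif EBV 2 0 ebv_mu = op_zero EBV 2 1"
  "op_cmp EBV 2 0 2 0 0 ebv_mu ebv_mu = op_cmp EBV 2 0 2 0 1 ebv_mu ebv_mu"
  "op_cmp EBV 1 (-2) 1 (-1) 0 ebv_i ebv_di = op_cmp EBV 1 (-1) 1 (-2) 0 ebv_di ebv_i"
  "ebv_value (DO_term (Gen EBV_mu) 2 (-2) (Gen EBV_i)) = op_zero EBV 3 (-2)"
proof -
  note g = oterm_of_EBV_gens
  have ad: "term_arity EBV_presentation (Gen EBV_mu) = 2" "term_degree EBV_presentation (Gen EBV_mu) = 0"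
    "term_arity EBV_presentation (Gen EBV_i) = 1" "term_degree EBV_presentation (Gen EBV_i) = -2"
    using term_arity_degree[OF g(1)] term_arity_degree[OF g(2)] by auto
  have tr: "Transposition.transpose 0 1 permutes {..<2::nat}" by (rule permutes_swap_id) auto
  have rel: "(s, t) \<in> rels EBV_presentation" if "(s, t) \<in> {
      (Act (Gen EBV_mu) (Transposition.transpose 0 1), Gen EBV_mu),
      (Dif (Gen EBV_mu), Zero 2 1),
      (Cmp 0 (Gen EBV_mu) (Gen EBV_mu), Cmp 1 (Gen EBV_mu) (Gen EBV_mu)),
      (Cmp 0 (Gen EBV_i) (Dif (Gen EBV_i)), Cmp 0 (Dif (Gen EBV_i)) (Gen EBV_i)),
      (DO_term (Gen EBV_mu) 2 (-2) (Gen EBV_i), Zero 3 (-2)) }" for s t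
    using that by (simp add: EBV_presentation_def)
  have di: "oterm_of EBV_presentation 1 (-1) (Dif (Gen EBV_i))" by (rule oterm_of_dif_eq[OF g(2)]) simp
  have "ebv_value (Act (Gen EBV_mu) (Transposition.transpose 0 1)) = ebv_value (Gen EBV_mu)"
    by (rule EBV_relation[OF rel oterm_of.act[OF g(1) tr] g(1)]) simp
  then show "op_act EBV 2 0 ebv_mu (Transposition.transpose 0 1) = ebv_mu" using ad by simp
  have "ebv_value (Dif (Gen EBV_mu)) = ebv_value (Zero 2 1)"
    by (rule EBV_relation[OF rel oterm_of_dif_eq[OF g(1)] oterm_of.zero]) simp_all
  then show "op_dif EBV 2 0 ebv_mu = op_zero EBV 2 1" using ad by simp
  have "ebv_value (Cmp 0 (Gen EBV_mu) (Gen EBV_mu)) = ebv_value (Cmp 1 (Gen EBV_mu) (Gen EBV_mu))"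
    by (rule EBV_relation[OF rel oterm_of.cmp[OF g(1) g(1)] oterm_of.cmp[OF g(1) g(1)]]) simp_all
  then show "op_cmp EBV 2 0 2 0 0 ebv_mu ebv_mu = op_cmp EBV 2 0 2 0 1 ebv_mu ebv_mu" using ad by simp
  have "ebv_value (Cmp 0 (Gen EBV_i) (Dif (Gen EBV_i))) = ebv_value (Cmp 0 (Dif (Gen EBV_i)) (Gen EBV_i))"
    by (rule EBV_relation[OF rel, of _ _ 1 "-3"])
      (simp, rule oterm_of_cmp_eq[OF g(2) di], simp_all, rule oterm_of_cmp_eq[OF di g(2)], simp_all)
  then show "op_cmp EBV 1 (-2) 1 (-1) 0 ebv_i ebv_di = op_cmp EBV 1 (-1) 1 (-2) 0 ebv_di ebv_i" using ad by simp
  have "ebv_value (DO_term (Gen EBV_mu) 2 (-2) (Gen EBV_i)) = ebv_value (Zero 3 (-2))"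
    using oterm_of_DO_term[OF g, of 2] by (intro EBV_relation[OF rel _ oterm_of.zero]) simp_all
  then show "ebv_value (DO_term (Gen EBV_mu) 2 (-2) (Gen EBV_i)) = op_zero EBV 3 (-2)" by simp
qed

text \<open>Applying \<open>d\<close> to \<open>i d(i) = d(i) i\<close> gives \<open>d(i)\<^sup>2 = - d(i)\<^sup>2\<close>.\<close>

lemma ebv_di_squared: "op_cmp EBV 1 (-1) 1 (-1) 0 ebv_di ebv_di = op_zero EBV 1 (-2)" (is "?X = _")
proof -
  note i = EBV_gens_in(2) and di = ebv_di_in
  have X: "?X \<in> op_car EBV 1 (-2)" using EBV.cmp_closed[OF di di, of 0] by (simp add: One_nat_def[symmetric])
  have ddi: "op_dif EBV 1 (-1) ebv_di = op_zero EBV 1 0" using EBV.dif_dif[OF i] by simp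
  have "op_dif EBV 1 (-3) (op_cmp EBV 1 (-2) 1 (-1) 0 ebv_i ebv_di) = ?X"
    using EBV.dif_cmp[OF i di, of 0] EBV.cmp_zero_right[OF i, of 0 1 0]
    by (simp add: One_nat_def[symmetric] ddi EBV.smul_zero EBV.smul_one EBV.zero_closed EBV.add_zero X)
  moreover have "op_dif EBV 1 (-3) (op_cmp EBV 1 (-1) 1 (-2) 0 ebv_di ebv_i) = op_smul EBV 1 (-2) (-1) ?X"
    using EBV.dif_cmp[OF di i, of 0] EBV.cmp_zero_left[OF i, of 0 1 0] EBV.smul_closed[OF X, of "-1"]
    by (simp add: One_nat_def[symmetric] ddi EBV.add_commute[OF EBV.zero_closed] EBV.add_zero)
  ultimately have eq: "?X = op_smul EBV 1 (-2) (-1) ?X" using EBV_relations(4) by simp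
  have "op_add EBV 1 (-2) ?X ?X = op_zero EBV 1 (-2)" using EBV.add_minus[OF X] eq by simp
  then have "op_smul EBV 1 (-2) 2 ?X = op_zero EBV 1 (-2)"
    using EBV.add_smul[OF X, of 1 1] by (simp add: EBV.smul_one[OF X])
  then have "op_smul EBV 1 (-2) (1/2 * 2) ?X = op_zero EBV 1 (-2)"
    using EBV.smul_smul[OF X, of "1/2" 2] by (simp add: EBV.smul_zero)
  then show ?thesis by (simp add: EBV.smul_one[OF X])
qed

definition bvd_assign :: "bvd_gen \<Rightarrow> ebv_gen oterm set" where
  "bvd_assign g = (case g of BVD_mu \<Rightarrow> ebv_mu | BVD_Delta \<Rightarrow> op_smul EBV 1 (-1) (-1) ebv_di
     | BVD_phi n \<Rightarrow> if n = 1 then ebv_i else op_zero EBV 1 (- 2 * int n))"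

lemma bvd_assign_in: "g \<in> gens BVD_presentation \<Longrightarrow>
    bvd_assign g \<in> op_car EBV (gen_arity BVD_presentation g) (gen_degree BVD_presentation g)"
  by (auto simp: BVD_presentation_simps bvd_assign_def EBV_gens_in EBV.smul_closed ebv_di_in EBV.zero_closed)

abbreviation "bvd_value \<equiv> term_value BVD_presentation EBV bvd_assign"

text \<open>Since \<open>d(\<mu>) = 0\<close>, differentiating a relation \<open>DO\<^sub>n(D)\<close> yields \<open>DO\<^sub>n(d(D))\<close>. It is enough to follow
  the relation \<open>t' = - d(t)\<close> between terms through the construction of \<open>DO_term\<close>.\<close>

definition minus_dif_of :: "nat \<Rightarrow> int \<Rightarrow> bvd_gen oterm \<Rightarrow> ebv_gen oterm \<Rightarrow> bool" where
  "minus_dif_of n k t' t \<longleftrightarrow> oterm_of BVD_presentation n (k + 1) t' \<and> oterm_of EBV_presentation n k t \<and>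
    bvd_value t' = op_smul EBV n (k + 1) (-1) (op_dif EBV n k (ebv_value t))"

lemma ebv_value_in: "oterm_of EBV_presentation n k t \<Longrightarrow> ebv_value t \<in> op_car EBV n k"
  using term_value_in_car[OF EBV.dg_operad_axioms, of EBV_presentation "gen_class EBV_presentation"]
    gen_class_in[of _ EBV_presentation] by (simp add: EBV_def)

lemma mu_pow_closed_value:
  "bvd_value (mu_pow (Gen BVD_mu) (Suc q)) = ebv_value (mu_pow (Gen EBV_mu) (Suc q)) \<and>
    op_dif EBV (Suc q) 0 (ebv_value (mu_pow (Gen EBV_mu) (Suc q))) = op_zero EBV (Suc q) 1"
proof (induction q)
  case 0
  then show ?case using EBV.dif_unit by (simp add: One_nat_def)
next
  case (Suc q)
  let ?M = "ebv_value (mu_pow (Gen EBV_mu) (Suc q))"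
  note t = oterm_of_mu_pow[OF oterm_of_EBV_gens(1), of q] oterm_of_mu_pow[OF oterm_of_BVD_gens(1), of q]
  note m = EBV_gens_in(1)
  have M: "?M \<in> op_car EBV (Suc q) 0" by (rule ebv_value_in[OF t(1)])
  have ad: "term_arity EBV_presentation (Gen EBV_mu) = 2" "term_degree EBV_presentation (Gen EBV_mu) = 0"
    "term_arity BVD_presentation (Gen BVD_mu) = 2" "term_degree BVD_presentation (Gen BVD_mu) = 0"
    using term_arity_degree[OF oterm_of_EBV_gens(1)] term_arity_degree[OF oterm_of_BVD_gens(1)] by auto
  have v: "ebv_value (mu_pow (Gen EBV_mu) (Suc (Suc q))) = op_cmp EBV 2 0 (Suc q) 0 0 ebv_mu ?M"
    using term_arity_degree[OF t(1)] ad by simp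
  have v': "bvd_value (mu_pow (Gen BVD_mu) (Suc (Suc q))) = op_cmp EBV 2 0 (Suc q) 0 0 ebv_mu ?M"
    using term_arity_degree[OF t(2)] ad conjunct1[OF Suc]
    by (simp add: bvd_assign_def[of BVD_mu])
  have "op_dif EBV (Suc (Suc q)) 0 (op_cmp EBV 2 0 (Suc q) 0 0 ebv_mu ?M) = op_zero EBV (Suc (Suc q)) 1"
    using EBV.dif_cmp[OF m M, of 0] EBV.cmp_zero_left[OF M, of 0 2 1] EBV.cmp_zero_right[OF m, of 0 "Suc q" 1] Suc
    by (simp add: EBV_relations(2) EBV.smul_zero EBV.zero_add)
  then show ?case unfolding v v' by simp
qed

lemma minus_dif_of_generator_product:
  assumes "1 \<le> p"
  shows "minus_dif_of p (-2) (Cmp 0 (Gen BVD_Delta) (mu_pow (Gen BVD_mu) p)) (Cmp 0 (Gen EBV_i) (mu_pow (Gen EBV_mu) p))"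
proof -
  obtain q where p: "p = Suc q" using assms by (cases p) auto
  let ?M = "ebv_value (mu_pow (Gen EBV_mu) p)"
  note t = oterm_of_mu_pow[OF oterm_of_EBV_gens(1), of q, folded p] oterm_of_mu_pow[OF oterm_of_BVD_gens(1), of q, folded p]
  note i = EBV_gens_in(2)
  have M: "?M \<in> op_car EBV p 0" by (rule ebv_value_in[OF t(1)])
  have dM: "op_dif EBV p 0 ?M = op_zero EBV p 1" and M': "bvd_value (mu_pow (Gen BVD_mu) p) = ?M"
    using mu_pow_closed_value[of q] p by auto
  have ad: "term_arity EBV_presentation (Gen EBV_i) = 1" "term_degree EBV_presentation (Gen EBV_i) = -2"
    "term_arity BVD_presentation (Gen BVD_Delta) = 1" "term_degree BVD_presentation (Gen BVD_Delta) = -1"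
    using term_arity_degree[OF oterm_of_EBV_gens(2)] term_arity_degree[OF oterm_of_BVD_gens(2)] by auto
  have c: "op_cmp EBV 1 (-1) p 0 0 ebv_di ?M \<in> op_car EBV p (-1)"
    using EBV.cmp_closed[OF ebv_di_in M, of 0] by simp
  have "op_dif EBV p (-2) (op_cmp EBV 1 (-2) p 0 0 ebv_i ?M) = op_cmp EBV 1 (-1) p 0 0 ebv_di ?M"
    using EBV.dif_cmp[OF i M, of 0] EBV.cmp_zero_right[OF i, of 0 p 1]
    by (simp add: dM EBV.smul_zero EBV.smul_one EBV.zero_closed EBV.add_zero c)
  moreover have "bvd_value (Cmp 0 (Gen BVD_Delta) (mu_pow (Gen BVD_mu) p)) =
      op_smul EBV p (-1) (-1) (op_cmp EBV 1 (-1) p 0 0 ebv_di ?M)"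
    using term_arity_degree[OF t(2)] ad EBV.cmp_smul_left[OF ebv_di_in M, of 0 "-1"] by (simp add: M' bvd_assign_def)
  ultimately show ?thesis
    unfolding minus_dif_of_def
    using term_arity_degree[OF t(1)] ad
    by (auto intro!: oterm_of_cmp_eq[OF oterm_of_EBV_gens(2) t(1)] oterm_of_cmp_eq[OF oterm_of_BVD_gens(2) t(2)])
qed

lemma minus_dif_of_mu_pow:
  assumes x: "minus_dif_of n k t' t" and n: "1 \<le> n"
  shows "minus_dif_of (q + n) k (Cmp 0 (mu_pow (Gen BVD_mu) (Suc q)) t') (Cmp 0 (mu_pow (Gen EBV_mu) (Suc q)) t)"
proof -
  let ?M = "ebv_value (mu_pow (Gen EBV_mu) (Suc q))"
  note m = oterm_of_mu_pow[OF oterm_of_EBV_gens(1), of q] oterm_of_mu_pow[OF oterm_of_BVD_gens(1), of q]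
  have t: "oterm_of EBV_presentation n k t" "oterm_of BVD_presentation n (k + 1) t'"
    and v: "bvd_value t' = op_smul EBV n (k + 1) (-1) (op_dif EBV n k (ebv_value t))"
    using x by (auto simp: minus_dif_of_def)
  have M: "?M \<in> op_car EBV (Suc q) 0" by (rule ebv_value_in[OF m(1)])
  have T: "ebv_value t \<in> op_car EBV n k" by (rule ebv_value_in[OF t(1)])
  have dT: "op_dif EBV n k (ebv_value t) \<in> op_car EBV n (k + 1)" by (rule EBV.dif_closed[OF T])
  have N: "Suc q + n - 1 = q + n" using n by simp
  have c: "op_cmp EBV (Suc q) 0 n (k + 1) 0 ?M (op_dif EBV n k (ebv_value t)) \<in> op_car EBV (q + n) (k + 1)"
    using EBV.cmp_closed[OF M dT, of 0] N by simp
  have "op_dif EBV (q + n) k (op_cmp EBV (Suc q) 0 n k 0 ?M (ebv_value t)) =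
      op_add EBV (q + n) (k + 1) (op_zero EBV (q + n) (k + 1)) (op_cmp EBV (Suc q) 0 n (k + 1) 0 ?M (op_dif EBV n k (ebv_value t)))"
    using EBV.dif_cmp[OF M T, of 0] EBV.cmp_zero_left[OF T, of 0 "Suc q" 1] mu_pow_closed_value[of q] N c
    by (simp add: EBV.smul_one add.commute[of 1 k])
  also have "\<dots> = op_cmp EBV (Suc q) 0 n (k + 1) 0 ?M (op_dif EBV n k (ebv_value t))"
    by (simp add: EBV.add_commute[OF EBV.zero_closed c] EBV.add_zero c)
  finally have d: "op_dif EBV (q + n) k (op_cmp EBV (Suc q) 0 n k 0 ?M (ebv_value t)) =
      op_cmp EBV (Suc q) 0 n (k + 1) 0 ?M (op_dif EBV n k (ebv_value t))" .
  have "bvd_value (Cmp 0 (mu_pow (Gen BVD_mu) (Suc q)) t') = op_cmp EBV (Suc q) 0 n (k + 1) 0 ?M (bvd_value t')"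
    using term_arity_degree[OF m(2)] term_arity_degree[OF t(2)] mu_pow_closed_value[of q] by (simp del: mu_pow.simps)
  also have "\<dots> = op_smul EBV (q + n) (k + 1) (-1) (op_cmp EBV (Suc q) 0 n (k + 1) 0 ?M (op_dif EBV n k (ebv_value t)))"
    unfolding v using EBV.cmp_smul_right[OF M dT, of 0 "-1"] N by simp
  finally show ?thesis
    unfolding minus_dif_of_def
    using d term_arity_degree[OF m(1)] term_arity_degree[OF t(1)] N
    by (auto intro!: oterm_of_cmp_eq[OF m(1) t(1)] oterm_of_cmp_eq[OF m(2) t(2)] simp del: mu_pow.simps)
qed

lemma minus_dif_of_Act:
  assumes "minus_dif_of n k t' t" "\<tau> permutes {..<n}"
  shows "minus_dif_of n k (Act t' \<tau>) (Act t \<tau>)"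
proof -
  have t: "oterm_of EBV_presentation n k t" "oterm_of BVD_presentation n (k + 1) t'"
    and v: "bvd_value t' = op_smul EBV n (k + 1) (-1) (op_dif EBV n k (ebv_value t))"
    using assms by (auto simp: minus_dif_of_def)
  have T: "ebv_value t \<in> op_car EBV n k" by (rule ebv_value_in[OF t(1)])
  show ?thesis
    unfolding minus_dif_of_def
    using t v assms(2) EBV.dif_closed[OF T] T
    by (auto simp: term_arity_degree EBV.dif_act EBV.act_smul intro: oterm_of.act)
qed

lemma minus_dif_of_Smul:
  assumes "minus_dif_of n k t' t"
  shows "minus_dif_of n k (Smul a t') (Smul a t)"
proof -
  have t: "oterm_of EBV_presentation n k t" "oterm_of BVD_presentation n (k + 1) t'"
    and v: "bvd_value t' = op_smul EBV n (k + 1) (-1) (op_dif EBV n k (ebv_value t))"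
    using assms by (auto simp: minus_dif_of_def)
  have T: "ebv_value t \<in> op_car EBV n k" by (rule ebv_value_in[OF t(1)])
  show ?thesis
    unfolding minus_dif_of_def
    using t v EBV.dif_closed[OF T] T
    by (auto simp: term_arity_degree EBV.dif_smul EBV.smul_smul intro: oterm_of.smul)
qed

lemma minus_dif_of_Sum_term:
  assumes S: "finite S" and f: "\<And>a. a \<in> S \<Longrightarrow> minus_dif_of n k (f' a) (f a)" and k': "k' = k + 1"
  shows "minus_dif_of n k (Sum_term n k' f' S) (Sum_term n k f S)"
proof -
  let ?x = "\<lambda>a. ebv_value (f a)"
  have t: "oterm_of EBV_presentation n k (f a)" "oterm_of BVD_presentation n (k + 1) (f' a)"
    and v: "bvd_value (f' a) = op_smul EBV n (k + 1) (-1) (op_dif EBV n k (?x a))" if "a \<in> S" for a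
    using f[OF that] by (auto simp: minus_dif_of_def)
  have X: "?x a \<in> op_car EBV n k" if "a \<in> S" for a by (rule ebv_value_in[OF t(1)[OF that]])
  have "foldr (\<lambda>a. op_add EBV n (k + 1) (bvd_value (f' a))) xs (op_zero EBV n (k + 1)) =
     op_smul EBV n (k + 1) (-1) (op_dif EBV n k (foldr (\<lambda>a. op_add EBV n k (?x a)) xs (op_zero EBV n k)))"
    if "set xs \<subseteq> S" for xs
    using that
  proof (induction xs)
    case Nil
    then show ?case by (simp add: EBV.dif_zero EBV.smul_zero)
  next
    case (Cons a xs)
    have a: "a \<in> S" and xs: "set xs \<subseteq> S" using Cons.prems by auto
    have F: "foldr (\<lambda>a. op_add EBV n k (?x a)) xs (op_zero EBV n k) \<in> op_car EBV n k"
      by (rule EBV.foldr_closed) (use xs X in auto)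
    show ?case
      using Cons.IH[OF xs] by (simp add: v[OF a] EBV.dif_add[OF X[OF a] F] EBV.smul_add[OF EBV.dif_closed[OF X[OF a]] EBV.dif_closed[OF F]])
  qed
  then have "bvd_value (Sum_term n k' f' S) = op_smul EBV n (k + 1) (-1) (op_dif EBV n k (ebv_value (Sum_term n k f S)))"
    using term_value_Sum_term[OF S, of EBV_presentation f n k EBV "gen_class EBV_presentation"]
      term_value_Sum_term[OF S, of BVD_presentation f' n "k + 1" EBV bvd_assign]
      term_arity_degree[OF t(1)] term_arity_degree[OF t(2)] set_enum[OF S] k' by simp
  then show ?thesis
    unfolding minus_dif_of_def k' by (auto intro!: oterm_of_Sum_term[OF S] t)
qed

lemma minus_dif_of_DO_term:
  "minus_dif_of (n + 1) (-2) (DO_term (Gen BVD_mu) n (-1) (Gen BVD_Delta)) (DO_term (Gen EBV_mu) n (-2) (Gen EBV_i))"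
  unfolding DO_term_def
proof (rule minus_dif_of_Sum_term[OF finite_DO_index])
  fix a assume "a \<in> {(p, q). p + q = n + 1 \<and> 1 \<le> p}"
  then obtain p q where a: "a = (p, q)" and pq: "p + q = n + 1" "1 \<le> p" by auto
  have "minus_dif_of (n + 1) (-2) (Act (Cmp 0 (mu_pow (Gen BVD_mu) (Suc q)) (Cmp 0 (Gen BVD_Delta) (mu_pow (Gen BVD_mu) p))) (inv \<sigma>))
      (Act (Cmp 0 (mu_pow (Gen EBV_mu) (Suc q)) (Cmp 0 (Gen EBV_i) (mu_pow (Gen EBV_mu) p))) (inv \<sigma>))"
    if "\<sigma> \<in> shuffles_perm p q" for \<sigma>
  proof (rule minus_dif_of_Act)
    show "inv \<sigma> permutes {..<n + 1}" using that pq by (intro permutes_inv) (auto simp: shuffles_perm_def)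
    show "minus_dif_of (n + 1) (-2) (Cmp 0 (mu_pow (Gen BVD_mu) (Suc q)) (Cmp 0 (Gen BVD_Delta) (mu_pow (Gen BVD_mu) p)))
      (Cmp 0 (mu_pow (Gen EBV_mu) (Suc q)) (Cmp 0 (Gen EBV_i) (mu_pow (Gen EBV_mu) p)))"
      using minus_dif_of_mu_pow[OF minus_dif_of_generator_product[OF pq(2)] pq(2), of q] pq by (simp add: add.commute)
  qed
  then show "minus_dif_of (n + 1) (-2)
     (case a of (p, q) \<Rightarrow> Smul ((-1) ^ p) (Sum_term (n + 1) (-1)
        (\<lambda>\<sigma>. Act (Cmp 0 (mu_pow (Gen BVD_mu) (q + 1)) (Cmp 0 (Gen BVD_Delta) (mu_pow (Gen BVD_mu) p))) (inv \<sigma>)) (shuffles_perm p q)))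
     (case a of (p, q) \<Rightarrow> Smul ((-1) ^ p) (Sum_term (n + 1) (-2)
        (\<lambda>\<sigma>. Act (Cmp 0 (mu_pow (Gen EBV_mu) (q + 1)) (Cmp 0 (Gen EBV_i) (mu_pow (Gen EBV_mu) p))) (inv \<sigma>)) (shuffles_perm p q)))"
    unfolding a prod.case
    by (intro minus_dif_of_Smul minus_dif_of_Sum_term finite_shuffles_perm) (simp_all add: One_nat_def del: mu_pow.simps)
qed simp

lemma bvd_value_phi: "1 \<le> n \<Longrightarrow> bvd_value (Gen (BVD_phi n)) \<in> op_car EBV 1 (- 2 * int n)"
  by (auto simp: bvd_assign_def EBV_gens_in EBV.zero_closed)

lemma oterm_of_Bracket_term:
  assumes "oterm_of R 1 k a" "oterm_of R 1 l b" "K = k + l"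
  shows "oterm_of R 1 K (Bracket_term k l a b)"
  unfolding Bracket_term_def
  by (intro oterm_of.add oterm_of.smul oterm_of_cmp_eq[OF assms(1,2)] oterm_of_cmp_eq[OF assms(2,1)]) (use assms(3) in simp_all)

lemma oterm_of_phi_bracket:
  "qs \<noteq> [] \<Longrightarrow> \<forall>q\<in>set qs. 1 \<le> q \<Longrightarrow> oterm_of BVD_presentation 1 (1 - 2 * int (sum_list qs)) (phi_bracket qs)"
proof (induction qs rule: phi_bracket.induct)
  case (2 q)
  then show ?case using oterm_of_dif_eq[OF oterm_of_BVD_gens(3)[of q]] by simp
next
  case (3 q q' qs)
  then have "oterm_of BVD_presentation 1 (1 - 2 * int (sum_list (q' # qs))) (phi_bracket (q' # qs))" by simp
  then show ?case
    using 3 by (simp only: phi_bracket.simps, intro oterm_of_Bracket_term oterm_of_BVD_gens(3)) auto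
qed simp

text \<open>With \<open>\<phi>\<^sub>n \<mapsto> 0\<close> for \<open>n \<ge> 2\<close>, the innermost bracket is either zero or \<open>[i, d(i)] = 0\<close>.\<close>

lemma bvd_value_phi_bracket:
  "2 \<le> length qs \<Longrightarrow> \<forall>q\<in>set qs. 1 \<le> q \<Longrightarrow> bvd_value (phi_bracket qs) = op_zero EBV 1 (1 - 2 * int (sum_list qs))"
proof (induction qs rule: phi_bracket.induct)
  case (3 q q' qs)
  define l where "l = 1 - 2 * int (sum_list (q' # qs))"
  define k where "k = - 2 * int q"
  let ?x = "bvd_value (Gen (BVD_phi q))" and ?y = "bvd_value (phi_bracket (q' # qs))"
  have x: "?x \<in> op_car EBV 1 k" using 3 bvd_value_phi[of q] by (simp add: k_def)
  have ty: "oterm_of BVD_presentation 1 l (phi_bracket (q' # qs))"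
    unfolding l_def by (rule oterm_of_phi_bracket) (use 3 in auto)
  have tx: "oterm_of BVD_presentation 1 k (Gen (BVD_phi q))" unfolding k_def by (rule oterm_of_BVD_gens(3)) (use 3 in simp)
  have y: "?y \<in> op_car EBV 1 l"
    using term_value_in_car[OF EBV.dg_operad_axioms bvd_assign_in ty] by simp
  have kl: "k + l = 1 - 2 * int (sum_list (q # q' # qs))" by (simp add: k_def l_def)
  have val: "bvd_value (phi_bracket (q # q' # qs)) = op_add EBV 1 (k + l) (op_cmp EBV 1 k 1 l 0 ?x ?y)
      (op_smul EBV 1 (k + l) (- ((-1) powi (k * l))) (op_cmp EBV 1 l 1 k 0 ?y ?x))"
    unfolding phi_bracket.simps k_def[symmetric] l_def[symmetric] Bracket_term_def
    using term_arity_degree[OF tx] term_arity_degree[OF ty] by (simp add: One_nat_def[symmetric] add.commute del: phi_bracket.simps term_value.simps(1) term_arity.simps(1) term_degree.simps(1))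
  have zero: ?case if "?x = op_zero EBV 1 k \<or> ?y = op_zero EBV 1 l"
    using that unfolding val kl[symmetric]
    using EBV.cmp_zero_left[OF y, of 0 1 k] EBV.cmp_zero_right[OF y, of 0 1 k] EBV.cmp_zero_left[OF x, of 0 1 l] EBV.cmp_zero_right[OF x, of 0 1 l]
    by (auto simp: One_nat_def[symmetric] EBV.smul_zero EBV.zero_add add.commute simp del: phi_bracket.simps term_value.simps(1))
  show ?case
  proof (cases "qs = []")
    case False
    then have "?y = op_zero EBV 1 l" unfolding l_def using 3 by (intro "3.IH") (auto simp: One_nat_def Suc_le_eq)
    then show ?thesis using zero by blast
  next
    case True
    then have y_eq: "?y = op_dif EBV 1 (- 2 * int q') (bvd_assign (BVD_phi q'))" and l: "l = 1 - 2 * int q'"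
      using term_arity_degree[OF oterm_of_BVD_gens(3)[of q']] 3 by (simp_all add: l_def)
    consider "q \<noteq> 1" | "q' \<noteq> 1" | "q = 1" "q' = 1" by blast
    then show ?thesis
    proof cases
      case 1
      then have "?x = op_zero EBV 1 k" by (simp add: bvd_assign_def k_def)
      then show ?thesis using zero by blast
    next
      case 2
      then have "?y = op_zero EBV 1 l"
        unfolding y_eq l using EBV.dif_zero[of 1 "- 2 * int q'"] by (simp add: bvd_assign_def add.commute)
      then show ?thesis using zero by blast
    next
      case 3
      then have "?x = ebv_i" "?y = ebv_di" "k = -2" "l = -1" unfolding y_eq by (simp_all add: bvd_assign_def k_def l)
      moreover have "op_cmp EBV 1 (-2) 1 (-1) 0 ebv_i ebv_di \<in> op_car EBV 1 (-3)"
        using EBV.cmp_closed[OF EBV_gens_in(2) ebv_di_in, of 0] by (simp add: One_nat_def[symmetric])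
      ultimately show ?thesis
        unfolding val kl[symmetric] using EBV_relations(4) EBV.add_minus by (simp del: phi_bracket.simps term_value.simps(1))
    qed
  qed
qed auto

lemma finite_compositions: "finite {qs :: nat list. length qs = p \<and> sum_list qs = n \<and> (\<forall>q\<in>set qs. 1 \<le> q)}"
proof (rule finite_subset)
  show "{qs :: nat list. length qs = p \<and> sum_list qs = n \<and> (\<forall>q\<in>set qs. 1 \<le> q)} \<subseteq> {qs. set qs \<subseteq> {..n} \<and> length qs = p}"
    by (auto dest: member_le_sum_list)
  show "finite {qs :: nat list. set qs \<subseteq> {..n} \<and> length qs = p}" by (rule finite_lists_length_eq) simp
qed

lemma bvd_value_phi_relation:
  assumes n: "2 \<le> n"
  shows "bvd_value (phi_relation n) = op_zero EBV 1 (1 - 2 * int n)"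
proof -
  let ?C = "\<lambda>p. {qs. length qs = p \<and> sum_list qs = n \<and> (\<forall>q\<in>set qs. 1 \<le> q)}"
  let ?k = "1 - 2 * int n"
  let ?s = "\<lambda>p. Sum_term 1 ?k phi_bracket (?C p)"
  have br: "oterm_of BVD_presentation 1 ?k (phi_bracket qs)" "bvd_value (phi_bracket qs) = op_zero EBV 1 ?k" if "qs \<in> ?C p" "2 \<le> p" for qs p
  proof -
    have "qs \<noteq> []" using that by auto
    then show "oterm_of BVD_presentation 1 ?k (phi_bracket qs)" using oterm_of_phi_bracket[of qs] that by simp
    show "bvd_value (phi_bracket qs) = op_zero EBV 1 ?k" using bvd_value_phi_bracket[of qs] that by simp
  qed
  have ts: "oterm_of BVD_presentation 1 ?k (?s p)" if "2 \<le> p" for p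
    by (rule oterm_of_Sum_term[OF finite_compositions]) (rule br(1)[OF _ that])
  have vs: "bvd_value (?s p) = op_zero EBV 1 ?k" if "2 \<le> p" for p
  proof -
    have "bvd_value (?s p) = foldr (\<lambda>a. op_add EBV 1 ?k (bvd_value (phi_bracket a))) (set_enum (?C p)) (op_zero EBV 1 ?k)"
      by (rule term_value_Sum_term[OF finite_compositions]) (rule term_arity_degree[OF br(1)[OF _ that]])
    also have "\<dots> = op_zero EBV 1 ?k"
      by (rule EBV.foldr_zero, rule br(2)[OF _ that]) (use set_enum[OF finite_compositions, of p n] in blast)
    finally show ?thesis .
  qed
  have "bvd_value (Sum_term 1 ?k (\<lambda>p. Smul (1 / fact p) (?s p)) {2..n}) =
    foldr (\<lambda>p. op_add EBV 1 ?k (bvd_value (Smul (1 / fact p) (?s p)))) (set_enum {2..n}) (op_zero EBV 1 ?k)"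
    by (rule term_value_Sum_term) (use term_arity_degree[OF ts] in auto)
  also have "\<dots> = op_zero EBV 1 ?k"
    by (rule EBV.foldr_zero) (use set_enum[of "{2..n}"] term_arity_degree[OF ts] vs in \<open>auto simp: EBV.smul_zero\<close>)
  finally have sum: "bvd_value (Sum_term 1 ?k (\<lambda>p. Smul (1 / fact p) (?s p)) {2..n}) = op_zero EBV 1 ?k" .
  have "bvd_value (Dif (Gen (BVD_phi n))) = op_zero EBV 1 ?k"
    using EBV.dif_zero[of 1 "- 2 * int n"] term_arity_degree[OF oterm_of_BVD_gens(3)[of n]] n
    by (simp add: bvd_assign_def add.commute)
  moreover have "term_arity BVD_presentation (Dif (Gen (BVD_phi n))) = 1 \<and> term_degree BVD_presentation (Dif (Gen (BVD_phi n))) = ?k"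
    using term_arity_degree[OF oterm_of_BVD_gens(3)[of n]] n by simp
  ultimately show ?thesis unfolding phi_relation_def by (simp add: sum EBV.zero_add del: term_arity.simps(6) term_degree.simps(6) term_value.simps(6))
qed

lemma bvd_relations:
  assumes "(s, t) \<in> rels BVD_presentation"
  shows "bvd_value s = bvd_value t"
proof -
  have ad: "term_arity BVD_presentation (Gen BVD_mu) = 2" "term_degree BVD_presentation (Gen BVD_mu) = 0"
    "term_arity BVD_presentation (Gen BVD_Delta) = 1" "term_degree BVD_presentation (Gen BVD_Delta) = -1"
    "term_arity BVD_presentation (Gen (BVD_phi 1)) = 1" "term_degree BVD_presentation (Gen (BVD_phi 1)) = -2"
    using term_arity_degree[OF oterm_of_BVD_gens(1)] term_arity_degree[OF oterm_of_BVD_gens(2)]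
      term_arity_degree[OF oterm_of_BVD_gens(3)[of 1]] by auto
  have as: "bvd_assign BVD_mu = ebv_mu" "bvd_assign BVD_Delta = op_smul EBV 1 (-1) (-1) ebv_di" "bvd_assign (BVD_phi 1) = ebv_i"
    by (simp_all add: bvd_assign_def)
  note di = ebv_di_in
  note sdi = EBV.smul_closed[OF di, of "-1"]
  have X: "op_cmp EBV 1 (-1) 1 (-1) 0 ebv_di ebv_di \<in> op_car EBV 1 (-2)" using EBV.cmp_closed[OF di di, of 0] by (simp add: One_nat_def[symmetric])
  have "bvd_value (Dif (Gen BVD_Delta)) = op_zero EBV 1 0"
    using EBV.dif_smul[OF di, of "-1"] EBV.dif_dif[OF EBV_gens_in(2)] ad by (simp add: as EBV.smul_zero)
  moreover have "bvd_value (Cmp 0 (Gen BVD_Delta) (Gen BVD_Delta)) = op_zero EBV 1 (-2)"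
    using EBV.cmp_smul_left[OF di sdi, of 0 "-1"] EBV.cmp_smul_right[OF di di, of 0 "-1"] ad
    by (simp add: One_nat_def[symmetric] as ebv_di_squared EBV.smul_zero)
  moreover have "bvd_value (DO_term (Gen BVD_mu) 2 (-1) (Gen BVD_Delta)) = op_zero EBV 3 (-1)"
    using minus_dif_of_DO_term[of 2] EBV_relations(5) EBV.dif_zero[of 3 "-2"]
    by (simp add: minus_dif_of_def EBV.smul_zero)
  moreover have "bvd_value (Dif (Gen (BVD_phi 1))) = bvd_value (Smul (-1) (Gen BVD_Delta))"
    using ad by (simp add: as EBV.smul_smul[OF di] EBV.smul_one[OF di])
  moreover have "bvd_value (Act (Gen BVD_mu) (Transposition.transpose 0 1)) = bvd_value (Gen BVD_mu)"
    "bvd_value (Dif (Gen BVD_mu)) = bvd_value (Zero 2 1)"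
    "bvd_value (Cmp 0 (Gen BVD_mu) (Gen BVD_mu)) = bvd_value (Cmp 1 (Gen BVD_mu) (Gen BVD_mu))"
    using ad EBV_relations by (simp_all add: as)
  moreover have "bvd_value (phi_relation n) = bvd_value (Zero 1 (1 - 2 * int n))" if "2 \<le> n" for n
    using bvd_value_phi_relation[OF that] by simp
  ultimately show ?thesis using assms unfolding BVD_presentation_def presentation.simps by fastforce
qed

section \<open>The morphism from \<open>EBV\<close> to the endomorphism operad of the de Rham complex\<close>

lemma degree_sign_square: "degree_sign \<sigma> ds * degree_sign \<sigma> ds = 1"
  unfolding degree_sign_def prod.distrib[symmetric] by (intro prod.neutral ballI) (simp add: minus_one_powi_if)

text \<open>Undoing a permutation exchanges the same pairs again.\<close>

lemma degree_sign_inv: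
  assumes \<sigma>: "\<sigma> permutes {..<length ds}"
  shows "degree_sign (inv \<sigma>) ds = degree_sign \<sigma> (permute_list \<sigma> ds)"
proof -
  have \<sigma>': "\<sigma> permutes {..<length (permute_list \<sigma> ds)}" using \<sigma> by simp
  have "permute_list (inv \<sigma>) (permute_list \<sigma> ds) = ds"
    using permute_list_compose[OF permutes_inv[OF \<sigma>], of \<sigma>] permutes_inv_o[OF \<sigma>] by simp
  then have "degree_sign \<sigma> (permute_list \<sigma> ds) * degree_sign (inv \<sigma>) ds = 1"
    using degree_sign_compose[OF \<sigma>', of "inv \<sigma>"] permutes_inv[OF \<sigma>] permutes_inv_o[OF \<sigma>] by (simp add: degree_sign_id)
  then show ?thesis
    using degree_sign_square[of \<sigma> "permute_list \<sigma> ds"] by (metis mult.commute mult.left_commute mult.right_neutral)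
qed

context cochain_complex
begin

lemma pact_inv_eq:
  assumes "\<sigma> permutes {..<n}" "zs \<in> tuples X n"
  shows "pact n k f (inv \<sigma>) zs = degree_sign \<sigma> (map fst (permute_list \<sigma> zs)) *\<^sub>R f (permute_list \<sigma> zs)"
proof -
  have "length zs = n" using assms(2) by (simp add: tuples_iff)
  then have \<sigma>: "\<sigma> permutes {..<length zs}" using assms(1) by simp
  show ?thesis
    using degree_sign_inv[of \<sigma> "map fst zs"] \<sigma> permute_list_map[OF \<sigma>, of fst]
    by (simp add: pact_eq[OF assms(2)] permutes_inv_inv[OF \<sigma>])
qed

lemma term_value_Sum_term_End:
  assumes "finite S" "\<And>a. a \<in> S \<Longrightarrow> oterm_of R n k (f a)"
  shows "term_value R (End_operad X) \<phi> (Sum_term n k f S) = (\<Sum>a\<in>S. term_value R (End_operad X) \<phi> (f a))"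
proof -
  have "foldr (\<lambda>a. (+) (term_value R (End_operad X) \<phi> (f a))) xs 0 = sum_list (map (\<lambda>a. term_value R (End_operad X) \<phi> (f a)) xs)" for xs
    by (induction xs) simp_all
  then show ?thesis
    using term_value_Sum_term[OF assms(1), of R f n k "End_operad X" \<phi>] term_arity_degree[OF assms(2)] set_enum[OF assms(1)]
    by (simp add: End_operad_def sum_list_distinct_conv_sum_set)
qed

end

context smooth_manifold
begin

lemma tuples_twoE:
  assumes "zs \<in> tuples dR 2"
  obtains k \<alpha> l \<beta> where "zs = [(k, \<alpha>), (l, \<beta>)]" "\<alpha> \<in> cx dR k" "\<beta> \<in> cx dR l"
  using assms by (auto simp: tuples_iff numeral_2_eq_2 length_Suc_conv)

lemma tuples_threeE:
  assumes "zs \<in> tuples dR 3"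
  obtains k \<alpha> l \<beta> r \<gamma> where "zs = [(k, \<alpha>), (l, \<beta>), (r, \<gamma>)]" "\<alpha> \<in> cx dR k" "\<beta> \<in> cx dR l" "\<gamma> \<in> cx dR r"
  using assms by (auto simp: tuples_iff numeral_3_eq_3 length_Suc_conv)

lemma wedge_op_transposed: "pact 2 0 (wedge_op A) (Transposition.transpose 0 1) = wedge_op A"
proof
  fix zs
  show "pact 2 0 (wedge_op A) (Transposition.transpose 0 1) zs = wedge_op A zs"
  proof (cases "zs \<in> tuples dR 2")
    case True
    then obtain k \<alpha> l \<beta> where zs: "zs = [(k, \<alpha>), (l, \<beta>)]" and m: "\<alpha> \<in> cx dR k" "\<beta> \<in> cx dR l"
      by (rule tuples_twoE)
    have s: "degree_sign (Transposition.transpose 0 1) [k, l] = (-1) powi (k * l)"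
      by (simp add: degree_sign_def One_nat_def lessThan_Suc Transposition.transpose_def)
    have p: "permute_list (inv (Transposition.transpose 0 1)) zs = [(l, \<beta>), (k, \<alpha>)]"
      by (simp add: zs permute_list_def One_nat_def Transposition.transpose_def)
    show ?thesis unfolding pact_eq[OF True] p by (simp add: zs s wedge_op_eq m wedge_commute[OF m])
  next
    case False
    then show ?thesis by (simp add: pact_outside wedge_op_def)
  qed
qed

text \<open>This is the Leibniz rule.\<close>

lemma op_dif_wedge_op: "op_dif (End_operad dR) 2 0 (wedge_op A) = 0"
proof
  fix zs
  show "op_dif (End_operad dR) 2 0 (wedge_op A) zs = 0 zs"
  proof (cases "zs \<in> tuples dR 2")
    case True
    then obtain k \<alpha> l \<beta> where zs: "zs = [(k, \<alpha>), (l, \<beta>)]" and m: "\<alpha> \<in> cx dR k" "\<beta> \<in> cx dR l"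
      by (rule tuples_twoE)
    have d: "ext_d A \<alpha> \<in> cx dR (k + 1)" "ext_d A \<beta> \<in> cx dR (l + 1)"
      using cx_d_in[OF m(1)] cx_d_in[OF m(2)] by (simp_all add: cx_d_de_Rham)
    have "op_dif (End_operad dR) 2 0 (wedge_op A) zs = ext_d A (wedge_op A zs)
       - (wedge_op A [(k + 1, ext_d A \<alpha>), (l, \<beta>)] + (-1) powi k *\<^sub>R wedge_op A [(k, \<alpha>), (l + 1, ext_d A \<beta>)])"
      using True by (simp add: End_operad_def zs cx_d_de_Rham numeral_2_eq_2 lessThan_Suc del: tdeg_simps(3))
    then show ?thesis by (simp add: zs m d wedge_op_eq ext_d_wedge[OF m])
  next
    case False
    then show ?thesis by (simp add: End_operad_def)
  qed
qed

lemma wedge_op_iterated: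
  assumes "\<alpha> \<in> cx dR k" "\<beta> \<in> cx dR l" "\<gamma> \<in> cx dR r"
  shows "pcmp 2 0 2 0 0 (wedge_op A) (wedge_op A) [(k, \<alpha>), (l, \<beta>), (r, \<gamma>)] = wedge (wedge \<alpha> \<beta>) \<gamma>"
  using pcmp_split[of 0 2 "[]" "[(k, \<alpha>), (l, \<beta>)]" 2 "[(r, \<gamma>)]" 0 0 "wedge_op A" "wedge_op A"] assms
  by (simp add: wedge_op_eq wedge_in)

lemma wedge_op_assoc: "pcmp 2 0 2 0 0 (wedge_op A) (wedge_op A) = pcmp 2 0 2 0 1 (wedge_op A) (wedge_op A)"
proof
  fix zs
  show "pcmp 2 0 2 0 0 (wedge_op A) (wedge_op A) zs = pcmp 2 0 2 0 1 (wedge_op A) (wedge_op A) zs"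
  proof (cases "zs \<in> tuples dR 3")
    case True
    then obtain k \<alpha> l \<beta> r \<gamma> where zs: "zs = [(k, \<alpha>), (l, \<beta>), (r, \<gamma>)]" and m: "\<alpha> \<in> cx dR k" "\<beta> \<in> cx dR l" "\<gamma> \<in> cx dR r"
      by (rule tuples_threeE)
    show ?thesis
      using wedge_op_iterated[OF m] m
        pcmp_split[of 1 2 "[(k, \<alpha>)]" "[(l, \<beta>), (r, \<gamma>)]" 2 "[]" 0 0 "wedge_op A" "wedge_op A"]
      by (simp add: zs wedge_op_eq wedge_in wedge_assoc)
  next
    case False
    then show ?thesis using pcmp_outside[of zs 2 2] by simp
  qed
qed

end

context Poisson_manifold
begin

abbreviation "interior_op \<equiv> unary_op A \<iota>"
abbreviation "Lie_op \<equiv> unary_op A (Lie_derivative A 2 \<pi>)"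

text \<open>The degree of \<open>i\<^sub>\<pi>\<close> being even, \<open>[d, i\<^sub>\<pi>] = - [i\<^sub>\<pi>, d]\<close>.\<close>

lemma op_dif_interior_op: "op_dif (End_operad dR) 1 (-2) interior_op = - Lie_op"
proof
  fix zs
  show "op_dif (End_operad dR) 1 (-2) interior_op zs = (- Lie_op) zs"
  proof (cases "zs \<in> tuples dR 1")
    case True
    then obtain k \<omega> where zs: "zs = [(k, \<omega>)]" and m: "\<omega> \<in> cx dR k"
      by (auto simp: tuples_iff One_nat_def length_Suc_conv)
    have d: "ext_d A \<omega> \<in> cx dR (k + 1)" using cx_d_in[OF m] by (simp add: cx_d_de_Rham)
    have "op_dif (End_operad dR) 1 (-2) interior_op zs = ext_d A (interior_op [(k, \<omega>)]) - interior_op [(k + 1, ext_d A \<omega>)]"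
      using True by (simp add: End_operad_def zs cx_d_de_Rham One_nat_def lessThan_Suc minus_one_powi_if)
    then show ?thesis by (simp add: zs unary_op_apply[OF m] unary_op_apply[OF d] Lie_derivative_def fun_eq_iff)
  next
    case False
    then show ?thesis by (simp add: End_operad_def unary_op_def)
  qed
qed

lemma Lie_op_in: "Lie_op \<in> ml 1 (-1)"
  using op_dif_in[OF interior_op_in] ml_closed(3)[of Lie_op 1 "-1" "-1"]
    ml_closed(3)[of "- Lie_op" 1 "-1" "-1"] by (simp add: op_dif_interior_op)

lemma interior_op_Lie_op_commute: "pcmp 1 (-2) 1 (-1) 0 interior_op Lie_op = pcmp 1 (-1) 1 (-2) 0 Lie_op interior_op"
proof
  fix zs
  show "pcmp 1 (-2) 1 (-1) 0 interior_op Lie_op zs = pcmp 1 (-1) 1 (-2) 0 Lie_op interior_op zs"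
  proof (cases "zs \<in> tuples dR 1")
    case True
    then obtain k \<omega> where zs: "zs = [(k, \<omega>)]" and m: "\<omega> \<in> cx dR k"
      by (auto simp: tuples_iff One_nat_def length_Suc_conv)
    have L: "Lie_derivative A 2 \<pi> \<omega> \<in> cx dR (k - 1)"
      using ml_in[OF Lie_op_in, of zs] m unary_op_apply[OF m, of "Lie_derivative A 2 \<pi>"] by (simp add: zs)
    have "\<iota> (Lie_derivative A 2 \<pi> \<omega>) = - \<iota> (ext_d A (\<iota> \<omega>) - \<iota> (ext_d A \<omega>))"
      using interior_product_linear[of "-1" "ext_d A (\<iota> \<omega>) - \<iota> (ext_d A \<omega>)" 0 0]
      by (simp add: Lie_derivative_def)
    also have "\<dots> = Lie_derivative A 2 \<pi> (\<iota> \<omega>)"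
      unfolding interior_product_Lie_commute[OF m] by (simp add: Lie_derivative_def)
    finally have eq: "\<iota> (Lie_derivative A 2 \<pi> \<omega>) = Lie_derivative A 2 \<pi> (\<iota> \<omega>)" .
    show ?thesis
      using pcmp_split[of 0 1 "[]" "[(k, \<omega>)]" 1 "[]" "-2" "-1" interior_op Lie_op]
        pcmp_split[of 0 1 "[]" "[(k, \<omega>)]" 1 "[]" "-1" "-2" Lie_op interior_op] m
      by (simp add: zs unary_op_apply[OF m] unary_op_apply[OF L] unary_op_apply[OF interior_product_in[OF m]] eq)
  next
    case False
    then show ?thesis using pcmp_outside[of zs 1 1] by (simp add: One_nat_def)
  qed
qed

definition ebv_assign :: "ebv_gen \<Rightarrow> (int \<times> ('m, 'e) form) list \<Rightarrow> ('m, 'e) form" where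
  "ebv_assign g = (case g of EBV_mu \<Rightarrow> wedge_op A | EBV_i \<Rightarrow> interior_op)"

lemma ebv_assign_simps: "ebv_assign EBV_mu = wedge_op A" "ebv_assign EBV_i = interior_op"
  by (simp_all add: ebv_assign_def)

lemma op_car_End: "op_car (End_operad dR) = ml"
  by (simp add: End_operad_def)

lemma ebv_assign_in: "ebv_assign g \<in> op_car (End_operad dR) (gen_arity EBV_presentation g) (gen_degree EBV_presentation g)"
  by (cases g) (simp_all add: ebv_assign_simps op_car_End EBV_presentation_simps wedge_op_in interior_op_in)

abbreviation "form_value \<equiv> term_value EBV_presentation (End_operad dR) ebv_assign"
abbreviation "summand p q \<equiv> Cmp 0 (mu_pow (Gen EBV_mu) (q + 1)) (Cmp 0 (Gen EBV_i) (mu_pow (Gen EBV_mu) p))"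

lemma summand_values:
  assumes m: "\<alpha> \<in> cx dR k" "\<beta> \<in> cx dR l" "\<gamma> \<in> cx dR r"
  shows "form_value (summand 1 2) [(k, \<alpha>), (l, \<beta>), (r, \<gamma>)] = wedge (wedge (\<iota> \<alpha>) \<beta>) \<gamma>"
    and "form_value (summand 2 1) [(k, \<alpha>), (l, \<beta>), (r, \<gamma>)] = wedge (\<iota> (wedge \<alpha> \<beta>)) \<gamma>"
    and "form_value (summand 3 0) [(k, \<alpha>), (l, \<beta>), (r, \<gamma>)] = \<iota> (wedge (wedge \<alpha> \<beta>) \<gamma>)"
proof -
  let ?W = "wedge_op A" and ?u = "op_unit (End_operad dR)"
  let ?W3 = "pcmp 2 0 2 0 0 ?W ?W"
  have pow: "mu_pow t 1 = Unit" "mu_pow t 2 = Cmp 0 t Unit" "mu_pow t 3 = Cmp 0 t (Cmp 0 t Unit)" for t :: "ebv_gen oterm"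
    by (simp_all add: One_nat_def numeral_2_eq_2 numeral_3_eq_3)
  have ar: "1 + 2 = (3::nat)" "2 + 1 = (3::nat)" "1 + 1 = (2::nat)" "0 + 1 = (1::nat)" "2 + 1 - 1 = (2::nat)"
    "2 + 2 - 1 = (3::nat)" "1 + 1 - 1 = (1::nat)" "1 + 2 - 1 = (2::nat)" "1 + 3 - 1 = (3::nat)" "2 - 1 = (1::nat)" "3 - 1 = (2::nat)" "2 + 2 = (4::nat)" "4 - 1 = (3::nat)" by simp_all
  have Wu: "pcmp 2 0 1 0 0 ?W ?u = ?W" by (rule pcmp_unit[OF wedge_op_in]) simp
  have Iu: "pcmp 1 (-2) 1 0 0 interior_op ?u = interior_op" by (rule pcmp_unit[OF interior_op_in]) simp
  have W3: "?W3 \<in> ml 3 0" using pcmp_in[OF wedge_op_in wedge_op_in, of 0] by simp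
  have IW3: "pcmp 1 (-2) 3 0 0 interior_op ?W3 \<in> ml 3 (-2)" using pcmp_in[OF interior_op_in W3, of 0] by simp
  note ev = ar Wu Iu EBV_presentation_simps ebv_assign_simps term_value.simps term_arity.simps term_degree.simps add_0_left add_0_right
  have \<iota>: "\<iota> \<alpha> \<in> cx dR (k - 2)" "\<iota> (wedge \<alpha> \<beta>) \<in> cx dR (k + l - 2)"
    using interior_product_in[OF m(1)] interior_product_in[OF wedge_in[OF m(1,2)]] by auto
  have \<alpha>\<beta>: "wedge \<alpha> \<beta> \<in> cx dR (k + l)" and \<alpha>\<beta>\<gamma>: "wedge (wedge \<alpha> \<beta>) \<gamma> \<in> cx dR (k + l + r)"
    using wedge_in m by blast+
  have "form_value (summand 1 2) = pcmp 3 0 1 (-2) 0 ?W3 interior_op" by (simp only: pow ev)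
  then show "form_value (summand 1 2) [(k, \<alpha>), (l, \<beta>), (r, \<gamma>)] = wedge (wedge (\<iota> \<alpha>) \<beta>) \<gamma>"
    using pcmp_split[of 0 3 "[]" "[(k, \<alpha>)]" 1 "[(l, \<beta>), (r, \<gamma>)]" 0 "-2" ?W3 interior_op] m
      wedge_op_iterated[OF \<iota>(1) m(2,3)]
    by (simp add: unary_op_apply[OF m(1)])
  have "form_value (summand 2 1) = pcmp 2 0 2 (-2) 0 ?W (pcmp 1 (-2) 2 0 0 interior_op ?W)" by (simp only: pow ev)
  then show "form_value (summand 2 1) [(k, \<alpha>), (l, \<beta>), (r, \<gamma>)] = wedge (\<iota> (wedge \<alpha> \<beta>)) \<gamma>"
    using pcmp_split[of 0 2 "[]" "[(k, \<alpha>), (l, \<beta>)]" 2 "[(r, \<gamma>)]" 0 "-2" ?W "pcmp 1 (-2) 2 0 0 interior_op ?W"] m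
      pcmp_split[of 0 1 "[]" "[(k, \<alpha>), (l, \<beta>)]" 2 "[]" "-2" 0 interior_op ?W]
    by (simp add: wedge_op_eq[OF m(1,2)] wedge_op_eq[OF \<iota>(2) m(3)] unary_op_apply[OF \<alpha>\<beta>])
  have "form_value (summand 3 0) = pcmp 1 0 3 (-2) 0 ?u (pcmp 1 (-2) 3 0 0 interior_op ?W3)" by (simp only: pow ev)
  also have "\<dots> = pcmp 1 (-2) 3 0 0 interior_op ?W3" by (rule unit_pcmp[OF IW3])
  finally show "form_value (summand 3 0) [(k, \<alpha>), (l, \<beta>), (r, \<gamma>)] = \<iota> (wedge (wedge \<alpha> \<beta>) \<gamma>)"
    using pcmp_split[of 0 1 "[]" "[(k, \<alpha>), (l, \<beta>), (r, \<gamma>)]" 3 "[]" "-2" 0 interior_op ?W3] m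
    by (simp add: wedge_op_iterated[OF m] unary_op_apply[OF \<alpha>\<beta>\<gamma>] add.assoc[symmetric])
qed

text \<open>In each case, the argument or pair of arguments that is put into the innermost product runs
  through all possibilities.\<close>

lemma sum_shuffles_three:
  "sum F (shuffles_perm 1 2) = F (lift_perm id) + F (lift_perm (lift_perm id) \<circ> cycle_perm 1)
     + F (lift_perm (lift_perm id \<circ> cycle_perm 1) \<circ> cycle_perm 1)"
  "sum F (shuffles_perm 2 1) = F (lift_perm (lift_perm id)) + F (lift_perm (lift_perm id \<circ> cycle_perm 1))
     + F (lift_perm id \<circ> cycle_perm 2)"
  "sum F (shuffles_perm 3 0) = F id"
  by (simp_all add: One_nat_def numeral_2_eq_2 sum_shuffles_perm_Suc add.assoc)

text \<open>For \<open>(p, q) = (1, 2)\<close>, \<open>(2, 1)\<close> and \<open>(3, 0)\<close> the relation sums over the \<open>p\<close> arguments whose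
  product \<open>i\<^sub>\<pi>\<close> is applied to. Shuffles act with the Koszul signs of \<open>interior_product_order_two\<close>.\<close>

lemma interior_op_order_two: "form_value (DO_term (Gen EBV_mu) 2 (-2) (Gen EBV_i)) = 0"
proof
  fix zs
  note t = oterm_of_EBV_gens
  let ?act = "\<lambda>p q \<sigma>. Act (summand p q) (inv \<sigma>)"
  let ?S = "{(p::nat, q). p + q = 2 + 1 \<and> 1 \<le> p}"
  have S: "?S = {(1, 2), (2, 1), (3, 0)}" by auto
  have tact: "oterm_of EBV_presentation 3 (-2) (?act p q \<sigma>)" if "(p, q) \<in> ?S" "\<sigma> \<in> shuffles_perm p q" for p q \<sigma>
    using oterm_of_DO_summand(3)[OF t, of p q 2 \<sigma>] that by simp
  have tsum: "oterm_of EBV_presentation 3 (-2) (Sum_term 3 (-2) (?act p q) (shuffles_perm p q))" if "(p, q) \<in> ?S" for p q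
    by (rule oterm_of_Sum_term[OF finite_shuffles_perm tact[OF that]])
  have vact: "form_value (?act p q \<sigma>) = pact 3 (-2) (form_value (summand p q)) (inv \<sigma>)"
    if "(p, q) \<in> ?S" "\<sigma> \<in> shuffles_perm p q" for p q \<sigma>
  proof -
    have "oterm_of EBV_presentation 3 (-2) (summand p q)"
      using oterm_of_DO_summand(2)[OF t, of p q 2 \<sigma>] that by simp
    then show ?thesis using term_arity_degree[of EBV_presentation 3 "-2" "summand p q"] by (simp only: term_value.simps)
  qed
  have vsum: "form_value (Sum_term 3 (-2) (?act p q) (shuffles_perm p q)) =
      (\<Sum>\<sigma>\<in>shuffles_perm p q. pact 3 (-2) (form_value (summand p q)) (inv \<sigma>))" if "(p, q) \<in> ?S" for p q
  proof -
    have "form_value (Sum_term 3 (-2) (?act p q) (shuffles_perm p q)) = (\<Sum>\<sigma>\<in>shuffles_perm p q. form_value (?act p q \<sigma>))"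
      by (rule term_value_Sum_term_End[OF finite_shuffles_perm]) (rule tact[OF that])
    also have "\<dots> = (\<Sum>\<sigma>\<in>shuffles_perm p q. pact 3 (-2) (form_value (summand p q)) (inv \<sigma>))"
      by (rule sum.cong[OF HOL.refl vact[OF that]])
    finally show ?thesis .
  qed
  have "form_value (DO_term (Gen EBV_mu) 2 (-2) (Gen EBV_i)) =
    (\<Sum>(p, q)\<in>?S. form_value (Smul ((-1) ^ p) (Sum_term 3 (-2) (?act p q) (shuffles_perm p q))))"
  proof -
    have "oterm_of EBV_presentation 3 (-2) (case a of (p, q) \<Rightarrow> Smul ((-1) ^ p) (Sum_term 3 (-2) (?act p q) (shuffles_perm p q)))"
      if "a \<in> ?S" for a
      using tsum that by (auto intro: oterm_of.smul)
    from term_value_Sum_term_End[OF finite_DO_index this, where \<phi> = ebv_assign]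
    show ?thesis unfolding DO_term_def by (simp add: case_prod_unfold)
  qed
  also have "\<dots> = (\<Sum>(p, q)\<in>?S. (-1) ^ p *\<^sub>R (\<Sum>\<sigma>\<in>shuffles_perm p q. pact 3 (-2) (form_value (summand p q)) (inv \<sigma>)))"
  proof (rule sum.cong[OF HOL.refl])
    fix a assume "a \<in> ?S"
    moreover obtain p q where "a = (p, q)" by (cases a)
    ultimately show "(case a of (p, q) \<Rightarrow> form_value (Smul ((-1) ^ p) (Sum_term 3 (-2) (?act p q) (shuffles_perm p q)))) =
      (case a of (p, q) \<Rightarrow> (-1) ^ p *\<^sub>R (\<Sum>\<sigma>\<in>shuffles_perm p q. pact 3 (-2) (form_value (summand p q)) (inv \<sigma>)))"
      using vsum[of p q] by (simp only: prod.case term_value.simps) (simp add: End_operad_def)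
  qed
  finally have DO: "form_value (DO_term (Gen EBV_mu) 2 (-2) (Gen EBV_i)) =
    - (\<Sum>\<sigma>\<in>shuffles_perm 1 2. pact 3 (-2) (form_value (summand 1 2)) (inv \<sigma>))
    + (\<Sum>\<sigma>\<in>shuffles_perm 2 1. pact 3 (-2) (form_value (summand 2 1)) (inv \<sigma>))
    - (\<Sum>\<sigma>\<in>shuffles_perm 3 0. pact 3 (-2) (form_value (summand 3 0)) (inv \<sigma>))"
    unfolding S by (simp del: mu_pow.simps shuffles_perm_zero)
  show "form_value (DO_term (Gen EBV_mu) 2 (-2) (Gen EBV_i)) zs = 0 zs"
  proof (cases "zs \<in> tuples dR 3")
    case False
    then show ?thesis unfolding DO by (simp add: sum_fun_apply pact_outside)
  next
    case True
    then obtain k \<alpha> l \<beta> r \<gamma> where zs: "zs = [(k, \<alpha>), (l, \<beta>), (r, \<gamma>)]" and m: "\<alpha> \<in> cx dR k" "\<beta> \<in> cx dR l" "\<gamma> \<in> cx dR r"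
      by (rule tuples_threeE)
    have act: "(\<Sum>\<sigma>\<in>shuffles_perm p q. pact 3 (-2) F (inv \<sigma>)) zs =
      (\<Sum>\<sigma>\<in>shuffles_perm p q. degree_sign \<sigma> (map fst (permute_list \<sigma> zs)) *\<^sub>R F (permute_list \<sigma> zs))"
      if "p + q = 3" for F p q
    proof -
      have "(\<Sum>\<sigma>\<in>shuffles_perm p q. pact 3 (-2) F (inv \<sigma>)) zs = (\<Sum>\<sigma>\<in>shuffles_perm p q. pact 3 (-2) F (inv \<sigma>) zs)"
        by (rule sum_fun_apply)
      also have "\<dots> = (\<Sum>\<sigma>\<in>shuffles_perm p q. degree_sign \<sigma> (map fst (permute_list \<sigma> zs)) *\<^sub>R F (permute_list \<sigma> zs))"
        using that True by (intro sum.cong HOL.refl pact_inv_eq) (auto simp: shuffles_perm_def)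
      finally show ?thesis .
    qed
    have "1 + 2 = (3::nat)" "2 + 1 = (3::nat)" "3 + 0 = (3::nat)" by simp_all
    note sums = this[THEN act]
    have split_apply: "(- a + b - c) zs = - a zs + b zs - c zs" for a b c :: "(int \<times> ('m, 'e) form) list \<Rightarrow> ('m, 'e) form"
      by simp
    have perm: "permute_list (lift_perm id) zs = zs"
      "permute_list (lift_perm (lift_perm id)) zs = zs"
      "permute_list (lift_perm (lift_perm id) \<circ> cycle_perm 1) zs = [(l, \<beta>), (k, \<alpha>), (r, \<gamma>)]"
      "permute_list (lift_perm (lift_perm id \<circ> cycle_perm 1) \<circ> cycle_perm 1) zs = [(r, \<gamma>), (k, \<alpha>), (l, \<beta>)]"
      "permute_list (lift_perm (lift_perm id \<circ> cycle_perm 1)) zs = [(k, \<alpha>), (r, \<gamma>), (l, \<beta>)]"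
      "permute_list (lift_perm id \<circ> cycle_perm 2) zs = [(l, \<beta>), (r, \<gamma>), (k, \<alpha>)]"
      by (simp_all add: zs permute_list_def cycle_perm_def lift_perm_def upt_rec One_nat_def numeral_2_eq_2)
    have sgn: "degree_sign (lift_perm id) [a, b, c] = 1"
      "degree_sign (lift_perm (lift_perm id)) [a, b, c] = 1"
      "degree_sign (lift_perm (lift_perm id) \<circ> cycle_perm 1) [a, b, c] = (-1) powi (a * b)"
      "degree_sign (lift_perm (lift_perm id \<circ> cycle_perm 1) \<circ> cycle_perm 1) [a, b, c] = (-1) powi (a * (b + c))"
      "degree_sign (lift_perm (lift_perm id \<circ> cycle_perm 1)) [a, b, c] = (-1) powi (b * c)"
      "degree_sign (lift_perm id \<circ> cycle_perm 2) [a, b, c] = (-1) powi ((a + b) * c)" for a b c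
      by (simp_all add: degree_sign_def cycle_perm_def lift_perm_def lessThan_Suc One_nat_def numeral_2_eq_2 distrib_left distrib_right minus_one_powi_add)
    have "form_value (DO_term (Gen EBV_mu) 2 (-2) (Gen EBV_i)) zs =
      - (wedge (wedge (\<iota> \<alpha>) \<beta>) \<gamma> + (-1) powi (l * k) *\<^sub>R wedge (wedge (\<iota> \<beta>) \<alpha>) \<gamma>
          + (-1) powi (r * (k + l)) *\<^sub>R wedge (wedge (\<iota> \<gamma>) \<alpha>) \<beta>)
      + (wedge (\<iota> (wedge \<alpha> \<beta>)) \<gamma> + (-1) powi (r * l) *\<^sub>R wedge (\<iota> (wedge \<alpha> \<gamma>)) \<beta>
          + (-1) powi ((l + r) * k) *\<^sub>R wedge (\<iota> (wedge \<beta> \<gamma>)) \<alpha>)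
      - \<iota> (wedge (wedge \<alpha> \<beta>) \<gamma>)"
      unfolding DO split_apply unfolding sums unfolding sum_shuffles_three
      by (simp only: zs perm[unfolded zs] permute_list_id list.map fst_conv sgn degree_sign_id scaleR_one summand_values m)
    also have "\<dots> = 0"
      unfolding interior_product_order_two[OF m] by (simp add: mult.commute add.commute)
    finally show ?thesis by simp
  qed
qed

lemma ebv_assign_relations:
  assumes "(s, t) \<in> rels EBV_presentation"
  shows "form_value s = form_value t"
proof -
  let ?E = "End_operad dR"
  have z: "op_zero ?E n k = 0" for n k by (simp add: End_operad_def)
  have smul: "pcmp 1 (-2) 1 (-1) 0 interior_op (- Lie_op) = - pcmp 1 (-2) 1 (-1) 0 interior_op Lie_op"
    "pcmp 1 (-1) 1 (-2) 0 (- Lie_op) interior_op = - pcmp 1 (-1) 1 (-2) 0 Lie_op interior_op"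
    using pcmp_diff_left[of 1 "-1" 1 "-2" 0 0 Lie_op interior_op] pcmp_diff_left[of 1 "-1" 1 "-2" 0 0 0 interior_op]
      pcmp_scale_right[OF interior_op_in Lie_op_in, of 0 "-1"] by simp_all
  note ev = EBV_presentation_simps ebv_assign_simps z
  have "form_value (Act (Gen EBV_mu) (Transposition.transpose 0 1)) = form_value (Gen EBV_mu)"
    using wedge_op_transposed by (simp add: ev)
  moreover have "form_value (Dif (Gen EBV_mu)) = form_value (Zero 2 1)"
    using op_dif_wedge_op by (simp add: ev)
  moreover have "form_value (Cmp 0 (Gen EBV_mu) (Gen EBV_mu)) = form_value (Cmp 1 (Gen EBV_mu) (Gen EBV_mu))"
    using wedge_op_assoc by (simp add: ev)
  moreover have "form_value (Cmp 0 (Gen EBV_i) (Dif (Gen EBV_i))) = form_value (Cmp 0 (Dif (Gen EBV_i)) (Gen EBV_i))"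
    using interior_op_Lie_op_commute by (simp add: ev op_dif_interior_op smul)
  moreover have "form_value (DO_term (Gen EBV_mu) 2 (-2) (Gen EBV_i)) = form_value (Zero 3 (-2))"
    using interior_op_order_two by (simp add: z)
  ultimately show ?thesis using assms unfolding EBV_presentation_def presentation.simps by fastforce
qed

end

section \<open>The factorization\<close>

lemma dg_operad_hom_smul: "\<lbrakk>F \<in> dg_operad_hom P Q; x \<in> op_car P n k\<rbrakk> \<Longrightarrow> F n k (op_smul P n k a x) = op_smul Q n k a (F n k x)"
  and dg_operad_hom_dif: "\<lbrakk>F \<in> dg_operad_hom P Q; x \<in> op_car P n k\<rbrakk> \<Longrightarrow> F n (k + 1) (op_dif P n k x) = op_dif Q n k (F n k x)"
  by (auto simp: dg_operad_hom_def)

theorem proposition1p2: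
  fixes M :: "'m topology" and A :: "('m, 'e::real_inner) chart set" and \<pi> :: "('m, 'e) polyvector"
  assumes "Poisson_manifold M A \<pi>"
  defines "is_F \<equiv> \<lambda>F. F \<in> dg_operad_hom BV_mod_Delta (End_operad (de_Rham A))
      \<and> F 2 0 (gen_class BVD_presentation BVD_mu) = wedge_op A
      \<and> F 1 (-1) (gen_class BVD_presentation BVD_Delta) = unary_op A (Lie_derivative A 2 \<pi>)
      \<and> F 1 (-2) (gen_class BVD_presentation (BVD_phi 1)) = unary_op A (interior_product 2 \<pi>)
      \<and> (\<forall>n\<ge>2. F 1 (- 2 * int n) (gen_class BVD_presentation (BVD_phi n))
              = op_zero (End_operad (de_Rham A)) 1 (- 2 * int n))"
    and "is_G \<equiv> \<lambda>G. G \<in> dg_operad_hom BV_mod_Delta EBV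
      \<and> G 2 0 (gen_class BVD_presentation BVD_mu) = gen_class EBV_presentation EBV_mu
      \<and> G 1 (-1) (gen_class BVD_presentation BVD_Delta)
          = op_smul EBV 1 (-1) (-1) (op_dif EBV 1 (-2) (gen_class EBV_presentation EBV_i))
      \<and> G 1 (-2) (gen_class BVD_presentation (BVD_phi 1)) = gen_class EBV_presentation EBV_i
      \<and> (\<forall>n\<ge>2. G 1 (- 2 * int n) (gen_class BVD_presentation (BVD_phi n))
              = op_zero EBV 1 (- 2 * int n))"
    and "is_H \<equiv> \<lambda>H. H \<in> dg_operad_hom EBV (End_operad (de_Rham A))
      \<and> H 2 0 (gen_class EBV_presentation EBV_mu) = wedge_op A
      \<and> H 1 (-2) (gen_class EBV_presentation EBV_i) = unary_op A (interior_product 2 \<pi>)"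
  shows "(\<exists>!F. is_F F) \<and> (\<exists>!G. is_G G) \<and> (\<exists>!H. is_H H) \<and>
    (\<forall>F G H. is_F F \<longrightarrow> is_G G \<longrightarrow> is_H H \<longrightarrow> F = operad_hom_comp BV_mod_Delta H G)"
proof -
  interpret Poisson_manifold M A \<pi> by fact
  let ?E = "End_operad (de_Rham A)"
  have E: "dg_operad ?E" by (rule dg_operad_End)
  have existence_H: "\<exists>H. is_H H"
  proof -
    obtain H where H: "H \<in> dg_operad_hom (presented_operad EBV_presentation) ?E"
      "\<forall>g\<in>gens EBV_presentation. H (gen_arity EBV_presentation g) (gen_degree EBV_presentation g) (gen_class EBV_presentation g) = ebv_assign g"
      using presented_operad_universal[OF E, of EBV_presentation ebv_assign, OF ebv_assign_in ebv_assign_relations] by blast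
    then have "is_H H"
      using bspec[OF H(2), of EBV_mu] bspec[OF H(2), of EBV_i]
      by (simp add: is_H_def EBV_def EBV_presentation_simps ebv_assign_simps)
    then show ?thesis by blast
  qed
  have existence_G: "\<exists>G. is_G G"
  proof -
    obtain G where G: "G \<in> dg_operad_hom (presented_operad BVD_presentation) EBV"
      "\<forall>g\<in>gens BVD_presentation. G (gen_arity BVD_presentation g) (gen_degree BVD_presentation g) (gen_class BVD_presentation g) = bvd_assign g"
      using presented_operad_universal[OF EBV.dg_operad_axioms, of BVD_presentation bvd_assign, OF bvd_assign_in bvd_relations] by blast
    have "G 1 (- 2 * int n) (gen_class BVD_presentation (BVD_phi n)) = bvd_assign (BVD_phi n)" if "1 \<le> n" for n
      using bspec[OF G(2), of "BVD_phi n"] that by (simp add: BVD_presentation_simps)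
    note phi = this this[of 1, simplified]
    have "is_G G"
      using G(1) bspec[OF G(2), of BVD_mu] bspec[OF G(2), of BVD_Delta] phi
      by (auto simp: is_G_def BV_mod_Delta_def BVD_presentation_simps bvd_assign_def)
    then show ?thesis by blast
  qed
  have composite: "is_F (operad_hom_comp BV_mod_Delta H G)" if G: "is_G G" and H: "is_H H" for G H
  proof -
    have homs: "G \<in> dg_operad_hom BV_mod_Delta EBV" "H \<in> dg_operad_hom EBV ?E" using G H by (simp_all add: is_G_def is_H_def)
    have "gen_class BVD_presentation g \<in> op_car BV_mod_Delta (gen_arity BVD_presentation g) (gen_degree BVD_presentation g)"
      if "g \<in> gens BVD_presentation" for g using gen_class_in[OF that] by (simp add: BV_mod_Delta_def)
    from this[of BVD_mu] this[of BVD_Delta] this[of "BVD_phi _"]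
    have gens: "gen_class BVD_presentation BVD_mu \<in> op_car BV_mod_Delta 2 0"
      "gen_class BVD_presentation BVD_Delta \<in> op_car BV_mod_Delta 1 (-1)"
      "\<And>n. 1 \<le> n \<Longrightarrow> gen_class BVD_presentation (BVD_phi n) \<in> op_car BV_mod_Delta 1 (- 2 * int n)"
      by (simp_all add: BVD_presentation_simps)
    have "H 1 (-1) ebv_di = - Lie_op"
      using dg_operad_hom_dif[OF homs(2) EBV_gens_in(2)] H by (simp add: is_H_def op_dif_interior_op)
    then have Delta: "H 1 (-1) (op_smul EBV 1 (-1) (-1) ebv_di) = Lie_op"
      using dg_operad_hom_smul[OF homs(2) ebv_di_in, of "-1"] by (simp add: End_operad_def)
    have phi: "2 \<le> n \<Longrightarrow> H 1 (- 2 * int n) (op_zero EBV 1 (- 2 * int n)) = op_zero ?E 1 (- 2 * int n)" for n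
      by (rule dg_operad_hom_zero[OF homs(2)])
    show ?thesis
      using G H gens(1,2) gens(3)[of 1] gens(3) Delta phi dg_operad_hom_comp[OF homs]
      by (simp add: is_F_def is_G_def is_H_def operad_hom_comp_def compose_def)
  qed
  have unique_BVD: "F = F'"
    if "F \<in> dg_operad_hom BV_mod_Delta Q" "F' \<in> dg_operad_hom BV_mod_Delta Q"
      "F 2 0 (gen_class BVD_presentation BVD_mu) = F' 2 0 (gen_class BVD_presentation BVD_mu)"
      "F 1 (-1) (gen_class BVD_presentation BVD_Delta) = F' 1 (-1) (gen_class BVD_presentation BVD_Delta)"
      "F 1 (-2) (gen_class BVD_presentation (BVD_phi 1)) = F' 1 (-2) (gen_class BVD_presentation (BVD_phi 1))"
      "\<And>n. 2 \<le> n \<Longrightarrow> F 1 (- 2 * int n) (gen_class BVD_presentation (BVD_phi n)) = F' 1 (- 2 * int n) (gen_class BVD_presentation (BVD_phi n))"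
    for F F' :: "nat \<Rightarrow> int \<Rightarrow> bvd_gen oterm set \<Rightarrow> 'q" and Q
  proof (rule dg_operad_hom_eqI[OF that(1,2)[unfolded BV_mod_Delta_def]])
    fix g assume g: "g \<in> gens BVD_presentation"
    show "F (gen_arity BVD_presentation g) (gen_degree BVD_presentation g) (gen_class BVD_presentation g) =
      F' (gen_arity BVD_presentation g) (gen_degree BVD_presentation g) (gen_class BVD_presentation g)"
    proof (cases g)
      case (BVD_phi n)
      then have "n = 1 \<or> 2 \<le> n" using g by (auto simp: BVD_presentation_simps)
      then show ?thesis using that(5,6) by (auto simp: BVD_phi BVD_presentation_simps)
    qed (use that(3,4) in \<open>simp_all add: BVD_presentation_simps\<close>)
  qed
  have unique_F: "F = F'" if "is_F F" "is_F F'" for F F'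
    using that by (intro unique_BVD[of F ?E F']) (simp_all add: is_F_def)
  have unique_G: "G = G'" if "is_G G" "is_G G'" for G G'
    using that by (intro unique_BVD[of G EBV G']) (simp_all add: is_G_def)
  have unique_H: "H = H'" if "is_H H" "is_H H'" for H H'
  proof (rule dg_operad_hom_eqI)
    show "H \<in> dg_operad_hom (presented_operad EBV_presentation) ?E" "H' \<in> dg_operad_hom (presented_operad EBV_presentation) ?E"
      using that by (simp_all add: is_H_def EBV_def)
    fix g
    show "H (gen_arity EBV_presentation g) (gen_degree EBV_presentation g) (gen_class EBV_presentation g) =
      H' (gen_arity EBV_presentation g) (gen_degree EBV_presentation g) (gen_class EBV_presentation g)"
      using that by (cases g) (simp_all add: EBV_presentation_simps is_H_def)
  qed
  obtain G H where "is_G G" "is_H H" using existence_G existence_H by blast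
  then show ?thesis
    using composite unique_F unique_G unique_H by blast
qed

end
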